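(* Let $u$ be a regular feedback control that is a functional stop-gradient critical point of the expected basic mean-field adjoint matching loss $\mathbb E[\mathcal L_{\rm B\text{-}MFAM}]$, i.e. $$u(t,X^u_t,\mu^u_t)=-\sigma_t^T\,\mathbb E\big[a(t;\mathbb X^u,u)\mid X^u_t\big]\qquad dt\otimes d\mathbb P\text{-a.e.}$$ Let $(Y^u,Z^u)$ be the adjoint processes associated with $u$. Assume that $(x,\mu)\mapsto g(x,\mu)$ is L-convex and that, for $dt\otimes d\mathbb P$-a.e. $(t,\omega)$, the map $$(x,\mu,a)\mapsto H(t,x,\mu,Y^u_t,Z^u_t,a)$$ is jointly L-convex. Then the control process $u_t=u(t,X^u_t,\mu^u_t)$ is the unique (up to $dt\otimes d\mathbb P$-null sets) optimal control process of the mean-field control problem, i.e. the unique minimizer of $J$ over all admissible controls.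
   Context: Problem. $W$ is an $m$-dimensional Brownian motion, $X_0\sim\mu_0\in\mathcal P_2(\mathbb R^d)$ (finite second moment) is independent of $W$, and $(\mathcal F_t)$ is the (completed) filtration generated by $X_0$ and $W$. Admissible controls are the $\mathbb R^m$-valued progressively measurable processes $\alpha$ with $\mathbb E\int_0^T|\alpha_t|^2dt<\infty$ (the admissibility requirements on the coefficients hold automatically below). Minimize $$J(\alpha)=\mathbb E\Big[\int_0^T\big(f(t,X_t,\mu_t)+\tfrac12|\alpha_t|^2\big)dt+g(X_T,\mu_T)\Big],\quad dX_t=\big(b(t,X_t,\mu_t)+\sigma_t\alpha_t\big)dt+\sigma_t\,dW_t,\quad \mu_t=\mathcal L_{X_t},$$ with $\sigma_t\in\mathbb R^{d\times m}$ deterministic. $D_\mu$ is the Lions derivative ($D_\mu h(\mathcal L_X)(X)$ represents the Fréchet derivative of the lift $X\mapsto h(\mathcal L_X)$ on $L^2(\Omega;\mathbb R^d)$; matrix-valued, row by row, for vector-valued $h$). Regularity assumptions. $\sigma$ is bounded and continuous; $\int_0^T|b(t,x,\mu)|^2dt<\infty$ for all $(x,\mu)$; $b$ is Lipschitz in $(x,\mu)$ (with the Wasserstein distance $W_2$) uniformly in $t$; $b,f$ are continuously differentiable in $x$ and Lions differentiable in $\mu$, and so is $g$; $\nabla_xb,D_\mu b$ are continuous and bounded; $\nabla_xf,D_\mu f,\nabla_xg,D_\mu g$ are continuous with at most linear growth; $f,g$ have at most quadratic growth in $x$ and the second moment of $\mu$. Regular feedback control: a continuous $u:[0,T]\times\mathbb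 R^d\times\mathcal P_2(\mathbb R^d)\to\mathbb R^m$, continuously differentiable in $x$ and Lions differentiable in $\mu$ with continuous bounded derivatives. $X^u$ is the state under $\alpha_t=u(t,X^u_t,\mu^u_t)$, $\mu^u_t=\mathcal L_{X^u_t}$, and $\mathbb X^u$ its whole path. Put $\widetilde b^u(t,x,\mu)=b(t,x,\mu)+\sigma_tu(t,x,\mu)$ and $\widetilde f^u(t,x,\mu)=f(t,x,\mu)+\frac12|u(t,x,\mu)|^2$. Basic mean-field adjoint: $a_t=a(t;\mathbb X^u,u)$ is the unique solution of the pathwise (non-adapted) backward ODE on $[0,T]$ $$\tfrac{d}{dt}a_t=-\nabla_x\widetilde b^u(t,X^u_t,\mu^u_t)^Ta_t-\nabla_x\widetilde f^u(t,X^u_t,\mu^u_t)-\widehat{\mathbb E}\big[D_\mu\widetilde b^u(t,\widehat X^u_t,\mu^u_t)(X^u_t)^T\widehat a_t\big]-\widehat{\mathbb E}\big[D_\mu\widetilde f^u(t,\widehat X^u_t,\mu^u_t)(X^u_t)\big],$$ $$a_T=\nabla_xg(X^u_T,\mu^u_T)+\widehat{\mathbb E}[D_\mu g(\widehat X^u_T,\mu^u_T)(X^u_T)].$$ Hats denote (joint) independent copies and $\widehat{\mathbb E}$ is expectation over the copy only. Basic loss: $\mathcal L_{\rm B\text{-}MFAM}(w;u)=\frac12\int_0^T|w(t,X^u_t,\mu^u_t)+\sigma_t^Ta(t;\mathbb X^u,u)|^2dt$. A functional stop-gradient critical point is a feedback $u$ such that the first variation of $w\mapsto\mathbb E[\mathcal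 L_{\rm B\text{-}MFAM}(w;u)]$, with the reference argument $u$ (hence $X^u$ and $a$) frozen, vanishes at $w=u$ in all directions that are square-integrable along $(t,X^u_t)$; this is equivalent to the displayed identity in the claim. Hamiltonian: $H(t,x,\mu,y,z,a)=f(t,x,\mu)+\frac12|a|^2+(b(t,x,\mu)+\sigma_ta)^Ty+\mathrm{Tr}(\sigma_t^Tz)$. The adjoint processes $(Y^u,Z^u)$ are the square-integrable adapted solution of $$dY_t=-\Big(\nabla_xb(t,X^u_t,\mu^u_t)^TY_t+\nabla_xf(t,X^u_t,\mu^u_t)+\widehat{\mathbb E}\big[D_\mu b(t,\widehat X^u_t,\mu^u_t)(X^u_t)^T\widehat Y_t+D_\mu f(t,\widehat X^u_t,\mu^u_t)(X^u_t)\big]\Big)dt+Z_t\,dW_t,$$ $Y_T=\nabla_xg(X^u_T,\mu^u_T)+\widehat{\mathbb E}[D_\mu g(\widehat X^u_T,\mu^u_T)(X^u_T)]$. L-convexity of $h(x,\mu,a)$: for all $(x,\mu,a),(x',\mu',a')$ and all square-integrable $\widehat X\sim\mu$, $\widehat X'\sim\mu'$ on a common probability space, $h(x',\mu',a')\ge h(x,\mu,a)+\partial_xh(x,\mu,a)\cdot(x'-x)+\partial_ah(x,\mu,a)\cdot(a'-a)+\widehat{\mathbb E}[D_\mu h(x,\mu,a)(\widehat X)\cdot(\widehat X'-\widehat X)]$; similarly for $g(x,\mu)$ without the $a$-term. *)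

theory Defs
  imports "HOL-Probability.Probability"
begin

section \<open>The Wasserstein space and Lions derivatives\<close>

definition P2 :: "'a::euclidean_space measure set" where
  "P2 = {\<mu>. sets \<mu> = sets borel \<and> prob_space \<mu> \<and> integrable \<mu> (\<lambda>x. (norm x)\<^sup>2)}"

definition moment2 :: "'a::euclidean_space measure \<Rightarrow> real" where
  "moment2 \<mu> = (\<integral>x. (norm x)\<^sup>2 \<partial>\<mu>)"

definition couplings :: "'a::euclidean_space measure \<Rightarrow> 'a measure \<Rightarrow> ('a \<times> 'a) measure set" where
  "couplings \<mu> \<nu> = {\<pi>. sets \<pi> = sets borel \<and> distr \<pi> borel fst = \<mu> \<and> distr \<pi> borel snd = \<nu>}"

definition W2 :: "'a::euclidean_space measure \<Rightarrow> 'a measure \<Rightarrow> real" where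
  "W2 \<mu> \<nu> = sqrt (INF \<pi>\<in>couplings \<mu> \<nu>. \<integral>p. (dist (fst p) (snd p))\<^sup>2 \<partial>\<pi>)"

text \<open>Joint continuity on \<open>[0,T] \<times> C \<times> P2\<close>, with the distance \<^term>\<open>W2\<close> on the last factor. Since
  this factor carries no topological type class, continuity is expressed by sequences.\<close>

definition continuous_P2 ::
  "real \<Rightarrow> (real \<Rightarrow> 'c::metric_space \<Rightarrow> 'a::euclidean_space measure \<Rightarrow> 'b::topological_space) \<Rightarrow> bool" where
  "continuous_P2 T h \<longleftrightarrow>
    (\<forall>t x \<mu> s y \<nu>. t \<in> {0..T} \<longrightarrow> \<mu> \<in> P2 \<longrightarrow> (\<forall>n. s n \<in> {0..T}) \<longrightarrow> (\<forall>n. \<nu> n \<in> P2) \<longrightarrow>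
       s \<longlonglongrightarrow> t \<longrightarrow> y \<longlonglongrightarrow> x \<longrightarrow> (\<lambda>n. W2 (\<nu> n) \<mu>) \<longlonglongrightarrow> 0 \<longrightarrow>
       (\<lambda>n. h (s n) (y n) (\<nu> n)) \<longlonglongrightarrow> h t x \<mu>)"

definition L2 :: "'w measure \<Rightarrow> ('w \<Rightarrow> 'a::euclidean_space) set" where
  "L2 \<Omega> = {X. X \<in> borel_measurable \<Omega> \<and> integrable \<Omega> (\<lambda>\<omega>. (norm (X \<omega>))\<^sup>2)}"

definition L2_norm :: "'w measure \<Rightarrow> ('w \<Rightarrow> 'a::euclidean_space) \<Rightarrow> real" where
  "L2_norm \<Omega> X = sqrt (\<integral>\<omega>. (norm (X \<omega>))\<^sup>2 \<partial>\<Omega>)"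

text \<open>The lift of \<open>h\<close> to \<open>L\<^sup>2(\<Omega>)\<close> is Frechet differentiable at every \<open>X\<close> with law \<open>\<mu>\<close>, with derivative
  \<open>Y \<mapsto> E[D(X) Y]\<close>. Here \<open>D x\<close> is a linear map, so that real-valued and vector-valued \<open>h\<close> are treated
  alike: it is \<open>v \<mapsto> D\<^sub>\<mu>h(\<mu>)(x) \<bullet> v\<close> resp. \<open>v \<mapsto> D\<^sub>\<mu>h(\<mu>)(x) *v v\<close> below. The function \<open>D\<close> is determined
  up to \<open>\<mu>\<close>-null sets only when \<open>\<Omega>\<close> carries a random variable of law \<open>\<mu>\<close>; this holds for every \<open>\<mu>\<close> if
  \<open>\<Omega>\<close> carries a Brownian motion.\<close>

definition has_lions_derivative ::
  "'w measure \<Rightarrow> ('a::euclidean_space measure \<Rightarrow> 'b::euclidean_space) \<Rightarrow> ('a \<Rightarrow> 'a \<Rightarrow> 'b) \<Rightarrow> 'a measure \<Rightarrow> bool"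
  where
  "has_lions_derivative \<Omega> h D \<mu> \<longleftrightarrow>
    (\<forall>x. linear (D x)) \<and>
    (\<forall>v. (\<lambda>x. D x v) \<in> borel_measurable borel \<and> integrable \<mu> (\<lambda>x. (norm (D x v))\<^sup>2)) \<and>
    (\<forall>X\<in>L2 \<Omega>. distr \<Omega> borel X = \<mu> \<longrightarrow>
      (\<forall>\<epsilon>>0. \<exists>\<delta>>0. \<forall>Y\<in>L2 \<Omega>. L2_norm \<Omega> Y < \<delta> \<longrightarrow>
        norm (h (distr \<Omega> borel (\<lambda>\<omega>. X \<omega> + Y \<omega>)) - h \<mu> - (\<integral>\<omega>. D (X \<omega>) (Y \<omega>) \<partial>\<Omega>))
          \<le> \<epsilon> * L2_norm \<Omega> Y))"

text \<open>Being jointly continuous, the Lions derivatives \<open>hm t x \<mu>\<close> in the following two definitions are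
  determined everywhere, not only \<open>\<mu>\<close>-almost everywhere.\<close>

definition C1_vector ::
  "'w measure \<Rightarrow> real \<Rightarrow> (real \<Rightarrow> real^'d \<Rightarrow> (real^'d) measure \<Rightarrow> real^'k)
    \<Rightarrow> (real \<Rightarrow> real^'d \<Rightarrow> (real^'d) measure \<Rightarrow> real^'d^'k)
    \<Rightarrow> (real \<Rightarrow> real^'d \<Rightarrow> (real^'d) measure \<Rightarrow> real^'d \<Rightarrow> real^'d^'k) \<Rightarrow> bool" where
  "C1_vector \<Omega> T h hx hm \<longleftrightarrow>
    (\<forall>t\<in>{0..T}. \<forall>x. \<forall>\<mu>\<in>P2.
       ((\<lambda>y. h t y \<mu>) has_derivative (\<lambda>v. hx t x \<mu> *v v)) (at x) \<and>
       has_lions_derivative \<Omega> (\<lambda>\<nu>. h t x \<nu>) (\<lambda>y v. hm t x \<mu> y *v v) \<mu>) \<and>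
    continuous_P2 T hx \<and> continuous_P2 T (\<lambda>t (x, y) \<mu>. hm t x \<mu> y)"

definition C1_scalar ::
  "'w measure \<Rightarrow> real \<Rightarrow> (real \<Rightarrow> real^'d \<Rightarrow> (real^'d) measure \<Rightarrow> real)
    \<Rightarrow> (real \<Rightarrow> real^'d \<Rightarrow> (real^'d) measure \<Rightarrow> real^'d)
    \<Rightarrow> (real \<Rightarrow> real^'d \<Rightarrow> (real^'d) measure \<Rightarrow> real^'d \<Rightarrow> real^'d) \<Rightarrow> bool" where
  "C1_scalar \<Omega> T h hx hm \<longleftrightarrow>
    (\<forall>t\<in>{0..T}. \<forall>x. \<forall>\<mu>\<in>P2.
       GDERIV (\<lambda>y. h t y \<mu>) x :> hx t x \<mu> \<and>
       has_lions_derivative \<Omega> (\<lambda>\<nu>. h t x \<nu>) (\<lambda>y v. hm t x \<mu> y \<bullet> v) \<mu>) \<and>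
    continuous_P2 T hx \<and> continuous_P2 T (\<lambda>t (x, y) \<mu>. hm t x \<mu> y)"

definition bounded_derivatives ::
  "real \<Rightarrow> (real \<Rightarrow> 'a::euclidean_space \<Rightarrow> 'a measure \<Rightarrow> 'b::real_normed_vector)
    \<Rightarrow> (real \<Rightarrow> 'a \<Rightarrow> 'a measure \<Rightarrow> 'a \<Rightarrow> 'b) \<Rightarrow> bool" where
  "bounded_derivatives T hx hm \<longleftrightarrow>
    (\<exists>C. \<forall>t\<in>{0..T}. \<forall>x y. \<forall>\<mu>\<in>P2. norm (hx t x \<mu>) \<le> C \<and> norm (hm t x \<mu> y) \<le> C)"

definition linear_growth_derivatives ::
  "real \<Rightarrow> (real \<Rightarrow> 'a::euclidean_space \<Rightarrow> 'a measure \<Rightarrow> 'b::real_normed_vector)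
    \<Rightarrow> (real \<Rightarrow> 'a \<Rightarrow> 'a measure \<Rightarrow> 'a \<Rightarrow> 'b) \<Rightarrow> bool" where
  "linear_growth_derivatives T hx hm \<longleftrightarrow>
    (\<exists>C. \<forall>t\<in>{0..T}. \<forall>x y. \<forall>\<mu>\<in>P2.
       norm (hx t x \<mu>) \<le> C * (1 + norm x + sqrt (moment2 \<mu>)) \<and>
       norm (hm t x \<mu> y) \<le> C * (1 + norm x + norm y + sqrt (moment2 \<mu>)))"

definition quadratic_growth ::
  "real \<Rightarrow> (real \<Rightarrow> 'a::euclidean_space \<Rightarrow> 'a measure \<Rightarrow> real) \<Rightarrow> bool" where
  "quadratic_growth T h \<longleftrightarrow>
    (\<exists>C. \<forall>t\<in>{0..T}. \<forall>x. \<forall>\<mu>\<in>P2. \<bar>h t x \<mu>\<bar> \<le> C * (1 + (norm x)\<^sup>2 + moment2 \<mu>))"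

text \<open>In both convexity notions the variables \<open>X\<close>, \<open>X'\<close> live on an arbitrary probability measure on
  \<open>'a \<times> 'a\<close>; a sample space of this type is general enough because only the joint law of \<open>(X, X')\<close>
  enters. The space \<open>\<Omega>\<close> serves only to define the Lions derivative.\<close>

definition L_convex ::
  "'w measure \<Rightarrow> ('a::euclidean_space \<Rightarrow> 'a measure \<Rightarrow> 'e::euclidean_space \<Rightarrow> real) \<Rightarrow> bool" where
  "L_convex \<Omega> h \<longleftrightarrow>
    (\<forall>x a. \<forall>\<mu>\<in>P2. \<exists>p q D.
      GDERIV (\<lambda>y. h y \<mu> a) x :> p \<and> GDERIV (\<lambda>c. h x \<mu> c) a :> q \<and>
      has_lions_derivative \<Omega> (\<lambda>\<nu>. h x \<nu> a) (\<lambda>y v. D y \<bullet> v) \<mu> \<and>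
      (\<forall>x' a'. \<forall>\<mu>'\<in>P2. \<forall>(P :: ('a \<times> 'a) measure) X X'.
        prob_space P \<longrightarrow> X \<in> L2 P \<longrightarrow> X' \<in> L2 P \<longrightarrow>
        distr P borel X = \<mu> \<longrightarrow> distr P borel X' = \<mu>' \<longrightarrow>
        h x' \<mu>' a' \<ge> h x \<mu> a + p \<bullet> (x' - x) + q \<bullet> (a' - a) + (\<integral>\<omega>. D (X \<omega>) \<bullet> (X' \<omega> - X \<omega>) \<partial>P)))"

definition L_convex_state ::
  "'w measure \<Rightarrow> ('a::euclidean_space \<Rightarrow> 'a measure \<Rightarrow> real) \<Rightarrow> bool" where
  "L_convex_state \<Omega> h \<longleftrightarrow>
    (\<forall>x. \<forall>\<mu>\<in>P2. \<exists>p D.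
      GDERIV (\<lambda>y. h y \<mu>) x :> p \<and>
      has_lions_derivative \<Omega> (\<lambda>\<nu>. h x \<nu>) (\<lambda>y v. D y \<bullet> v) \<mu> \<and>
      (\<forall>x'. \<forall>\<mu>'\<in>P2. \<forall>(P :: ('a \<times> 'a) measure) X X'.
        prob_space P \<longrightarrow> X \<in> L2 P \<longrightarrow> X' \<in> L2 P \<longrightarrow>
        distr P borel X = \<mu> \<longrightarrow> distr P borel X' = \<mu>' \<longrightarrow>
        h x' \<mu>' \<ge> h x \<mu> + p \<bullet> (x' - x) + (\<integral>\<omega>. D (X \<omega>) \<bullet> (X' \<omega> - X \<omega>) \<partial>P)))"


section \<open>Brownian motion and the stochastic integral\<close>

definition dt_dP :: "'w measure \<Rightarrow> real \<Rightarrow> (real \<times> 'w) measure" where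
  "dt_dP M T = restrict_space lborel {0..T} \<Otimes>\<^sub>M M"

definition generated ::
  "'w measure \<Rightarrow> 'i set \<Rightarrow> ('i \<Rightarrow> 'w \<Rightarrow> 'a::topological_space) \<Rightarrow> 'w set set" where
  "generated M I V = sigma_sets (space M) {V i -` A \<inter> space M | i A. i \<in> I \<and> A \<in> sets borel}"

definition brownian_motion :: "'w measure \<Rightarrow> real \<Rightarrow> (real \<Rightarrow> 'w \<Rightarrow> real^'m) \<Rightarrow> bool" where
  "brownian_motion M T W \<longleftrightarrow>
    (\<forall>t\<in>{0..T}. W t \<in> borel_measurable M) \<and>
    (AE \<omega> in M. W 0 \<omega> = 0 \<and> continuous_on {0..T} (\<lambda>t. W t \<omega>)) \<and>
    (\<forall>s t. 0 \<le> s \<longrightarrow> s < t \<longrightarrow> t \<le> T \<longrightarrow>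
       distributed M lborel (\<lambda>\<omega>. W t \<omega> - W s \<omega>)
         (\<lambda>x. ennreal (\<Prod>i\<in>UNIV. normal_density 0 (sqrt (t - s)) (x $ i))) \<and>
       prob_space.indep_set M (generated M {0..s} W) (generated M {()} (\<lambda>_ \<omega>. W t \<omega> - W s \<omega>)))"

text \<open>A complete probability space with a Brownian motion \<open>W\<close> and an independent square-integrable
  initial condition \<open>X0\<close>.\<close>

definition stochastic_basis ::
  "'w measure \<Rightarrow> real \<Rightarrow> ('w \<Rightarrow> real^'d) \<Rightarrow> (real \<Rightarrow> 'w \<Rightarrow> real^'m) \<Rightarrow> bool" where
  "stochastic_basis M T X0 W \<longleftrightarrow>
    prob_space M \<and> complete_measure M \<and> 0 < T \<and> brownian_motion M T W \<and>
    X0 \<in> borel_measurable M \<and> distr M borel X0 \<in> P2 \<and>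
    prob_space.indep_set M (generated M {()} (\<lambda>_. X0)) (generated M {0..T} W)"

definition filt ::
  "'w measure \<Rightarrow> ('w \<Rightarrow> real^'d) \<Rightarrow> (real \<Rightarrow> 'w \<Rightarrow> real^'m) \<Rightarrow> real \<Rightarrow> 'w measure" where
  "filt M X0 W t =
    sigma (space M) (generated M {()} (\<lambda>_. X0) \<union> generated M {0..t} W \<union> null_sets M)"

definition progressive ::
  "(real \<Rightarrow> 'w measure) \<Rightarrow> real \<Rightarrow> (real \<Rightarrow> 'w \<Rightarrow> 'a::topological_space) \<Rightarrow> bool" where
  "progressive F T V \<longleftrightarrow>
    (\<forall>t\<in>{0..T}. (\<lambda>(s, \<omega>). V s \<omega>) \<in> borel_measurable (restrict_space borel {0..t} \<Otimes>\<^sub>M F t))"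

text \<open>\<open>E[sup\<^sub>t |V\<^sub>t|\<^sup>2] < \<infinity>\<close>, phrased by an integrable bound in order not to presuppose that the
  supremum is measurable.\<close>

definition S2_bounded :: "'w measure \<Rightarrow> real \<Rightarrow> (real \<Rightarrow> 'w \<Rightarrow> 'a::real_normed_vector) \<Rightarrow> bool" where
  "S2_bounded M T V \<longleftrightarrow>
    (\<exists>\<zeta>. integrable M \<zeta> \<and> (AE \<omega> in M. \<forall>t\<in>{0..T}. (norm (V t \<omega>))\<^sup>2 \<le> \<zeta> \<omega>))"

definition continuous_paths ::
  "'w measure \<Rightarrow> real \<Rightarrow> (real \<Rightarrow> 'w \<Rightarrow> 'a::topological_space) \<Rightarrow> bool" where
  "continuous_paths M T V \<longleftrightarrow> (AE \<omega> in M. continuous_on {0..T} (\<lambda>t. V t \<omega>))"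

text \<open>The simple integrand \<open>\<Sum>\<^sub>i\<^sub><\<^sub>n \<xi>\<^sub>i 1\<^bsub>(\<tau>\<^sub>i, \<tau>\<^sub>i\<^sub>+\<^sub>1]\<^esub>\<close>, with bounded, \<open>F (\<tau> i)\<close>-measurable \<open>\<xi> i\<close>.\<close>

definition simple_integrand ::
  "'w measure \<Rightarrow> (real \<Rightarrow> 'w measure) \<Rightarrow> real \<Rightarrow> nat \<Rightarrow> (nat \<Rightarrow> real) \<Rightarrow> (nat \<Rightarrow> 'w \<Rightarrow> real^'m^'d) \<Rightarrow> bool"
  where
  "simple_integrand M F T n \<tau> \<xi> \<longleftrightarrow>
    (\<forall>i\<le>n. \<tau> i \<in> {0..T}) \<and> (\<forall>i<n. \<tau> i \<le> \<tau> (Suc i)) \<and>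
    (\<forall>i<n. \<xi> i \<in> borel_measurable (F (\<tau> i)) \<and> (\<exists>C. \<forall>\<omega>\<in>space M. norm (\<xi> i \<omega>) \<le> C))"

definition simple_value ::
  "nat \<Rightarrow> (nat \<Rightarrow> real) \<Rightarrow> (nat \<Rightarrow> 'w \<Rightarrow> real^'m^'d) \<Rightarrow> real \<Rightarrow> 'w \<Rightarrow> real^'m^'d" where
  "simple_value n \<tau> \<xi> t \<omega> = (\<Sum>i<n. indicator {\<tau> i<..\<tau> (Suc i)} t *\<^sub>R \<xi> i \<omega>)"

definition simple_integral ::
  "(real \<Rightarrow> 'w \<Rightarrow> real^'m) \<Rightarrow> nat \<Rightarrow> (nat \<Rightarrow> real) \<Rightarrow> (nat \<Rightarrow> 'w \<Rightarrow> real^'m^'d) \<Rightarrow> real \<Rightarrow> 'w \<Rightarrow> real^'d"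
  where
  "simple_integral W n \<tau> \<xi> t \<omega> =
    (\<Sum>i<n. \<xi> i \<omega> *v (W (min t (\<tau> (Suc i))) \<omega> - W (min t (\<tau> i)) \<omega>))"

text \<open>\<open>I\<close> is a continuous version of the Ito integral process \<open>t \<mapsto> \<integral>\<^sub>0\<^sup>t Z\<^sub>s dW\<^sub>s\<close> of a square-integrable
  progressive integrand: the \<open>L\<^sup>2\<close>-limit of the integrals of simple integrands that approximate \<open>Z\<close> in
  \<open>L\<^sup>2(dt \<otimes> dP)\<close>.\<close>

definition ito_integral ::
  "'w measure \<Rightarrow> (real \<Rightarrow> 'w measure) \<Rightarrow> real \<Rightarrow> (real \<Rightarrow> 'w \<Rightarrow> real^'m)
    \<Rightarrow> (real \<Rightarrow> 'w \<Rightarrow> real^'m^'d) \<Rightarrow> (real \<Rightarrow> 'w \<Rightarrow> real^'d) \<Rightarrow> bool" where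
  "ito_integral M F T W Z I \<longleftrightarrow>
    progressive F T Z \<and> integrable (dt_dP M T) (\<lambda>(t, \<omega>). (norm (Z t \<omega>))\<^sup>2) \<and>
    (\<forall>t\<in>{0..T}. I t \<in> borel_measurable (F t)) \<and> continuous_paths M T I \<and>
    (\<exists>n \<tau> \<xi>. (\<forall>k. simple_integrand M F T (n k) (\<tau> k) (\<xi> k)) \<and>
      (\<lambda>k. \<integral>\<^sup>+(t, \<omega>). ennreal ((norm (simple_value (n k) (\<tau> k) (\<xi> k) t \<omega> - Z t \<omega>))\<^sup>2) \<partial>dt_dP M T)
        \<longlonglongrightarrow> 0 \<and>
      (\<forall>t\<in>{0..T}.
        (\<lambda>k. \<integral>\<^sup>+\<omega>. ennreal ((norm (simple_integral W (n k) (\<tau> k) (\<xi> k) t \<omega> - I t \<omega>))\<^sup>2) \<partial>M)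
          \<longlonglongrightarrow> 0))"


section \<open>The mean-field control problem\<close>

definition law :: "'w measure \<Rightarrow> (real \<Rightarrow> 'w \<Rightarrow> 'a::topological_space) \<Rightarrow> real \<Rightarrow> 'a measure" where
  "law M X t = distr M borel (X t)"

definition regular_coefficients ::
  "'w measure \<Rightarrow> real \<Rightarrow> (real \<Rightarrow> real^'m^'d)
    \<Rightarrow> (real \<Rightarrow> real^'d \<Rightarrow> (real^'d) measure \<Rightarrow> real^'d)
    \<Rightarrow> (real \<Rightarrow> real^'d \<Rightarrow> (real^'d) measure \<Rightarrow> real^'d^'d)
    \<Rightarrow> (real \<Rightarrow> real^'d \<Rightarrow> (real^'d) measure \<Rightarrow> real^'d \<Rightarrow> real^'d^'d)
    \<Rightarrow> (real \<Rightarrow> real^'d \<Rightarrow> (real^'d) measure \<Rightarrow> real)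
    \<Rightarrow> (real \<Rightarrow> real^'d \<Rightarrow> (real^'d) measure \<Rightarrow> real^'d)
    \<Rightarrow> (real \<Rightarrow> real^'d \<Rightarrow> (real^'d) measure \<Rightarrow> real^'d \<Rightarrow> real^'d)
    \<Rightarrow> (real^'d \<Rightarrow> (real^'d) measure \<Rightarrow> real)
    \<Rightarrow> (real^'d \<Rightarrow> (real^'d) measure \<Rightarrow> real^'d)
    \<Rightarrow> (real^'d \<Rightarrow> (real^'d) measure \<Rightarrow> real^'d \<Rightarrow> real^'d) \<Rightarrow> bool" where
  "regular_coefficients M T \<sigma> b bx bm f fx fm g gx gm \<longleftrightarrow>
    continuous_on {0..T} \<sigma> \<and> bounded (\<sigma> ` {0..T}) \<and>
    (\<forall>x. \<forall>\<mu>\<in>P2. set_borel_measurable lborel {0..T} (\<lambda>t. b t x \<mu>) \<and>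
       set_integrable lborel {0..T} (\<lambda>t. (norm (b t x \<mu>))\<^sup>2) \<and>
       set_borel_measurable lborel {0..T} (\<lambda>t. f t x \<mu>)) \<and>
    (\<exists>L. \<forall>t\<in>{0..T}. \<forall>x x'. \<forall>\<mu>\<in>P2. \<forall>\<mu>'\<in>P2.
       norm (b t x \<mu> - b t x' \<mu>') \<le> L * (norm (x - x') + W2 \<mu> \<mu>')) \<and>
    C1_vector M T b bx bm \<and> bounded_derivatives T bx bm \<and>
    C1_scalar M T f fx fm \<and> linear_growth_derivatives T fx fm \<and>
    C1_scalar M T (\<lambda>_. g) (\<lambda>_. gx) (\<lambda>_. gm) \<and>
    linear_growth_derivatives T (\<lambda>_. gx) (\<lambda>_. gm) \<and>
    quadratic_growth T f \<and> quadratic_growth T (\<lambda>_. g)"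

definition admissible ::
  "'w measure \<Rightarrow> (real \<Rightarrow> 'w measure) \<Rightarrow> real \<Rightarrow> (real \<Rightarrow> 'w \<Rightarrow> real^'m) \<Rightarrow> bool" where
  "admissible M F T \<alpha> \<longleftrightarrow>
    progressive F T \<alpha> \<and> integrable (dt_dP M T) (\<lambda>(t, \<omega>). (norm (\<alpha> t \<omega>))\<^sup>2)"

definition state_process ::
  "'w measure \<Rightarrow> real \<Rightarrow> ('w \<Rightarrow> real^'d) \<Rightarrow> (real \<Rightarrow> 'w \<Rightarrow> real^'m) \<Rightarrow> (real \<Rightarrow> real^'m^'d)
    \<Rightarrow> (real \<Rightarrow> real^'d \<Rightarrow> (real^'d) measure \<Rightarrow> real^'d)
    \<Rightarrow> (real \<Rightarrow> 'w \<Rightarrow> real^'m) \<Rightarrow> (real \<Rightarrow> 'w \<Rightarrow> real^'d) \<Rightarrow> bool" where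
  "state_process M T X0 W \<sigma> b \<alpha> X \<longleftrightarrow>
    progressive (filt M X0 W) T X \<and> continuous_paths M T X \<and> S2_bounded M T X \<and>
    (\<exists>S. ito_integral M (filt M X0 W) T W (\<lambda>t \<omega>. \<sigma> t) S \<and>
      (AE \<omega> in M. \<forall>t\<in>{0..T}.
        X t \<omega> = X0 \<omega> + (LINT s:{0..t}|lborel. b s (X s \<omega>) (law M X s) + \<sigma> s *v \<alpha> s \<omega>) + S t \<omega>))"

definition cost ::
  "'w measure \<Rightarrow> real \<Rightarrow> (real \<Rightarrow> 'a \<Rightarrow> 'a measure \<Rightarrow> real) \<Rightarrow> ('a \<Rightarrow> 'a measure \<Rightarrow> real)
    \<Rightarrow> (real \<Rightarrow> 'w \<Rightarrow> 'b::real_normed_vector) \<Rightarrow> (real \<Rightarrow> 'w \<Rightarrow> 'a::topological_space) \<Rightarrow> real" where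
  "cost M T f g \<alpha> X =
    (\<integral>\<omega>. (LINT t:{0..T}|lborel. f t (X t \<omega>) (law M X t) + (norm (\<alpha> t \<omega>))\<^sup>2 / 2)
       + g (X T \<omega>) (law M X T) \<partial>M)"

text \<open>The state equation determines \<open>X\<close> up to indistinguishability, so \<open>J(\<alpha>)\<close> is the value of
  \<open>cost\<close> at \<open>\<alpha>\<close> and any state process \<open>X\<close> of \<open>\<alpha>\<close>.\<close>

definition optimal_control ::
  "'w measure \<Rightarrow> real \<Rightarrow> ('w \<Rightarrow> real^'d) \<Rightarrow> (real \<Rightarrow> 'w \<Rightarrow> real^'m) \<Rightarrow> (real \<Rightarrow> real^'m^'d)
    \<Rightarrow> (real \<Rightarrow> real^'d \<Rightarrow> (real^'d) measure \<Rightarrow> real^'d)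
    \<Rightarrow> (real \<Rightarrow> real^'d \<Rightarrow> (real^'d) measure \<Rightarrow> real)
    \<Rightarrow> (real^'d \<Rightarrow> (real^'d) measure \<Rightarrow> real) \<Rightarrow> (real \<Rightarrow> 'w \<Rightarrow> real^'m) \<Rightarrow> bool" where
  "optimal_control M T X0 W \<sigma> b f g \<alpha> \<longleftrightarrow>
    admissible M (filt M X0 W) T \<alpha> \<and>
    (\<exists>X. state_process M T X0 W \<sigma> b \<alpha> X \<and>
      (\<forall>\<beta> X'. admissible M (filt M X0 W) T \<beta> \<longrightarrow> state_process M T X0 W \<sigma> b \<beta> X' \<longrightarrow>
        cost M T f g \<alpha> X \<le> cost M T f g \<beta> X'))"

definition hamiltonian ::
  "(real \<Rightarrow> real^'m^'d) \<Rightarrow> (real \<Rightarrow> real^'d \<Rightarrow> (real^'d) measure \<Rightarrow> real^'d)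
    \<Rightarrow> (real \<Rightarrow> real^'d \<Rightarrow> (real^'d) measure \<Rightarrow> real)
    \<Rightarrow> real \<Rightarrow> real^'d \<Rightarrow> (real^'d) measure \<Rightarrow> real^'d \<Rightarrow> real^'m^'d \<Rightarrow> real^'m \<Rightarrow> real" where
  "hamiltonian \<sigma> b f t x \<mu> y z a =
    f t x \<mu> + (norm a)\<^sup>2 / 2 + (b t x \<mu> + \<sigma> t *v a) \<bullet> y + trace (transpose (\<sigma> t) ** z)"


section \<open>Adjoint equations\<close>

text \<open>The terms shared by the two adjoint equations, for an adjoint process \<open>p\<close>. The variable
  \<open>\<omega>'\<close> is the sample point of the independent copy \<open>(X', p')\<close> of \<open>(X, p)\<close>.\<close>

definition adjoint_driver ::
  "'w measure \<Rightarrow> (real \<Rightarrow> real^'d \<Rightarrow> (real^'d) measure \<Rightarrow> real^'d^'d)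
    \<Rightarrow> (real \<Rightarrow> real^'d \<Rightarrow> (real^'d) measure \<Rightarrow> real^'d \<Rightarrow> real^'d^'d)
    \<Rightarrow> (real \<Rightarrow> real^'d \<Rightarrow> (real^'d) measure \<Rightarrow> real^'d)
    \<Rightarrow> (real \<Rightarrow> real^'d \<Rightarrow> (real^'d) measure \<Rightarrow> real^'d \<Rightarrow> real^'d)
    \<Rightarrow> (real \<Rightarrow> 'w \<Rightarrow> real^'d) \<Rightarrow> (real \<Rightarrow> 'w \<Rightarrow> real^'d) \<Rightarrow> real \<Rightarrow> 'w \<Rightarrow> real^'d" where
  "adjoint_driver M bx bm fx fm X p t \<omega> =
    transpose (bx t (X t \<omega>) (law M X t)) *v p t \<omega> + fx t (X t \<omega>) (law M X t)
    + (\<integral>\<omega>'. transpose (bm t (X t \<omega>') (law M X t) (X t \<omega>)) *v p t \<omega>' \<partial>M)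
    + (\<integral>\<omega>'. fm t (X t \<omega>') (law M X t) (X t \<omega>) \<partial>M)"

definition adjoint_terminal ::
  "'w measure \<Rightarrow> real \<Rightarrow> (real^'d \<Rightarrow> (real^'d) measure \<Rightarrow> real^'d)
    \<Rightarrow> (real^'d \<Rightarrow> (real^'d) measure \<Rightarrow> real^'d \<Rightarrow> real^'d)
    \<Rightarrow> (real \<Rightarrow> 'w \<Rightarrow> real^'d) \<Rightarrow> 'w \<Rightarrow> real^'d" where
  "adjoint_terminal M T gx gm X \<omega> =
    gx (X T \<omega>) (law M X T) + (\<integral>\<omega>'. gm (X T \<omega>') (law M X T) (X T \<omega>) \<partial>M)"

definition adjoint_processes ::
  "'w measure \<Rightarrow> real \<Rightarrow> ('w \<Rightarrow> real^'d) \<Rightarrow> (real \<Rightarrow> 'w \<Rightarrow> real^'m)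
    \<Rightarrow> (real \<Rightarrow> real^'d \<Rightarrow> (real^'d) measure \<Rightarrow> real^'d^'d)
    \<Rightarrow> (real \<Rightarrow> real^'d \<Rightarrow> (real^'d) measure \<Rightarrow> real^'d \<Rightarrow> real^'d^'d)
    \<Rightarrow> (real \<Rightarrow> real^'d \<Rightarrow> (real^'d) measure \<Rightarrow> real^'d)
    \<Rightarrow> (real \<Rightarrow> real^'d \<Rightarrow> (real^'d) measure \<Rightarrow> real^'d \<Rightarrow> real^'d)
    \<Rightarrow> (real^'d \<Rightarrow> (real^'d) measure \<Rightarrow> real^'d)
    \<Rightarrow> (real^'d \<Rightarrow> (real^'d) measure \<Rightarrow> real^'d \<Rightarrow> real^'d)
    \<Rightarrow> (real \<Rightarrow> 'w \<Rightarrow> real^'d) \<Rightarrow> (real \<Rightarrow> 'w \<Rightarrow> real^'d) \<Rightarrow> (real \<Rightarrow> 'w \<Rightarrow> real^'m^'d) \<Rightarrow> bool" where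
  "adjoint_processes M T X0 W bx bm fx fm gx gm X Y Z \<longleftrightarrow>
    progressive (filt M X0 W) T Y \<and> continuous_paths M T Y \<and> S2_bounded M T Y \<and>
    (\<exists>I. ito_integral M (filt M X0 W) T W Z I \<and>
      (AE \<omega> in M. \<forall>t\<in>{0..T}.
        Y t \<omega> = Y 0 \<omega> - (LINT s:{0..t}|lborel. adjoint_driver M bx bm fx fm X Y s \<omega>) + I t \<omega>)) \<and>
    (AE \<omega> in M. Y T \<omega> = adjoint_terminal M T gx gm X \<omega>)"


section \<open>Feedback controls and basic mean-field adjoint matching\<close>

definition regular_feedback ::
  "'w measure \<Rightarrow> real \<Rightarrow> (real \<Rightarrow> real^'d \<Rightarrow> (real^'d) measure \<Rightarrow> real^'m)
    \<Rightarrow> (real \<Rightarrow> real^'d \<Rightarrow> (real^'d) measure \<Rightarrow> real^'d^'m)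
    \<Rightarrow> (real \<Rightarrow> real^'d \<Rightarrow> (real^'d) measure \<Rightarrow> real^'d \<Rightarrow> real^'d^'m) \<Rightarrow> bool" where
  "regular_feedback M T u ux um \<longleftrightarrow>
    continuous_P2 T u \<and> C1_vector M T u ux um \<and> bounded_derivatives T ux um"

definition feedback_control ::
  "'w measure \<Rightarrow> (real \<Rightarrow> 'a \<Rightarrow> 'a measure \<Rightarrow> 'b) \<Rightarrow> (real \<Rightarrow> 'w \<Rightarrow> 'a::topological_space) \<Rightarrow> real \<Rightarrow> 'w \<Rightarrow> 'b"
  where
  "feedback_control M u X t \<omega> = u t (X t \<omega>) (law M X t)"

text \<open>The closed-loop coefficients \<open>b + \<sigma> u\<close> and \<open>f + |u|\<^sup>2 / 2\<close> and their derivatives in the space and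
  measure variables, which are computed from those of \<open>b\<close>, \<open>f\<close> and \<open>u\<close>; see the lemmas below.\<close>

definition cl_drift ::
  "(real \<Rightarrow> real^'m^'d) \<Rightarrow> (real \<Rightarrow> real^'d \<Rightarrow> (real^'d) measure \<Rightarrow> real^'d)
    \<Rightarrow> (real \<Rightarrow> real^'d \<Rightarrow> (real^'d) measure \<Rightarrow> real^'m)
    \<Rightarrow> real \<Rightarrow> real^'d \<Rightarrow> (real^'d) measure \<Rightarrow> real^'d" where
  "cl_drift \<sigma> b u t x \<mu> = b t x \<mu> + \<sigma> t *v u t x \<mu>"

definition cl_drift_dx ::
  "(real \<Rightarrow> real^'m^'d) \<Rightarrow> (real \<Rightarrow> real^'d \<Rightarrow> (real^'d) measure \<Rightarrow> real^'d^'d)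
    \<Rightarrow> (real \<Rightarrow> real^'d \<Rightarrow> (real^'d) measure \<Rightarrow> real^'d^'m)
    \<Rightarrow> real \<Rightarrow> real^'d \<Rightarrow> (real^'d) measure \<Rightarrow> real^'d^'d" where
  "cl_drift_dx \<sigma> bx ux t x \<mu> = bx t x \<mu> + \<sigma> t ** ux t x \<mu>"

definition cl_drift_dm ::
  "(real \<Rightarrow> real^'m^'d) \<Rightarrow> (real \<Rightarrow> real^'d \<Rightarrow> (real^'d) measure \<Rightarrow> real^'d \<Rightarrow> real^'d^'d)
    \<Rightarrow> (real \<Rightarrow> real^'d \<Rightarrow> (real^'d) measure \<Rightarrow> real^'d \<Rightarrow> real^'d^'m)
    \<Rightarrow> real \<Rightarrow> real^'d \<Rightarrow> (real^'d) measure \<Rightarrow> real^'d \<Rightarrow> real^'d^'d" where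
  "cl_drift_dm \<sigma> bm um t x \<mu> y = bm t x \<mu> y + \<sigma> t ** um t x \<mu> y"

definition cl_cost ::
  "(real \<Rightarrow> real^'d \<Rightarrow> (real^'d) measure \<Rightarrow> real)
    \<Rightarrow> (real \<Rightarrow> real^'d \<Rightarrow> (real^'d) measure \<Rightarrow> real^'m)
    \<Rightarrow> real \<Rightarrow> real^'d \<Rightarrow> (real^'d) measure \<Rightarrow> real" where
  "cl_cost f u t x \<mu> = f t x \<mu> + (norm (u t x \<mu>))\<^sup>2 / 2"

definition cl_cost_dx ::
  "(real \<Rightarrow> real^'d \<Rightarrow> (real^'d) measure \<Rightarrow> real^'d)
    \<Rightarrow> (real \<Rightarrow> real^'d \<Rightarrow> (real^'d) measure \<Rightarrow> real^'m)
    \<Rightarrow> (real \<Rightarrow> real^'d \<Rightarrow> (real^'d) measure \<Rightarrow> real^'d^'m)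
    \<Rightarrow> real \<Rightarrow> real^'d \<Rightarrow> (real^'d) measure \<Rightarrow> real^'d" where
  "cl_cost_dx fx u ux t x \<mu> = fx t x \<mu> + transpose (ux t x \<mu>) *v u t x \<mu>"

definition cl_cost_dm ::
  "(real \<Rightarrow> real^'d \<Rightarrow> (real^'d) measure \<Rightarrow> real^'d \<Rightarrow> real^'d)
    \<Rightarrow> (real \<Rightarrow> real^'d \<Rightarrow> (real^'d) measure \<Rightarrow> real^'m)
    \<Rightarrow> (real \<Rightarrow> real^'d \<Rightarrow> (real^'d) measure \<Rightarrow> real^'d \<Rightarrow> real^'d^'m)
    \<Rightarrow> real \<Rightarrow> real^'d \<Rightarrow> (real^'d) measure \<Rightarrow> real^'d \<Rightarrow> real^'d" where
  "cl_cost_dm fm u um t x \<mu> y = fm t x \<mu> y + transpose (um t x \<mu> y) *v u t x \<mu>"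

lemma L2_product_bound:
  fixes A B :: "'w \<Rightarrow> real"
  assumes [measurable]: "A \<in> borel_measurable \<Omega>" "B \<in> borel_measurable \<Omega>"
    and A: "integrable \<Omega> (\<lambda>\<omega>. (A \<omega>)\<^sup>2)" and B: "integrable \<Omega> (\<lambda>\<omega>. (B \<omega>)\<^sup>2)"
  shows "integrable \<Omega> (\<lambda>\<omega>. A \<omega> * B \<omega>)"
    and "(\<integral>\<omega>. \<bar>A \<omega> * B \<omega>\<bar> \<partial>\<Omega>) \<le> ((\<integral>\<omega>. (A \<omega>)\<^sup>2 \<partial>\<Omega>) + 1) * sqrt (\<integral>\<omega>. (B \<omega>)\<^sup>2 \<partial>\<Omega>)"
proof -
  define K N where "K = (\<integral>\<omega>. (A \<omega>)\<^sup>2 \<partial>\<Omega>)" and "N = (\<integral>\<omega>. (B \<omega>)\<^sup>2 \<partial>\<Omega>)"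
  have nn: "K \<ge> 0" "N \<ge> 0" by (auto simp: K_def N_def)
  have young: "\<bar>x * y\<bar> \<le> c * x\<^sup>2 + y\<^sup>2 / c" if "c > 0" for c x y :: real
  proof -
    have "2 * \<bar>x * y\<bar> = 2 * (sqrt c * \<bar>x\<bar>) * (\<bar>y\<bar> / sqrt c)"
      using that by (simp add: abs_mult)
    also have "\<dots> \<le> (sqrt c * \<bar>x\<bar>)\<^sup>2 + (\<bar>y\<bar> / sqrt c)\<^sup>2"
      by (rule sum_squares_bound)
    also have "\<dots> = c * x\<^sup>2 + y\<^sup>2 / c"
      using that by (simp add: power_mult_distrib power_divide)
    finally have "2 * \<bar>x * y\<bar> \<le> c * x\<^sup>2 + y\<^sup>2 / c" .
    moreover have "0 \<le> \<bar>x * y\<bar>" by simp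
    ultimately show ?thesis by linarith
  qed
  show int: "integrable \<Omega> (\<lambda>\<omega>. A \<omega> * B \<omega>)"
    by (rule Bochner_Integration.integrable_bound[OF Bochner_Integration.integrable_add[OF A B]])
       (use young[of 1] in auto)
  show "(\<integral>\<omega>. \<bar>A \<omega> * B \<omega>\<bar> \<partial>\<Omega>) \<le> (K + 1) * sqrt N"
  proof (cases "N = 0")
    case True
    then have "AE \<omega> in \<Omega>. (B \<omega>)\<^sup>2 = 0"
      unfolding N_def using integral_nonneg_eq_0_iff_AE[OF B] by simp
    then have "(\<integral>\<omega>. \<bar>A \<omega> * B \<omega>\<bar> \<partial>\<Omega>) = (\<integral>\<omega>. 0 \<partial>\<Omega>)"
      by (intro integral_cong_AE) auto
    then show ?thesis using True by simp
  next
    case False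
    with nn have c: "sqrt N > 0" by simp
    have "(\<integral>\<omega>. \<bar>A \<omega> * B \<omega>\<bar> \<partial>\<Omega>) \<le> (\<integral>\<omega>. sqrt N * (A \<omega>)\<^sup>2 + (B \<omega>)\<^sup>2 / sqrt N \<partial>\<Omega>)"
      using int A B young[OF c] by (intro integral_mono) auto
    also have "\<dots> = sqrt N * K + N / sqrt N"
      using A B by (simp add: K_def N_def)
    also have "\<dots> = (K + 1) * sqrt N"
      using nn by (simp add: algebra_simps real_div_sqrt)
    finally show ?thesis .
  qed
qed

lemma lions_linear_part:
  fixes D :: "'a::euclidean_space \<Rightarrow> 'a \<Rightarrow> 'b::euclidean_space"
  assumes lin: "\<And>x. linear (D x)"
    and meas [measurable]: "\<And>v. (\<lambda>x. D x v) \<in> borel_measurable borel"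
    and sq: "\<And>v. integrable (distr \<Omega> borel X) (\<lambda>x. (norm (D x v))\<^sup>2)"
    and [measurable]: "X \<in> borel_measurable \<Omega>"
  shows "\<And>Y. Y \<in> L2 \<Omega> \<Longrightarrow> integrable \<Omega> (\<lambda>\<omega>. D (X \<omega>) (Y \<omega>))"
    and "\<exists>C\<ge>0. \<forall>Y\<in>L2 \<Omega>. norm (\<integral>\<omega>. D (X \<omega>) (Y \<omega>) \<partial>\<Omega>) \<le> C * L2_norm \<Omega> Y"
proof -
  have rep: "D x v = (\<Sum>i\<in>Basis. (v \<bullet> i) *\<^sub>R D x i)" for x v
  proof -
    have "D x v = D x (\<Sum>i\<in>Basis. (v \<bullet> i) *\<^sub>R i)" by (simp add: euclidean_representation)
    also have "\<dots> = (\<Sum>i\<in>Basis. (v \<bullet> i) *\<^sub>R D x i)"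
      by (simp add: linear_sum[OF lin] linear_scale[OF lin])
    finally show ?thesis .
  qed
  have sq': "integrable \<Omega> (\<lambda>\<omega>. (norm (D (X \<omega>) i))\<^sup>2)" for i
    using sq[of i] by (subst (asm) integrable_distr_eq) auto
  define C where "C = (\<Sum>i\<in>(Basis::'a set). (\<integral>\<omega>. (norm (D (X \<omega>) i))\<^sup>2 \<partial>\<Omega>) + 1)"
  have key: "integrable \<Omega> (\<lambda>\<omega>. (Y \<omega> \<bullet> i) *\<^sub>R D (X \<omega>) i) \<and>
      norm (\<integral>\<omega>. (Y \<omega> \<bullet> i) *\<^sub>R D (X \<omega>) i \<partial>\<Omega>)
        \<le> ((\<integral>\<omega>. (norm (D (X \<omega>) i))\<^sup>2 \<partial>\<Omega>) + 1) * L2_norm \<Omega> Y"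
    if Y: "Y \<in> L2 \<Omega>" and i: "i \<in> Basis" for Y and i :: 'a
  proof -
    have [measurable]: "Y \<in> borel_measurable \<Omega>" and Y2: "integrable \<Omega> (\<lambda>\<omega>. (norm (Y \<omega>))\<^sup>2)"
      using Y by (auto simp: L2_def)
    have int: "integrable \<Omega> (\<lambda>\<omega>. norm (D (X \<omega>) i) * norm (Y \<omega>))"
      and le: "(\<integral>\<omega>. \<bar>norm (D (X \<omega>) i) * norm (Y \<omega>)\<bar> \<partial>\<Omega>)
        \<le> ((\<integral>\<omega>. (norm (D (X \<omega>) i))\<^sup>2 \<partial>\<Omega>) + 1) * L2_norm \<Omega> Y"
      using L2_product_bound[of "\<lambda>\<omega>. norm (D (X \<omega>) i)" \<Omega> "\<lambda>\<omega>. norm (Y \<omega>)"] sq' Y2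
      by (auto simp: L2_norm_def)
    have bd: "norm ((Y \<omega> \<bullet> i) *\<^sub>R D (X \<omega>) i) \<le> norm (D (X \<omega>) i) * norm (Y \<omega>)" for \<omega>
      using Basis_le_norm[OF i, of "Y \<omega>"] by (simp add: mult.commute[of "norm (D (X \<omega>) i)"] mult_right_mono)
    have 1: "integrable \<Omega> (\<lambda>\<omega>. (Y \<omega> \<bullet> i) *\<^sub>R D (X \<omega>) i)"
      by (rule Bochner_Integration.integrable_bound[OF int]) (use bd in auto)
    have "norm (\<integral>\<omega>. (Y \<omega> \<bullet> i) *\<^sub>R D (X \<omega>) i \<partial>\<Omega>) \<le> (\<integral>\<omega>. norm (D (X \<omega>) i) * norm (Y \<omega>) \<partial>\<Omega>)"
      by (rule order_trans[OF integral_norm_bound integral_mono[OF integrable_norm[OF 1] int bd]])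
    with 1 le show ?thesis by simp
  qed
  show "integrable \<Omega> (\<lambda>\<omega>. D (X \<omega>) (Y \<omega>))" if "Y \<in> L2 \<Omega>" for Y
    using key[OF that] by (subst rep) (auto intro!: Bochner_Integration.integrable_sum)
  have "norm (\<integral>\<omega>. D (X \<omega>) (Y \<omega>) \<partial>\<Omega>) \<le> C * L2_norm \<Omega> Y" if "Y \<in> L2 \<Omega>" for Y
  proof -
    have "(\<integral>\<omega>. D (X \<omega>) (Y \<omega>) \<partial>\<Omega>) = (\<Sum>i\<in>Basis. \<integral>\<omega>. (Y \<omega> \<bullet> i) *\<^sub>R D (X \<omega>) i \<partial>\<Omega>)"
      using key[OF that] by (subst rep) (auto intro!: Bochner_Integration.integral_sum)
    also have "norm \<dots> \<le> (\<Sum>i\<in>(Basis::'a set). ((\<integral>\<omega>. (norm (D (X \<omega>) i))\<^sup>2 \<partial>\<Omega>) + 1) * L2_norm \<Omega> Y)"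
      using key[OF that] by (intro sum_norm_le) auto
    also have "\<dots> = C * L2_norm \<Omega> Y"
      by (simp add: C_def sum_distrib_right)
    finally show ?thesis .
  qed
  moreover have "C \<ge> 0"
    by (auto simp: C_def intro!: sum_nonneg add_nonneg_nonneg)
  ultimately show "\<exists>C\<ge>0. \<forall>Y\<in>L2 \<Omega>. norm (\<integral>\<omega>. D (X \<omega>) (Y \<omega>) \<partial>\<Omega>) \<le> C * L2_norm \<Omega> Y"
    by blast
qed

lemma has_lions_derivative_add:
  fixes \<Omega> :: "'w measure" and h k :: "'a::euclidean_space measure \<Rightarrow> 'b::euclidean_space"
  assumes \<mu>: "\<mu> \<in> P2"
    and h: "has_lions_derivative \<Omega> h D \<mu>" and k: "has_lions_derivative \<Omega> k E \<mu>"
  shows "has_lions_derivative \<Omega> (\<lambda>\<nu>. h \<nu> + k \<nu>) (\<lambda>x v. D x v + E x v) \<mu>"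
  unfolding has_lions_derivative_def
proof (intro conjI allI impI ballI)
  note H = h[unfolded has_lions_derivative_def] and K = k[unfolded has_lions_derivative_def]
  have [measurable_cong]: "sets \<mu> = sets borel"
    using \<mu> by (simp add: P2_def)
  show "linear (\<lambda>v. D x v + E x v)" for x
    using H K by (intro linear_compose_add) auto
  have [measurable]: "(\<lambda>x. D x v) \<in> borel_measurable borel" "(\<lambda>x. E x v) \<in> borel_measurable borel" for v
    using H K by auto
  show "(\<lambda>x. D x v + E x v) \<in> borel_measurable borel" for v
    by measurable
  show "integrable \<mu> (\<lambda>x. (norm (D x v + E x v))\<^sup>2)" for v
  proof (rule Bochner_Integration.integrable_bound)
    have "integrable \<mu> (\<lambda>x. (norm (D x v))\<^sup>2)" "integrable \<mu> (\<lambda>x. (norm (E x v))\<^sup>2)"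
      using H K by auto
    then show "integrable \<mu> (\<lambda>x. 2 * (norm (D x v))\<^sup>2 + 2 * (norm (E x v))\<^sup>2)"
      by auto
    have *: "(norm (a + b))\<^sup>2 \<le> 2 * (norm a)\<^sup>2 + 2 * (norm b)\<^sup>2" for a b :: 'b
    proof -
      have "(norm (a + b))\<^sup>2 \<le> (norm a + norm b)\<^sup>2"
        by (intro power_mono norm_triangle_ineq) auto
      also have "\<dots> \<le> 2 * (norm a)\<^sup>2 + 2 * (norm b)\<^sup>2"
        using sum_squares_bound[of "norm a" "norm b"] by (simp add: power2_sum)
      finally show ?thesis .
    qed
    show "AE x in \<mu>. norm ((norm (D x v + E x v))\<^sup>2) \<le> norm (2 * (norm (D x v))\<^sup>2 + 2 * (norm (E x v))\<^sup>2)"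
      using * by simp
  qed measurable
next
  note H = h[unfolded has_lions_derivative_def] and K = k[unfolded has_lions_derivative_def]
  fix X and \<epsilon> :: real
  assume X: "X \<in> L2 \<Omega>" and law: "distr \<Omega> borel X = \<mu>" and "\<epsilon> > 0"
  then have "\<epsilon> / 2 > 0" by simp
  have [measurable]: "X \<in> borel_measurable \<Omega>"
    using X by (simp add: L2_def)
  obtain \<delta>1 where 1: "\<delta>1 > 0" "\<And>Y. Y \<in> L2 \<Omega> \<Longrightarrow> L2_norm \<Omega> Y < \<delta>1 \<Longrightarrow>
      norm (h (distr \<Omega> borel (\<lambda>\<omega>. X \<omega> + Y \<omega>)) - h \<mu> - (\<integral>\<omega>. D (X \<omega>) (Y \<omega>) \<partial>\<Omega>))
        \<le> \<epsilon> / 2 * L2_norm \<Omega> Y"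
    using H X law \<open>\<epsilon> / 2 > 0\<close> by blast
  obtain \<delta>2 where 2: "\<delta>2 > 0" "\<And>Y. Y \<in> L2 \<Omega> \<Longrightarrow> L2_norm \<Omega> Y < \<delta>2 \<Longrightarrow>
      norm (k (distr \<Omega> borel (\<lambda>\<omega>. X \<omega> + Y \<omega>)) - k \<mu> - (\<integral>\<omega>. E (X \<omega>) (Y \<omega>) \<partial>\<Omega>))
        \<le> \<epsilon> / 2 * L2_norm \<Omega> Y"
    using K X law \<open>\<epsilon> / 2 > 0\<close> by blast
  show "\<exists>\<delta>>0. \<forall>Y\<in>L2 \<Omega>. L2_norm \<Omega> Y < \<delta> \<longrightarrow>
      norm (h (distr \<Omega> borel (\<lambda>\<omega>. X \<omega> + Y \<omega>)) + k (distr \<Omega> borel (\<lambda>\<omega>. X \<omega> + Y \<omega>)) - (h \<mu> + k \<mu>)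
        - (\<integral>\<omega>. D (X \<omega>) (Y \<omega>) + E (X \<omega>) (Y \<omega>) \<partial>\<Omega>)) \<le> \<epsilon> * L2_norm \<Omega> Y"
  proof (intro exI[of _ "min \<delta>1 \<delta>2"] conjI ballI impI)
    fix Y :: "'w \<Rightarrow> 'a" assume Y: "Y \<in> L2 \<Omega>" "L2_norm \<Omega> Y < min \<delta>1 \<delta>2"
    let ?\<nu> = "distr \<Omega> borel (\<lambda>\<omega>. X \<omega> + Y \<omega>)"
    have "integrable \<Omega> (\<lambda>\<omega>. D (X \<omega>) (Y \<omega>))" "integrable \<Omega> (\<lambda>\<omega>. E (X \<omega>) (Y \<omega>))"
      using lions_linear_part(1)[of D \<Omega> X Y] lions_linear_part(1)[of E \<Omega> X Y] H K Y law by auto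
    then have "h ?\<nu> + k ?\<nu> - (h \<mu> + k \<mu>) - (\<integral>\<omega>. D (X \<omega>) (Y \<omega>) + E (X \<omega>) (Y \<omega>) \<partial>\<Omega>)
        = (h ?\<nu> - h \<mu> - (\<integral>\<omega>. D (X \<omega>) (Y \<omega>) \<partial>\<Omega>)) + (k ?\<nu> - k \<mu> - (\<integral>\<omega>. E (X \<omega>) (Y \<omega>) \<partial>\<Omega>))"
      by simp
    also have "norm \<dots> \<le> \<epsilon> / 2 * L2_norm \<Omega> Y + \<epsilon> / 2 * L2_norm \<Omega> Y"
      using 1(2)[of Y] 2(2)[of Y] Y by (intro norm_triangle_le add_mono) auto
    finally show "norm (h ?\<nu> + k ?\<nu> - (h \<mu> + k \<mu>)
        - (\<integral>\<omega>. D (X \<omega>) (Y \<omega>) + E (X \<omega>) (Y \<omega>) \<partial>\<Omega>)) \<le> \<epsilon> * L2_norm \<Omega> Y"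
      by simp
  qed (use 1 2 in auto)
qed

lemma has_lions_derivative_compose:
  fixes \<Omega> :: "'w measure" and h :: "'a::euclidean_space measure \<Rightarrow> 'b::euclidean_space"
    and G :: "'b \<Rightarrow> 'c::euclidean_space"
  assumes \<mu>: "\<mu> \<in> P2" and h: "has_lions_derivative \<Omega> h D \<mu>"
    and G: "(G has_derivative G') (at (h \<mu>))"
  shows "has_lions_derivative \<Omega> (\<lambda>\<nu>. G (h \<nu>)) (\<lambda>x v. G' (D x v)) \<mu>"
  unfolding has_lions_derivative_def
proof (intro conjI allI impI ballI)
  note H = h[unfolded has_lions_derivative_def]
  have [measurable_cong]: "sets \<mu> = sets borel"
    using \<mu> by (simp add: P2_def)
  have G': "bounded_linear G'"
    using G by (rule has_derivative_bounded_linear)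
  have [measurable]: "G' \<in> borel_measurable borel"
    using G' by (intro borel_measurable_continuous_onI linear_continuous_on)
  have [measurable]: "(\<lambda>x. D x v) \<in> borel_measurable borel" for v
    using H by auto
  show "linear (\<lambda>v. G' (D x v))" for x
    using linear_compose[of "D x" G'] H bounded_linear.linear[OF G'] by (simp add: o_def)
  show "(\<lambda>x. G' (D x v)) \<in> borel_measurable borel" for v
    by measurable
  obtain B where B: "\<And>x. norm (G' x) \<le> norm x * B"
    using bounded_linear.bounded[OF G'] by blast
  show "integrable \<mu> (\<lambda>x. (norm (G' (D x v)))\<^sup>2)" for v
  proof (rule Bochner_Integration.integrable_bound)
    show "integrable \<mu> (\<lambda>x. (norm (D x v))\<^sup>2 * B\<^sup>2)"
      using H by auto
    show "AE x in \<mu>. norm ((norm (G' (D x v)))\<^sup>2) \<le> norm ((norm (D x v))\<^sup>2 * B\<^sup>2)"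
      using power_mono[OF B, of _ 2] by (simp add: power_mult_distrib)
  qed measurable
next
  note H = h[unfolded has_lions_derivative_def]
  have G': "bounded_linear G'"
    using G by (rule has_derivative_bounded_linear)
  obtain B where B: "\<And>x. norm (G' x) \<le> norm x * B" "B > 0"
    using bounded_linear.pos_bounded[OF G'] by blast
  fix X and \<epsilon> :: real
  assume X: "X \<in> L2 \<Omega>" and law: "distr \<Omega> borel X = \<mu>" and \<epsilon>: "\<epsilon> > 0"
  have [measurable]: "X \<in> borel_measurable \<Omega>"
    using X by (simp add: L2_def)
  obtain C where C: "C \<ge> 0" "\<And>Y. Y \<in> L2 \<Omega> \<Longrightarrow> norm (\<integral>\<omega>. D (X \<omega>) (Y \<omega>) \<partial>\<Omega>) \<le> C * L2_norm \<Omega> Y"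
    using lions_linear_part(2)[of D \<Omega> X] H law by auto
  define \<eta> where "\<eta> = \<epsilon> / (2 * (C + 1))"
  have \<eta>: "\<eta> > 0" using \<epsilon> C by (simp add: \<eta>_def)
  obtain d where d: "d > 0"
    "\<And>y. norm (y - h \<mu>) < d \<Longrightarrow> norm (G y - G (h \<mu>) - G' (y - h \<mu>)) \<le> \<eta> * norm (y - h \<mu>)"
    using G[unfolded has_derivative_at_alt] \<eta> by blast
  define \<kappa> where "\<kappa> = min 1 (\<epsilon> / (2 * B))"
  have \<kappa>: "\<kappa> > 0" "\<kappa> \<le> 1" "\<kappa> * B \<le> \<epsilon> / 2"
    using \<epsilon> B(2) by (auto simp: \<kappa>_def min_def field_simps)
  obtain \<delta> where \<delta>: "\<delta> > 0" "\<And>Y. Y \<in> L2 \<Omega> \<Longrightarrow> L2_norm \<Omega> Y < \<delta> \<Longrightarrow>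
      norm (h (distr \<Omega> borel (\<lambda>\<omega>. X \<omega> + Y \<omega>)) - h \<mu> - (\<integral>\<omega>. D (X \<omega>) (Y \<omega>) \<partial>\<Omega>))
        \<le> \<kappa> * L2_norm \<Omega> Y"
    using H X law \<kappa>(1) by blast
  show "\<exists>\<delta>>0. \<forall>Y\<in>L2 \<Omega>. L2_norm \<Omega> Y < \<delta> \<longrightarrow>
      norm (G (h (distr \<Omega> borel (\<lambda>\<omega>. X \<omega> + Y \<omega>))) - G (h \<mu>) - (\<integral>\<omega>. G' (D (X \<omega>) (Y \<omega>)) \<partial>\<Omega>))
        \<le> \<epsilon> * L2_norm \<Omega> Y"
  proof (intro exI[of _ "min \<delta> (d / (C + 1))"] conjI ballI impI)
    show "0 < min \<delta> (d / (C + 1))" using \<delta> d C by simp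
    fix Y :: "'w \<Rightarrow> 'a" assume Y: "Y \<in> L2 \<Omega>" "L2_norm \<Omega> Y < min \<delta> (d / (C + 1))"
    let ?\<nu> = "distr \<Omega> borel (\<lambda>\<omega>. X \<omega> + Y \<omega>)"
    define e where "e = (\<integral>\<omega>. D (X \<omega>) (Y \<omega>) \<partial>\<Omega>)"
    define N where "N = L2_norm \<Omega> Y"
    have N0: "N \<ge> 0" by (simp add: N_def L2_norm_def)
    have r: "norm (h ?\<nu> - h \<mu> - e) \<le> \<kappa> * N"
      using \<delta>(2)[of Y] Y by (simp add: e_def N_def)
    have "norm (h ?\<nu> - h \<mu>) \<le> norm (h ?\<nu> - h \<mu> - e) + norm e"
      using norm_triangle_sub[of "h ?\<nu> - h \<mu>" e] by simp
    also have "\<dots> \<le> 1 * N + C * N"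
      using r C(2)[OF Y(1)] mult_right_mono[OF \<kappa>(2) N0] by (simp add: e_def N_def)
    finally have \<Delta>: "norm (h ?\<nu> - h \<mu>) \<le> (C + 1) * N" by (simp add: algebra_simps)
    also have "\<dots> < d"
      using Y(2) C(1) by (simp add: N_def field_simps)
    finally have "norm (G (h ?\<nu>) - G (h \<mu>) - G' (h ?\<nu> - h \<mu>)) \<le> \<eta> * norm (h ?\<nu> - h \<mu>)"
      by (rule d(2))
    also have "\<dots> \<le> \<eta> * ((C + 1) * N)"
      using \<Delta> \<eta> by (intro mult_left_mono) auto
    also have "\<dots> = \<epsilon> / 2 * N"
      using C(1) by (simp add: \<eta>_def field_simps)
    finally have 1: "norm (G (h ?\<nu>) - G (h \<mu>) - G' (h ?\<nu> - h \<mu>)) \<le> \<epsilon> / 2 * N" .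
    have "norm (G' (h ?\<nu> - h \<mu> - e)) \<le> \<kappa> * N * B"
      using B(1)[of "h ?\<nu> - h \<mu> - e"] mult_right_mono[OF r less_imp_le[OF B(2)]] by linarith
    also have "\<dots> = \<kappa> * B * N" by simp
    also have "\<dots> \<le> \<epsilon> / 2 * N"
      using \<kappa>(3) N0 by (rule mult_right_mono)
    finally have 2: "norm (G' (h ?\<nu> - h \<mu> - e)) \<le> \<epsilon> / 2 * N" .
    have "integrable \<Omega> (\<lambda>\<omega>. D (X \<omega>) (Y \<omega>))"
      using lions_linear_part(1)[of D \<Omega> X Y] H Y law by auto
    then have "(\<integral>\<omega>. G' (D (X \<omega>) (Y \<omega>)) \<partial>\<Omega>) = G' e"
      unfolding e_def by (rule integral_bounded_linear[OF G'])
    then have "G (h ?\<nu>) - G (h \<mu>) - (\<integral>\<omega>. G' (D (X \<omega>) (Y \<omega>)) \<partial>\<Omega>)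
        = (G (h ?\<nu>) - G (h \<mu>) - G' (h ?\<nu> - h \<mu>)) + G' (h ?\<nu> - h \<mu> - e)"
      by (simp add: bounded_linear.linear[OF G'] linear_diff)
    also have "norm \<dots> \<le> \<epsilon> / 2 * N + \<epsilon> / 2 * N"
      using 1 2 by (intro norm_triangle_le add_mono)
    finally show "norm (G (h ?\<nu>) - G (h \<mu>) - (\<integral>\<omega>. G' (D (X \<omega>) (Y \<omega>)) \<partial>\<Omega>)) \<le> \<epsilon> * L2_norm \<Omega> Y"
      by (simp add: N_def)
  qed
qed

text \<open>The closed-loop derivatives above are indeed the derivatives of the closed-loop coefficients.\<close>

lemma cl_drift_derivatives:
  assumes "C1_vector \<Omega> T b bx bm" and "C1_vector \<Omega> T u ux um" and "t \<in> {0..T}" and "\<mu> \<in> P2"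
  shows "((\<lambda>y. cl_drift \<sigma> b u t y \<mu>) has_derivative (\<lambda>v. cl_drift_dx \<sigma> bx ux t x \<mu> *v v)) (at x)"
    and "has_lions_derivative \<Omega> (\<lambda>\<nu>. cl_drift \<sigma> b u t x \<nu>) (\<lambda>y v. cl_drift_dm \<sigma> bm um t x \<mu> y *v v) \<mu>"
proof -
  have b: "((\<lambda>y. b t y \<mu>) has_derivative (\<lambda>v. bx t x \<mu> *v v)) (at x)"
      "has_lions_derivative \<Omega> (\<lambda>\<nu>. b t x \<nu>) (\<lambda>y v. bm t x \<mu> y *v v) \<mu>"
    and u: "((\<lambda>y. u t y \<mu>) has_derivative (\<lambda>v. ux t x \<mu> *v v)) (at x)"
      "has_lions_derivative \<Omega> (\<lambda>\<nu>. u t x \<nu>) (\<lambda>y v. um t x \<mu> y *v v) \<mu>"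
    using assms by (auto simp: C1_vector_def)
  have lin: "bounded_linear (\<lambda>v. \<sigma> t *v v)"
    by (rule matrix_vector_mul_bounded_linear)
  show "((\<lambda>y. cl_drift \<sigma> b u t y \<mu>) has_derivative (\<lambda>v. cl_drift_dx \<sigma> bx ux t x \<mu> *v v)) (at x)"
    using has_derivative_add[OF b(1) bounded_linear.has_derivative[OF lin u(1)]]
    by (simp add: cl_drift_def cl_drift_dx_def matrix_vector_mult_add_rdistrib matrix_vector_mul_assoc)
  have "((\<lambda>v. \<sigma> t *v v) has_derivative (\<lambda>v. \<sigma> t *v v)) (at (u t x \<mu>))"
    by (rule bounded_linear_imp_has_derivative[OF lin])
  from has_lions_derivative_add[OF assms(4) b(2) has_lions_derivative_compose[OF assms(4) u(2) this]]
  show "has_lions_derivative \<Omega> (\<lambda>\<nu>. cl_drift \<sigma> b u t x \<nu>) (\<lambda>y v. cl_drift_dm \<sigma> bm um t x \<mu> y *v v) \<mu>"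
    by (simp add: cl_drift_def cl_drift_dm_def matrix_vector_mult_add_rdistrib matrix_vector_mul_assoc)
qed

lemma cl_cost_derivatives:
  assumes "C1_scalar \<Omega> T f fx fm" and "C1_vector \<Omega> T u ux um" and "t \<in> {0..T}" and "\<mu> \<in> P2"
  shows "GDERIV (\<lambda>y. cl_cost f u t y \<mu>) x :> cl_cost_dx fx u ux t x \<mu>"
    and "has_lions_derivative \<Omega> (\<lambda>\<nu>. cl_cost f u t x \<nu>) (\<lambda>y v. cl_cost_dm fm u um t x \<mu> y \<bullet> v) \<mu>"
proof -
  have f: "((\<lambda>y. f t y \<mu>) has_derivative (\<lambda>v. v \<bullet> fx t x \<mu>)) (at x)"
      "has_lions_derivative \<Omega> (\<lambda>\<nu>. f t x \<nu>) (\<lambda>y v. fm t x \<mu> y \<bullet> v) \<mu>"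
    and u: "((\<lambda>y. u t y \<mu>) has_derivative (\<lambda>v. ux t x \<mu> *v v)) (at x)"
      "has_lions_derivative \<Omega> (\<lambda>\<nu>. u t x \<nu>) (\<lambda>y v. um t x \<mu> y *v v) \<mu>"
    using assms by (auto simp: C1_vector_def C1_scalar_def gderiv_def)
  have q: "((\<lambda>v. (norm v)\<^sup>2 / 2) has_derivative (\<lambda>v. w \<bullet> v)) (at w)" for w :: "real^'c"
    unfolding power2_norm_eq_inner
    by (auto intro!: derivative_eq_intros simp: inner_commute)
  have tr: "(transpose A *v w) \<bullet> v = w \<bullet> (A *v v)" for A :: "real^'n^'c" and v w
    by (metis dot_lmul_matrix inner_commute transpose_matrix_vector)
  show "GDERIV (\<lambda>y. cl_cost f u t y \<mu>) x :> cl_cost_dx fx u ux t x \<mu>"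
    using has_derivative_add[OF f(1) has_derivative_compose[OF u(1) q]]
    by (simp add: gderiv_def cl_cost_def cl_cost_dx_def inner_add tr[symmetric] inner_commute)
  from has_lions_derivative_add[OF assms(4) f(2) has_lions_derivative_compose[OF assms(4) u(2) q]]
  show "has_lions_derivative \<Omega> (\<lambda>\<nu>. cl_cost f u t x \<nu>) (\<lambda>y v. cl_cost_dm fm u um t x \<mu> y \<bullet> v) \<mu>"
    by (simp only: cl_cost_def cl_cost_dm_def inner_add_left tr)
qed

definition basic_adjoint ::
  "'w measure \<Rightarrow> real \<Rightarrow> (real \<Rightarrow> real^'m^'d)
    \<Rightarrow> (real \<Rightarrow> real^'d \<Rightarrow> (real^'d) measure \<Rightarrow> real^'d^'d)
    \<Rightarrow> (real \<Rightarrow> real^'d \<Rightarrow> (real^'d) measure \<Rightarrow> real^'d \<Rightarrow> real^'d^'d)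
    \<Rightarrow> (real \<Rightarrow> real^'d \<Rightarrow> (real^'d) measure \<Rightarrow> real^'d)
    \<Rightarrow> (real \<Rightarrow> real^'d \<Rightarrow> (real^'d) measure \<Rightarrow> real^'d \<Rightarrow> real^'d)
    \<Rightarrow> (real^'d \<Rightarrow> (real^'d) measure \<Rightarrow> real^'d)
    \<Rightarrow> (real^'d \<Rightarrow> (real^'d) measure \<Rightarrow> real^'d \<Rightarrow> real^'d)
    \<Rightarrow> (real \<Rightarrow> real^'d \<Rightarrow> (real^'d) measure \<Rightarrow> real^'m)
    \<Rightarrow> (real \<Rightarrow> real^'d \<Rightarrow> (real^'d) measure \<Rightarrow> real^'d^'m)
    \<Rightarrow> (real \<Rightarrow> real^'d \<Rightarrow> (real^'d) measure \<Rightarrow> real^'d \<Rightarrow> real^'d^'m)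
    \<Rightarrow> (real \<Rightarrow> 'w \<Rightarrow> real^'d) \<Rightarrow> (real \<Rightarrow> 'w \<Rightarrow> real^'d) \<Rightarrow> bool" where
  "basic_adjoint M T \<sigma> bx bm fx fm gx gm u ux um X a \<longleftrightarrow>
    (\<lambda>(t, \<omega>). a t \<omega>) \<in> borel_measurable (dt_dP M T) \<and> S2_bounded M T a \<and>
    (AE \<omega> in M. \<forall>t\<in>{0..T}.
      ((\<lambda>s. a s \<omega>) has_vector_derivative
         - adjoint_driver M (cl_drift_dx \<sigma> bx ux) (cl_drift_dm \<sigma> bm um)
             (cl_cost_dx fx u ux) (cl_cost_dm fm u um) X a t \<omega>) (at t within {0..T})) \<and>
    (AE \<omega> in M. a T \<omega> = adjoint_terminal M T gx gm X \<omega>)"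

definition basic_loss ::
  "'w measure \<Rightarrow> real \<Rightarrow> (real \<Rightarrow> real^'m^'d) \<Rightarrow> (real \<Rightarrow> 'w \<Rightarrow> real^'d) \<Rightarrow> (real \<Rightarrow> 'w \<Rightarrow> real^'d)
    \<Rightarrow> (real \<Rightarrow> real^'d \<Rightarrow> (real^'d) measure \<Rightarrow> real^'m) \<Rightarrow> 'w \<Rightarrow> real" where
  "basic_loss M T \<sigma> X a w \<omega> =
    (LINT t:{0..T}|lborel. (norm (w t (X t \<omega>) (law M X t) + transpose (\<sigma> t) *v a t \<omega>))\<^sup>2) / 2"

text \<open>The stop-gradient is expressed by \<open>X\<close> and \<open>a\<close> staying fixed while the first argument \<open>w\<close> of the
  loss is varied.\<close>

definition stop_gradient_critical ::
  "'w measure \<Rightarrow> real \<Rightarrow> (real \<Rightarrow> real^'m^'d) \<Rightarrow> (real \<Rightarrow> real^'d \<Rightarrow> (real^'d) measure \<Rightarrow> real^'m)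
    \<Rightarrow> (real \<Rightarrow> 'w \<Rightarrow> real^'d) \<Rightarrow> (real \<Rightarrow> 'w \<Rightarrow> real^'d) \<Rightarrow> bool" where
  "stop_gradient_critical M T \<sigma> u X a \<longleftrightarrow>
    (\<forall>\<phi> :: real \<Rightarrow> real^'d \<Rightarrow> (real^'d) measure \<Rightarrow> real^'m.
      (\<lambda>(t, x). \<phi> t x (law M X t)) \<in> borel_measurable (restrict_space borel {0..T} \<Otimes>\<^sub>M borel) \<longrightarrow>
      integrable (dt_dP M T) (\<lambda>(t, \<omega>). (norm (\<phi> t (X t \<omega>) (law M X t)))\<^sup>2) \<longrightarrow>
      ((\<lambda>\<epsilon>. \<integral>\<omega>. basic_loss M T \<sigma> X a (\<lambda>t x \<mu>. u t x \<mu> + \<epsilon> *\<^sub>R \<phi> t x \<mu>) \<omega> \<partial>M)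
        has_real_derivative 0) (at 0))"

end

theory Submission
  imports Defs
begin

text \<open>
  The noise \<open>\<sigma> dW\<close> is additive and deterministic, so it cancels in the difference of two controlled states,
  and no Ito formula is needed.

  Testing criticality with \<open>\<phi>(t, x) = E[(u\<^sub>t + \<sigma>\<^sub>t\<^sup>T a\<^sub>t) \<psi>(X\<^sub>t)] \<psi>(x)\<close> shows that the residual
  \<open>u\<^sub>t + \<sigma>\<^sub>t\<^sup>T a\<^sub>t\<close> has vanishing conditional expectation given \<open>X\<^sub>t\<close>, for every \<open>t\<close>. By Gronwall estimates \<open>X\<^sub>r\<close>
  for \<open>r \<ge> t\<close>, and hence \<open>a\<^sub>t\<close>, is measurable with respect to \<open>X\<^sub>t\<close> and the increments of \<open>W\<close> after \<open>t\<close>, which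
  are independent of \<open>F\<^sub>t\<close>; hence the residual is orthogonal to all of \<open>L\<^sup>2(F\<^sub>t)\<close>. In the equation for \<open>a - Y\<close>
  the derivatives of \<open>u\<close> are multiplied by the residual only, so a backward Gronwall argument gives
  \<open>E[a\<^sub>t | F\<^sub>t] = Y\<^sub>t\<close> and therefore \<open>u\<^sub>t = - \<sigma>\<^sub>t\<^sup>T Y\<^sub>t\<close>.

  The stochastic maximum principle then applies: convexity of \<open>g\<close> and of the Hamiltonian and the duality between
  \<open>Y\<close> and \<open>X' - X\<close> give \<open>J(\<beta>) \<ge> J(u) + E[\<integral> |\<beta>\<^sub>t - u\<^sub>t|\<^sup>2 dt] / 2\<close>; the quadratic term is the exact Taylor
  remainder in the control, and it also yields uniqueness.
\<close>

section \<open>Matrices, square-integrable variables and conditional projections\<close>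

text \<open>The state equation asserts only that some version of the integral of \<sigma> exists, as
  a limit of simple integrals whose coefficients may be random. Two states come with unrelated
  versions, so the cancellation of the noise rests on uniqueness of the Wiener integral. Replacing
  the random coefficients by their means does not increase the error, because \<sigma> is
  deterministic. This reduces uniqueness to a covariance computation for step functions, and it
  shows that noise increments after t are limits of functions of the increments of W after t alone.

  The quantities in the Gronwall arguments are distances to conditional projections, or bounds over
  all adapted test vectors; their measurability in time is never established. No integral inequality
  is formed for them. Explicit bounds c * s^n are iterated instead, so that only continuous
  majorants are integrated, and the bounds C^n t^n / n! tend to 0.

  Measurability up to null sets is expressed by almost sure equality with the conditional
  projection, a form that survives limits in \<open>L2\<close>.\<close>

lemma norm_matrix_vector_le: "norm (A *v x) \<le> norm A * norm x"
  for A :: "real^'n^'k" and x :: "real^'n"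
proof -
  \<comment> \<open>Row by row, by Cauchy-Schwarz; the norm of a matrix is its Frobenius
    norm.\<close>
  have "(norm (A *v x))\<^sup>2 = (\<Sum>i\<in>UNIV. (A $ i \<bullet> x)\<^sup>2)"
    by (simp add: norm_vec_def L2_set_def sum_nonneg matrix_vector_mul_component)
  also have "\<dots> \<le> (\<Sum>i\<in>UNIV. (norm (A $ i) * norm x)\<^sup>2)"
    by (intro sum_mono) (metis Cauchy_Schwarz_ineq2 abs_ge_zero power2_abs power_mono)
  also have "\<dots> = (norm A * norm x)\<^sup>2"
    by (simp add: norm_vec_def[of A] L2_set_def sum_nonneg power_mult_distrib sum_distrib_right)
  finally show ?thesis
    by (rule power2_le_imp_le) simp
qed

lemma bounded_bilinear_matrix_vector: "bounded_bilinear (\<lambda>(A :: real^'n^'k) x. A *v x)"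
  by (intro bounded_bilinear.intro)
    (auto simp: matrix_vector_mult_add_rdistrib matrix_vector_right_distrib scaleR_matrix_vector_assoc
      matrix_vector_mult_scaleR intro!: exI[of _ 1] norm_matrix_vector_le)

lemma bounded_linear_transpose: "bounded_linear (transpose :: real^'n^'k \<Rightarrow> real^'k^'n)"
  by (intro linear_conv_bounded_linear[THEN iffD1] linearI)
    (auto simp: transpose_def vec_eq_iff)

lemma norm_transpose: "norm (transpose A) = norm A" for A :: "real^'n^'k"
proof -
  have "(norm (transpose A))\<^sup>2 = (norm A)\<^sup>2"
    unfolding norm_vec_def L2_set_def transpose_def
    by (simp add: sum_nonneg) (rule sum.swap)
  then show ?thesis by simp
qed

lemma transpose_inner: "(transpose A *v w) \<bullet> v = w \<bullet> (A *v v)" for A :: "real^'n^'k"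
  by (metis dot_lmul_matrix inner_commute transpose_matrix_vector)

lemmas continuous_matrix_vector [continuous_intros] =
  bounded_bilinear.continuous[OF bounded_bilinear_matrix_vector]
  bounded_bilinear.continuous_on[OF bounded_bilinear_matrix_vector]
  bounded_linear.continuous_on[OF bounded_linear_transpose]

lemmas tendsto_matrix_vector [tendsto_intros] =
  bounded_bilinear.tendsto[OF bounded_bilinear_matrix_vector]
  bounded_linear.tendsto[OF bounded_linear_transpose]

lemma borel_measurable_matrix_vector [measurable]:
  fixes A :: "'x \<Rightarrow> real^'n^'k"
  assumes "A \<in> borel_measurable M" "x \<in> borel_measurable M"
  shows "(\<lambda>z. A z *v x z) \<in> borel_measurable M"
  using assms by (rule borel_measurable_continuous_Pair) (intro continuous_intros)

lemma borel_measurable_transpose [measurable]: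
  fixes A :: "'x \<Rightarrow> real^'n^'k"
  assumes "A \<in> borel_measurable M"
  shows "(\<lambda>z. transpose (A z)) \<in> borel_measurable M"
  using assms by (rule borel_measurable_continuous_on[rotated]) (intro continuous_intros)

section \<open>Calculus in the space \<open>L2\<close>\<close>

lemma L2_I: "X \<in> borel_measurable M \<Longrightarrow> integrable M (\<lambda>w. (norm (X w))\<^sup>2) \<Longrightarrow> X \<in> L2 M"
  by (simp add: L2_def)

lemma L2_measurable [measurable_dest]: "X \<in> L2 M \<Longrightarrow> X \<in> borel_measurable M"
  and L2_integrable: "X \<in> L2 M \<Longrightarrow> integrable M (\<lambda>w. (norm (X w))\<^sup>2)"
  by (auto simp: L2_def)

lemma L2_norm_nonneg [simp]: "0 \<le> L2_norm M X"
  by (simp add: L2_norm_def)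

lemma L2_norm_sq: "(L2_norm M X)\<^sup>2 = (\<integral>w. (norm (X w))\<^sup>2 \<partial>M)"
  by (simp add: L2_norm_def)

text \<open>The domination principle behind most membership proofs below: measurability together
  with a bound by a multiple of a known element.\<close>

lemma L2_bound:
  assumes [measurable]: "X \<in> borel_measurable M" and Y: "Y \<in> L2 M" and c: "0 \<le> c"
    and le: "AE w in M. norm (X w) \<le> c * norm (Y w)"
  shows "X \<in> L2 M" and "L2_norm M X \<le> c * L2_norm M Y"
proof -
  have le2: "AE w in M. (norm (X w))\<^sup>2 \<le> c\<^sup>2 * (norm (Y w))\<^sup>2"
    using le by eventually_elim (metis norm_ge_zero power_mono power_mult_distrib)
  have 1: "integrable M (\<lambda>w. c\<^sup>2 * (norm (Y w))\<^sup>2)"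
    using L2_integrable[OF Y] by simp
  have 2: "integrable M (\<lambda>w. (norm (X w))\<^sup>2)"
    using le2 by (intro Bochner_Integration.integrable_bound[OF 1]) auto
  then show "X \<in> L2 M" by (simp add: L2_def)
  have "(\<integral>w. (norm (X w))\<^sup>2 \<partial>M) \<le> c\<^sup>2 * (\<integral>w. (norm (Y w))\<^sup>2 \<partial>M)"
    using integral_mono_AE[OF 2 1 le2] by simp
  then have "sqrt (\<integral>w. (norm (X w))\<^sup>2 \<partial>M) \<le> sqrt (c\<^sup>2 * (\<integral>w. (norm (Y w))\<^sup>2 \<partial>M))"
    by simp
  then show "L2_norm M X \<le> c * L2_norm M Y"
    using c by (simp add: L2_norm_def real_sqrt_mult)
qed

lemma L2_cong_AE:
  assumes "X \<in> borel_measurable M" "Y \<in> L2 M" "AE w in M. X w = Y w"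
  shows "X \<in> L2 M"
  using assms by (intro L2_bound(1)[of X M Y 1]) auto

lemma L2_inner:
  assumes X: "X \<in> L2 M" and Y: "Y \<in> L2 M"
  shows "integrable M (\<lambda>w. X w \<bullet> Y w)"
    and "integrable M (\<lambda>w. norm (X w) * norm (Y w))"
    and "(\<integral>w. norm (X w) * norm (Y w) \<partial>M) \<le> L2_norm M X * L2_norm M Y"
    and "\<bar>\<integral>w. X w \<bullet> Y w \<partial>M\<bar> \<le> L2_norm M X * L2_norm M Y"
proof -
  note [measurable] = L2_measurable[OF X] L2_measurable[OF Y]
  note iX = L2_integrable[OF X] and iY = L2_integrable[OF Y]
  show 1: "integrable M (\<lambda>w. norm (X w) * norm (Y w))"
    using L2_product_bound(1)[of "\<lambda>w. norm (X w)" M "\<lambda>w. norm (Y w)"] iX iY by simp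
  show 2: "integrable M (\<lambda>w. X w \<bullet> Y w)"
    by (rule Bochner_Integration.integrable_bound[OF 1]) (auto simp: Cauchy_Schwarz_ineq2)
  show 3: "(\<integral>w. norm (X w) * norm (Y w) \<partial>M) \<le> L2_norm M X * L2_norm M Y"
  proof (cases "L2_norm M X = 0 \<or> L2_norm M Y = 0")
    case True
    then have "(AE w in M. (norm (X w))\<^sup>2 = 0) \<or> (AE w in M. (norm (Y w))\<^sup>2 = 0)"
      using integral_nonneg_eq_0_iff_AE[OF iX] integral_nonneg_eq_0_iff_AE[OF iY]
      by (auto simp: L2_norm_def)
    then have "AE w in M. norm (X w) * norm (Y w) = 0"
      by auto
    then have "(\<integral>w. norm (X w) * norm (Y w) \<partial>M) = 0"
      by (subst integral_cong_AE[where g="\<lambda>_. 0"]) auto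
    then show ?thesis by simp
  next
    case False
    define A B where "A = L2_norm M X" and "B = L2_norm M Y"
    have pos: "A > 0" "B > 0"
      using False by (simp_all add: A_def B_def less_le)
    \<comment> \<open>Young's inequality with weights \<open>B / A\<close> and \<open>A / B\<close>,
      chosen so that both terms integrate to \<open>A * B\<close>.\<close>
    have "norm (X w) * norm (Y w) \<le> (B / A * (norm (X w))\<^sup>2 + A / B * (norm (Y w))\<^sup>2) / 2" for w
      using sum_squares_bound[of "B * norm (X w)" "A * norm (Y w)"] pos
      by (simp add: field_simps power2_eq_square)
    then have "(\<integral>w. norm (X w) * norm (Y w) \<partial>M)
        \<le> (\<integral>w. (B / A * (norm (X w))\<^sup>2 + A / B * (norm (Y w))\<^sup>2) / 2 \<partial>M)"
      using 1 iX iY by (intro integral_mono) auto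
    also have "\<dots> = (B / A * A\<^sup>2 + A / B * B\<^sup>2) / 2"
      using iX iY by (simp add: A_def B_def L2_norm_sq)
    also have "\<dots> = A * B"
      using pos by (simp add: power2_eq_square)
    finally show ?thesis by (simp add: A_def B_def)
  qed
  have "\<bar>\<integral>w. X w \<bullet> Y w \<partial>M\<bar> \<le> (\<integral>w. \<bar>X w \<bullet> Y w\<bar> \<partial>M)"
    by (rule integral_abs_bound)
  also have "\<dots> \<le> (\<integral>w. norm (X w) * norm (Y w) \<partial>M)"
    using 1 2 by (intro integral_mono) (auto simp: Cauchy_Schwarz_ineq2)
  finally show "\<bar>\<integral>w. X w \<bullet> Y w \<partial>M\<bar> \<le> L2_norm M X * L2_norm M Y"
    using 3 by simp
qed

lemma L2_add:
  assumes X: "X \<in> L2 M" and Y: "Y \<in> L2 M"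
  shows "(\<lambda>w. X w + Y w) \<in> L2 M"
    and "L2_norm M (\<lambda>w. X w + Y w) \<le> L2_norm M X + L2_norm M Y"
proof -
  note [measurable] = L2_measurable[OF X] L2_measurable[OF Y]
  have eq: "(norm (X w + Y w))\<^sup>2 = (norm (X w))\<^sup>2 + (norm (Y w))\<^sup>2 + 2 * (X w \<bullet> Y w)" for w
    unfolding power2_norm_eq_inner by (simp add: inner_add inner_commute)
  have int: "integrable M (\<lambda>w. (norm (X w + Y w))\<^sup>2)"
    unfolding eq using L2_integrable[OF X] L2_integrable[OF Y] L2_inner(1)[OF X Y] by auto
  then show "(\<lambda>w. X w + Y w) \<in> L2 M" by (simp add: L2_def)
  have "(L2_norm M (\<lambda>w. X w + Y w))\<^sup>2 = (L2_norm M X)\<^sup>2 + (L2_norm M Y)\<^sup>2 + 2 * (\<integral>w. X w \<bullet> Y w \<partial>M)"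
    unfolding L2_norm_sq eq using L2_integrable[OF X] L2_integrable[OF Y] L2_inner(1)[OF X Y] by simp
  also have "\<dots> \<le> (L2_norm M X + L2_norm M Y)\<^sup>2"
    using L2_inner(4)[OF X Y] by (simp add: power2_sum)
  finally show "L2_norm M (\<lambda>w. X w + Y w) \<le> L2_norm M X + L2_norm M Y"
    by (rule power2_le_imp_le) simp
qed

lemma L2_scaleR:
  assumes X: "X \<in> L2 M"
  shows "(\<lambda>w. c *\<^sub>R X w) \<in> L2 M"
  using X by (intro L2_bound(1)[OF _ X, of _ "\<bar>c\<bar>"]) (auto dest: L2_measurable)

lemma L2_diff:
  assumes X: "X \<in> L2 M" and Y: "Y \<in> L2 M"
  shows "(\<lambda>w. X w - Y w) \<in> L2 M"
  using L2_add(1)[OF X L2_scaleR[OF Y, of "-1"]] by simp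

lemma L2_norm_minus: "L2_norm M (\<lambda>w. - X w) = L2_norm M X"
  by (simp add: L2_norm_def)

lemma L2_norm_triangle3:
  assumes X: "X \<in> L2 M" and Y: "Y \<in> L2 M" and Z: "Z \<in> L2 M"
  shows "L2_norm M (\<lambda>w. X w - Z w) \<le> L2_norm M (\<lambda>w. X w - Y w) + L2_norm M (\<lambda>w. Y w - Z w)"
  using L2_add(2)[OF L2_diff[OF X Y] L2_diff[OF Y Z]] by simp

lemma L2_norm_eq_0:
  assumes X: "X \<in> L2 M" and "L2_norm M X = 0"
  shows "AE w in M. X w = 0"
proof -
  have "AE w in M. (norm (X w))\<^sup>2 = 0"
    using assms(2) integral_nonneg_eq_0_iff_AE[OF L2_integrable[OF X]] by (simp add: L2_norm_def)
  then show ?thesis by simp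
qed

lemma L2_zero: "(\<lambda>_. 0) \<in> L2 M"
  by (simp add: L2_def)

lemma L2_sum: "(\<And>i. i \<in> I \<Longrightarrow> X i \<in> L2 M) \<Longrightarrow> (\<lambda>w. \<Sum>i\<in>I. X i w) \<in> L2 M"
  by (induction I rule: infinite_finite_induct) (auto intro: L2_zero L2_add)

lemma L2_const: "finite_measure M \<Longrightarrow> (\<lambda>_. c) \<in> L2 M"
  using finite_measure.integrable_const[of M "(norm c)\<^sup>2"] by (simp add: L2_def)

lemma L2_imp_integrable:
  assumes "finite_measure M" and X: "X \<in> L2 M"
  shows "integrable M X"
proof -
  have [measurable]: "X \<in> borel_measurable M" using X by (rule L2_measurable)
  have "integrable M (\<lambda>w. norm (X w) * norm (1::real))"
  proof (rule L2_product_bound(1))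
    show "integrable M (\<lambda>_. (norm (1::real))\<^sup>2)"
      by (rule finite_measure.integrable_const[OF assms(1)])
  qed (use L2_integrable[OF X] in auto)
  then show ?thesis
    by (simp add: integrable_norm_iff)
qed

lemma L2_matrix:
  fixes A :: "'w \<Rightarrow> real^'n^'k"
  assumes [measurable]: "A \<in> borel_measurable M" and X: "X \<in> L2 M" and c: "0 \<le> c"
    and A: "\<And>w. w \<in> space M \<Longrightarrow> norm (A w) \<le> c"
  shows "(\<lambda>w. A w *v X w) \<in> L2 M"
    and "L2_norm M (\<lambda>w. A w *v X w) \<le> c * L2_norm M X"
proof -
  have [measurable]: "X \<in> borel_measurable M" using X by (rule L2_measurable)
  have "AE w in M. norm (A w *v X w) \<le> c * norm (X w)"
    using A by (intro AE_I2 order_trans[OF norm_matrix_vector_le] mult_right_mono) auto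
  then show "(\<lambda>w. A w *v X w) \<in> L2 M" "L2_norm M (\<lambda>w. A w *v X w) \<le> c * L2_norm M X"
    by (auto intro: L2_bound[OF _ X c])
qed

lemma L2_component:
  assumes X: "X \<in> L2 M" and b: "b \<in> Basis"
  shows "(\<lambda>w. X w \<bullet> b) \<in> L2 M"
  using b Basis_le_norm[OF b] L2_measurable[OF X] by (intro L2_bound(1)[OF _ X, of _ 1]) auto

text \<open>Conditional expectation of a vector, assembled from the real-valued one in each
  coordinate. On \<open>L2 M\<close> it is the orthogonal projection onto the
  \<open>F\<close>-measurable elements.\<close>

definition cond_proj :: "'w measure \<Rightarrow> 'w measure \<Rightarrow> ('w \<Rightarrow> 'a::euclidean_space) \<Rightarrow> 'w \<Rightarrow> 'a" where
  "cond_proj M F X w = (\<Sum>b\<in>Basis. real_cond_exp M F (\<lambda>w. X w \<bullet> b) w *\<^sub>R b)"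

section \<open>Conditional expectation as orthogonal projection\<close>

context finite_measure_subalgebra
begin

lemma measurable_sub: "f \<in> measurable F N \<Longrightarrow> f \<in> measurable M N"
  by (rule measurable_from_subalg[OF subalg])

lemma cond_proj_measurable [measurable]: "cond_proj M F X \<in> borel_measurable F"
  unfolding cond_proj_def[abs_def] by measurable

text \<open>Conditional Jensen inequality for the square, coordinate by coordinate.\<close>

lemma cond_proj_L2:
  assumes X: "X \<in> L2 M"
  shows "cond_proj M F X \<in> L2 M"
proof -
  have "(\<lambda>w. real_cond_exp M F (\<lambda>w. X w \<bullet> b) w *\<^sub>R b) \<in> L2 M" if b: "b \<in> Basis" for b
  proof -
    have Xb: "(\<lambda>w. X w \<bullet> b) \<in> L2 M"
      by (rule L2_component[OF X b])
    have cv: "convex_on (UNIV :: real set) (\<lambda>x. x\<^sup>2)"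
      by (rule convex_power2)
    have "integrable M (\<lambda>w. (real_cond_exp M F (\<lambda>w. X w \<bullet> b) w)\<^sup>2)"
      using L2_imp_integrable[OF finite_measure_axioms Xb] L2_integrable[OF Xb] cv
      by (intro integrable_convex_cond_exp[of _ UNIV]) (auto intro!: continuous_intros)
    then show ?thesis
      using b by (intro L2_I) (auto simp: power_mult_distrib)
  qed
  then show ?thesis
    unfolding cond_proj_def[abs_def] by (intro L2_sum)
qed

lemma cond_proj_inner:
  assumes X: "X \<in> L2 M" and \<eta>: "\<eta> \<in> L2 M" and [measurable]: "\<eta> \<in> borel_measurable F"
  shows "(\<integral>w. cond_proj M F X w \<bullet> \<eta> w \<partial>M) = (\<integral>w. X w \<bullet> \<eta> w \<partial>M)"
proof -
  have Xm [measurable]: "X \<in> borel_measurable M" using X by (rule L2_measurable)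
  have int: "integrable M (\<lambda>w. (\<eta> w \<bullet> b) * (X w \<bullet> b))" if "b \<in> Basis" for b
    using L2_inner(1)[OF L2_component[OF \<eta> that] L2_component[OF X that]] by simp
  note R = real_cond_exp_intg[OF int]
  have eq: "cond_proj M F X w \<bullet> \<eta> w
      = (\<Sum>b\<in>Basis. (\<eta> w \<bullet> b) * real_cond_exp M F (\<lambda>w. X w \<bullet> b) w)" for w
    unfolding cond_proj_def inner_sum_left inner_scaleR_left
    by (rule sum.cong[OF refl]) (metis inner_commute mult.commute)
  have "(\<integral>w. cond_proj M F X w \<bullet> \<eta> w \<partial>M)
      = (\<integral>w. (\<Sum>b\<in>Basis. (\<eta> w \<bullet> b) * real_cond_exp M F (\<lambda>w. X w \<bullet> b) w) \<partial>M)"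
    by (simp only: eq)
  also have "\<dots> = (\<Sum>b\<in>Basis. \<integral>w. (\<eta> w \<bullet> b) * real_cond_exp M F (\<lambda>w. X w \<bullet> b) w \<partial>M)"
    by (intro Bochner_Integration.integral_sum R(1)) auto
  also have "\<dots> = (\<Sum>b\<in>Basis. \<integral>w. (\<eta> w \<bullet> b) * (X w \<bullet> b) \<partial>M)"
    by (intro sum.cong refl R(2)) auto
  also have "\<dots> = (\<integral>w. (\<Sum>b\<in>Basis. (\<eta> w \<bullet> b) * (X w \<bullet> b)) \<partial>M)"
    using int by (intro Bochner_Integration.integral_sum[symmetric]) auto
  also have "\<dots> = (\<integral>w. X w \<bullet> \<eta> w \<partial>M)"
    by (subst (3) euclidean_inner) (simp only: mult.commute)
  finally show ?thesis .
qed

lemma cond_proj_residual_orthogonal: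
  assumes X: "X \<in> L2 M" and \<eta>: "\<eta> \<in> L2 M" and "\<eta> \<in> borel_measurable F"
  shows "(\<integral>w. (X w - cond_proj M F X w) \<bullet> \<eta> w \<partial>M) = 0"
proof -
  have "(\<integral>w. (X w - cond_proj M F X w) \<bullet> \<eta> w \<partial>M)
      = (\<integral>w. X w \<bullet> \<eta> w \<partial>M) - (\<integral>w. cond_proj M F X w \<bullet> \<eta> w \<partial>M)"
    unfolding inner_diff_left
    by (rule Bochner_Integration.integral_diff[OF L2_inner(1)[OF X \<eta>] L2_inner(1)[OF cond_proj_L2[OF X] \<eta>]])
  then show ?thesis
    using cond_proj_inner[OF assms] by linarith
qed

text \<open>Best approximation: the residual is orthogonal to
  \<open>cond_proj M F X - \<eta>\<close>, so its squared norm equals its inner product with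
  \<open>X - \<eta>\<close>, and Cauchy-Schwarz applies.\<close>

lemma cond_proj_residual_norm_le:
  assumes X: "X \<in> L2 M" and \<eta>: "\<eta> \<in> L2 M" "\<eta> \<in> borel_measurable F"
  shows "L2_norm M (\<lambda>w. X w - cond_proj M F X w) \<le> L2_norm M (\<lambda>w. X w - \<eta> w)"
proof -
  define \<rho> where "\<rho> = (\<lambda>w. X w - cond_proj M F X w)"
  have \<rho>: "\<rho> \<in> L2 M" unfolding \<rho>_def by (rule L2_diff[OF X cond_proj_L2[OF X]])
  define \<zeta> where "\<zeta> = (\<lambda>w. cond_proj M F X w - \<eta> w)"
  have \<zeta>: "\<zeta> \<in> L2 M" "\<zeta> \<in> borel_measurable F"
    unfolding \<zeta>_def using L2_diff[OF cond_proj_L2[OF X] \<eta>(1)] \<eta>(2) by auto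
  have "(L2_norm M \<rho>)\<^sup>2 = (\<integral>w. \<rho> w \<bullet> \<rho> w \<partial>M)"
    by (simp add: L2_norm_sq power2_norm_eq_inner)
  also have "\<dots> = (\<integral>w. \<rho> w \<bullet> \<rho> w \<partial>M) + (\<integral>w. \<rho> w \<bullet> \<zeta> w \<partial>M)"
    using cond_proj_residual_orthogonal[OF X \<zeta>] by (simp add: \<rho>_def)
  also have "\<dots> = (\<integral>w. \<rho> w \<bullet> (X w - \<eta> w) \<partial>M)"
    using L2_inner(1)[OF \<rho> \<rho>] L2_inner(1)[OF \<rho> \<zeta>(1)]
    by (subst Bochner_Integration.integral_add[symmetric])
      (auto simp: inner_add_right[symmetric] \<rho>_def \<zeta>_def)
  also have "\<dots> \<le> L2_norm M \<rho> * L2_norm M (\<lambda>w. X w - \<eta> w)"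
    using L2_inner(4)[OF \<rho> L2_diff[OF X \<eta>(1)]] by simp
  finally have "L2_norm M \<rho> * L2_norm M \<rho> \<le> L2_norm M \<rho> * L2_norm M (\<lambda>w. X w - \<eta> w)"
    by (simp add: power2_eq_square)
  then show ?thesis
    unfolding \<rho>_def[symmetric]
    by (cases "L2_norm M \<rho> = 0") (auto simp: mult_le_cancel_left less_le)
qed

text \<open>The residual is the smallest possible error, so approximability up to every
  \<open>\<epsilon>\<close> makes it vanish.\<close>

lemma AE_eq_cond_proj:
  assumes X: "X \<in> L2 M"
    and approx: "\<And>\<epsilon>. 0 < \<epsilon> \<Longrightarrow> \<exists>\<eta>. \<eta> \<in> L2 M \<and> \<eta> \<in> borel_measurable F \<and> L2_norm M (\<lambda>w. X w - \<eta> w) \<le> \<epsilon>"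
  shows "AE w in M. X w = cond_proj M F X w"
proof -
  have "L2_norm M (\<lambda>w. X w - cond_proj M F X w) \<le> 0"
    using cond_proj_residual_norm_le[OF X] approx by (meson field_le_epsilon order_trans add_0 order_refl le_add_same_cancel2)
  then have "L2_norm M (\<lambda>w. X w - cond_proj M F X w) = 0"
    by (simp add: order_antisym)
  from L2_norm_eq_0[OF L2_diff[OF X cond_proj_L2[OF X]] this] show ?thesis by simp
qed

end

text \<open>Gronwall's lemma in Picard form: round \<open>n\<close> yields the bound
  \<open>K * C ^ n / fact n * t ^ n\<close>, which tends to 0. \<open>P t k\<close> is to be read
  as: the quantity at time \<open>t\<close> is at most \<open>k\<close>. A predicate covers both a
  norm and a bound that ranges over a family of test vectors, and it leaves the integration of
  monomials to the hypothesis \<open>step\<close>.\<close>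

lemma gronwall_iterate:
  fixes P :: "real \<Rightarrow> real \<Rightarrow> bool"
  assumes C: "0 \<le> C" and K: "0 \<le> K"
    and base: "\<And>t. t \<in> {0..R} \<Longrightarrow> P t K"
    and step: "\<And>c n t. 0 \<le> c \<Longrightarrow> t \<in> {0..R} \<Longrightarrow> (\<And>s. s \<in> {0..t} \<Longrightarrow> P s (c * s ^ n)) \<Longrightarrow>
      P t (C * c * t ^ Suc n / Suc n)"
    and t: "t \<in> {0..R}" and \<epsilon>: "0 < \<epsilon>"
  shows "\<exists>\<kappa>. 0 \<le> \<kappa> \<and> \<kappa> < \<epsilon> \<and> P t \<kappa>"
proof -
  have P: "P t (K * C ^ n / fact n * t ^ n)" if "t \<in> {0..R}" for n t
    using that
  proof (induction n arbitrary: t)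
    case 0
    then show ?case using base by simp
  next
    case (Suc n)
    have "P t (C * (K * C ^ n / fact n) * t ^ Suc n / Suc n)"
      using Suc C K by (intro step) auto
    also have "C * (K * C ^ n / fact n) * t ^ Suc n / Suc n = K * C ^ Suc n / fact (Suc n) * t ^ Suc n"
      by (simp add: field_simps)
    finally show ?case .
  qed
  have "(\<lambda>n. inverse (fact n) * (C * t) ^ n) \<longlonglongrightarrow> 0"
    using summable_exp[of "C * t"] by (rule summable_LIMSEQ_zero)
  then have "(\<lambda>n. K * (inverse (fact n) * (C * t) ^ n)) \<longlonglongrightarrow> 0"
    by (rule tendsto_mult_right_zero)
  then have "eventually (\<lambda>n. K * (inverse (fact n) * (C * t) ^ n) < \<epsilon>) sequentially"
    using \<epsilon> by (rule order_tendstoD)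
  then obtain n where "K * (inverse (fact n) * (C * t) ^ n) < \<epsilon>"
    by (auto simp: eventually_sequentially)
  then have "K * C ^ n / fact n * t ^ n < \<epsilon>"
    by (simp add: field_simps power_mult_distrib)
  moreover have "0 \<le> K * C ^ n / fact n * t ^ n"
    using C K t by auto
  ultimately show ?thesis using P[OF t, of n] by blast
qed

section \<open>Time integrals of processes\<close>

lemma finite_measure_time: "finite_measure (restrict_space lborel {0..T::real})"
  by (rule finite_measureI) (auto simp: emeasure_restrict_space space_restrict_space emeasure_lborel_Icc_eq)

lemma time_pair_sigma_finite:
  assumes "prob_space M"
  shows "pair_sigma_finite (restrict_space lborel {0..T::real}) M"
  using finite_measure.axioms(1)[OF finite_measure_time] prob_space_imp_sigma_finite[OF assms]
  by (rule pair_sigma_finite.intro)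

text \<open>Integrals over subintervals become integrals over the fixed finite measure space
  \<open>{0..T}\<close>, so that the one product measure \<open>dt_dP\<close> serves all of
  them.\<close>

lemma set_integral_time:
  fixes f :: "real \<Rightarrow> 'a::euclidean_space"
  assumes "0 \<le> r" "s \<le> T"
  shows "(LINT q:{r..s}|lborel. f q) = (\<integral>q. indicator {r..s} q *\<^sub>R f q \<partial>restrict_space lborel {0..T})"
    and "set_integrable lborel {r..s} f \<longleftrightarrow> integrable (restrict_space lborel {0..T}) (\<lambda>q. indicator {r..s} q *\<^sub>R f q)"
proof -
  have eq: "indicator {0..T} q * indicator {r..s} q = (indicator {r..s} q :: real)" for q
    using assms by (auto simp: indicator_def)
  show "(LINT q:{r..s}|lborel. f q) = (\<integral>q. indicator {r..s} q *\<^sub>R f q \<partial>restrict_space lborel {0..T})"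
    by (simp add: integral_restrict_space eq set_lebesgue_integral_def)
  show "set_integrable lborel {r..s} f \<longleftrightarrow> integrable (restrict_space lborel {0..T}) (\<lambda>q. indicator {r..s} q *\<^sub>R f q)"
    by (simp add: integrable_restrict_space eq set_integrable_def)
qed

lemma integrable_dt_dP_indicator:
  fixes h :: "real \<Rightarrow> 'w \<Rightarrow> 'a::euclidean_space"
  assumes h: "integrable (dt_dP M T) (\<lambda>(t, w). h t w)"
  shows "integrable (dt_dP M T) (\<lambda>(t, w). indicator {r..s} t *\<^sub>R h t w)"
proof (rule Bochner_Integration.integrable_bound[OF h])
  have [measurable]: "(\<lambda>(t, w). h t w) \<in> borel_measurable (restrict_space lborel {0..T} \<Otimes>\<^sub>M M)"
    using h by (auto simp: dt_dP_def)
  have [measurable]: "(\<lambda>t. indicator {r..s} t :: real) \<in> borel_measurable (restrict_space lborel {0..T})"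
    by (rule measurable_restrict_space1) simp
  show "(\<lambda>(t, w). indicator {r..s} t *\<^sub>R h t w) \<in> borel_measurable (dt_dP M T)"
    unfolding dt_dP_def by (auto simp: case_prod_beta')
qed (auto simp: indicator_def)

lemma dt_dP_fubini:
  fixes h :: "real \<Rightarrow> 'w \<Rightarrow> 'a::euclidean_space"
  assumes M: "prob_space M" and h: "integrable (dt_dP M T) (\<lambda>(t, w). h t w)" and rs: "0 \<le> r" "s \<le> T"
  shows "integrable M (\<lambda>w. LINT q:{r..s}|lborel. h q w)"
    and "(\<integral>w. (LINT q:{r..s}|lborel. h q w) \<partial>M) = (LINT q:{r..s}|lborel. \<integral>w. h q w \<partial>M)"
    and "AE w in M. set_integrable lborel {r..s} (\<lambda>q. h q w)"
    and "set_integrable lborel {r..s} (\<lambda>q. \<integral>w. h q w \<partial>M)"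
    and "(LINT q:{0..T}|lborel. \<integral>w. h q w \<partial>M) = (\<integral>(t, w). h t w \<partial>dt_dP M T)"
proof -
  interpret P: pair_sigma_finite "restrict_space lborel {0..T}" M
    by (rule time_pair_sigma_finite[OF M])
  have i: "integrable (restrict_space lborel {0..T} \<Otimes>\<^sub>M M) (\<lambda>(t, w). indicator {r..s} t *\<^sub>R h t w)"
    using integrable_dt_dP_indicator[OF h, of r s] by (simp add: dt_dP_def)
  show "integrable M (\<lambda>w. LINT q:{r..s}|lborel. h q w)"
    unfolding set_integral_time(1)[OF rs] using P.integrable_snd[OF i] by simp
  show "AE w in M. set_integrable lborel {r..s} (\<lambda>q. h q w)"
    unfolding set_integral_time(2)[OF rs] using P.AE_integrable_snd[OF i] by simp
  show "set_integrable lborel {r..s} (\<lambda>q. \<integral>w. h q w \<partial>M)"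
    unfolding set_integral_time(2)[OF rs] using P.integrable_fst[OF i] by simp
  show "(\<integral>w. (LINT q:{r..s}|lborel. h q w) \<partial>M) = (LINT q:{r..s}|lborel. \<integral>w. h q w \<partial>M)"
    unfolding set_integral_time(1)[OF rs] using P.Fubini_integral[OF i] by simp
  have i0: "integrable (restrict_space lborel {0..T} \<Otimes>\<^sub>M M) (\<lambda>(t, w). h t w)"
    using h by (simp add: dt_dP_def)
  have "(LINT q:{0..T}|lborel. \<integral>w. h q w \<partial>M) = (\<integral>q. (\<integral>w. h q w \<partial>M) \<partial>restrict_space lborel {0..T})"
    by (simp add: integral_restrict_space set_lebesgue_integral_def)
  also have "\<dots> = (\<integral>(t, w). h t w \<partial>dt_dP M T)"
    unfolding dt_dP_def using P.integral_fst[OF i0] by simp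
  finally show "(LINT q:{0..T}|lborel. \<integral>w. h q w \<partial>M) = (\<integral>(t, w). h t w \<partial>dt_dP M T)" .
qed

lemma AE_dt_dP_D:
  assumes M: "prob_space M" and "AE (t, w) in dt_dP M T. Q t w"
  shows "AE t in restrict_space lborel {0..T}. AE w in M. Q t w"
proof -
  interpret P: pair_sigma_finite "restrict_space lborel {0..T}" M
    by (rule time_pair_sigma_finite[OF M])
  show ?thesis
    using P.AE_pair[OF assms(2)[unfolded dt_dP_def]] by simp
qed

lemma dt_dP_section:
  assumes h: "(\<lambda>(t, w). h t w) \<in> borel_measurable (dt_dP M T)" and t: "t \<in> {0..T}"
  shows "h t \<in> borel_measurable M"
  using measurable_compose[OF measurable_Pair1' h[unfolded dt_dP_def]] t
  by (simp add: space_restrict_space)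

text \<open>Cauchy-Schwarz in time: the squared norm of the integral is at most
  \<open>\<bar>T\<bar>\<close> times the integral of the squared norms, whose expectation is
  finite.\<close>

lemma L2_time_integral:
  fixes \<beta> :: "real \<Rightarrow> 'w \<Rightarrow> 'a::euclidean_space"
  assumes M: "prob_space M" and \<beta>: "(\<lambda>(t, w). \<beta> t w) \<in> L2 (dt_dP M T)"
    and rs: "0 \<le> r" "s \<le> T"
  shows "integrable (dt_dP M T) (\<lambda>(t, w). \<beta> t w)"
    and "(\<lambda>w. LINT q:{r..s}|lborel. \<beta> q w) \<in> L2 M"
    and "AE w in M. set_integrable lborel {0..T} (\<lambda>q. (norm (\<beta> q w))\<^sup>2) \<and> set_integrable lborel {r..s} (\<lambda>q. \<beta> q w)"
proof -
  interpret M: prob_space M by fact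
  interpret P: pair_sigma_finite "restrict_space lborel {0..T}" M
    by (rule time_pair_sigma_finite[OF M])
  have fin: "finite_measure (dt_dP M T)"
    unfolding dt_dP_def by (intro finite_measure_pair_measure finite_measure_time M.finite_measure_axioms)
  note int = L2_integrable[OF \<beta>]
  show i1: "integrable (dt_dP M T) (\<lambda>(t, w). \<beta> t w)"
    by (rule L2_imp_integrable[OF fin \<beta>])
  have i2: "integrable (dt_dP M T) (\<lambda>(t, w). (norm (\<beta> t w))\<^sup>2)"
    using int by (simp add: case_prod_beta')
  show ae: "AE w in M. set_integrable lborel {0..T} (\<lambda>q. (norm (\<beta> q w))\<^sup>2) \<and> set_integrable lborel {r..s} (\<lambda>q. \<beta> q w)"
    using dt_dP_fubini(3)[OF M i2, of 0 T] dt_dP_fubini(3)[OF M i1 rs] by auto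
  show "(\<lambda>w. LINT q:{r..s}|lborel. \<beta> q w) \<in> L2 M"
  proof (rule L2_I)
    show m: "(\<lambda>w. LINT q:{r..s}|lborel. \<beta> q w) \<in> borel_measurable M"
      using dt_dP_fubini(1)[OF M i1 rs] by auto
    have dom: "integrable M (\<lambda>w. \<bar>T\<bar> * (LINT q:{0..T}|lborel. (norm (\<beta> q w))\<^sup>2))"
      using dt_dP_fubini(1)[OF M i2, of 0 T] by simp
    show "integrable M (\<lambda>w. (norm (LINT q:{r..s}|lborel. \<beta> q w))\<^sup>2)"
    proof (rule Bochner_Integration.integrable_bound[OF dom])
      show "(\<lambda>w. (norm (LINT q:{r..s}|lborel. \<beta> q w))\<^sup>2) \<in> borel_measurable M" using m by measurable
      show "AE w in M. norm ((norm (LINT q:{r..s}|lborel. \<beta> q w))\<^sup>2)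
          \<le> norm (\<bar>T\<bar> * (LINT q:{0..T}|lborel. (norm (\<beta> q w))\<^sup>2))"
        using ae
      proof eventually_elim
        case (elim w)
        let ?L = "restrict_space lborel {0..T}"
        let ?h = "\<lambda>q. indicator {r..s} q *\<^sub>R \<beta> q w"
        have hi: "integrable ?L ?h" using elim by (simp add: set_integral_time(2)[OF rs])
        have sq: "integrable ?L (\<lambda>q. (norm (\<beta> q w))\<^sup>2)"
          using elim by (simp add: integrable_restrict_space set_integrable_def)
        have [measurable]: "?h \<in> borel_measurable ?L" using hi by (rule borel_measurable_integrable)
        have "(\<lambda>q. (norm (?h q))\<^sup>2) \<in> borel_measurable ?L" by measurable
        then have "integrable ?L (\<lambda>q. (norm (?h q))\<^sup>2)"
          by (intro Bochner_Integration.integrable_bound[OF sq]) (auto simp: indicator_def)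
        moreover have "(\<lambda>q. norm (?h q)) \<in> borel_measurable ?L" by measurable
        ultimately have hL: "(\<lambda>q. norm (?h q)) \<in> L2 ?L" by (intro L2_I) (simp_all only: real_norm_def abs_norm_cancel)
        have one: "(\<lambda>q. 1 :: real) \<in> L2 ?L" by (rule L2_const[OF finite_measure_time])
        have "norm (LINT q:{r..s}|lborel. \<beta> q w) \<le> (\<integral>q. norm (?h q) \<partial>?L)"
          unfolding set_integral_time(1)[OF rs] by (rule integral_norm_bound)
        also have "\<dots> \<le> L2_norm ?L (\<lambda>q. norm (?h q)) * L2_norm ?L (\<lambda>q. 1 :: real)"
          using L2_inner(3)[OF hL one] by simp
        finally have "(norm (LINT q:{r..s}|lborel. \<beta> q w))\<^sup>2
            \<le> (L2_norm ?L (\<lambda>q. norm (?h q)) * L2_norm ?L (\<lambda>q. 1 :: real))\<^sup>2"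
          by (rule power_mono) simp
        also have "\<dots> = (\<integral>q. (norm (?h q))\<^sup>2 \<partial>?L) * (\<integral>q. 1 \<partial>?L)"
          by (simp add: power_mult_distrib L2_norm_sq)
        also have "\<dots> \<le> (\<integral>q. (norm (\<beta> q w))\<^sup>2 \<partial>?L) * \<bar>T\<bar>"
        proof (rule mult_mono)
          show "(\<integral>q. (norm (?h q))\<^sup>2 \<partial>?L) \<le> (\<integral>q. (norm (\<beta> q w))\<^sup>2 \<partial>?L)"
            using L2_integrable[OF hL] sq by (intro integral_mono) (auto simp: indicator_def)
          show "(\<integral>q. 1 \<partial>?L) \<le> \<bar>T\<bar>"
            by (simp add: measure_restrict_space space_restrict_space)
        qed auto
        also have "(\<integral>q. (norm (\<beta> q w))\<^sup>2 \<partial>?L) = (LINT q:{0..T}|lborel. (norm (\<beta> q w))\<^sup>2)"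
          by (simp add: integral_restrict_space set_lebesgue_integral_def)
        finally show ?case by (simp add: mult.commute)
      qed
    qed
  qed
qed

lemma L2_time_inner:
  fixes \<beta> \<gamma> :: "real \<Rightarrow> 'w \<Rightarrow> 'a::euclidean_space"
  assumes "(\<lambda>(t, w). \<beta> t w) \<in> L2 (dt_dP M T)" "(\<lambda>(t, w). \<gamma> t w) \<in> L2 (dt_dP M T)"
  shows "integrable (dt_dP M T) (\<lambda>(t, w). \<beta> t w \<bullet> \<gamma> t w)"
  using L2_inner(1)[OF assms] by (simp add: case_prod_beta')

lemma L2_time_constant:
  fixes \<rho> :: "'w \<Rightarrow> 'a::euclidean_space"
  assumes M: "prob_space M" and \<rho>: "\<rho> \<in> L2 M"
  shows "(\<lambda>(t, w). \<rho> w) \<in> L2 (dt_dP M T)"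
proof -
  interpret M: prob_space M by fact
  interpret T: finite_measure "restrict_space lborel {0..T}" by (rule finite_measure_time)
  have [measurable]: "\<rho> \<in> borel_measurable M" using \<rho> by (rule L2_measurable)
  interpret P: pair_sigma_finite "restrict_space lborel {0..T}" M
    by (rule time_pair_sigma_finite[OF M])
  have "integrable (restrict_space lborel {0..T} \<Otimes>\<^sub>M M) (\<lambda>(t, w). (norm (\<rho> w))\<^sup>2)"
    using L2_integrable[OF \<rho>] by (intro P.Fubini_integrable) auto
  then show ?thesis
    by (auto simp: L2_def dt_dP_def case_prod_beta')
qed

text \<open>Fubini for the pairing with a vector that is constant in time. Later estimates of time
  integrals pass through such pairings, so that only real functions of time have to be
  compared.\<close>

lemma time_integral_inner:
  fixes \<beta> :: "real \<Rightarrow> 'w \<Rightarrow> 'a::euclidean_space"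
  assumes M: "prob_space M" and \<beta>: "(\<lambda>(t, w). \<beta> t w) \<in> L2 (dt_dP M T)" and \<rho>: "\<rho> \<in> L2 M"
    and rs: "0 \<le> r" "s \<le> T"
  shows "(\<integral>w. (LINT q:{r..s}|lborel. \<beta> q w) \<bullet> \<rho> w \<partial>M) = (LINT q:{r..s}|lborel. \<integral>w. \<beta> q w \<bullet> \<rho> w \<partial>M)"
    and "set_integrable lborel {r..s} (\<lambda>q. \<integral>w. \<beta> q w \<bullet> \<rho> w \<partial>M)"
proof -
  have i: "integrable (dt_dP M T) (\<lambda>(t, w). \<beta> t w \<bullet> \<rho> w)"
    by (rule L2_time_inner[OF \<beta> L2_time_constant[OF M \<rho>]])
  have m: "(\<lambda>w. LINT q:{r..s}|lborel. \<beta> q w) \<in> L2 M"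
    by (rule L2_time_integral(2)[OF M \<beta> rs])
  have "(\<integral>w. (LINT q:{r..s}|lborel. \<beta> q w) \<bullet> \<rho> w \<partial>M) = (\<integral>w. (LINT q:{r..s}|lborel. \<beta> q w \<bullet> \<rho> w) \<partial>M)"
  proof (rule integral_cong_AE)
    show "(\<lambda>w. (LINT q:{r..s}|lborel. \<beta> q w) \<bullet> \<rho> w) \<in> borel_measurable M"
      using m \<rho> by (auto dest!: L2_measurable)
    show "(\<lambda>w. LINT q:{r..s}|lborel. \<beta> q w \<bullet> \<rho> w) \<in> borel_measurable M"
      using dt_dP_fubini(1)[OF M i rs] by auto
    show "AE w in M. (LINT q:{r..s}|lborel. \<beta> q w) \<bullet> \<rho> w = (LINT q:{r..s}|lborel. \<beta> q w \<bullet> \<rho> w)"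
      using L2_time_integral(3)[OF M \<beta> rs]
      by eventually_elim (simp add: set_lebesgue_integral_def set_integrable_def flip: integral_inner_left)
  qed
  then show "(\<integral>w. (LINT q:{r..s}|lborel. \<beta> q w) \<bullet> \<rho> w \<partial>M) = (LINT q:{r..s}|lborel. \<integral>w. \<beta> q w \<bullet> \<rho> w \<partial>M)"
    using dt_dP_fubini(2)[OF M i rs] by simp
  show "set_integrable lborel {r..s} (\<lambda>q. \<integral>w. \<beta> q w \<bullet> \<rho> w \<partial>M)"
    by (rule dt_dP_fubini(4)[OF M i rs])
qed

lemma time_integral_inner_le:
  fixes \<beta> :: "real \<Rightarrow> 'w \<Rightarrow> 'a::euclidean_space"
  assumes M: "prob_space M" and \<beta>: "(\<lambda>(t, w). \<beta> t w) \<in> L2 (dt_dP M T)" and \<rho>: "\<rho> \<in> L2 M"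
    and rs: "0 \<le> r" "s \<le> T"
    and le: "\<And>q. q \<in> {r..s} \<Longrightarrow> (\<integral>w. \<beta> q w \<bullet> \<rho> w \<partial>M) \<le> k q" and k: "continuous_on {r..s} k"
  shows "(\<integral>w. (LINT q:{r..s}|lborel. \<beta> q w) \<bullet> \<rho> w \<partial>M) \<le> (LINT q:{r..s}|lborel. k q)"
  unfolding time_integral_inner(1)[OF M \<beta> \<rho> rs]
  by (intro set_integral_mono time_integral_inner(2)[OF M \<beta> \<rho> rs] borel_integrable_atLeastAtMost' k le)

text \<open>The monomials of the Gronwall iterations: the first form serves the forward equation for
  the state, the second the backward equations.\<close>

lemma set_integral_powers:
  fixes r s c :: real
  assumes "r \<le> s"
  shows "(LINT q:{r..s}|lborel. c * (q - r) ^ n) = c * (s - r) ^ Suc n / Suc n"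
    and "(LINT q:{r..s}|lborel. c * (s - q) ^ n) = c * (s - r) ^ Suc n / Suc n"
proof -
  have 1: "(\<integral>q. indicator {r..s} q *\<^sub>R (c * (q - r) ^ n) \<partial>lborel)
      = c * (s - r) ^ Suc n / Suc n - c * (r - r) ^ Suc n / Suc n"
    by (rule integral_FTC_atLeastAtMost[OF assms])
      (auto intro!: derivative_eq_intros continuous_intros simp: has_real_derivative_iff_has_vector_derivative[symmetric]
       simp del: power_Suc)
  have 2: "(\<integral>q. indicator {r..s} q *\<^sub>R (c * (s - q) ^ n) \<partial>lborel)
      = - (c * (s - s) ^ Suc n / Suc n) - - (c * (s - r) ^ Suc n / Suc n)"
    by (rule integral_FTC_atLeastAtMost[OF assms])
      (auto intro!: derivative_eq_intros continuous_intros simp: has_real_derivative_iff_has_vector_derivative[symmetric]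
       simp del: power_Suc)
  show "(LINT q:{r..s}|lborel. c * (q - r) ^ n) = c * (s - r) ^ Suc n / Suc n"
    and "(LINT q:{r..s}|lborel. c * (s - q) ^ n) = c * (s - r) ^ Suc n / Suc n"
    using 1 2 unfolding set_lebesgue_integral_def by simp_all
qed

section \<open>The Brownian filtration\<close>

text \<open>Dynkin's argument with the event \<open>E\<close> kept fixed: the events that are
  independent of \<open>E\<close> are closed under complements and disjoint unions.\<close>

lemma (in prob_space) indep_sigma_sets:
  assumes GG: "Int_stable GG" "GG \<subseteq> events" and E: "E \<in> events"
    and indep: "\<And>A. A \<in> GG \<Longrightarrow> prob (A \<inter> E) = prob A * prob E"
    and A: "A \<in> sigma_sets (space M) GG"
  shows "prob (A \<inter> E) = prob A * prob E"
proof -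
  have ev: "sigma_sets (space M) GG \<subseteq> events"
    by (rule sets.sigma_sets_subset[OF GG(2)])
  have sp: "GG \<subseteq> Pow (space M)" using GG(2) sets.space_closed by blast
  show ?thesis
    using GG(1) sp A
  proof (induction rule: sigma_sets_induct_disjoint)
    case (basic A)
    then show ?case by (rule indep)
  next
    case empty
    then show ?case by simp
  next
    case (compl A)
    then have [measurable]: "A \<in> events" using ev by auto
    have "prob ((space M - A) \<inter> E) = prob (E - A \<inter> E)"
      using E sets.sets_into_space[OF E] by (intro arg_cong[where f=prob]) auto
    also have "\<dots> = prob E - prob (A \<inter> E)"
      using E by (intro finite_measure_Diff) auto
    finally show ?case
      using compl by (simp add: prob_compl algebra_simps)
  next
    case (union A)
    then have Aev: "range A \<subseteq> events" using ev by auto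
    have "(\<lambda>i. prob (A i \<inter> E)) sums prob (\<Union>i. A i \<inter> E)"
      using Aev E union(1) by (intro finite_measure_UNION) (auto simp: disjoint_family_on_def)
    moreover have "(\<lambda>i. prob (A i) * prob E) sums (prob (\<Union>i. A i) * prob E)"
      using Aev union(1) by (intro sums_mult2 finite_measure_UNION) auto
    ultimately show ?case
      using union(3) sums_unique2 by (simp add: UN_simps(4)[symmetric] del: UN_simps) blast
  qed
qed

lemma generated_subset_Pow: "generated M I V \<subseteq> Pow (space M)"
proof -
  have "{V i -` A \<inter> space M |i A. i \<in> I \<and> A \<in> sets borel} \<subseteq> Pow (space M)" by auto
  then show ?thesis unfolding generated_def using sigma_sets_into_sp by blast
qed

lemma sets_generated: "sets (sigma (space M) (generated M I V)) = generated M I V"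
proof -
  have "{V i -` A \<inter> space M |i A. i \<in> I \<and> A \<in> sets borel} \<subseteq> Pow (space M)" by auto
  then show ?thesis
    using generated_subset_Pow[of M I V] by (simp add: generated_def sigma_sets_sigma_sets_eq)
qed

lemma generated_vimage: "i \<in> I \<Longrightarrow> A \<in> sets borel \<Longrightarrow> V i -` A \<inter> space M \<in> generated M I V"
  unfolding generated_def by (rule sigma_sets.Basic) auto

lemma measurable_generated:
  "i \<in> I \<Longrightarrow> V i \<in> borel_measurable (sigma (space M) (generated M I V))"
  by (rule measurableI) (auto simp: sets_generated space_measure_of generated_subset_Pow generated_vimage)

lemma generated_least:
  fixes V :: "'i \<Rightarrow> 'w \<Rightarrow> 'b::topological_space"
  assumes "space N = space M" and "\<And>i. i \<in> I \<Longrightarrow> V i \<in> borel_measurable N"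
  shows "generated M I V \<subseteq> sets N"
proof -
  have "{V i -` A \<inter> space M |i A. i \<in> I \<and> A \<in> sets borel} \<subseteq> sets N"
  proof safe
    fix i A assume "i \<in> I" "A \<in> sets (borel :: 'b measure)"
    then show "V i -` A \<inter> space M \<in> sets N"
      using measurable_sets[OF assms(2), of i A] by (simp add: assms(1))
  qed
  from sets.sigma_sets_subset[OF this] show ?thesis
    by (simp add: generated_def assms(1))
qed

lemma generated_mono: "I \<subseteq> J \<Longrightarrow> generated M I V \<subseteq> generated M J V"
  unfolding generated_def by (intro sigma_sets_mono') auto

lemma Int_stable_Int_sets:
  "Int_stable {A \<inter> B | A B. A \<in> sets N \<and> B \<in> sets N'}"
  unfolding Int_stable_def
proof safe
  fix A B A' B' assume "A \<in> sets N" "B \<in> sets N'" "A' \<in> sets N" "B' \<in> sets N'"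
  then show "\<exists>A'' B''. A \<inter> B \<inter> (A' \<inter> B') = A'' \<inter> B'' \<and> A'' \<in> sets N \<and> B'' \<in> sets N'"
    by (intro exI[of _ "A \<inter> A'"] exI[of _ "B \<inter> B'"]) auto
qed

locale brownian_basis =
  fixes M :: "'w measure" and T :: real
    and X0 :: "'w \<Rightarrow> real^'d" and W :: "real \<Rightarrow> 'w \<Rightarrow> real^'m"
  assumes basis: "stochastic_basis M T X0 W"
begin

abbreviation F :: "real \<Rightarrow> 'w measure" where "F \<equiv> filt M X0 W"

text \<open>No null sets are adjoined, in contrast to \<open>filt\<close>; in the independence
  statements they occur only on the side of the past.\<close>

definition increments :: "real set \<Rightarrow> real \<Rightarrow> 'w measure" where
  "increments I t = sigma (space M) (generated M I (\<lambda>r w. W r w - W t w))"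

sublocale prob_space M
  using basis by (simp add: stochastic_basis_def)

lemma T_pos: "0 < T"
  and X0_measurable [measurable]: "X0 \<in> borel_measurable M"
  and W_measurable: "t \<in> {0..T} \<Longrightarrow> W t \<in> borel_measurable M"
  and W_increment_distributed: "0 \<le> s \<Longrightarrow> s < t \<Longrightarrow> t \<le> T \<Longrightarrow>
       distributed M lborel (\<lambda>w. W t w - W s w)
         (\<lambda>x. ennreal (\<Prod>i\<in>UNIV. normal_density 0 (sqrt (t - s)) (x $ i)))"
  and W_increment_indep: "0 \<le> s \<Longrightarrow> s < t \<Longrightarrow> t \<le> T \<Longrightarrow>
       indep_set (generated M {0..s} W) (generated M {()} (\<lambda>_ w. W t w - W s w))"
  and X0_indep: "indep_set (generated M {()} (\<lambda>_. X0)) (generated M {0..T} W)"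
proof -
  note B = basis[unfolded stochastic_basis_def brownian_motion_def]
  show "0 < T" using B by (elim conjE)
  show "X0 \<in> borel_measurable M" using B by (elim conjE)
  show "W t \<in> borel_measurable M" if "t \<in> {0..T}" using B that by (elim conjE) (rule bspec)
  have inc: "\<forall>s t. 0 \<le> s \<longrightarrow> s < t \<longrightarrow> t \<le> T \<longrightarrow>
       distributed M lborel (\<lambda>w. W t w - W s w)
         (\<lambda>x. ennreal (\<Prod>i\<in>UNIV. normal_density 0 (sqrt (t - s)) (x $ i))) \<and>
       indep_set (generated M {0..s} W) (generated M {()} (\<lambda>_ w. W t w - W s w))"
    using B by (elim conjE)
  show "distributed M lborel (\<lambda>w. W t w - W s w)
         (\<lambda>x. ennreal (\<Prod>i\<in>UNIV. normal_density 0 (sqrt (t - s)) (x $ i)))"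
    and "indep_set (generated M {0..s} W) (generated M {()} (\<lambda>_ w. W t w - W s w))"
    if "0 \<le> s" "s < t" "t \<le> T"
    using inc that by simp_all
  show "indep_set (generated M {()} (\<lambda>_. X0)) (generated M {0..T} W)"
    using B by (elim conjE)
qed

lemma filt_generators:
  "generated M {()} (\<lambda>_. X0) \<union> generated M {0..t} W \<union> null_sets M \<subseteq> Pow (space M)"
  by (intro Un_least generated_subset_Pow) (auto simp: null_sets_def dest: sets.sets_into_space)

lemma space_filt [simp]: "space (F t) = space M"
  unfolding filt_def by (rule space_measure_of[OF filt_generators])

lemma sets_filt: "sets (F t) = sigma_sets (space M)
    (generated M {()} (\<lambda>_. X0) \<union> generated M {0..t} W \<union> null_sets M)"
  unfolding filt_def by (rule sets_measure_of[OF filt_generators])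

lemma sets_filt_subset:
  assumes "t \<le> T" shows "sets (F t) \<subseteq> sets M"
proof -
  have "generated M {()} (\<lambda>_. X0) \<union> generated M {0..t} W \<union> null_sets M \<subseteq> sets M"
    using assms by (intro Un_least generated_least) (auto intro: W_measurable)
  from sets.sigma_sets_subset[OF this] show ?thesis
    unfolding sets_filt .
qed

lemma subalgebra_filt: "t \<le> T \<Longrightarrow> subalgebra M (F t)"
  by (simp add: subalgebra_def sets_filt_subset)

lemma filt_to_M: "t \<le> T \<Longrightarrow> f \<in> measurable (F t) N \<Longrightarrow> f \<in> measurable M N"
  by (rule measurable_from_subalg[OF subalgebra_filt])

lemma sets_filt_mono:
  assumes "s \<le> t" shows "sets (F s) \<subseteq> sets (F t)"
  unfolding sets_filt using assms
  by (intro sigma_sets_mono' Un_mono generated_mono) auto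

lemma filt_mono: "s \<le> t \<Longrightarrow> f \<in> measurable (F s) N \<Longrightarrow> f \<in> measurable (F t) N"
  by (rule measurable_from_subalg[of "F t" "F s"]) (simp_all add: subalgebra_def sets_filt_mono)

lemma generated_subset_filt:
  "generated M {0..t} W \<subseteq> sets (F t)" "generated M {()} (\<lambda>_. X0) \<subseteq> sets (F t)"
  unfolding sets_filt by (rule subsetI, rule sigma_sets.Basic, simp)+

lemma W_measurable_filt: "s \<in> {0..t} \<Longrightarrow> W s \<in> borel_measurable (F t)"
  using generated_vimage[of s "{0..t}" _ W M] generated_subset_filt(1)[of t]
  by (intro measurableI) auto

lemma space_increments [simp]: "space (increments I t) = space M"
  unfolding increments_def by (rule space_measure_of[OF generated_subset_Pow])

lemma sets_increments: "sets (increments I t) = generated M I (\<lambda>r w. W r w - W t w)"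
  unfolding increments_def by (rule sets_generated)

lemma increments_subset:
  assumes "I \<subseteq> {0..T}" "t \<in> {0..T}" shows "sets (increments I t) \<subseteq> sets M"
  unfolding sets_increments using assms
  by (intro generated_least borel_measurable_diff W_measurable) auto

lemma increments_subset_filt:
  assumes "I \<subseteq> {0..s}" "t \<in> {0..s}" shows "sets (increments I t) \<subseteq> sets (F s)"
  unfolding sets_increments using assms
  by (intro generated_least borel_measurable_diff W_measurable_filt) auto

lemma measurable_increments: "r \<in> I \<Longrightarrow> (\<lambda>w. W r w - W t w) \<in> borel_measurable (increments I t)"
  unfolding increments_def by (rule measurable_generated[of r I "\<lambda>r w. W r w - W t w"])

text \<open>The definition of Brownian motion provides independence only from the past of
  \<open>W\<close>; \<open>X0\<close> enters through its independence of the whole path.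
  Intersections of an event of \<open>X0\<close> with an event of the past of \<open>W\<close>,
  together with the null sets, form a pi-system that generates \<open>F s\<close>.\<close>

lemma filt_indep_increment:
  assumes st: "0 \<le> s" "s < t" "t \<le> T" and A: "A \<in> sets (F s)"
    and E: "E \<in> sets (increments {t} s)"
  shows "prob (A \<inter> E) = prob A * prob E"
proof -
  let ?X = "sigma (space M) (generated M {()} (\<lambda>_. X0))" and ?W = "sigma (space M) (generated M {0..s} W)"
  have Xs: "sets ?X = generated M {()} (\<lambda>_. X0)" and Ws: "sets ?W = generated M {0..s} W"
    by (rule sets_generated)+
  have Xev: "sets ?X \<subseteq> events" unfolding Xs by (rule generated_least) auto
  have Wev: "sets ?W \<subseteq> events" unfolding Ws using st by (intro generated_least W_measurable) auto
  have WT: "generated M {0..s} W \<subseteq> generated M {0..T} W"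
    using st by (intro generated_mono) auto
  have Eev: "E \<in> events" using E increments_subset[of "{t}" s] st by auto
  have ET: "E \<in> generated M {0..T} W"
  proof -
    let ?N = "sigma (space M) (generated M {0..T} W)"
    have "generated M {t} (\<lambda>r w. W r w - W s w) \<subseteq> sets ?N"
      using st by (intro generated_least borel_measurable_diff measurable_generated)
        (auto simp: space_measure_of generated_subset_Pow)
    then show ?thesis using E unfolding sets_increments sets_generated by auto
  qed
  have EW: "E \<in> generated M {()} (\<lambda>_ w. W t w - W s w)"
    using E unfolding sets_increments generated_def by simp
  let ?P = "{C \<inter> D | C D. C \<in> sets ?X \<and> D \<in> sets ?W} \<union> null_sets M"
  have "Int_stable ?P"
  proof (rule Int_stableI)
    fix A B assume AB: "A \<in> ?P" "B \<in> ?P"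
    have ev: "A \<in> events" "B \<in> events" using AB Xev Wev by auto
    show "A \<inter> B \<in> ?P"
    proof (cases "A \<in> null_sets M \<or> B \<in> null_sets M")
      case True
      then have "A \<inter> B \<in> null_sets M"
        using ev by (metis null_set_Int1 null_set_Int2)
      then show ?thesis by blast
    next
      case False
      then have "A \<in> {C \<inter> D | C D. C \<in> sets ?X \<and> D \<in> sets ?W}" "B \<in> {C \<inter> D | C D. C \<in> sets ?X \<and> D \<in> sets ?W}"
        using AB by simp_all
      from Int_stableD[OF Int_stable_Int_sets this] show ?thesis by (rule UnI1)
    qed
  qed
  moreover have "?P \<subseteq> events" using Xev Wev by auto
  moreover have "prob (B \<inter> E) = prob B * prob E" if "B \<in> ?P" for B
    using that
  proof
    assume "B \<in> null_sets M"
    then have "B \<inter> E \<in> null_sets M" using Eev by (rule null_set_Int2)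
    then show ?thesis using \<open>B \<in> null_sets M\<close> by (simp add: measure_eq_0_null_sets)
  next
    assume "B \<in> {C \<inter> D | C D. C \<in> sets ?X \<and> D \<in> sets ?W}"
    then obtain C D where B: "B = C \<inter> D" and C: "C \<in> sets ?X" and D: "D \<in> sets ?W" by blast
    have DE: "D \<inter> E \<in> generated M {0..T} W"
    proof -
      have "D \<inter> E \<in> sets (sigma (space M) (generated M {0..T} W))"
        using D ET WT unfolding Ws by (intro sets.Int) (auto simp: sets_generated)
      then show ?thesis by (simp only: sets_generated)
    qed
    \<comment> \<open>First \<open>X0\<close> is split off from the path, with
      \<open>D \<inter> E\<close> regarded as one event of the path; then the increment is split off
      from the past of \<open>W\<close>; finally \<open>X0\<close> and that past are
      recombined.\<close>
    have "prob (B \<inter> E) = prob (C \<inter> (D \<inter> E))" by (simp add: B Int_assoc)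
    also have "\<dots> = prob C * prob (D \<inter> E)"
      using C DE unfolding Xs by (intro indep_setD[OF X0_indep])
    also have "prob (D \<inter> E) = prob D * prob E"
      using D EW unfolding Ws by (intro indep_setD[OF W_increment_indep[OF st]])
    also have "prob C * (prob D * prob E) = (prob C * prob D) * prob E" by simp
    also have "prob C * prob D = prob B"
      using C D WT unfolding B Xs Ws by (intro indep_setD[OF X0_indep, symmetric]) auto
    finally show ?thesis .
  qed
  moreover have "A \<in> sigma_sets (space M) ?P"
  proof -
    have "generated M {()} (\<lambda>_. X0) \<union> generated M {0..s} W \<union> null_sets M \<subseteq> ?P"
    proof safe
      fix B assume B: "B \<in> generated M {()} (\<lambda>_. X0)"
      then have "B \<subseteq> space M" using generated_subset_Pow by blast
      then have "B = B \<inter> space ?W" "B \<in> sets ?X"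
        using B by (auto simp: Xs space_measure_of generated_subset_Pow)
      then show "\<exists>C D. B = C \<inter> D \<and> C \<in> sets ?X \<and> D \<in> sets ?W" by blast
    next
      fix B assume B: "B \<in> generated M {0..s} W"
      then have "B \<subseteq> space M" using generated_subset_Pow by blast
      then have "B = space ?X \<inter> B" "B \<in> sets ?W"
        using B by (auto simp: Ws space_measure_of generated_subset_Pow)
      then show "\<exists>C D. B = C \<inter> D \<and> C \<in> sets ?X \<and> D \<in> sets ?W" by blast
    qed
    then have "sets (F s) \<subseteq> sigma_sets (space M) ?P"
      unfolding sets_filt by (rule sigma_sets_mono')
    then show ?thesis using A by blast
  qed
  ultimately show ?thesis using Eev by (intro indep_sigma_sets[of ?P E A]) auto
qed

text \<open>Induction that adds the latest time \<open>r\<close>. The increments over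
  \<open>R\<close> belong to the past at the last earlier time \<open>m\<close>, so the increment
  from \<open>m\<close> to \<open>r\<close> can be split off first, and the induction hypothesis
  handles the rest.\<close>

lemma filt_indep_finite_increments:
  assumes t: "0 \<le> t" and A: "A \<in> sets (F t)"
  shows "finite R \<Longrightarrow> R \<subseteq> {t<..T} \<Longrightarrow> E \<in> sets (increments R t) \<Longrightarrow> prob (A \<inter> E) = prob A * prob E"
proof (induction R arbitrary: E rule: finite_linorder_max_induct)
  case empty
  have "E = {} \<or> E = space M"
    using empty(2) unfolding sets_increments generated_def by (auto simp: sigma_sets_empty_eq)
  moreover have "t \<le> T \<or> \<not> t \<le> T" by simp
  ultimately show ?case
    using A sets.sets_into_space[OF A] by (auto simp: prob_space Int_absorb2)
next
  case (insert r R)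
  \<comment> \<open>Including \<open>t\<close> makes the set nonempty; \<open>m = t\<close> if there
    is no earlier time.\<close>
  define m where "m = Max (insert t R)"
  have m: "m \<in> insert t R" "t \<le> m" "R \<subseteq> {0..m}" "m < r" "r \<le> T"
  proof -
    have fin: "finite (insert t R)" using insert by simp
    show 1: "m \<in> insert t R" unfolding m_def using fin by (rule Max_in) simp
    show "t \<le> m" unfolding m_def using fin by (rule Max_ge) simp
    have "q \<le> m" if "q \<in> R" for q unfolding m_def using fin by (rule Max_ge) (simp add: that)
    then show "R \<subseteq> {0..m}" using insert.prems t by fastforce
    show "m < r" using 1 insert by auto
    show "r \<le> T" using insert.prems by simp
  qed
  have tT: "t \<le> T" using m by simp
  have mT: "0 \<le> m" "m \<le> T" using m t by auto
  let ?R = "increments R t" and ?r = "increments {r} m"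
  have Rev: "sets ?R \<subseteq> events" using m t by (intro increments_subset) auto
  have rev: "sets ?r \<subseteq> events" using m t by (intro increments_subset) auto
  have RF: "sets ?R \<subseteq> sets (F m)" using m t by (intro increments_subset_filt) auto
  have Aev: "A \<in> events" using A sets_filt_subset[OF tT] by auto
  have AF: "A \<in> sets (F m)" using A sets_filt_mono[OF m(2)] by auto
  let ?P = "{C \<inter> D | C D. C \<in> sets ?R \<and> D \<in> sets ?r}"
  have Pev: "?P \<subseteq> events" using Rev rev by auto
  have P: "prob (B \<inter> A) = prob B * prob A" if BP: "B \<in> ?P" for B
  proof -
    obtain C D where B: "B = C \<inter> D" and C: "C \<in> sets ?R" and D: "D \<in> sets ?r" using BP by blast
    have CF: "C \<in> sets (F m)" using C RF by auto
    have "prob (B \<inter> A) = prob ((A \<inter> C) \<inter> D)" by (simp add: B Int_ac)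
    also have "\<dots> = prob (A \<inter> C) * prob D"
      using m mT AF CF D by (intro filt_indep_increment[of m r]) auto
    also have "\<dots> = prob A * (prob C * prob D)"
      using insert(3)[OF _ C] insert.prems by simp
    also have "prob C * prob D = prob B"
      unfolding B using m mT CF D by (intro filt_indep_increment[of m r, symmetric]) auto
    finally show ?thesis by simp
  qed
  have "sets (increments (insert r R) t) \<subseteq> sigma_sets (space M) ?P"
  proof -
    let ?N = "sigma (space M) ?P"
    have Psp: "?P \<subseteq> Pow (space M)" using Pev sets.space_closed by blast
    have N: "space ?N = space M" "sets ?N = sigma_sets (space M) ?P"
      using Psp by auto
    have RN: "sets ?R \<subseteq> sets ?N"
    proof
      fix C assume C: "C \<in> sets ?R"
      then have "C = C \<inter> space ?r" using sets.sets_into_space[OF C] by auto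
      then have "C \<in> ?P" using C by blast
      then show "C \<in> sets ?N" unfolding N by (rule sigma_sets.Basic)
    qed
    have rN: "sets ?r \<subseteq> sets ?N"
    proof
      fix D assume D: "D \<in> sets ?r"
      then have "D = space ?R \<inter> D" using sets.sets_into_space[OF D] by auto
      then have "D \<in> ?P" using D by blast
      then show "D \<in> sets ?N" unfolding N by (rule sigma_sets.Basic)
    qed
    have Rm: "(\<lambda>w. W q w - W t w) \<in> borel_measurable ?N" if "q \<in> R" for q
      using measurable_increments[OF that] RN
      by (intro measurable_from_subalg[of ?N ?R]) (auto simp: subalgebra_def N)
    have rm: "(\<lambda>w. W r w - W m w) \<in> borel_measurable ?N"
      using measurable_increments[of r "{r}"] rN
      by (intro measurable_from_subalg[of ?N ?r]) (auto simp: subalgebra_def N)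
    \<comment> \<open>This is 0 if \<open>m = t\<close>, and one of the generating increments
      otherwise.\<close>
    have "(\<lambda>w. W m w - W t w) \<in> borel_measurable ?N"
      using m(1) Rm by auto
    from borel_measurable_add[OF rm this] have "(\<lambda>w. W r w - W t w) \<in> borel_measurable ?N"
      by simp
    with Rm N(1) have "generated M (insert r R) (\<lambda>r w. W r w - W t w) \<subseteq> sets ?N"
      by (intro generated_least) auto
    then show ?thesis
      unfolding N(2) by (simp only: sets_increments)
  qed
  then have "prob (E \<inter> A) = prob E * prob A"
    using insert.prems(2) by (intro indep_sigma_sets[OF Int_stable_Int_sets Pev Aev P]) auto
  then show ?case by (subst Int_commute, subst mult.commute)
qed

text \<open>The events that depend on finitely many later increments form a pi-system, since two
  finite sets of times can be joined, and they generate all future increments.\<close>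

lemma filt_indep_future:
  assumes t: "0 \<le> t" "t \<le> T" and A: "A \<in> sets (F t)" and E: "E \<in> sets (increments {t<..T} t)"
  shows "prob (A \<inter> E) = prob A * prob E"
proof -
  let ?RR = "{R. finite R \<and> R \<subseteq> {t<..T}}"
  let ?P = "\<Union>R\<in>?RR. sets (increments R t)"
  have mono: "sets (increments R t) \<subseteq> sets (increments R' t)" if "R \<subseteq> R'" for R R'
    unfolding sets_increments by (rule generated_mono[OF that])
  have "Int_stable ?P"
  proof (rule Int_stableI)
    fix C D assume CD: "C \<in> ?P" "D \<in> ?P"
    then obtain R R' where C: "C \<in> sets (increments R t)" and D: "D \<in> sets (increments R' t)"
      and R: "finite R" "R \<subseteq> {t<..T}" "finite R'" "R' \<subseteq> {t<..T}" by blast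
    have "C \<inter> D \<in> sets (increments (R \<union> R') t)"
      using C D mono[of R "R \<union> R'"] mono[of R' "R \<union> R'"] by auto
    then show "C \<inter> D \<in> ?P" using R by (intro UN_I[of "R \<union> R'"]) auto
  qed
  moreover have "?P \<subseteq> events"
  proof (rule UN_least)
    fix R assume "R \<in> ?RR"
    then show "sets (increments R t) \<subseteq> events" using t by (intro increments_subset) auto
  qed
  moreover have "A \<in> events" using A sets_filt_subset[OF t(2)] by auto
  moreover have "prob (B \<inter> A) = prob B * prob A" if BP: "B \<in> ?P" for B
  proof -
    obtain R where "finite R" "R \<subseteq> {t<..T}" "B \<in> sets (increments R t)" using BP by blast
    from filt_indep_finite_increments[OF t(1) A this] show ?thesis
      by (subst Int_commute, subst mult.commute)
  qed
  moreover have "E \<in> sigma_sets (space M) ?P"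
  proof -
    let ?N = "sigma (space M) ?P"
    have Psp: "?P \<subseteq> Pow (space M)"
      using \<open>?P \<subseteq> events\<close> sets.space_closed by blast
    have N: "space ?N = space M" "sets ?N = sigma_sets (space M) ?P"
      using space_measure_of[OF Psp] sets_measure_of[OF Psp] by simp_all
    have "(\<lambda>w. W r w - W t w) \<in> borel_measurable ?N" if r: "r \<in> {t<..T}" for r
    proof (rule measurable_from_subalg[OF _ measurable_increments])
      have "{r} \<in> ?RR" using r by simp
      then have "sets (increments {r} t) \<subseteq> ?P" by (rule UN_upper)
      then have "sets (increments {r} t) \<subseteq> sets ?N" unfolding N by blast
      then show "subalgebra ?N (increments {r} t)"
        unfolding subalgebra_def by (simp only: N(1) space_increments)
    qed simp
    then have "sets (increments {t<..T} t) \<subseteq> sets ?N"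
      unfolding sets_increments[of "{t<..T}"] by (rule generated_least[OF N(1)])
    then show ?thesis using E unfolding N(2) by (rule subsetD)
  qed
  ultimately have "prob (E \<inter> A) = prob E * prob A"
    by (rule indep_sigma_sets)
  then show ?thesis by (subst Int_commute, subst mult.commute)
qed

end

section \<open>Moments of Brownian increments\<close>

text \<open>Lebesgue measure on vectors is the image of a product measure indexed by the basis, and
  the basis is indexed by the coordinates through \<open>axis\<close>.\<close>

lemma integral_lborel_prod_vec:
  fixes h :: "'m::finite \<Rightarrow> real \<Rightarrow> real"
  assumes h: "\<And>i. integrable lborel (h i)"
  shows "integrable lborel (\<lambda>x::real^'m. \<Prod>i\<in>UNIV. h i (x $ i))"
    and "(\<integral>x. (\<Prod>i\<in>UNIV. h i (x $ i)) \<partial>(lborel :: (real^'m) measure)) = (\<Prod>i\<in>UNIV. \<integral>y. h i y \<partial>lborel)"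
proof -
  interpret P: product_sigma_finite "\<lambda>_ :: real^'m. lborel :: real measure"
    by standard
  let ?e = "\<lambda>i::'m. axis i (1::real)"
  have inj: "inj ?e" by (auto simp: inj_on_def axis_eq_axis)
  have B: "(Basis :: (real^'m) set) = range ?e" by (auto simp: Basis_vec_def)
  \<comment> \<open>The factors have to be indexed by basis vectors to match the product
    measure.\<close>
  define H where "H b = h (inv ?e b)" for b :: "real^'m"
  have He: "H (?e i) = h i" for i by (simp add: H_def inv_f_f[OF inj])
  have Hint: "integrable lborel (H b)" for b by (simp add: H_def h)
  have comp: "(\<Sum>b\<in>Basis. f b *\<^sub>R b) $ i = f (?e i)" for f :: "real^'m \<Rightarrow> real" and i
  proof -
    have "?e i \<in> Basis" unfolding B by blast
    then have "(\<Sum>b\<in>Basis. f b *\<^sub>R b) \<bullet> ?e i = f (?e i)" by simp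
    then show ?thesis by (simp only: cart_eq_inner_axis[symmetric])
  qed
  have prodB: "(\<Prod>b\<in>Basis. H b (f b)) = (\<Prod>i\<in>UNIV. h i (f (?e i)))" for f
    unfolding B prod.reindex[OF inj] by (simp only: o_def He)
  have eq: "(\<Prod>i\<in>UNIV. h i ((\<Sum>b\<in>Basis. f b *\<^sub>R b) $ i)) = (\<Prod>b\<in>Basis. H b (f b))" for f :: "real^'m \<Rightarrow> real"
    by (simp only: comp prodB)
  have m1: "(\<lambda>f. \<Sum>b\<in>Basis. f b *\<^sub>R b) \<in> measurable (Pi\<^sub>M Basis (\<lambda>_::real^'m. lborel)) borel"
    by measurable
  have [measurable]: "h i \<in> borel_measurable borel" for i
    using borel_measurable_integrable[OF h[of i]] by simp
  have m2: "(\<lambda>x::real^'m. \<Prod>i\<in>UNIV. h i (x $ i)) \<in> borel_measurable borel"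
    by measurable
  have i: "integrable (Pi\<^sub>M Basis (\<lambda>_::real^'m. lborel)) (\<lambda>f. \<Prod>b\<in>Basis. H b (f b))"
    by (rule P.product_integrable_prod) (auto intro: Hint)
  show "integrable lborel (\<lambda>x::real^'m. \<Prod>i\<in>UNIV. h i (x $ i))"
    unfolding lborel_eq[where 'a="real^'m"] integrable_distr_eq[OF m1 m2] eq by (rule i)
  have "(\<integral>x. (\<Prod>i\<in>UNIV. h i (x $ i)) \<partial>(lborel :: (real^'m) measure)) = (\<Prod>b\<in>Basis. \<integral>y. H b y \<partial>lborel)"
    unfolding lborel_eq[where 'a="real^'m"] integral_distr[OF m1 m2] eq
    by (rule P.product_integral_prod) (auto intro: Hint)
  also have "\<dots> = (\<Prod>i\<in>UNIV. \<integral>y. h i y \<partial>lborel)"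
    unfolding B by (subst prod.reindex[OF inj]) (simp add: He)
  finally show "(\<integral>x. (\<Prod>i\<in>UNIV. h i (x $ i)) \<partial>(lborel :: (real^'m) measure)) = (\<Prod>i\<in>UNIV. \<integral>y. h i y \<partial>lborel)" .
qed

lemma (in prob_space) indep_sets_integral_mult:
  fixes h g :: "'a \<Rightarrow> real"
  assumes G: "subalgebra M G" and N: "subalgebra M N"
    and indep: "\<And>A E. A \<in> sets G \<Longrightarrow> E \<in> sets N \<Longrightarrow> prob (A \<inter> E) = prob A * prob E"
    and h: "h \<in> borel_measurable G" "integrable M h" and g: "g \<in> borel_measurable N" "integrable M g"
  shows "integrable M (\<lambda>w. h w * g w)" "(\<integral>w. h w * g w \<partial>M) = (\<integral>w. h w \<partial>M) * (\<integral>w. g w \<partial>M)"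
proof -
  have sp: "space G = space M" "space N = space M" and ss: "sets G \<subseteq> events" "sets N \<subseteq> events"
    using G N by (auto simp: subalgebra_def)
  have "indep_var borel h borel g"
    unfolding indep_var_eq
  proof (intro conjI)
    show "h \<in> borel_measurable M" "g \<in> borel_measurable M" using h g by auto
    have "{h -` A \<inter> space M | A. A \<in> sets borel} \<subseteq> sets G"
      using measurable_sets[OF h(1)] unfolding sp by blast
    from sets.sigma_sets_subset[OF this]
    have 1: "sigma_sets (space M) {h -` A \<inter> space M | A. A \<in> sets borel} \<subseteq> sets G"
      unfolding sp .
    have "{g -` A \<inter> space M | A. A \<in> sets borel} \<subseteq> sets N"
      using measurable_sets[OF g(1)] unfolding sp by blast
    from sets.sigma_sets_subset[OF this]
    have 2: "sigma_sets (space M) {g -` A \<inter> space M | A. A \<in> sets borel} \<subseteq> sets N"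
      unfolding sp .
    show "indep_set (sigma_sets (space M) {h -` A \<inter> space M | A. A \<in> sets borel})
        (sigma_sets (space M) {g -` A \<inter> space M | A. A \<in> sets borel})"
    proof (rule indep_setI)
      show "sigma_sets (space M) {h -` A \<inter> space M | A. A \<in> sets borel} \<subseteq> events"
        "sigma_sets (space M) {g -` A \<inter> space M | A. A \<in> sets borel} \<subseteq> events"
        using 1 2 ss by (blast intro: order_trans)+
    qed (rule indep, (rule subsetD[OF 1] subsetD[OF 2], assumption)+)
  qed
  then show "integrable M (\<lambda>w. h w * g w)" "(\<integral>w. h w * g w \<partial>M) = (\<integral>w. h w \<partial>M) * (\<integral>w. g w \<partial>M)"
    by (rule indep_var_integrable[OF _ h(2) g(2)], rule indep_var_lebesgue_integral[OF _ h(2) g(2)])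
qed

text \<open>A monomial times the product density is again a product over the coordinates, with the
  extra factors attached to the coordinates \<open>i\<close> and \<open>j\<close>. A coordinate of
  odd degree contributes the factor 0.\<close>

lemma integral_normal_density_products:
  fixes i j :: "'m::finite"
  assumes v: "0 < v"
  defines "p \<equiv> (\<lambda>x::real^'m. \<Prod>k\<in>UNIV. normal_density 0 (sqrt v) (x $ k))"
  shows "integrable lborel (\<lambda>x. p x * x $ i)" "(\<integral>x. p x * x $ i \<partial>lborel) = 0"
    and "integrable lborel (\<lambda>x. p x * (x $ i * x $ j))"
      "(\<integral>x. p x * (x $ i * x $ j) \<partial>lborel) = (if i = j then v else 0)"
proof -
  have sv: "0 < sqrt v" using v by simp
  let ?nd = "normal_density 0 (sqrt v)"
  note nd = integrable_normal_density[OF sv, of 0] integral_normal_density[OF sv, of 0]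
    integrable_normal_moment_nz_1[OF sv, of 0] integral_normal_moment_nz_1[OF sv, of 0]
  have nd2: "integrable lborel (\<lambda>y. ?nd y * (y * y))" "(\<integral>y. ?nd y * (y * y) \<partial>lborel) = v"
    using integrable_normal_moment[OF sv, of 0 2] integral_normal_moment_even[OF sv, of 0 1] v
    by (simp_all add: power2_eq_square)
  define h1 where "h1 k y = ?nd y * (if k = i then y else 1)" for k y
  have h1: "integrable lborel (h1 k)" for k
    using nd by (cases "k = i") (simp_all add: h1_def[abs_def])
  have e1: "p x * x $ i = (\<Prod>k\<in>UNIV. h1 k (x $ k))" for x
    unfolding h1_def prod.distrib p_def by simp
  show "integrable lborel (\<lambda>x. p x * x $ i)"
    unfolding e1 by (rule integral_lborel_prod_vec(1)[OF h1])
  have "(\<integral>x. p x * x $ i \<partial>lborel) = (\<Prod>k\<in>UNIV. \<integral>y. h1 k y \<partial>lborel)"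
    unfolding e1 by (rule integral_lborel_prod_vec(2)[OF h1])
  also have "\<dots> = 0"
  proof (rule prod_zero)
    have "(\<integral>y. h1 i y \<partial>lborel) = 0" using nd by (simp add: h1_def)
    then show "\<exists>k\<in>UNIV. (\<integral>y. h1 k y \<partial>lborel) = 0" by blast
  qed simp
  finally show "(\<integral>x. p x * x $ i \<partial>lborel) = 0" .
  define h2 where "h2 k y = ?nd y * ((if k = i then y else 1) * (if k = j then y else 1))" for k y
  have h2: "integrable lborel (h2 k)" for k
    using nd nd2 by (cases "k = i"; cases "k = j") (simp_all add: h2_def[abs_def])
  have e2: "p x * (x $ i * x $ j) = (\<Prod>k\<in>UNIV. h2 k (x $ k))" for x
    unfolding h2_def prod.distrib p_def by simp
  show "integrable lborel (\<lambda>x. p x * (x $ i * x $ j))"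
    unfolding e2 by (rule integral_lborel_prod_vec(1)[OF h2])
  have "(\<integral>x. p x * (x $ i * x $ j) \<partial>lborel) = (\<Prod>k\<in>UNIV. \<integral>y. h2 k y \<partial>lborel)"
    unfolding e2 by (rule integral_lborel_prod_vec(2)[OF h2])
  also have "\<dots> = (if i = j then v else 0)"
  proof (cases "i = j")
    case True
    have "(\<integral>y. h2 k y \<partial>lborel) = (if k = i then v else 1)" for k
      using nd nd2 True by (simp add: h2_def)
    then show ?thesis using True by simp
  next
    case False
    have "(\<Prod>k\<in>UNIV. \<integral>y. h2 k y \<partial>lborel) = 0"
    proof (rule prod_zero)
      have "(\<integral>y. h2 i y \<partial>lborel) = 0" using nd False by (simp add: h2_def)
      then show "\<exists>k\<in>UNIV. (\<integral>y. h2 k y \<partial>lborel) = 0" by blast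
    qed simp
    then show ?thesis using False by simp
  qed
  finally show "(\<integral>x. p x * (x $ i * x $ j) \<partial>lborel) = (if i = j then v else 0)" .
qed

lemma norm_vec_power2: "(norm x)\<^sup>2 = (\<Sum>i\<in>UNIV. x $ i * x $ i)" for x :: "real^'n"
  by (simp only: power2_norm_eq_inner inner_vec_def inner_real_def)

context brownian_basis
begin

lemma increment_moments:
  fixes s t :: real
  assumes st: "0 \<le> s" "s \<le> t" "t \<le> T"
  shows "(\<lambda>w. W t w - W s w) \<in> L2 M"
    and "(\<integral>w. (W t w - W s w) $ i \<partial>M) = 0"
    and "(\<integral>w. (W t w - W s w) $ i * (W t w - W s w) $ j \<partial>M) = (if i = j then t - s else 0)"
    and "(\<integral>w. (norm (W t w - W s w))\<^sup>2 \<partial>M) = CARD('m) * (t - s)"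
proof -
  have [measurable]: "W t \<in> borel_measurable M" "W s \<in> borel_measurable M"
    using st by (auto intro: W_measurable)
  have *: "integrable M (\<lambda>w. (W t w - W s w) $ i * (W t w - W s w) $ j) \<and>
      (\<integral>w. (W t w - W s w) $ i \<partial>M) = 0 \<and>
      (\<integral>w. (W t w - W s w) $ i * (W t w - W s w) $ j \<partial>M) = (if i = j then t - s else 0)" for i j
  \<comment> \<open>For \<open>s = t\<close> there is no density to work with, but the increment is
    0.\<close>
  proof (cases "s = t")
    case False
    then have lt: "s < t" "0 < t - s" using st by auto
    note D = W_increment_distributed[OF st(1) lt(1) st(3)]
    note I = integral_normal_density_products[OF lt(2), where 'm='m]
    have nn: "0 \<le> (\<Prod>i\<in>UNIV. normal_density 0 (sqrt (t - s)) (x $ i))" for x :: "real^'m"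
      by (intro prod_nonneg) auto
    have m: "(\<lambda>x::real^'m. x $ i) \<in> borel_measurable lborel" "(\<lambda>x::real^'m. x $ i * x $ j) \<in> borel_measurable lborel"
      by measurable
    show ?thesis
      using distributed_integral[OF D m(1) nn] distributed_integral[OF D m(2) nn]
        distributed_integrable[OF D m(2) nn] I(2)[of i] I(3)[of i j] I(4)[of i j]
      by simp
  qed simp
  show "(\<integral>w. (W t w - W s w) $ i \<partial>M) = 0"
    and "(\<integral>w. (W t w - W s w) $ i * (W t w - W s w) $ j \<partial>M) = (if i = j then t - s else 0)"
    using *[of i j] by auto
  have "integrable M (\<lambda>w. (norm (W t w - W s w))\<^sup>2)"
    unfolding norm_vec_power2 using * by (intro Bochner_Integration.integrable_sum) blast
  then show "(\<lambda>w. W t w - W s w) \<in> L2 M"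
    by (simp add: L2_def)
  have "(\<integral>w. (norm (W t w - W s w))\<^sup>2 \<partial>M) = (\<Sum>i\<in>(UNIV::'m set). t - s)"
    unfolding norm_vec_power2 using * by (subst Bochner_Integration.integral_sum) (auto simp del: vector_minus_component)
  then show "(\<integral>w. (norm (W t w - W s w))\<^sup>2 \<partial>M) = CARD('m) * (t - s)"
    by simp
qed

lemma increment_indep_integral:
  fixes h g :: "'w \<Rightarrow> real"
  assumes st: "0 \<le> s" "s < t" "t \<le> T"
    and h: "h \<in> borel_measurable (F s)" "integrable M h"
    and g: "g \<in> borel_measurable (increments {t} s)" "integrable M g"
  shows "integrable M (\<lambda>w. h w * g w)" "(\<integral>w. h w * g w \<partial>M) = (\<integral>w. h w \<partial>M) * (\<integral>w. g w \<partial>M)"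
proof -
  have 1: "subalgebra M (F s)" using st by (intro subalgebra_filt) auto
  have 2: "subalgebra M (increments {t} s)"
    using st increments_subset[of "{t}" s] by (simp add: subalgebra_def)
  show "integrable M (\<lambda>w. h w * g w)" "(\<integral>w. h w * g w \<partial>M) = (\<integral>w. h w \<partial>M) * (\<integral>w. g w \<partial>M)"
    by (rule indep_sets_integral_mult[OF 1 2 _ h g], rule filt_indep_increment[OF st], assumption, assumption)+
qed

text \<open>These are the properties of a single summand of a simple integral. The bound by the
  Frobenius norm costs a factor \<open>CARD('m)\<close> against the exact isometry; this is
  harmless, because only convergence to 0 is drawn from it.\<close>

lemma increment_integrand:
  fixes s t :: real and \<zeta> :: "'w \<Rightarrow> real^'m^'k"
  assumes st: "0 \<le> s" "s \<le> t" "t \<le> T"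
    and \<zeta>: "\<zeta> \<in> borel_measurable (F s)" "\<And>w. w \<in> space M \<Longrightarrow> norm (\<zeta> w) \<le> c"
  shows "(\<lambda>w. \<zeta> w *v (W t w - W s w)) \<in> L2 M"
    and "(\<lambda>w. \<zeta> w *v (W t w - W s w)) \<in> borel_measurable (F t)"
    and "(\<integral>w. (norm (\<zeta> w *v (W t w - W s w)))\<^sup>2 \<partial>M)
      \<le> CARD('m) * (t - s) * (\<integral>w. (norm (\<zeta> w))\<^sup>2 \<partial>M)"
    and "\<eta> \<in> L2 M \<Longrightarrow> \<eta> \<in> borel_measurable (F s) \<Longrightarrow>
      (\<integral>w. (\<zeta> w *v (W t w - W s w)) \<bullet> \<eta> w \<partial>M) = 0"
proof -
  have \<zeta>M [measurable]: "\<zeta> \<in> borel_measurable M" using filt_to_M[OF _ \<zeta>(1)] st by auto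
  have \<zeta>c: "\<And>w. w \<in> space M \<Longrightarrow> norm (\<zeta> w) \<le> \<bar>c\<bar>" using \<zeta>(2) by force
  note m1 = increment_moments(1)[OF st]
  show L: "(\<lambda>w. \<zeta> w *v (W t w - W s w)) \<in> L2 M"
    by (rule L2_matrix(1)[OF \<zeta>M m1 _ \<zeta>c]) auto
  have [measurable]: "W t \<in> borel_measurable (F t)" "W s \<in> borel_measurable (F t)" "\<zeta> \<in> borel_measurable (F t)"
    using st filt_mono[OF st(2) \<zeta>(1)] by (auto intro: W_measurable_filt)
  show "(\<lambda>w. \<zeta> w *v (W t w - W s w)) \<in> borel_measurable (F t)"
    by measurable
  have incm: "(\<lambda>w. W t w - W s w) \<in> borel_measurable (increments {t} s)"
    by (rule measurable_increments) simp
  note [measurable] = incm \<zeta>(1)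
  show "(\<integral>w. (norm (\<zeta> w *v (W t w - W s w)))\<^sup>2 \<partial>M)
      \<le> CARD('m) * (t - s) * (\<integral>w. (norm (\<zeta> w))\<^sup>2 \<partial>M)"
  proof (cases "s = t")
    case False
    then have lt: "s < t" using st by simp
    have iz: "integrable M (\<lambda>w. (norm (\<zeta> w))\<^sup>2)"
    proof (rule integrable_const_bound[where B="\<bar>c\<bar>\<^sup>2"])
      show "AE w in M. norm ((norm (\<zeta> w))\<^sup>2) \<le> \<bar>c\<bar>\<^sup>2"
        using power_mono[OF \<zeta>c norm_ge_zero, of _ 2] by (intro AE_I2) simp
    qed measurable
    have mz: "(\<lambda>w. (norm (\<zeta> w))\<^sup>2) \<in> borel_measurable (F s)" by measurable
    have mg: "(\<lambda>w. (norm (W t w - W s w))\<^sup>2) \<in> borel_measurable (increments {t} s)" by measurable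
    note P = increment_indep_integral[OF st(1) lt st(3) mz iz mg L2_integrable[OF m1]]
    have "(\<integral>w. (norm (\<zeta> w *v (W t w - W s w)))\<^sup>2 \<partial>M)
        \<le> (\<integral>w. (norm (\<zeta> w))\<^sup>2 * (norm (W t w - W s w))\<^sup>2 \<partial>M)"
    proof (rule integral_mono[OF L2_integrable[OF L] P(1)])
      fix w
      show "(norm (\<zeta> w *v (W t w - W s w)))\<^sup>2 \<le> (norm (\<zeta> w))\<^sup>2 * (norm (W t w - W s w))\<^sup>2"
        using power_mono[OF norm_matrix_vector_le norm_ge_zero, of "\<zeta> w" "W t w - W s w" 2]
        by (simp only: power_mult_distrib)
    qed
    also have "\<dots> = CARD('m) * (t - s) * (\<integral>w. (norm (\<zeta> w))\<^sup>2 \<partial>M)"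
      unfolding P(2) increment_moments(4)[OF st] by simp
    finally show ?thesis .
  qed simp
  show "(\<integral>w. (\<zeta> w *v (W t w - W s w)) \<bullet> \<eta> w \<partial>M) = 0"
    if \<eta>: "\<eta> \<in> L2 M" and [measurable]: "\<eta> \<in> borel_measurable (F s)"
  proof (cases "s = t")
    case False
    then have lt: "s < t" using st by simp
    \<comment> \<open>Moving \<open>\<zeta>\<close> to the other side leaves a vector known at time
      \<open>s\<close>, so that each product of coordinates has independent factors, one of them
      centred.\<close>
    define \<theta> where "\<theta> w = transpose (\<zeta> w) *v \<eta> w" for w
    have \<theta>L: "\<theta> \<in> L2 M"
      unfolding \<theta>_def[abs_def]
      by (rule L2_matrix(1)[OF _ \<eta> abs_ge_zero[of c]]) (simp_all add: norm_transpose \<zeta>c)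
    have \<theta>m: "\<theta> \<in> borel_measurable (F s)" unfolding \<theta>_def[abs_def] by measurable
    have *: "integrable M (\<lambda>w. \<theta> w $ l * (W t w - W s w) $ l) \<and>
        (\<integral>w. \<theta> w $ l * (W t w - W s w) $ l \<partial>M) = 0" for l
    proof -
      have il: "integrable M (\<lambda>w. \<theta> w $ l)"
        unfolding cart_eq_inner_axis
        by (intro L2_imp_integrable finite_measure_axioms L2_component[OF \<theta>L]) simp
      have ml: "(\<lambda>w. \<theta> w $ l) \<in> borel_measurable (F s)"
        unfolding cart_eq_inner_axis by (rule borel_measurable_inner[OF \<theta>m borel_measurable_const])
      have ig: "integrable M (\<lambda>w. (W t w - W s w) $ l)"
        unfolding cart_eq_inner_axis
        by (intro L2_imp_integrable finite_measure_axioms L2_component[OF m1]) simp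
      have mg: "(\<lambda>w. (W t w - W s w) $ l) \<in> borel_measurable (increments {t} s)"
        unfolding cart_eq_inner_axis by (rule borel_measurable_inner[OF incm borel_measurable_const])
      note P = increment_indep_integral[OF st(1) lt st(3) ml il mg ig]
      show ?thesis
        using P(1) unfolding P(2) increment_moments(2)[OF st] mult_zero_right by (rule conjI) (rule refl)
    qed
    have "(\<zeta> w *v (W t w - W s w)) \<bullet> \<eta> w = (\<Sum>l\<in>UNIV. \<theta> w $ l * (W t w - W s w) $ l)" for w
    proof -
      have "(\<zeta> w *v (W t w - W s w)) \<bullet> \<eta> w = \<theta> w \<bullet> (W t w - W s w)"
        unfolding \<theta>_def transpose_inner by (rule inner_commute)
      then show ?thesis by (simp only: inner_vec_def inner_real_def)
    qed
    then have "(\<integral>w. (\<zeta> w *v (W t w - W s w)) \<bullet> \<eta> w \<partial>M)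
        = (\<integral>w. (\<Sum>l\<in>UNIV. \<theta> w $ l * (W t w - W s w) $ l) \<partial>M)"
      by (simp only:)
    also have "\<dots> = (\<Sum>l\<in>UNIV. \<integral>w. \<theta> w $ l * (W t w - W s w) $ l \<partial>M)"
      by (rule Bochner_Integration.integral_sum) (rule *[THEN conjunct1])
    also have "\<dots> = 0"
      by (rule sum.neutral) (rule ballI, rule *[THEN conjunct2])
    finally show ?thesis .
  qed simp
qed

end

section \<open>The Ito integral\<close>

text \<open>Translates the convergence of nonnegative integrals in \<open>ito_integral\<close>. Such
  an integral is finite only from some index on, hence the eventual membership in
  \<open>L2\<close>.\<close>

lemma L2_norm_tendsto_0:
  fixes D :: "nat \<Rightarrow> 'x \<Rightarrow> 'a::euclidean_space"
  assumes [measurable]: "\<And>k. D k \<in> borel_measurable N"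
    and lim: "(\<lambda>k. \<integral>\<^sup>+w. ennreal ((norm (D k w))\<^sup>2) \<partial>N) \<longlonglongrightarrow> 0"
  shows "(\<lambda>k. L2_norm N (D k)) \<longlonglongrightarrow> 0" and "\<exists>K. \<forall>k\<ge>K. D k \<in> L2 N"
proof -
  have eq: "(\<integral>w. (norm (D k w))\<^sup>2 \<partial>N) = enn2real (\<integral>\<^sup>+w. ennreal ((norm (D k w))\<^sup>2) \<partial>N)" for k
    by (intro integral_eq_nn_integral) auto
  have "(\<lambda>k. enn2real (\<integral>\<^sup>+w. ennreal ((norm (D k w))\<^sup>2) \<partial>N)) \<longlonglongrightarrow> 0"
    using lim by (intro tendsto_enn2real) auto
  then have "(\<lambda>k. sqrt (\<integral>w. (norm (D k w))\<^sup>2 \<partial>N)) \<longlonglongrightarrow> sqrt 0"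
    unfolding eq by (rule tendsto_real_sqrt)
  then show "(\<lambda>k. L2_norm N (D k)) \<longlonglongrightarrow> 0"
    unfolding L2_norm_def by simp
  have "eventually (\<lambda>k. (\<integral>\<^sup>+w. ennreal ((norm (D k w))\<^sup>2) \<partial>N) < 1) sequentially"
    using lim by (rule order_tendstoD) simp
  then obtain K where K: "\<And>k. k \<ge> K \<Longrightarrow> (\<integral>\<^sup>+w. ennreal ((norm (D k w))\<^sup>2) \<partial>N) < 1"
    by (auto simp: eventually_sequentially)
  have "D k \<in> L2 N" if "k \<ge> K" for k
  proof (rule L2_I)
    show "integrable N (\<lambda>w. (norm (D k w))\<^sup>2)"
      using K[OF that] by (intro integrableI_nonneg) (auto simp: less_trans[OF _ ennreal_one_less_top])
  qed simp
  then show "\<exists>K. \<forall>k\<ge>K. D k \<in> L2 N" by blast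
qed

lemma tendsto_0_norm_bound:
  fixes x :: "nat \<Rightarrow> real"
  assumes "\<And>k. \<bar>c\<bar> \<le> x k" "x \<longlonglongrightarrow> 0"
  shows "c = 0"
proof -
  have "\<bar>c\<bar> \<le> 0" using assms by (intro LIMSEQ_le_const[OF assms(2)]) auto
  then show ?thesis by simp
qed

text \<open>Its use is that replacing a variable by its mean does not increase the distance to a
  constant, and that the spread around the mean is bounded by that distance as well.\<close>

lemma (in prob_space) variance_decomposition:
  fixes X :: "'a \<Rightarrow> 'b::euclidean_space"
  assumes X: "X \<in> L2 M"
  shows "(\<integral>w. (norm (X w - c))\<^sup>2 \<partial>M) = (\<integral>w. (norm (X w - expectation X))\<^sup>2 \<partial>M) + (norm (expectation X - c))\<^sup>2"
proof -
  have i: "integrable M X" by (rule L2_imp_integrable[OF finite_measure_axioms X])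
  define m where "m = expectation X"
  have L: "(\<lambda>w. X w - m) \<in> L2 M"
    by (rule L2_diff[OF X L2_const[OF finite_measure_axioms]])
  have "(norm (X w - c))\<^sup>2 = (norm (X w - m))\<^sup>2 + 2 * (X w \<bullet> (m - c) - m \<bullet> (m - c)) + (norm (m - c))\<^sup>2" for w
    unfolding power2_norm_eq_inner by (simp add: inner_diff inner_commute algebra_simps)
  then have "(\<integral>w. (norm (X w - c))\<^sup>2 \<partial>M)
      = (\<integral>w. (norm (X w - m))\<^sup>2 + 2 * (X w \<bullet> (m - c) - m \<bullet> (m - c)) + (norm (m - c))\<^sup>2 \<partial>M)"
    by (simp only:)
  also have "\<dots> = (\<integral>w. (norm (X w - m))\<^sup>2 \<partial>M) + 2 * (m \<bullet> (m - c) - m \<bullet> (m - c)) + (norm (m - c))\<^sup>2"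
    using L2_integrable[OF L] i by (simp add: prob_space m_def)
  finally show ?thesis by (simp add: m_def)
qed

text \<open>Orthogonality is asked for in the order in which the martingale property supplies it:
  the later summand against the earlier one.\<close>

lemma L2_norm_sum_orthogonal:
  fixes Y :: "nat \<Rightarrow> 'x \<Rightarrow> 'a::euclidean_space"
  assumes Y: "\<And>i. i < n \<Longrightarrow> Y i \<in> L2 N"
    and orth: "\<And>i j. i < j \<Longrightarrow> j < n \<Longrightarrow> (\<integral>w. Y j w \<bullet> Y i w \<partial>N) = 0"
  shows "(\<integral>w. (norm (\<Sum>i<n. Y i w))\<^sup>2 \<partial>N) = (\<Sum>i<n. \<integral>w. (norm (Y i w))\<^sup>2 \<partial>N)"
  using assms
proof (induction n)
  case (Suc n)
  let ?S = "\<lambda>w. \<Sum>i<n. Y i w"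
  have S: "?S \<in> L2 N" using Suc.prems(1) by (intro L2_sum) auto
  have Yn: "Y n \<in> L2 N" using Suc.prems(1) by simp
  have "(\<integral>w. Y n w \<bullet> ?S w \<partial>N) = (\<Sum>i<n. \<integral>w. Y n w \<bullet> Y i w \<partial>N)"
    unfolding inner_sum_right using Suc.prems(1) by (intro Bochner_Integration.integral_sum L2_inner(1)) auto
  also have "\<dots> = 0" using Suc.prems(2) by (intro sum.neutral) auto
  finally have 0: "(\<integral>w. Y n w \<bullet> ?S w \<partial>N) = 0" .
  have "(norm (?S w + Y n w))\<^sup>2 = (norm (?S w))\<^sup>2 + (norm (Y n w))\<^sup>2 + 2 * (Y n w \<bullet> ?S w)" for w
    unfolding power2_norm_eq_inner by (simp only: inner_add_left inner_add_right inner_commute[of "?S w" "Y n w"])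
  then have "(\<integral>w. (norm (?S w + Y n w))\<^sup>2 \<partial>N)
      = (\<integral>w. (norm (?S w))\<^sup>2 + (norm (Y n w))\<^sup>2 + 2 * (Y n w \<bullet> ?S w) \<partial>N)"
    by (simp only:)
  also have "\<dots> = (\<integral>w. (norm (?S w))\<^sup>2 \<partial>N) + (\<integral>w. (norm (Y n w))\<^sup>2 \<partial>N)"
    using L2_integrable[OF S] L2_integrable[OF Yn] L2_inner(1)[OF Yn S] 0 by simp
  finally show ?case using Suc by simp
qed simp

text \<open>The half-open intervals are disjoint, so at most one summand is nonzero at
  \<open>q\<close>.\<close>

lemma norm_indicator_partition:
  fixes \<xi> :: "nat \<Rightarrow> 'a::real_normed_vector" and \<tau> :: "nat \<Rightarrow> real"
  assumes mono: "\<And>i j. i \<le> j \<Longrightarrow> j \<le> n \<Longrightarrow> \<tau> i \<le> \<tau> j"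
  shows "(norm (\<Sum>i<n. indicator {\<tau> i<..\<tau> (Suc i)} q *\<^sub>R \<xi> i))\<^sup>2
    = (\<Sum>i<n. indicator {\<tau> i<..\<tau> (Suc i)} q * (norm (\<xi> i))\<^sup>2)"
proof (cases "\<exists>j<n. q \<in> {\<tau> j<..\<tau> (Suc j)}")
  case True
  then obtain j where j: "j < n" "q \<in> {\<tau> j<..\<tau> (Suc j)}" by blast
  have z: "indicator {\<tau> i<..\<tau> (Suc i)} q = (0::real)" if "i < n" "i \<noteq> j" for i
  proof (cases "i < j")
    case True
    then have "\<tau> (Suc i) \<le> \<tau> j" using j by (intro mono) auto
    then show ?thesis using j by (auto simp: indicator_def)
  next
    case False
    then have "\<tau> (Suc j) \<le> \<tau> i" using that by (intro mono) auto
    then show ?thesis using j by (auto simp: indicator_def)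
  qed
  have "(\<Sum>i<n. indicator {\<tau> i<..\<tau> (Suc i)} q *\<^sub>R \<xi> i) = (\<Sum>i\<in>{j}. indicator {\<tau> i<..\<tau> (Suc i)} q *\<^sub>R \<xi> i)"
    using j z by (intro sum.mono_neutral_right) auto
  moreover have "(\<Sum>i<n. indicator {\<tau> i<..\<tau> (Suc i)} q * (norm (\<xi> i))\<^sup>2)
      = (\<Sum>i\<in>{j}. indicator {\<tau> i<..\<tau> (Suc i)} q * (norm (\<xi> i))\<^sup>2)"
    using j z by (intro sum.mono_neutral_right) auto
  ultimately show ?thesis using j(2) by (simp only: sum.insert finite.emptyI empty_iff sum.empty
      not_False_eq_True indicator_simps(1) scaleR_one add_0_right mult_1)
next
  case False
  then have z: "indicator {\<tau> i<..\<tau> (Suc i)} q = (0::real)" if "i < n" for i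
    using that by (auto simp: indicator_def)
  have "(\<Sum>i<n. indicator {\<tau> i<..\<tau> (Suc i)} q *\<^sub>R \<xi> i) = 0"
    using z by (intro sum.neutral) auto
  moreover have "(\<Sum>i<n. indicator {\<tau> i<..\<tau> (Suc i)} q * (norm (\<xi> i))\<^sup>2) = 0"
    using z by (intro sum.neutral) auto
  ultimately show ?thesis by simp
qed

lemma set_integral_indicator_Ioc:
  fixes a b :: real
  assumes "0 \<le> a" "a \<le> b" "b \<le> T"
  shows "(LINT q:{0..T}|lborel. indicator {a<..b} q * c) = (b - a) * (c::real)"
    and "set_integrable lborel {0..T} (\<lambda>q. indicator {a<..b} q * c)"
proof -
  have eq: "indicator {0..T} q *\<^sub>R (indicator {a<..b} q * c) = indicator {a<..b} q *\<^sub>R c" for q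
    using assms by (auto simp: indicator_def)
  show "(LINT q:{0..T}|lborel. indicator {a<..b} q * c) = (b - a) * c"
    unfolding set_lebesgue_integral_def eq using assms by simp
  have "emeasure lborel {a<..b} < \<infinity>" using assms by (simp add: emeasure_lborel_Ioc)
  then show "set_integrable lborel {0..T} (\<lambda>q. indicator {a<..b} q * c)"
    unfolding set_integrable_def eq by (intro integrable_scaleR_left integrable_real_indicator) auto
qed

section \<open>Simple integrals\<close>

context brownian_basis
begin

lemma simple_integrand_mono:
  assumes "simple_integrand M F T n \<tau> \<xi>" "i \<le> j" "j \<le> n"
  shows "\<tau> i \<le> \<tau> j"
  using assms(2,3)
proof (induction j rule: dec_induct)
  case (step j)
  then have "\<tau> j \<le> \<tau> (Suc j)" using assms(1) by (simp add: simple_integrand_def)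
  with step show ?case by simp
qed simp

lemma simple_integrand_points:
  assumes "simple_integrand M F T n \<tau> \<xi>" "i \<le> n"
  shows "0 \<le> \<tau> i" "\<tau> i \<le> T"
  using assms by (auto simp: simple_integrand_def)

lemma simple_integrand_L2:
  assumes S: "simple_integrand M F T n \<tau> \<xi>" and i: "i < n"
  shows "\<xi> i \<in> L2 M"
proof (rule L2_I)
  obtain c where m: "\<xi> i \<in> borel_measurable (F (\<tau> i))" and c: "\<And>w. w \<in> space M \<Longrightarrow> norm (\<xi> i w) \<le> c"
    using S i unfolding simple_integrand_def by blast
  show [measurable]: "\<xi> i \<in> borel_measurable M"
    using filt_to_M[OF _ m] simple_integrand_points[OF S, of i] i by simp
  show "integrable M (\<lambda>w. (norm (\<xi> i w))\<^sup>2)"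
  proof (rule integrable_const_bound[where B="c\<^sup>2"])
    show "AE w in M. norm ((norm (\<xi> i w))\<^sup>2) \<le> c\<^sup>2"
      using power_mono[OF c norm_ge_zero, of _ 2] by (intro AE_I2) simp
  qed measurable
qed

text \<open>The clamped end points \<open>a\<close> and \<open>b\<close> cut the interval number
  \<open>i\<close> down to its part between \<open>s\<close> and \<open>t\<close>; the increment is
  0 if there is none.\<close>

lemma simple_increment:
  fixes \<tau> :: "nat \<Rightarrow> real" and s t :: real
  assumes S: "simple_integrand M F T n \<tau> \<xi>" and i: "i < n" and st: "0 \<le> s" "s \<le> t" "t \<le> T"
  defines "a \<equiv> max s (min t (\<tau> i))" and "b \<equiv> max s (min t (\<tau> (Suc i)))"
  shows "(\<lambda>w. \<xi> i w *v (W b w - W a w)) \<in> L2 M"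
    and "(\<lambda>w. \<xi> i w *v (W b w - W a w)) \<in> borel_measurable (F b)"
    and "(\<integral>w. (norm (\<xi> i w *v (W b w - W a w)))\<^sup>2 \<partial>M)
      \<le> CARD('m) * (\<tau> (Suc i) - \<tau> i) * (\<integral>w. (norm (\<xi> i w))\<^sup>2 \<partial>M)"
    and "\<eta> \<in> L2 M \<Longrightarrow> \<eta> \<in> borel_measurable (F a) \<Longrightarrow>
      (\<integral>w. (\<xi> i w *v (W b w - W a w)) \<bullet> \<eta> w \<partial>M) = 0"
proof -
  obtain c where m: "\<xi> i \<in> borel_measurable (F (\<tau> i))" and c: "\<And>w. w \<in> space M \<Longrightarrow> norm (\<xi> i w) \<le> c"
    using S i unfolding simple_integrand_def by blast
  have \<tau>: "0 \<le> \<tau> i" "\<tau> i \<le> \<tau> (Suc i)" "\<tau> (Suc i) \<le> T"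
    using simple_integrand_points[OF S] simple_integrand_mono[OF S, of i "Suc i"] i by auto
  have ab: "0 \<le> a" "a \<le> b" "b \<le> T" "b - a \<le> \<tau> (Suc i) - \<tau> i"
    using st \<tau> by (auto simp: a_def b_def)
  \<comment> \<open>If the interval starts after \<open>t\<close>, then \<open>\<xi> i\<close> is
    not known at time \<open>a\<close>; but \<open>a = b\<close> in this case, so 0 may take its
    place. This makes the coefficient \<open>F a\<close>-measurable.\<close>
  define \<zeta> where "\<zeta> = (\<lambda>w. if \<tau> i \<le> t then \<xi> i w else 0)"
  have \<zeta>m: "\<zeta> \<in> borel_measurable (F a)"
  proof (cases "\<tau> i \<le> t")
    case True
    then have "\<tau> i \<le> a" by (simp add: a_def)
    from filt_mono[OF this m] True show ?thesis by (simp add: \<zeta>_def)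
  qed (simp add: \<zeta>_def)
  have c0: "0 \<le> \<bar>c\<bar>" by simp
  have \<zeta>c: "norm (\<zeta> w) \<le> \<bar>c\<bar>" if "w \<in> space M" for w
    using order_trans[OF c[OF that] abs_ge_self] by (simp add: \<zeta>_def)
  have eq: "\<xi> i w *v (W b w - W a w) = \<zeta> w *v (W b w - W a w)" for w
  proof (cases "\<tau> i \<le> t")
    case False
    then have "a = b" using \<tau> by (simp add: a_def b_def)
    then show ?thesis by simp
  qed (simp add: \<zeta>_def)
  note I = increment_integrand[OF ab(1-3) \<zeta>m \<zeta>c]
  show "(\<lambda>w. \<xi> i w *v (W b w - W a w)) \<in> L2 M"
    "(\<lambda>w. \<xi> i w *v (W b w - W a w)) \<in> borel_measurable (F b)"
    unfolding eq by (rule I(1), assumption, rule I(2), assumption)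
  show "(\<integral>w. (\<xi> i w *v (W b w - W a w)) \<bullet> \<eta> w \<partial>M) = 0"
    if "\<eta> \<in> L2 M" "\<eta> \<in> borel_measurable (F a)"
    unfolding eq using I(4) that by blast
  have \<xi>i: "integrable M (\<lambda>w. (norm (\<xi> i w))\<^sup>2)"
    by (rule L2_integrable[OF simple_integrand_L2[OF S i]])
  have "(\<integral>w. (norm (\<zeta> w *v (W b w - W a w)))\<^sup>2 \<partial>M) \<le> CARD('m) * (b - a) * (\<integral>w. (norm (\<zeta> w))\<^sup>2 \<partial>M)"
    by (rule I(3))
  also have "\<dots> \<le> CARD('m) * (\<tau> (Suc i) - \<tau> i) * (\<integral>w. (norm (\<xi> i w))\<^sup>2 \<partial>M)"
    using ab \<tau> by (intro mult_mono mult_left_mono) (cases "\<tau> i \<le> t"; simp add: \<zeta>_def)+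
  finally show "(\<integral>w. (norm (\<xi> i w *v (W b w - W a w)))\<^sup>2 \<partial>M)
      \<le> CARD('m) * (\<tau> (Suc i) - \<tau> i) * (\<integral>w. (norm (\<xi> i w))\<^sup>2 \<partial>M)"
    unfolding eq .
qed

text \<open>For every time \<open>r\<close>, the difference of \<open>W\<close> at
  \<open>min t r\<close> and at \<open>min s r\<close> is \<open>W\<close> at
  \<open>max s (min t r)\<close> minus \<open>W s\<close>; the common term \<open>W s\<close>
  cancels in each summand.\<close>

lemma simple_integral_diff:
  assumes S: "simple_integrand M F T n \<tau> \<xi>" and st: "0 \<le> s" "s \<le> t" "t \<le> T"
  shows "simple_integral W n \<tau> \<xi> t w - simple_integral W n \<tau> \<xi> s w
    = (\<Sum>i<n. \<xi> i w *v (W (max s (min t (\<tau> (Suc i)))) w - W (max s (min t (\<tau> i))) w))"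
proof -
  have "W (min t r) w - W (min s r) w = W (max s (min t r)) w - W s w" for r
    using st by (cases "r \<le> s") (auto simp: min_def max_def)
  then have e: "W (min t r) w = W (min s r) w + W (max s (min t r)) w - W s w" for r
    by (simp add: algebra_simps)
  have "\<xi> i w *v (W (min t (\<tau> (Suc i))) w - W (min t (\<tau> i)) w)
      - \<xi> i w *v (W (min s (\<tau> (Suc i))) w - W (min s (\<tau> i)) w)
      = \<xi> i w *v (W (max s (min t (\<tau> (Suc i)))) w - W (max s (min t (\<tau> i))) w)" for i
    unfolding matrix_vector_mult_diff_distrib[symmetric] e[of "\<tau> (Suc i)"] e[of "\<tau> i"]
    by (simp add: algebra_simps)
  then show ?thesis
    by (simp add: simple_integral_def sum_subtractf[symmetric])
qed

lemma simple_integral_0: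
  assumes S: "simple_integrand M F T n \<tau> \<xi>"
  shows "simple_integral W n \<tau> \<xi> 0 w = 0"
  unfolding simple_integral_def
proof (rule sum.neutral, rule ballI)
  fix i assume "i \<in> {..<n}"
  then have "min 0 (\<tau> (Suc i)) = 0" "min 0 (\<tau> i) = 0"
    using simple_integrand_points(1)[OF S, of i] simple_integrand_points(1)[OF S, of "Suc i"] by auto
  then show "\<xi> i w *v (W (min 0 (\<tau> (Suc i))) w - W (min 0 (\<tau> i)) w) = 0" by simp
qed

lemma simple_integral_L2:
  assumes S: "simple_integrand M F T n \<tau> \<xi>" and t: "t \<in> {0..T}"
  shows "simple_integral W n \<tau> \<xi> t \<in> L2 M"
proof -
  have t': "0 \<le> (0::real)" "0 \<le> t" "t \<le> T" using t by auto
  have "(\<lambda>w. \<Sum>i<n. \<xi> i w *v (W (max 0 (min t (\<tau> (Suc i)))) w - W (max 0 (min t (\<tau> i))) w)) \<in> L2 M"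
    by (rule L2_sum) (rule simple_increment(1)[OF S _ t'], simp)
  also have "(\<lambda>w. \<Sum>i<n. \<xi> i w *v (W (max 0 (min t (\<tau> (Suc i)))) w - W (max 0 (min t (\<tau> i))) w))
      = simple_integral W n \<tau> \<xi> t"
    using simple_integral_diff[OF S t'] simple_integral_0[OF S] by auto
  finally show ?thesis .
qed

text \<open>Each summand of the difference is an increment after \<open>s\<close>, where
  \<open>\<eta>\<close> is already known.\<close>

lemma simple_integral_martingale:
  assumes S: "simple_integrand M F T n \<tau> \<xi>" and st: "0 \<le> s" "s \<le> t" "t \<le> T"
    and \<eta>: "\<eta> \<in> L2 M" "\<eta> \<in> borel_measurable (F s)"
  shows "(\<integral>w. (simple_integral W n \<tau> \<xi> t w - simple_integral W n \<tau> \<xi> s w) \<bullet> \<eta> w \<partial>M) = 0"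
proof -
  have \<eta>m: "\<eta> \<in> borel_measurable (F (max s r))" for r
    by (rule filt_mono[OF _ \<eta>(2)]) simp
  let ?Y = "\<lambda>i w. \<xi> i w *v (W (max s (min t (\<tau> (Suc i)))) w - W (max s (min t (\<tau> i))) w)"
  have "(\<integral>w. (simple_integral W n \<tau> \<xi> t w - simple_integral W n \<tau> \<xi> s w) \<bullet> \<eta> w \<partial>M)
      = (\<integral>w. (\<Sum>i<n. ?Y i w \<bullet> \<eta> w) \<partial>M)"
    unfolding simple_integral_diff[OF S st] inner_sum_left by (rule refl)
  also have "\<dots> = (\<Sum>i<n. \<integral>w. ?Y i w \<bullet> \<eta> w \<partial>M)"
    by (intro Bochner_Integration.integral_sum L2_inner(1)[OF simple_increment(1)[OF S _ st] \<eta>(1)]) simp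
  also have "\<dots> = 0"
    by (intro sum.neutral ballI simple_increment(4)[OF S _ st \<eta>(1) \<eta>m]) simp
  finally show ?thesis .
qed

text \<open>One half of the Ito isometry, up to the factor \<open>CARD('m)\<close>: the summands are
  orthogonal, and since the intervals are disjoint the sum of their bounds is the time integral of
  the squared simple value.\<close>

lemma simple_integral_norm:
  assumes S: "simple_integrand M F T n \<tau> \<xi>" and t: "t \<in> {0..T}"
  shows "(\<integral>w. (norm (simple_integral W n \<tau> \<xi> t w))\<^sup>2 \<partial>M)
    \<le> CARD('m) * (LINT q:{0..T}|lborel. \<integral>w. (norm (simple_value n \<tau> \<xi> q w))\<^sup>2 \<partial>M)"
proof -
  have t': "0 \<le> (0::real)" "0 \<le> t" "t \<le> T" using t by auto
  define a where "a i = max 0 (min t (\<tau> i))" for i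
  let ?Y = "\<lambda>i w. \<xi> i w *v (W (a (Suc i)) w - W (a i) w)"
  note I = simple_increment[OF S _ t', folded a_def]
  have e: "simple_integral W n \<tau> \<xi> t w = (\<Sum>i<n. ?Y i w)" for w
    using simple_integral_diff[OF S t', of w] simple_integral_0[OF S, of w] by (simp add: a_def)
  have "(\<integral>w. (norm (simple_integral W n \<tau> \<xi> t w))\<^sup>2 \<partial>M) = (\<Sum>i<n. \<integral>w. (norm (?Y i w))\<^sup>2 \<partial>M)"
    unfolding e
  proof (rule L2_norm_sum_orthogonal)
    \<comment> \<open>The summand \<open>i\<close> is known at the end of its interval, hence no
      later than the start of interval \<open>j\<close>.\<close>
    fix i j assume ij: "i < j" "j < n"
    then have "\<tau> (Suc i) \<le> \<tau> j" by (intro simple_integrand_mono[OF S]) auto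
    then have le: "a (Suc i) \<le> a j" by (auto simp: a_def)
    have i: "i < n" using ij by simp
    show "(\<integral>w. ?Y j w \<bullet> ?Y i w \<partial>M) = 0"
      by (rule I(4)[OF ij(2) I(1)[OF i] filt_mono[OF le I(2)[OF i]]])
  qed (rule I(1))
  also have "\<dots> \<le> (\<Sum>i<n. CARD('m) * (\<tau> (Suc i) - \<tau> i) * (\<integral>w. (norm (\<xi> i w))\<^sup>2 \<partial>M))"
    by (intro sum_mono I(3)) simp
  also have "\<dots> = CARD('m) * (\<Sum>i<n. (\<tau> (Suc i) - \<tau> i) * (\<integral>w. (norm (\<xi> i w))\<^sup>2 \<partial>M))"
    by (simp add: sum_distrib_left mult.assoc)
  also have "(\<Sum>i<n. (\<tau> (Suc i) - \<tau> i) * (\<integral>w. (norm (\<xi> i w))\<^sup>2 \<partial>M))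
      = (\<Sum>i<n. LINT q:{0..T}|lborel. indicator {\<tau> i<..\<tau> (Suc i)} q * (\<integral>w. (norm (\<xi> i w))\<^sup>2 \<partial>M))"
    using simple_integrand_points[OF S] simple_integrand_mono[OF S]
    by (intro sum.cong refl set_integral_indicator_Ioc(1)[symmetric]) auto
  also have "\<dots> = (LINT q:{0..T}|lborel. \<Sum>i<n. indicator {\<tau> i<..\<tau> (Suc i)} q * (\<integral>w. (norm (\<xi> i w))\<^sup>2 \<partial>M))"
    unfolding set_lebesgue_integral_def scaleR_sum_right
    using simple_integrand_points[OF S] simple_integrand_mono[OF S]
    by (intro Bochner_Integration.integral_sum[symmetric]
        set_integral_indicator_Ioc(2)[unfolded set_integrable_def]) auto
  also have "(\<lambda>q. \<Sum>i<n. indicator {\<tau> i<..\<tau> (Suc i)} q * (\<integral>w. (norm (\<xi> i w))\<^sup>2 \<partial>M))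
      = (\<lambda>q. \<integral>w. (norm (simple_value n \<tau> \<xi> q w))\<^sup>2 \<partial>M)"
  proof
    fix q
    have "(\<integral>w. (norm (simple_value n \<tau> \<xi> q w))\<^sup>2 \<partial>M)
        = (\<integral>w. (\<Sum>i<n. indicator {\<tau> i<..\<tau> (Suc i)} q * (norm (\<xi> i w))\<^sup>2) \<partial>M)"
      unfolding simple_value_def
      by (intro Bochner_Integration.integral_cong refl norm_indicator_partition simple_integrand_mono[OF S])
    also have "\<dots> = (\<Sum>i<n. \<integral>w. indicator {\<tau> i<..\<tau> (Suc i)} q * (norm (\<xi> i w))\<^sup>2 \<partial>M)"
      by (intro Bochner_Integration.integral_sum integrable_mult_right L2_integrable simple_integrand_L2[OF S]) simp
    finally show "(\<Sum>i<n. indicator {\<tau> i<..\<tau> (Suc i)} q * (\<integral>w. (norm (\<xi> i w))\<^sup>2 \<partial>M))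
        = (\<integral>w. (norm (simple_value n \<tau> \<xi> q w))\<^sup>2 \<partial>M)"
      by simp
  qed
  finally show ?thesis .
qed

section \<open>Ito integrals as limits of simple integrals\<close>

lemma ito_integral_D:
  assumes I: "ito_integral M F T W Z I" and t: "t \<in> {0..T}"
  shows "I t \<in> borel_measurable (F t)" "I t \<in> L2 M"
proof -
  show m: "I t \<in> borel_measurable (F t)" using I t unfolding ito_integral_def by blast
  have mM: "I t \<in> borel_measurable M" using filt_to_M[OF _ m] t by simp
  obtain n \<tau> \<xi> where S: "\<And>k. simple_integrand M F T (n k) (\<tau> k) (\<xi> k)"
    and l: "(\<lambda>k. \<integral>\<^sup>+w. ennreal ((norm (simple_integral W (n k) (\<tau> k) (\<xi> k) t w - I t w))\<^sup>2) \<partial>M) \<longlonglongrightarrow> 0"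
    using I t unfolding ito_integral_def by blast
  note L = simple_integral_L2[OF S t]
  have "(\<lambda>w. simple_integral W (n k) (\<tau> k) (\<xi> k) t w - I t w) \<in> borel_measurable M" for k
    by (rule borel_measurable_diff[OF L2_measurable[OF L] mM])
  from L2_norm_tendsto_0(2)[OF this l] obtain k
    where k: "(\<lambda>w. simple_integral W (n k) (\<tau> k) (\<xi> k) t w - I t w) \<in> L2 M" by blast
  from L2_diff[OF L[of k] k] show "I t \<in> L2 M" by simp
qed

text \<open>The martingale property in the form in which it is used: increments are orthogonal to
  everything square-integrable known at time \<open>s\<close>. This is linear and continuous in the
  increment, so it passes to the limit from simple integrals.\<close>

lemma ito_integral_martingale:
  assumes I: "ito_integral M F T W Z I" and st: "0 \<le> s" "s \<le> t" "t \<le> T"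
    and \<eta>: "\<eta> \<in> L2 M" "\<eta> \<in> borel_measurable (F s)"
  shows "(\<integral>w. (I t w - I s w) \<bullet> \<eta> w \<partial>M) = 0"
proof -
  have t: "t \<in> {0..T}" "s \<in> {0..T}" using st by auto
  obtain n \<tau> \<xi> where S: "\<And>k. simple_integrand M F T (n k) (\<tau> k) (\<xi> k)"
    and l: "\<And>t. t \<in> {0..T} \<Longrightarrow>
      (\<lambda>k. \<integral>\<^sup>+w. ennreal ((norm (simple_integral W (n k) (\<tau> k) (\<xi> k) t w - I t w))\<^sup>2) \<partial>M) \<longlonglongrightarrow> 0"
    using I unfolding ito_integral_def by blast
  define J where "J k = simple_integral W (n k) (\<tau> k) (\<xi> k)" for k
  have J: "J k t \<in> L2 M" "J k s \<in> L2 M" for k unfolding J_def by (rule simple_integral_L2[OF S] t)+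
  note It = ito_integral_D(2)[OF I t(1)] and Is = ito_integral_D(2)[OF I t(2)]
  have D: "(\<lambda>w. J k t w - I t w) \<in> L2 M" "(\<lambda>w. J k s w - I s w) \<in> L2 M" for k
    by (rule L2_diff[OF J(1) It], rule L2_diff[OF J(2) Is])
  have lt: "(\<lambda>k. L2_norm M (\<lambda>w. J k t w - I t w)) \<longlonglongrightarrow> 0"
    by (rule L2_norm_tendsto_0(1)[OF L2_measurable[OF D(1)]]) (unfold J_def, rule l[OF t(1)])
  have ls: "(\<lambda>k. L2_norm M (\<lambda>w. J k s w - I s w)) \<longlonglongrightarrow> 0"
    by (rule L2_norm_tendsto_0(1)[OF L2_measurable[OF D(2)]]) (unfold J_def, rule l[OF t(2)])
  have "\<bar>\<integral>w. (I t w - I s w) \<bullet> \<eta> w \<partial>M\<bar>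
      \<le> (L2_norm M (\<lambda>w. J k t w - I t w) + L2_norm M (\<lambda>w. J k s w - I s w)) * L2_norm M \<eta>" for k
  proof -
    have 0: "(\<integral>w. (J k t w - J k s w) \<bullet> \<eta> w \<partial>M) = 0"
      unfolding J_def by (rule simple_integral_martingale[OF S st \<eta>])
    have "(I t w - I s w) \<bullet> \<eta> w = (J k t w - J k s w) \<bullet> \<eta> w - (J k t w - I t w) \<bullet> \<eta> w
        + (J k s w - I s w) \<bullet> \<eta> w" for w
      by (simp add: inner_diff_left)
    then have "(\<integral>w. (I t w - I s w) \<bullet> \<eta> w \<partial>M) = (\<integral>w. (J k t w - J k s w) \<bullet> \<eta> w
        - (J k t w - I t w) \<bullet> \<eta> w + (J k s w - I s w) \<bullet> \<eta> w \<partial>M)"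
      by (simp only:)
    also have "\<dots> = (\<integral>w. (J k t w - J k s w) \<bullet> \<eta> w \<partial>M) - (\<integral>w. (J k t w - I t w) \<bullet> \<eta> w \<partial>M)
        + (\<integral>w. (J k s w - I s w) \<bullet> \<eta> w \<partial>M)"
      by (subst Bochner_Integration.integral_add, rule Bochner_Integration.integrable_diff,
          (rule L2_inner(1)[OF _ \<eta>(1)] L2_diff[OF J] D)+,
          subst Bochner_Integration.integral_diff, (rule L2_inner(1)[OF _ \<eta>(1)] L2_diff[OF J] D refl)+)
    finally have "\<bar>\<integral>w. (I t w - I s w) \<bullet> \<eta> w \<partial>M\<bar>
        \<le> \<bar>\<integral>w. (J k t w - I t w) \<bullet> \<eta> w \<partial>M\<bar> + \<bar>\<integral>w. (J k s w - I s w) \<bullet> \<eta> w \<partial>M\<bar>"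
      using 0 by linarith
    also have "\<dots> \<le> (L2_norm M (\<lambda>w. J k t w - I t w) + L2_norm M (\<lambda>w. J k s w - I s w)) * L2_norm M \<eta>"
      unfolding distrib_right by (intro add_mono L2_inner(4) D \<eta>(1))
    finally show ?thesis .
  qed
  moreover have "(\<lambda>k. (L2_norm M (\<lambda>w. J k t w - I t w) + L2_norm M (\<lambda>w. J k s w - I s w)) * L2_norm M \<eta>) \<longlonglongrightarrow> 0"
    by (rule tendsto_mult_left_zero) (use tendsto_add[OF lt ls] in simp)
  ultimately show ?thesis by (rule tendsto_0_norm_bound)
qed

end

section \<open>Covariance isometry for deterministic step functions\<close>

lemma set_integral_indicators_min:
  fixes s t :: real
  assumes "s \<in> {0..T}" "t \<in> {0..T}"
  shows "(LINT q:{0..T}|lborel. indicator {0<..s} q * indicator {0<..t} q * c) = min s t * (c::real)"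
    and "set_integrable lborel {0..T} (\<lambda>q. indicator {0<..s} q * indicator {0<..t} q * c)"
proof -
  have eq: "indicator {0<..s} q * indicator {0<..t} q = (indicator {0<..min s t} q :: real)" for q
    by (auto simp: indicator_def)
  show "(LINT q:{0..T}|lborel. indicator {0<..s} q * indicator {0<..t} q * c) = min s t * (c::real)"
    "set_integrable lborel {0..T} (\<lambda>q. indicator {0<..s} q * indicator {0<..t} q * c)"
    unfolding eq using set_integral_indicator_Ioc[of 0 "min s t" T c] assms by auto
qed

context brownian_basis
begin

text \<open>For \<open>s \<le> t\<close> the increment after \<open>s\<close> is orthogonal to the
  past, which reduces the claim to equal times; there the second moments of the coordinates add up
  to the inner product of the matrices. \<open>W 0\<close> is subtracted because it vanishes only
  almost everywhere.\<close>

lemma brownian_covariance: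
  fixes C C' :: "real^'m^'k"
  assumes st: "s \<in> {0..T}" "t \<in> {0..T}"
  shows "(\<integral>w. (C *v (W s w - W 0 w)) \<bullet> (C' *v (W t w - W 0 w)) \<partial>M) = min s t * (C \<bullet> C')"
proof -
  have 1: "(\<lambda>w. C *v (W s w - W 0 w)) \<in> L2 M" "(\<lambda>w. C *v (W s w - W 0 w)) \<in> borel_measurable (F s)"
    if "s \<in> {0..T}" for s and C :: "real^'m^'k"
    using increment_integrand(1,2)[of 0 s "\<lambda>_. C" "norm C"] that by auto
  have eq: "(\<integral>w. (C *v (W s w - W 0 w)) \<bullet> (C' *v (W s w - W 0 w)) \<partial>M) = s * (C \<bullet> C')"
    if s: "s \<in> {0..T}" for s and C C' :: "real^'m^'k"
  proof -
    let ?B = "\<lambda>w. W s w - W 0 w"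
    have s0: "0 \<le> (0::real)" "0 \<le> s" "s \<le> T" using s by auto
    note mom = increment_moments[OF s0]
    have i: "integrable M (\<lambda>w. ?B w $ l * ?B w $ l')" for l l'
    proof -
      have "(\<lambda>w. ?B w $ l) \<in> L2 M" for l
        unfolding cart_eq_inner_axis by (rule L2_component[OF mom(1)]) simp
      from L2_inner(1)[OF this this] show ?thesis by (simp only: inner_real_def)
    qed
    have "(C *v ?B w) \<bullet> (C' *v ?B w)
        = (\<Sum>k\<in>UNIV. \<Sum>l\<in>UNIV. \<Sum>l'\<in>UNIV. (C $ k $ l * C' $ k $ l') * (?B w $ l * ?B w $ l'))" for w
      unfolding inner_vec_def matrix_vector_mult_def vec_lambda_beta inner_real_def sum_product
      by (intro sum.cong refl) (simp only: mult.assoc mult.left_commute mult.commute)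
    then have "(\<integral>w. (C *v ?B w) \<bullet> (C' *v ?B w) \<partial>M)
        = (\<integral>w. (\<Sum>k\<in>UNIV. \<Sum>l\<in>UNIV. \<Sum>l'\<in>UNIV. (C $ k $ l * C' $ k $ l') * (?B w $ l * ?B w $ l')) \<partial>M)"
      by (simp only:)
    also have "\<dots> = (\<Sum>k\<in>UNIV. \<Sum>l\<in>UNIV. \<Sum>l'\<in>UNIV. (C $ k $ l * C' $ k $ l') * (if l = l' then s - 0 else 0))"
      unfolding mom(3)[symmetric]
      by (simp only: Bochner_Integration.integral_sum Bochner_Integration.integrable_sum
          integrable_mult_right i integral_mult_right_zero)
    also have "\<dots> = s * (C \<bullet> C')"
      by (simp add: inner_vec_def sum_distrib_left if_distrib[of "\<lambda>x. _ * x"] mult.commute mult.left_commute cong: if_cong)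
    finally show ?thesis .
  qed
  have le: "(\<integral>w. (C *v (W s w - W 0 w)) \<bullet> (C' *v (W t w - W 0 w)) \<partial>M) = s * (C \<bullet> C')"
    if st: "s \<in> {0..T}" "t \<in> {0..T}" "s \<le> t" for s t and C C' :: "real^'m^'k"
  proof -
    have st': "0 \<le> s" "s \<le> t" "t \<le> T" using st by auto
    have L: "(\<lambda>w. C' *v (W t w - W s w)) \<in> L2 M"
      using increment_integrand(1)[OF st', of "\<lambda>_. C'" "norm C'"] by simp
    have 0: "(\<integral>w. (C' *v (W t w - W s w)) \<bullet> (C *v (W s w - W 0 w)) \<partial>M) = 0"
      using increment_integrand(4)[OF st', of "\<lambda>_. C'" "norm C'"] 1[OF st(1)] by simp
    have "(C *v (W s w - W 0 w)) \<bullet> (C' *v (W t w - W 0 w))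
        = (C *v (W s w - W 0 w)) \<bullet> (C' *v (W s w - W 0 w)) + (C' *v (W t w - W s w)) \<bullet> (C *v (W s w - W 0 w))" for w
    proof -
      have "C' *v (W t w - W 0 w) = C' *v (W s w - W 0 w) + C' *v (W t w - W s w)"
        by (simp add: matrix_vector_right_distrib[symmetric])
      then show ?thesis by (simp only: inner_add_right inner_commute)
    qed
    then have "(\<integral>w. (C *v (W s w - W 0 w)) \<bullet> (C' *v (W t w - W 0 w)) \<partial>M)
        = (\<integral>w. (C *v (W s w - W 0 w)) \<bullet> (C' *v (W s w - W 0 w)) + (C' *v (W t w - W s w)) \<bullet> (C *v (W s w - W 0 w)) \<partial>M)"
      by (simp only:)
    also have "\<dots> = s * (C \<bullet> C')"
      using L2_inner(1)[OF 1(1)[OF st(1), of C] 1(1)[OF st(1), of C']] L2_inner(1)[OF L 1(1)[OF st(1), of C]] 0 eq[OF st(1)]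
      by simp
    finally show ?thesis .
  qed
  show ?thesis
  proof (cases "s \<le> t")
    case True
    then show ?thesis using le[OF st True] by simp
  next
    case False
    then show ?thesis using le[OF st(2,1), of C' C] by (simp add: inner_commute min_def)
  qed
qed

text \<open>The graph of the Wiener integral on step functions, generated by steps from 0 to
  \<open>s\<close>. As a relation it admits sums without a common refinement of two partitions, and
  inner products reduce to pairs of single steps by induction.\<close>

inductive elementary :: "(real \<Rightarrow> real^'m^'k) \<Rightarrow> ('w \<Rightarrow> real^'k) \<Rightarrow> bool" where
  elementary_0: "elementary (\<lambda>_. 0) (\<lambda>_. 0)"
| elementary_step: "elementary v X \<Longrightarrow> s \<in> {0..T} \<Longrightarrow>
    elementary (\<lambda>q. v q + indicator {0<..s} q *\<^sub>R C) (\<lambda>w. X w + C *v (W s w - W 0 w))"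

lemma elementary_add: "elementary v X \<Longrightarrow> elementary v' X' \<Longrightarrow> elementary (\<lambda>q. v q + v' q) (\<lambda>w. X w + X' w)"
proof (induction rule: elementary.induct)
  case (elementary_step v X s C)
  have "elementary (\<lambda>q. (v q + v' q) + indicator {0<..s} q *\<^sub>R C) (\<lambda>w. (X w + X' w) + C *v (W s w - W 0 w))"
    using elementary_step by (intro elementary.elementary_step) auto
  then show ?case by (simp add: ac_simps)
qed simp

lemma elementary_L2: "elementary v X \<Longrightarrow> X \<in> L2 M"
proof (induction rule: elementary.induct)
  case (elementary_step v X s C)
  have "(\<lambda>w. C *v (W s w - W 0 w)) \<in> L2 M"
    using elementary_step increment_integrand(1)[of 0 s "\<lambda>_. C" "norm C"] by auto
  then show ?case using elementary_step by (intro L2_add) auto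
qed (rule L2_zero)

lemma elementary_base_inner:
  assumes "elementary v X" and t: "t \<in> {0..T}"
  shows "set_integrable lborel {0..T} (\<lambda>q. v q \<bullet> (indicator {0<..t} q *\<^sub>R C)) \<and>
    (\<integral>w. X w \<bullet> (C *v (W t w - W 0 w)) \<partial>M) = (LINT q:{0..T}|lborel. v q \<bullet> (indicator {0<..t} q *\<^sub>R C))"
  using assms(1)
proof (induction rule: elementary.induct)
  case elementary_0
  then show ?case by (simp add: set_integrable_def set_lebesgue_integral_def)
next
  case (elementary_step v X s D)
  let ?Bt = "\<lambda>w. C *v (W t w - W 0 w)" and ?Bs = "\<lambda>w. D *v (W s w - W 0 w)"
  have L: "?Bt \<in> L2 M" "?Bs \<in> L2 M"
    using t elementary_step(2) increment_integrand(1)[of 0 t "\<lambda>_. C" "norm C"]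
      increment_integrand(1)[of 0 s "\<lambda>_. D" "norm D"] by auto
  have e: "(v q + indicator {0<..s} q *\<^sub>R D) \<bullet> (indicator {0<..t} q *\<^sub>R C)
      = v q \<bullet> (indicator {0<..t} q *\<^sub>R C) + indicator {0<..s} q * indicator {0<..t} q * (D \<bullet> C)" for q
    by (simp add: inner_add_left algebra_simps)
  note I = set_integral_indicators_min[OF elementary_step(2) t, of "D \<bullet> C"]
  have "(\<integral>w. (X w + ?Bs w) \<bullet> ?Bt w \<partial>M) = (\<integral>w. X w \<bullet> ?Bt w \<partial>M) + (\<integral>w. ?Bs w \<bullet> ?Bt w \<partial>M)"
    unfolding inner_add_left
    by (intro Bochner_Integration.integral_add L2_inner(1) L elementary_L2[OF elementary_step(1)])
  also have "\<dots> = (LINT q:{0..T}|lborel. v q \<bullet> (indicator {0<..t} q *\<^sub>R C))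
      + (LINT q:{0..T}|lborel. indicator {0<..s} q * indicator {0<..t} q * (D \<bullet> C))"
    unfolding I(1) using elementary_step brownian_covariance[OF elementary_step(2) t, of D C] by simp
  also have "\<dots> = (LINT q:{0..T}|lborel. (v q + indicator {0<..s} q *\<^sub>R D) \<bullet> (indicator {0<..t} q *\<^sub>R C))"
    unfolding e using elementary_step I(2) by (intro set_integral_add(2)[symmetric]) auto
  finally show ?case
    unfolding e using elementary_step I(2) by (auto intro!: set_integral_add(1))
qed

text \<open>Bilinear extension of \<open>brownian_covariance\<close>, where \<open>min s t\<close>
  is the integral of the product of the indicators of \<open>{0<..s}\<close> and
  \<open>{0<..t}\<close>.\<close>

lemma elementary_inner:
  assumes v: "elementary v X" and v': "elementary v' X'"
  shows "set_integrable lborel {0..T} (\<lambda>q. v q \<bullet> v' q) \<and>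
    (\<integral>w. X w \<bullet> X' w \<partial>M) = (LINT q:{0..T}|lborel. v q \<bullet> v' q)"
  using v'
proof (induction rule: elementary.induct)
  case elementary_0
  then show ?case by (simp add: set_integrable_def set_lebesgue_integral_def)
next
  case (elementary_step v' X' t C)
  note B = elementary_base_inner[OF v elementary_step(2), of C]
  have L: "(\<lambda>w. C *v (W t w - W 0 w)) \<in> L2 M"
    using elementary_step(2) increment_integrand(1)[of 0 t "\<lambda>_. C" "norm C"] by auto
  have "(\<integral>w. X w \<bullet> (X' w + C *v (W t w - W 0 w)) \<partial>M)
      = (\<integral>w. X w \<bullet> X' w \<partial>M) + (\<integral>w. X w \<bullet> (C *v (W t w - W 0 w)) \<partial>M)"
    unfolding inner_add_right
    by (intro Bochner_Integration.integral_add L2_inner(1) L elementary_L2[OF elementary_step(1)] elementary_L2[OF v])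
  also have "\<dots> = (LINT q:{0..T}|lborel. v q \<bullet> (v' q + indicator {0<..t} q *\<^sub>R C))"
    unfolding inner_add_right using elementary_step B by (subst set_integral_add(2)) auto
  finally show ?case
    unfolding inner_add_right using elementary_step B by (auto intro!: set_integral_add(1))
qed

text \<open>An increment between two clamped times is a difference of two increments from 0;
  correspondingly, the indicator of the clamped interval is a difference of two indicators starting
  at 0.\<close>

lemma elementary_simple:
  fixes \<tau> :: "nat \<Rightarrow> real"
  assumes "\<And>i. i \<le> n \<Longrightarrow> \<tau> i \<in> {0..T}" "\<And>i. i < n \<Longrightarrow> \<tau> i \<le> \<tau> (Suc i)" and t: "t \<in> {0..T}"
  shows "elementary (\<lambda>q. \<Sum>i<n. (indicator {0<..t} q * indicator {\<tau> i<..\<tau> (Suc i)} q) *\<^sub>R c i)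
    (\<lambda>w. \<Sum>i<n. c i *v (W (min t (\<tau> (Suc i))) w - W (min t (\<tau> i)) w))"
  using assms(1,2)
proof (induction n)
  case 0
  show ?case by (simp add: elementary_0)
next
  case (Suc n)
  let ?a = "min t (\<tau> n)" and ?b = "min t (\<tau> (Suc n))"
  have \<tau>: "0 \<le> \<tau> n" "\<tau> n \<le> \<tau> (Suc n)" using Suc.prems(1)[of n] Suc.prems(2)[of n] by auto
  have ab: "?a \<in> {0..T}" "?b \<in> {0..T}"
    using Suc.prems(1)[of n] Suc.prems(1)[of "Suc n"] t by auto
  have IH: "elementary (\<lambda>q. \<Sum>i<n. (indicator {0<..t} q * indicator {\<tau> i<..\<tau> (Suc i)} q) *\<^sub>R c i)
    (\<lambda>w. \<Sum>i<n. c i *v (W (min t (\<tau> (Suc i))) w - W (min t (\<tau> i)) w))" (is "elementary ?v ?X")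
    using Suc.prems by (intro Suc.IH) auto
  have "indicator {0<..t} q * indicator {\<tau> n<..\<tau> (Suc n)} q = (indicator {0<..?b} q - indicator {0<..?a} q :: real)" for q
    using \<tau> by (auto simp: indicator_def)
  then have 1: "?v q + (indicator {0<..t} q * indicator {\<tau> n<..\<tau> (Suc n)} q) *\<^sub>R c n
      = ?v q + indicator {0<..?b} q *\<^sub>R c n + indicator {0<..?a} q *\<^sub>R (- c n)" for q
    by (simp add: scaleR_left_diff_distrib)
  have 2: "?X w + c n *v (W ?b w - W ?a w) = ?X w + c n *v (W ?b w - W 0 w) + (- c n) *v (W ?a w - W 0 w)" for w
    by (simp add: bounded_bilinear.minus_left[OF bounded_bilinear_matrix_vector] matrix_vector_mult_diff_distrib)
  have "elementary (\<lambda>q. ?v q + indicator {0<..?b} q *\<^sub>R c n + indicator {0<..?a} q *\<^sub>R (- c n))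
      (\<lambda>w. ?X w + c n *v (W ?b w - W 0 w) + (- c n) *v (W ?a w - W 0 w))"
    by (intro elementary_step IH ab)
  then show ?case unfolding sum.lessThan_Suc 1 2 .
qed

end

section \<open>Reduction of Wiener integrals to deterministic coefficients\<close>

lemma L2_norm_minus_commute: "L2_norm M (\<lambda>w. X w - Y w) = L2_norm M (\<lambda>w. Y w - X w)"
  unfolding L2_norm_def by (subst norm_minus_commute) (rule refl)

lemma measurable_pair_subalgebra:
  assumes "subalgebra M N" and f: "f \<in> measurable (A \<Otimes>\<^sub>M N) K"
  shows "f \<in> measurable (A \<Otimes>\<^sub>M M) K"
proof -
  have "(\<lambda>x. x) \<in> measurable M N"
    by (rule measurable_from_subalg[OF assms(1) measurable_ident_sets[OF refl]])
  from measurable_compose[OF measurable_snd this]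
  have "(\<lambda>z. (fst z, snd z)) \<in> measurable (A \<Otimes>\<^sub>M M) (A \<Otimes>\<^sub>M N)"
    by (intro measurable_Pair measurable_fst)
  from measurable_compose[OF this f] show ?thesis by simp
qed

lemma measurable_dt_dP:
  "f \<in> measurable (restrict_space borel {0..T} \<Otimes>\<^sub>M M) K \<longleftrightarrow> f \<in> measurable (dt_dP M T) K"
proof -
  have "sets (dt_dP M T) = sets (restrict_space borel {0..T} \<Otimes>\<^sub>M M)"
    unfolding dt_dP_def by (intro sets_pair_measure_cong sets_restrict_space_cong) auto
  from measurable_cong_sets[OF this refl] show ?thesis by blast
qed

context brownian_basis
begin

lemma simple_value_L2:
  assumes S: "simple_integrand M F T n \<tau> \<xi>"
  shows "(\<lambda>(q, w). simple_value n \<tau> \<xi> q w) \<in> L2 (dt_dP M T)"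
    and "simple_value n \<tau> \<xi> q \<in> L2 M"
    and "simple_value n \<tau> (\<lambda>i (_::'w). expectation (\<xi> i)) q w = expectation (simple_value n \<tau> \<xi> q)"
proof -
  interpret PP: pair_sigma_finite "restrict_space lborel {0..T}" M
    by (rule time_pair_sigma_finite[OF prob_space_axioms])
  note L = simple_integrand_L2[OF S]
  have "(\<lambda>z. indicator {\<tau> i<..\<tau> (Suc i)} (fst z) *\<^sub>R \<xi> i (snd z)) \<in> L2 (dt_dP M T)" if i: "i < n" for i
  proof -
    note [measurable] = L2_measurable[OF L[OF i]]
    have [measurable]: "(\<lambda>q. indicator {\<tau> i<..\<tau> (Suc i)} q :: real) \<in> borel_measurable (restrict_space lborel {0..T})"
      by (rule measurable_restrict_space1) simp
    have c: "(\<lambda>z. \<xi> i (snd z)) \<in> L2 (dt_dP M T)"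
      using L2_time_constant[OF prob_space_axioms L[OF i]] by (simp add: case_prod_beta')
    show ?thesis
    proof (rule L2_bound(1)[OF _ c, of _ 1])
      show "(\<lambda>z. indicator {\<tau> i<..\<tau> (Suc i)} (fst z) *\<^sub>R \<xi> i (snd z)) \<in> borel_measurable (dt_dP M T)"
        unfolding dt_dP_def by measurable
    qed (auto simp: indicator_def)
  qed
  then show "(\<lambda>(q, w). simple_value n \<tau> \<xi> q w) \<in> L2 (dt_dP M T)"
    unfolding simple_value_def case_prod_beta' by (intro L2_sum) auto
  show "simple_value n \<tau> \<xi> q \<in> L2 M"
    unfolding simple_value_def[abs_def] using L by (intro L2_sum L2_scaleR) auto
  have "expectation (simple_value n \<tau> \<xi> q) = (\<Sum>i<n. \<integral>w. indicator {\<tau> i<..\<tau> (Suc i)} q *\<^sub>R \<xi> i w \<partial>M)"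
    unfolding simple_value_def[abs_def]
    by (intro Bochner_Integration.integral_sum integrable_scaleR_right L2_imp_integrable[OF finite_measure_axioms] L) simp
  then show "simple_value n \<tau> (\<lambda>i (_::'w). expectation (\<xi> i)) q w = expectation (simple_value n \<tau> \<xi> q)"
    unfolding simple_value_def by simp
qed

lemma simple_integrand_centered:
  assumes S: "simple_integrand M F T n \<tau> \<xi>"
  shows "simple_integrand M F T n \<tau> (\<lambda>i (_::'w). expectation (\<xi> i))"
    and "simple_integrand M F T n \<tau> (\<lambda>i w. \<xi> i w - expectation (\<xi> i))"
proof -
  show "simple_integrand M F T n \<tau> (\<lambda>i (_::'w). expectation (\<xi> i))"
    using S unfolding simple_integrand_def by auto
  have "(\<lambda>w. \<xi> i w - expectation (\<xi> i)) \<in> borel_measurable (F (\<tau> i)) \<and>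
      (\<exists>C. \<forall>w\<in>space M. norm (\<xi> i w - expectation (\<xi> i)) \<le> C)" if i: "i < n" for i
  proof -
    obtain C where m: "\<xi> i \<in> borel_measurable (F (\<tau> i))" and C: "\<And>w. w \<in> space M \<Longrightarrow> norm (\<xi> i w) \<le> C"
      using S i unfolding simple_integrand_def by blast
    have "norm (\<xi> i w - expectation (\<xi> i)) \<le> C + norm (expectation (\<xi> i))" if "w \<in> space M" for w
      using norm_triangle_ineq4[of "\<xi> i w" "expectation (\<xi> i)"] C[OF that] by linarith
    moreover have "(\<lambda>w. \<xi> i w - expectation (\<xi> i)) \<in> borel_measurable (F (\<tau> i))"
      using m by measurable
    ultimately show ?thesis by blast
  qed
  then show "simple_integrand M F T n \<tau> (\<lambda>i w. \<xi> i w - expectation (\<xi> i))"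
    using S unfolding simple_integrand_def by blast
qed

text \<open>As \<sigma> is deterministic, the squared error at each time is the squared error of the
  mean plus the variance of the simple value; neither part exceeds the whole. The sample point
  \<open>undefined\<close> is a dummy, since averaged coefficients do not depend on it.\<close>

lemma simple_value_deterministic_approx:
  fixes \<xi> :: "nat \<Rightarrow> 'w \<Rightarrow> real^'m^'k" and \<sigma> :: "real \<Rightarrow> real^'m^'k"
  assumes S: "simple_integrand M F T n \<tau> \<xi>"
    and \<sigma>: "(\<lambda>(q, w). \<sigma> q) \<in> L2 (dt_dP M T)"
  defines "v \<equiv> (\<lambda>q. simple_value n \<tau> (\<lambda>i (_::'w). expectation (\<xi> i)) q undefined)"
    and "d \<equiv> L2_norm (dt_dP M T) (\<lambda>(q, w). simple_value n \<tau> \<xi> q w - \<sigma> q)"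
  shows "(\<lambda>(q, w). v q - \<sigma> q) \<in> L2 (dt_dP M T)"
    and "L2_norm (dt_dP M T) (\<lambda>(q, w). v q - \<sigma> q) \<le> d"
    and "(LINT q:{0..T}|lborel. \<integral>w. (norm (simple_value n \<tau> \<xi> q w - v q))\<^sup>2 \<partial>M) \<le> d\<^sup>2"
proof -
  note Sc = simple_integrand_centered(1)[OF S]
  have vq: "v q = expectation (simple_value n \<tau> \<xi> q)" for q
    unfolding v_def by (rule simple_value_L2(3)[OF S])
  have V: "(\<lambda>(q, w). simple_value n \<tau> \<xi> q w) \<in> L2 (dt_dP M T)" by (rule simple_value_L2(1)[OF S])
  have v: "(\<lambda>(q, w). v q) \<in> L2 (dt_dP M T)"
    using simple_value_L2(1)[OF Sc] unfolding v_def simple_value_def by (simp add: case_prod_beta')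
  show 1: "(\<lambda>(q, w). v q - \<sigma> q) \<in> L2 (dt_dP M T)"
    using L2_diff[OF v \<sigma>] by (simp add: case_prod_beta')
  have 2: "(\<lambda>(q, w). simple_value n \<tau> \<xi> q w - \<sigma> q) \<in> L2 (dt_dP M T)"
    using L2_diff[OF V \<sigma>] by (simp add: case_prod_beta')
  have 3: "(\<lambda>(q, w). simple_value n \<tau> \<xi> q w - v q) \<in> L2 (dt_dP M T)"
    using L2_diff[OF V v] by (simp add: case_prod_beta')
  have i1: "integrable (dt_dP M T) (\<lambda>(q, w). (norm (v q - \<sigma> q))\<^sup>2)"
    and i2: "integrable (dt_dP M T) (\<lambda>(q, w). (norm (simple_value n \<tau> \<xi> q w - \<sigma> q))\<^sup>2)"
    and i3: "integrable (dt_dP M T) (\<lambda>(q, w). (norm (simple_value n \<tau> \<xi> q w - v q))\<^sup>2)"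
    using L2_integrable[OF 1] L2_integrable[OF 2] L2_integrable[OF 3] by (simp_all add: case_prod_beta')
  have T0: "(0::real) \<le> 0" "T \<le> T" by simp_all
  note Fub = dt_dP_fubini[OF prob_space_axioms _ T0]
  have d2: "d\<^sup>2 = (LINT q:{0..T}|lborel. \<integral>w. (norm (simple_value n \<tau> \<xi> q w - \<sigma> q))\<^sup>2 \<partial>M)"
    unfolding d_def L2_norm_sq Fub(5)[OF i2] by (simp add: case_prod_beta')
  have dec: "(\<integral>w. (norm (simple_value n \<tau> \<xi> q w - \<sigma> q))\<^sup>2 \<partial>M)
      = (\<integral>w. (norm (simple_value n \<tau> \<xi> q w - v q))\<^sup>2 \<partial>M) + (\<integral>w. (norm (v q - \<sigma> q))\<^sup>2 \<partial>M)" for q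
    unfolding vq using variance_decomposition[OF simple_value_L2(2)[OF S], of q "\<sigma> q"] by (simp add: prob_space)
  show "(LINT q:{0..T}|lborel. \<integral>w. (norm (simple_value n \<tau> \<xi> q w - v q))\<^sup>2 \<partial>M) \<le> d\<^sup>2"
    unfolding d2 by (rule set_integral_mono[OF Fub(4)[OF i3] Fub(4)[OF i2]]) (simp add: dec)
  have "(L2_norm (dt_dP M T) (\<lambda>(q, w). v q - \<sigma> q))\<^sup>2 = (LINT q:{0..T}|lborel. \<integral>w. (norm (v q - \<sigma> q))\<^sup>2 \<partial>M)"
    unfolding L2_norm_sq Fub(5)[OF i1] by (simp add: case_prod_beta')
  also have "\<dots> \<le> d\<^sup>2"
    unfolding d2 by (rule set_integral_mono[OF Fub(4)[OF i1] Fub(4)[OF i2]]) (simp add: dec)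
  finally show "L2_norm (dt_dP M T) (\<lambda>(q, w). v q - \<sigma> q) \<le> d"
    by (rule power2_le_imp_le) (simp add: d_def)
qed

lemma simple_integral_centered:
  "simple_integral W n \<tau> (\<lambda>i w. \<xi> i w - c i) t w
    = simple_integral W n \<tau> \<xi> t w - simple_integral W n \<tau> (\<lambda>i _. c i) t w"
  unfolding simple_integral_def sum_subtractf[symmetric]
  by (intro sum.cong refl bounded_bilinear.diff_left[OF bounded_bilinear_matrix_vector])

text \<open>Subtracting the means leaves a simple integral with centred coefficients, whose norm is
  controlled by the variance part of the error. It tends to 0, so the integrals with averaged
  coefficients have the same limit.\<close>

lemma wiener_integral_approx:
  fixes \<sigma> :: "real \<Rightarrow> real^'m^'k"
  assumes I: "ito_integral M F T W (\<lambda>t w. \<sigma> t) S"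
  obtains n \<tau> and c :: "nat \<Rightarrow> nat \<Rightarrow> real^'m^'k" where
    "(\<lambda>(q, w). \<sigma> q) \<in> L2 (dt_dP M T)"
    "\<And>k. simple_integrand M F T (n k) (\<tau> k) (\<lambda>i (_::'w). c k i)"
    "\<And>k. (\<lambda>(q, w). simple_value (n k) (\<tau> k) (\<lambda>i (_::'w). c k i) q undefined - \<sigma> q) \<in> L2 (dt_dP M T)"
    "(\<lambda>k. L2_norm (dt_dP M T) (\<lambda>(q, w). simple_value (n k) (\<tau> k) (\<lambda>i (_::'w). c k i) q undefined - \<sigma> q)) \<longlonglongrightarrow> 0"
    "\<And>t. t \<in> {0..T} \<Longrightarrow>
      (\<lambda>k. L2_norm M (\<lambda>w. S t w - simple_integral W (n k) (\<tau> k) (\<lambda>i (_::'w). c k i) t w)) \<longlonglongrightarrow> 0"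
proof -
  obtain n \<tau> \<xi> where S: "\<And>k. simple_integrand M F T (n k) (\<tau> k) (\<xi> k)"
    and lv: "(\<lambda>k. \<integral>\<^sup>+(t, w). ennreal ((norm (simple_value (n k) (\<tau> k) (\<xi> k) t w - \<sigma> t))\<^sup>2) \<partial>dt_dP M T) \<longlonglongrightarrow> 0"
    and li: "\<And>t. t \<in> {0..T} \<Longrightarrow>
      (\<lambda>k. \<integral>\<^sup>+w. ennreal ((norm (simple_integral W (n k) (\<tau> k) (\<xi> k) t w - S t w))\<^sup>2) \<partial>M) \<longlonglongrightarrow> 0"
    and prog: "progressive F T (\<lambda>t (w::'w). \<sigma> t)"
    and int: "integrable (dt_dP M T) (\<lambda>(t, w). (norm (\<sigma> t))\<^sup>2)"
    using I unfolding ito_integral_def by blast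
  have "(\<lambda>z. \<sigma> (fst z)) \<in> borel_measurable (restrict_space borel {0..T} \<Otimes>\<^sub>M F T)"
    using prog T_pos unfolding progressive_def case_prod_beta' by simp
  from measurable_pair_subalgebra[OF subalgebra_filt[OF order_refl] this]
  have m2: "(\<lambda>z. \<sigma> (fst z)) \<in> borel_measurable (dt_dP M T)"
    unfolding measurable_dt_dP .
  then have \<sigma>: "(\<lambda>(q, w). \<sigma> q) \<in> L2 (dt_dP M T)"
    using int by (simp add: L2_def case_prod_beta')
  define c where "c k i = expectation (\<xi> k i)" for k i
  define d where "d k = L2_norm (dt_dP M T) (\<lambda>(q, w). simple_value (n k) (\<tau> k) (\<xi> k) q w - \<sigma> q)" for k
  note A = simple_value_deterministic_approx[OF S \<sigma>, folded c_def d_def]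
  have "(\<lambda>(q, w). simple_value (n k) (\<tau> k) (\<xi> k) q w - \<sigma> q) \<in> borel_measurable (dt_dP M T)" for k
    using borel_measurable_diff[OF L2_measurable[OF simple_value_L2(1)[OF S, of k]] L2_measurable[OF \<sigma>]]
    by (simp add: case_prod_beta')
  from L2_norm_tendsto_0(1)[OF this] lv have d: "d \<longlonglongrightarrow> 0"
    unfolding d_def by (simp add: case_prod_beta')
  have c1: "(\<lambda>k. L2_norm (dt_dP M T) (\<lambda>(q, w). simple_value (n k) (\<tau> k) (\<lambda>i (_::'w). c k i) q undefined - \<sigma> q)) \<longlonglongrightarrow> 0"
    by (rule tendsto_sandwich[OF _ _ tendsto_const d]) (auto intro!: always_eventually A(2))
  have c2: "(\<lambda>k. L2_norm M (\<lambda>w. S t w - simple_integral W (n k) (\<tau> k) (\<lambda>i (_::'w). c k i) t w)) \<longlonglongrightarrow> 0"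
    if t: "t \<in> {0..T}" for t
  proof -
    define e where "e k = L2_norm M (\<lambda>w. simple_integral W (n k) (\<tau> k) (\<xi> k) t w - S t w)" for k
    have St: "S t \<in> L2 M" by (rule ito_integral_D(2)[OF I t])
    note Jt = simple_integral_L2[OF S t]
    note Ct = simple_integral_L2[OF simple_integrand_centered(1)[OF S] t, folded c_def]
    have e: "e \<longlonglongrightarrow> 0"
      unfolding e_def by (rule L2_norm_tendsto_0(1)[OF L2_measurable[OF L2_diff[OF Jt St]] li[OF t]])
    have bd: "L2_norm M (\<lambda>w. S t w - simple_integral W (n k) (\<tau> k) (\<lambda>i (_::'w). c k i) t w)
        \<le> e k + sqrt (CARD('m)) * d k" for k
    proof -
      have val: "simple_value (n k) (\<tau> k) (\<lambda>i w. \<xi> k i w - c k i) q w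
          = simple_value (n k) (\<tau> k) (\<xi> k) q w - simple_value (n k) (\<tau> k) (\<lambda>i (_::'w). c k i) q undefined" for q w
        unfolding simple_value_def sum_subtractf[symmetric] scaleR_diff_right by (rule refl)
      have "(L2_norm M (\<lambda>w. simple_integral W (n k) (\<tau> k) (\<xi> k) t w - simple_integral W (n k) (\<tau> k) (\<lambda>i (_::'w). c k i) t w))\<^sup>2
          \<le> CARD('m) * (d k)\<^sup>2"
        unfolding L2_norm_sq simple_integral_centered[symmetric]
        by (rule order_trans[OF simple_integral_norm[OF simple_integrand_centered(2)[OF S, folded c_def] t]])
          (unfold val, rule mult_left_mono[OF A(3)], simp)
      also have "\<dots> = (sqrt (CARD('m)) * d k)\<^sup>2" by (simp add: power_mult_distrib)
      finally have "L2_norm M (\<lambda>w. simple_integral W (n k) (\<tau> k) (\<xi> k) t w - simple_integral W (n k) (\<tau> k) (\<lambda>i (_::'w). c k i) t w)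
          \<le> sqrt (CARD('m)) * d k"
        by (rule power2_le_imp_le) (simp add: d_def)
      moreover have "L2_norm M (\<lambda>w. S t w - simple_integral W (n k) (\<tau> k) (\<xi> k) t w) = e k"
        unfolding e_def by (rule L2_norm_minus_commute)
      ultimately show ?thesis
        using L2_norm_triangle3[OF St Jt[of k] Ct[of k]] by linarith
    qed
    have "(\<lambda>k. e k + sqrt (CARD('m)) * d k) \<longlonglongrightarrow> 0 + sqrt (CARD('m)) * 0"
      by (intro tendsto_intros e d)
    then have "(\<lambda>k. e k + sqrt (CARD('m)) * d k) \<longlonglongrightarrow> 0" by simp
    then show ?thesis
      by (rule tendsto_sandwich[OF _ _ tendsto_const, rotated 2]) (auto intro!: always_eventually bd)
  qed
  show thesis
    by (rule that[OF \<sigma> simple_integrand_centered(1)[OF S, folded c_def] A(1) c1 c2])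
qed

text \<open>The two versions may arise from unrelated sequences. With deterministic coefficients the
  difference of two simple integrals is again \<open>elementary\<close>, so the isometry bounds its
  norm by the distance of the integrands, both of which tend to \<sigma>.\<close>

lemma wiener_integral_unique:
  fixes \<sigma> :: "real \<Rightarrow> real^'m^'k"
  assumes I: "ito_integral M F T W (\<lambda>t w. \<sigma> t) S" and I': "ito_integral M F T W (\<lambda>t w. \<sigma> t) S'"
    and t: "t \<in> {0..T}"
  shows "AE w in M. S t w = S' t w"
proof -
  obtain n \<tau> and c :: "nat \<Rightarrow> nat \<Rightarrow> real^'m^'k" where \<sigma>: "(\<lambda>(q, w::'w). \<sigma> q) \<in> L2 (dt_dP M T)"
    and P: "\<And>k. simple_integrand M F T (n k) (\<tau> k) (\<lambda>i (_::'w). c k i)"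
    and v: "\<And>k. (\<lambda>(q, w). simple_value (n k) (\<tau> k) (\<lambda>i (_::'w). c k i) q undefined - \<sigma> q) \<in> L2 (dt_dP M T)"
    and vl: "(\<lambda>k. L2_norm (dt_dP M T) (\<lambda>(q, w). simple_value (n k) (\<tau> k) (\<lambda>i (_::'w). c k i) q undefined - \<sigma> q)) \<longlonglongrightarrow> 0"
    and Sl: "\<And>t. t \<in> {0..T} \<Longrightarrow>
      (\<lambda>k. L2_norm M (\<lambda>w. S t w - simple_integral W (n k) (\<tau> k) (\<lambda>i (_::'w). c k i) t w)) \<longlonglongrightarrow> 0"
    by (rule wiener_integral_approx[OF I]) (rule that)
  obtain n' \<tau>' and c' :: "nat \<Rightarrow> nat \<Rightarrow> real^'m^'k" where P': "\<And>k. simple_integrand M F T (n' k) (\<tau>' k) (\<lambda>i _. c' k i)"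
    and v': "\<And>k. (\<lambda>(q, w). simple_value (n' k) (\<tau>' k) (\<lambda>i (_::'w). c' k i) q undefined - \<sigma> q) \<in> L2 (dt_dP M T)"
    and vl': "(\<lambda>k. L2_norm (dt_dP M T) (\<lambda>(q, w). simple_value (n' k) (\<tau>' k) (\<lambda>i (_::'w). c' k i) q undefined - \<sigma> q)) \<longlonglongrightarrow> 0"
    and Sl': "\<And>t. t \<in> {0..T} \<Longrightarrow>
      (\<lambda>k. L2_norm M (\<lambda>w. S' t w - simple_integral W (n' k) (\<tau>' k) (\<lambda>i _. c' k i) t w)) \<longlonglongrightarrow> 0"
    by (rule wiener_integral_approx[OF I']) (rule that)
  define J where "J k = simple_integral W (n k) (\<tau> k) (\<lambda>i (_::'w). c k i) t" for k
  define J' where "J' k = simple_integral W (n' k) (\<tau>' k) (\<lambda>i _. c' k i) t" for k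
  define vs where "vs k q = simple_value (n k) (\<tau> k) (\<lambda>i (_::'w). c k i) q undefined" for k q
  define vs' where "vs' k q = simple_value (n' k) (\<tau>' k) (\<lambda>i (_::'w). c' k i) q undefined" for k q
  have J: "J k \<in> L2 M" "J' k \<in> L2 M" for k
    unfolding J_def J'_def by (rule simple_integral_L2[OF _ t], rule P P')+
  have St: "S t \<in> L2 M" "S' t \<in> L2 M" by (rule ito_integral_D(2)[OF I t], rule ito_integral_D(2)[OF I' t])
  define d where "d k = L2_norm (dt_dP M T) (\<lambda>z. vs k (fst z) - \<sigma> (fst z))
      + L2_norm (dt_dP M T) (\<lambda>z. vs' k (fst z) - \<sigma> (fst z))" for k
  have d: "d \<longlonglongrightarrow> 0"
    unfolding d_def vs_def vs'_def using tendsto_add[OF vl vl'] by (simp add: case_prod_beta')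
  have JJ: "L2_norm M (\<lambda>w. J k w - J' k w) \<le> d k" for k
  proof -
    define y where "y q = (\<Sum>i<n k. (indicator {0<..t} q * indicator {\<tau> k i<..\<tau> k (Suc i)} q) *\<^sub>R c k i)" for q
    \<comment> \<open>The sign is put into the coefficients because \<open>elementary\<close> is
      closed under sums.\<close>
    define y' where "y' q = (\<Sum>i<n' k. (indicator {0<..t} q * indicator {\<tau>' k i<..\<tau>' k (Suc i)} q) *\<^sub>R (- c' k i))" for q
    have "elementary y (J k)"
      unfolding y_def[abs_def] J_def simple_integral_def[abs_def]
      using P[of k] by (intro elementary_simple t) (auto simp: simple_integrand_def)
    moreover have "elementary y' (\<lambda>w. - J' k w)"
    proof -
      have "(\<lambda>w. - J' k w) = (\<lambda>w. \<Sum>i<n' k. (- c' k i) *v (W (min t (\<tau>' k (Suc i))) w - W (min t (\<tau>' k i)) w))"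
        by (simp add: J'_def simple_integral_def sum_negf[symmetric]
            bounded_bilinear.minus_left[OF bounded_bilinear_matrix_vector])
      then show ?thesis
        unfolding y'_def[abs_def]
        using P'[of k] by (simp only:) (intro elementary_simple t, auto simp: simple_integrand_def)
    qed
    ultimately have "elementary (\<lambda>q. y q + y' q) (\<lambda>w. J k w + - J' k w)" by (rule elementary_add)
    then have E: "elementary (\<lambda>q. y q + y' q) (\<lambda>w. J k w - J' k w)" by simp
    have yw: "y q + y' q = indicator {0<..t} q *\<^sub>R (vs k q - vs' k q)" for q
      by (simp only: y_def y'_def vs_def vs'_def simple_value_def scaleR_diff_right scaleR_sum_right
          scaleR_scaleR scaleR_minus_right sum_negf add_uminus_conv_diff)
    have L: "(\<lambda>z. vs k (fst z) - vs' k (fst z)) \<in> L2 (dt_dP M T)"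
      using L2_diff[OF v[of k] v'[of k]] by (simp add: vs_def vs'_def case_prod_beta')
    have i: "integrable (dt_dP M T) (\<lambda>(q, w). (norm (vs k q - vs' k q))\<^sup>2)"
      using L2_integrable[OF L] by (simp add: case_prod_beta')
    have T0: "(0::real) \<le> 0" "T \<le> T" by simp_all
    note Fub = dt_dP_fubini[OF prob_space_axioms i T0]
    have "(L2_norm M (\<lambda>w. J k w - J' k w))\<^sup>2 = (LINT q:{0..T}|lborel. (y q + y' q) \<bullet> (y q + y' q))"
      using elementary_inner[OF E E] by (simp add: L2_norm_sq power2_norm_eq_inner)
    also have "\<dots> \<le> (LINT q:{0..T}|lborel. \<integral>w. (norm (vs k q - vs' k q))\<^sup>2 \<partial>M)"
    proof (rule set_integral_mono[OF _ Fub(4)])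
      show "set_integrable lborel {0..T} (\<lambda>q. (y q + y' q) \<bullet> (y q + y' q))"
        using elementary_inner[OF E E] by simp
      show "(y q + y' q) \<bullet> (y q + y' q) \<le> (\<integral>w. (norm (vs k q - vs' k q))\<^sup>2 \<partial>M)" for q
        unfolding yw by (simp add: prob_space power2_norm_eq_inner indicator_def)
    qed
    also have "\<dots> = (L2_norm (dt_dP M T) (\<lambda>z. vs k (fst z) - vs' k (fst z)))\<^sup>2"
      unfolding Fub(5) L2_norm_sq by (simp add: case_prod_beta')
    finally have "L2_norm M (\<lambda>w. J k w - J' k w) \<le> L2_norm (dt_dP M T) (\<lambda>z. vs k (fst z) - vs' k (fst z))"
      by (rule power2_le_imp_le) simp
    also have "\<dots> \<le> d k"
    proof -
      have wL: "(\<lambda>z. vs k (fst z) - \<sigma> (fst z)) \<in> L2 (dt_dP M T)" "(\<lambda>z. vs' k (fst z) - \<sigma> (fst z)) \<in> L2 (dt_dP M T)"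
        using v[of k] v'[of k] by (simp_all add: vs_def vs'_def case_prod_beta')
      have "L2_norm (dt_dP M T) (\<lambda>z. (vs k (fst z) - \<sigma> (fst z)) + (\<sigma> (fst z) - vs' k (fst z)))
          \<le> L2_norm (dt_dP M T) (\<lambda>z. vs k (fst z) - \<sigma> (fst z)) + L2_norm (dt_dP M T) (\<lambda>z. \<sigma> (fst z) - vs' k (fst z))"
        using L2_add(2)[OF wL(1) L2_scaleR[OF wL(2), of "-1"]] by simp
      also have "L2_norm (dt_dP M T) (\<lambda>z. \<sigma> (fst z) - vs' k (fst z)) = L2_norm (dt_dP M T) (\<lambda>z. vs' k (fst z) - \<sigma> (fst z))"
        by (rule L2_norm_minus_commute)
      finally show ?thesis by (simp add: d_def)
    qed
    finally show ?thesis .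
  qed
  have "\<bar>L2_norm M (\<lambda>w. S t w - S' t w)\<bar>
      \<le> L2_norm M (\<lambda>w. S t w - J k w) + (d k + L2_norm M (\<lambda>w. S' t w - J' k w))" for k
  proof -
    have "L2_norm M (\<lambda>w. J' k w - S' t w) = L2_norm M (\<lambda>w. S' t w - J' k w)"
      by (rule L2_norm_minus_commute)
    then show ?thesis
      using L2_norm_triangle3[OF St(1) J(1)[of k] St(2)] L2_norm_triangle3[OF J(1)[of k] J(2)[of k] St(2)] JJ[of k]
        L2_norm_nonneg[of M "\<lambda>w. S t w - S' t w"] by linarith
  qed
  moreover have "(\<lambda>k. L2_norm M (\<lambda>w. S t w - J k w) + (d k + L2_norm M (\<lambda>w. S' t w - J' k w))) \<longlonglongrightarrow> 0"
    using tendsto_add[OF Sl[OF t] tendsto_add[OF d Sl'[OF t]]] by (simp add: J_def J'_def)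
  ultimately have "L2_norm M (\<lambda>w. S t w - S' t w) = 0" by (rule tendsto_0_norm_bound)
  from L2_norm_eq_0[OF L2_diff[OF St] this] show ?thesis by simp
qed

lemma increments_measurable_clamp:
  assumes tr: "0 \<le> t" "t \<le> r" "r \<le> T" and \<tau>: "0 \<le> \<tau>"
  shows "(\<lambda>w. W (min r \<tau>) w - W (min t \<tau>) w) \<in> borel_measurable (increments {t<..T} t)"
proof (cases "min r \<tau> \<le> t")
  case True
  then have "min r \<tau> = min t \<tau>" using tr by auto
  then show ?thesis by simp
next
  case False
  then have "min t \<tau> = t" "min r \<tau> \<in> {t<..T}" using tr by auto
  then show ?thesis using measurable_increments[of "min r \<tau>" "{t<..T}" t] by simp
qed

text \<open>With constant coefficients, the simple integral from \<open>t\<close> to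
  \<open>r\<close> is a linear combination of increments of \<open>W\<close> after \<open>t\<close>;
  random coefficients would bring in the past of \<open>W\<close>.\<close>

lemma wiener_increment_approx:
  fixes \<sigma> :: "real \<Rightarrow> real^'m^'k"
  assumes I: "ito_integral M F T W (\<lambda>t w. \<sigma> t) S"
    and tr: "0 \<le> t" "t \<le> r" "r \<le> T" and \<epsilon>: "0 < \<epsilon>"
  shows "\<exists>\<eta>. \<eta> \<in> L2 M \<and> \<eta> \<in> borel_measurable (increments {t<..T} t) \<and>
    L2_norm M (\<lambda>w. (S r w - S t w) - \<eta> w) \<le> \<epsilon>"
proof -
  have t: "t \<in> {0..T}" "r \<in> {0..T}" using tr by auto
  obtain n \<tau> and c :: "nat \<Rightarrow> nat \<Rightarrow> real^'m^'k" where P: "\<And>k. simple_integrand M F T (n k) (\<tau> k) (\<lambda>i (_::'w). c k i)"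
    and Sl: "\<And>t. t \<in> {0..T} \<Longrightarrow>
      (\<lambda>k. L2_norm M (\<lambda>w. S t w - simple_integral W (n k) (\<tau> k) (\<lambda>i (_::'w). c k i) t w)) \<longlonglongrightarrow> 0"
    by (rule wiener_integral_approx[OF I]) (rule that)
  define J where "J k = simple_integral W (n k) (\<tau> k) (\<lambda>i (_::'w). c k i)" for k
  have "(\<lambda>k. L2_norm M (\<lambda>w. S r w - J k r w) + L2_norm M (\<lambda>w. S t w - J k t w)) \<longlonglongrightarrow> 0"
    using tendsto_add[OF Sl[OF t(2)] Sl[OF t(1)]] by (simp add: J_def)
  from order_tendstoD(2)[OF this \<epsilon>] obtain k
    where k: "L2_norm M (\<lambda>w. S r w - J k r w) + L2_norm M (\<lambda>w. S t w - J k t w) < \<epsilon>"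
    by (auto simp: eventually_sequentially)
  have J: "J k r \<in> L2 M" "J k t \<in> L2 M" unfolding J_def by (rule simple_integral_L2[OF P] t)+
  have S: "S r \<in> L2 M" "S t \<in> L2 M" by (rule ito_integral_D(2)[OF I] t)+
  let ?N = "increments {t<..T} t"
  have ac1: "(p - q) - (p' - q') = (p - p') - (q - q')" for p q p' q' :: "real^'m"
    by simp
  have ac2: "(p - q) - (p' - q') = (p - p') + (q' - q)" for p q p' q' :: "real^'k"
    by simp
  have "(\<lambda>w. J k r w - J k t w) = (\<lambda>w. \<Sum>i<n k. c k i *v
      ((W (min r (\<tau> k (Suc i))) w - W (min t (\<tau> k (Suc i))) w) - (W (min r (\<tau> k i)) w - W (min t (\<tau> k i)) w)))"
    unfolding J_def simple_integral_def sum_subtractf[symmetric] matrix_vector_mult_diff_distrib[symmetric]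
    by (intro ext sum.cong refl arg_cong[where f="(*v) _"] ac1)
  also have "\<dots> \<in> borel_measurable ?N"
    using simple_integrand_points(1)[OF P[of k]]
    by (intro borel_measurable_sum borel_measurable_matrix_vector borel_measurable_const
        borel_measurable_diff[OF increments_measurable_clamp increments_measurable_clamp] tr) auto
  finally have m: "(\<lambda>w. J k r w - J k t w) \<in> borel_measurable ?N" .
  have "L2_norm M (\<lambda>w. (S r w - S t w) - (J k r w - J k t w))
      = L2_norm M (\<lambda>w. (S r w - J k r w) + (J k t w - S t w))"
    unfolding ac2 by (rule refl)
  also have "\<dots> \<le> L2_norm M (\<lambda>w. S r w - J k r w) + L2_norm M (\<lambda>w. J k t w - S t w)"
    by (intro L2_add(2) L2_diff S J)
  also have "L2_norm M (\<lambda>w. J k t w - S t w) = L2_norm M (\<lambda>w. S t w - J k t w)"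
    by (rule L2_norm_minus_commute)
  finally show ?thesis
    using k m L2_diff[OF J] by (intro exI[of _ "\<lambda>w. J k r w - J k t w"]) auto
qed

end

section \<open>Laws of square-integrable variables\<close>

lemma law_in_P2:
  assumes M: "prob_space M" and X: "X \<in> L2 M"
  shows "distr M borel X \<in> P2"
proof -
  note [measurable] = L2_measurable[OF X]
  have "integrable (distr M borel X) (\<lambda>x. (norm x)\<^sup>2)"
    using L2_integrable[OF X] by (subst integrable_distr_eq) auto
  moreover have "prob_space (distr M borel X)"
    by (rule prob_space.prob_space_distr[OF M]) measurable
  ultimately show ?thesis by (simp add: P2_def)
qed

lemma moment2_law: "X \<in> borel_measurable M \<Longrightarrow> sqrt (moment2 (distr M borel X)) = L2_norm M X"
  unfolding moment2_def L2_norm_def by (subst integral_distr) auto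

text \<open>The joint law of the two variables is one particular coupling. It also shows that the
  infimum is taken over a nonempty set, which gives the nonnegativity.\<close>

lemma W2_law_le:
  assumes X: "X \<in> L2 M" and Y: "Y \<in> L2 M"
  shows "0 \<le> W2 (distr M borel X) (distr M borel Y)"
    and "W2 (distr M borel X) (distr M borel Y) \<le> L2_norm M (\<lambda>w. X w - Y w)"
proof -
  note [measurable] = L2_measurable[OF X] L2_measurable[OF Y]
  define p where "p = distr M borel (\<lambda>w. (X w, Y w))"
  have pm: "(\<lambda>w. (X w, Y w)) \<in> measurable M borel" by measurable
  have fs: "fst \<in> measurable borel (borel :: 'b measure)" "snd \<in> measurable borel (borel :: 'b measure)"
    by (intro borel_measurable_continuous_onI continuous_intros)+
  have "distr p borel fst = distr M borel X" "distr p borel snd = distr M borel Y"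
    unfolding p_def by (simp_all add: distr_distr[OF fs(1) pm] distr_distr[OF fs(2) pm] o_def)
  then have p: "p \<in> couplings (distr M borel X) (distr M borel Y)"
    by (simp add: couplings_def p_def)
  let ?c = "\<lambda>q. \<integral>z. (dist (fst z) (snd z :: 'b))\<^sup>2 \<partial>q"
  have val: "?c p = (L2_norm M (\<lambda>w. X w - Y w))\<^sup>2"
    unfolding p_def L2_norm_sq
    by (subst integral_distr[OF pm]) (auto simp: dist_norm intro!: borel_measurable_continuous_onI continuous_intros)
  have "0 \<le> (INF q\<in>couplings (distr M borel X) (distr M borel Y). ?c q)"
    using p by (intro cINF_greatest) auto
  then show "0 \<le> W2 (distr M borel X) (distr M borel Y)"
    by (simp add: W2_def)
  have "(INF q\<in>couplings (distr M borel X) (distr M borel Y). ?c q) \<le> ?c p"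
    using p by (intro cINF_lower bdd_belowI2[where m=0]) auto
  then have "W2 (distr M borel X) (distr M borel Y) \<le> sqrt (?c p)"
    unfolding W2_def by (rule real_sqrt_le_mono)
  then show "W2 (distr M borel X) (distr M borel Y) \<le> L2_norm M (\<lambda>w. X w - Y w)"
    unfolding val by simp
qed

text \<open>A Frechet differentiable lift is continuous: allow the remainder the ratio 1 and add the
  bound for the linear part.\<close>

lemma has_lions_derivative_continuous:
  assumes h: "has_lions_derivative M h D (distr M borel X)" and X: "X \<in> L2 M" and Xn: "\<And>n::nat. Xn n \<in> L2 M"
    and lim: "(\<lambda>n. L2_norm M (\<lambda>w. Xn n w - X w)) \<longlonglongrightarrow> 0"
  shows "(\<lambda>n. h (distr M borel (Xn n))) \<longlonglongrightarrow> h (distr M borel X)"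
proof -
  note H = h[unfolded has_lions_derivative_def]
  have "\<exists>C\<ge>0. \<forall>Y\<in>L2 M. norm (\<integral>w. D (X w) (Y w) \<partial>M) \<le> C * L2_norm M Y"
    using H by (intro lions_linear_part(2)[of D M X] L2_measurable[OF X]) auto
  then obtain C where C: "C \<ge> 0" "\<And>Y. Y \<in> L2 M \<Longrightarrow> norm (\<integral>w. D (X w) (Y w) \<partial>M) \<le> C * L2_norm M Y"
    by blast
  obtain \<delta> where \<delta>: "\<delta> > 0" "\<And>Y. Y \<in> L2 M \<Longrightarrow> L2_norm M Y < \<delta> \<Longrightarrow>
      norm (h (distr M borel (\<lambda>w. X w + Y w)) - h (distr M borel X) - (\<integral>w. D (X w) (Y w) \<partial>M))
        \<le> 1 * L2_norm M Y"
    using H X zero_less_one by blast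
  have Y: "(\<lambda>w. Xn n w - X w) \<in> L2 M" for n by (rule L2_diff[OF Xn X])
  have "eventually (\<lambda>n. norm (h (distr M borel (Xn n)) - h (distr M borel X))
      \<le> (C + 1) * L2_norm M (\<lambda>w. Xn n w - X w)) sequentially"
    using order_tendstoD(2)[OF lim \<delta>(1)]
  proof eventually_elim
    case (elim n)
    let ?e = "\<integral>w. D (X w) (Xn n w - X w) \<partial>M"
    have "norm (h (distr M borel (Xn n)) - h (distr M borel X) - ?e) \<le> 1 * L2_norm M (\<lambda>w. Xn n w - X w)"
      using \<delta>(2)[OF Y elim] by simp
    moreover have "norm ?e \<le> C * L2_norm M (\<lambda>w. Xn n w - X w)" by (rule C(2)[OF Y])
    ultimately show ?case
      using norm_triangle_sub[of "h (distr M borel (Xn n)) - h (distr M borel X)" ?e]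
      by (simp add: distrib_right)
  qed
  moreover have "(\<lambda>n. (C + 1) * L2_norm M (\<lambda>w. Xn n w - X w)) \<longlonglongrightarrow> 0"
    by (rule tendsto_mult_right_zero[OF lim])
  ultimately have "(\<lambda>n. h (distr M borel (Xn n)) - h (distr M borel X)) \<longlonglongrightarrow> 0"
    by (rule Lim_null_comparison)
  then show ?thesis by (rule LIM_zero_cancel)
qed

text \<open>What is determined is the pairing with square-integrable directions. Along the
  directions \<open>c *\<^sub>R Y\<close> a gap \<open>d\<close> between the two pairings grows like
  \<open>c\<close>, while both remainders are smaller by an arbitrary factor.\<close>

lemma has_lions_derivative_unique:
  fixes D E :: "'a::euclidean_space \<Rightarrow> 'a \<Rightarrow> 'b::euclidean_space"
  assumes D: "has_lions_derivative M h D (distr M borel X)" and E: "has_lions_derivative M h E (distr M borel X)"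
    and X: "X \<in> L2 M" and Y: "Y \<in> L2 M"
  shows "(\<integral>w. D (X w) (Y w) \<partial>M) = (\<integral>w. E (X w) (Y w) \<partial>M)"
proof (rule ccontr)
  assume ne: "(\<integral>w. D (X w) (Y w) \<partial>M) \<noteq> (\<integral>w. E (X w) (Y w) \<partial>M)"
  note H = D[unfolded has_lions_derivative_def] and K = E[unfolded has_lions_derivative_def]
  define d where "d = (\<integral>w. D (X w) (Y w) \<partial>M) - (\<integral>w. E (X w) (Y w) \<partial>M)"
  \<comment> \<open>The 1 avoids division by 0. With \<open>4 * N\<close> in the denominator of
    \<open>\<epsilon>\<close> the two remainders together reach at most half of
    \<open>norm d\<close>.\<close>
  define N where "N = L2_norm M Y + 1"
  have N: "N > 0" "L2_norm M Y < N" using L2_norm_nonneg[of M Y] unfolding N_def by linarith+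
  define \<epsilon> where "\<epsilon> = norm d / (4 * N)"
  have \<epsilon>: "\<epsilon> > 0" using ne N by (simp add: \<epsilon>_def d_def)
  have Dl: "linear (D x)" "linear (E x)" for x using H K by blast+
  obtain \<delta>1 where 1: "\<delta>1 > 0" "\<And>Y. Y \<in> L2 M \<Longrightarrow> L2_norm M Y < \<delta>1 \<Longrightarrow>
      norm (h (distr M borel (\<lambda>w. X w + Y w)) - h (distr M borel X) - (\<integral>w. D (X w) (Y w) \<partial>M)) \<le> \<epsilon> * L2_norm M Y"
    using H X \<epsilon> by blast
  obtain \<delta>2 where 2: "\<delta>2 > 0" "\<And>Y. Y \<in> L2 M \<Longrightarrow> L2_norm M Y < \<delta>2 \<Longrightarrow>
      norm (h (distr M borel (\<lambda>w. X w + Y w)) - h (distr M borel X) - (\<integral>w. E (X w) (Y w) \<partial>M)) \<le> \<epsilon> * L2_norm M Y"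
    using K X \<epsilon> by blast
  define c where "c = min \<delta>1 \<delta>2 / N"
  have c: "c > 0" "c * N \<le> \<delta>1" "c * N \<le> \<delta>2" using 1 2 N by (auto simp: c_def)
  have cY: "(\<lambda>w. c *\<^sub>R Y w) \<in> L2 M" by (rule L2_scaleR[OF Y])
  have n: "L2_norm M (\<lambda>w. c *\<^sub>R Y w) = c * L2_norm M Y"
    using c by (simp add: L2_norm_def power_mult_distrib real_sqrt_mult)
  have "c * L2_norm M Y < c * N" using N c by simp
  then have small: "L2_norm M (\<lambda>w. c *\<^sub>R Y w) < \<delta>1" "L2_norm M (\<lambda>w. c *\<^sub>R Y w) < \<delta>2"
    using c n by linarith+
  define k where "k = h (distr M borel (\<lambda>w. X w + c *\<^sub>R Y w)) - h (distr M borel X)"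
  have A: "norm (k - c *\<^sub>R (\<integral>w. D (X w) (Y w) \<partial>M)) \<le> \<epsilon> * (c * L2_norm M Y)"
    using 1(2)[OF cY small(1)] by (simp add: n k_def linear_scale[OF Dl(1)])
  have B: "norm (k - c *\<^sub>R (\<integral>w. E (X w) (Y w) \<partial>M)) \<le> \<epsilon> * (c * L2_norm M Y)"
    using 2(2)[OF cY small(2)] by (simp add: n k_def linear_scale[OF Dl(2)])
  have "c * norm d = norm (c *\<^sub>R d)" using c by simp
  also have "c *\<^sub>R d = (k - c *\<^sub>R (\<integral>w. E (X w) (Y w) \<partial>M)) - (k - c *\<^sub>R (\<integral>w. D (X w) (Y w) \<partial>M))"
    by (simp add: d_def scaleR_diff_right)
  also have "norm \<dots> \<le> \<epsilon> * (c * L2_norm M Y) + \<epsilon> * (c * L2_norm M Y)"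
    by (rule order_trans[OF norm_triangle_ineq4 add_mono[OF B A]])
  also have "\<dots> = c * (2 * \<epsilon> * L2_norm M Y)" by simp
  finally have "norm d \<le> 2 * \<epsilon> * L2_norm M Y" using c by simp
  also have "\<dots> \<le> 2 * \<epsilon> * N" using N \<epsilon> by (intro mult_left_mono) auto
  also have "\<dots> = norm d / 2" using N by (simp add: \<epsilon>_def)
  finally show False using ne by (simp add: d_def)
qed

section \<open>Joint measurability in time and space\<close>

lemma continuous_measurable_time:
  fixes h :: "real \<times> 'c::euclidean_space \<Rightarrow> 'b::euclidean_space"
  assumes "continuous_on ({0..T} \<times> UNIV) h"
  shows "h \<in> borel_measurable (restrict_space borel {0..T} \<Otimes>\<^sub>M borel)"
proof -
  have "(\<lambda>z. (fst z, snd z)) \<in> measurable (restrict_space borel {0..T} \<Otimes>\<^sub>M borel) (borel \<Otimes>\<^sub>M (borel :: 'c measure))"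
    by (intro measurable_Pair measurable_snd measurable_compose[OF measurable_fst] measurable_restrict_space1
        measurable_ident_sets refl)
  then have "(\<lambda>z. z) \<in> measurable (restrict_space borel {0..T} \<Otimes>\<^sub>M borel) (borel :: (real \<times> 'c) measure)"
    unfolding borel_prod by simp
  then have "(\<lambda>z. z) \<in> measurable (restrict_space borel {0..T} \<Otimes>\<^sub>M borel) (restrict_space borel ({0..T} \<times> (UNIV :: 'c set)))"
    by (rule measurable_restrict_space2[rotated]) (auto simp: space_pair_measure space_restrict_space)
  from measurable_compose[OF this borel_measurable_continuous_on_restrict[OF assms]] show ?thesis .
qed

text \<open>The space variable is approximated by simple functions, which take finitely many values,
  so that measurability in time at fixed points suffices; continuity in space gives the
  limit.\<close>

lemma caratheodory_measurable:
  fixes h :: "'t \<Rightarrow> 'c::euclidean_space \<Rightarrow> 'b::euclidean_space"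
  assumes m: "\<And>x. (\<lambda>t. h t x) \<in> borel_measurable N" and c: "\<And>t. t \<in> space N \<Longrightarrow> continuous_on UNIV (h t)"
  shows "(\<lambda>(t, x). h t x) \<in> borel_measurable (N \<Otimes>\<^sub>M borel)"
proof -
  have "(\<lambda>x::'c. x) \<in> borel_measurable borel" by simp
  from borel_measurable_implies_sequence_metric[OF this, of 0]
  obtain s where s: "\<And>i. simple_function borel (s i)" "\<And>x::'c. (\<lambda>i. s i x) \<longlonglongrightarrow> x"
    by (auto simp: space_borel)
  show ?thesis
  proof (rule borel_measurable_LIMSEQ_metric)
    fix i
    have fin: "finite (range (s i))" using simple_functionD(1)[OF s(1)[of i]] by (simp add: space_borel)
    have si: "(\<lambda>z. s i (snd z)) \<in> measurable (N \<Otimes>\<^sub>M borel) (count_space (range (s i)))"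
      by (rule measurable_compose[OF measurable_snd])
        (use measurable_simple_function[OF s(1)] s(1)[of i] fin in
          \<open>auto simp: measurable_count_space_eq2 simple_function_def space_borel\<close>)
    have "(\<lambda>z. h (fst z) (s i (snd z))) \<in> borel_measurable (N \<Otimes>\<^sub>M borel)"
      by (rule measurable_compose_countable'[where f="\<lambda>y z. h (fst z) y", OF _ si])
        (auto intro: measurable_compose[OF measurable_fst m] countable_finite fin)
    then show "(\<lambda>(t, x). h t (s i x)) \<in> borel_measurable (N \<Otimes>\<^sub>M borel)"
      by (simp add: case_prod_beta')
  next
    fix z assume "z \<in> space (N \<Otimes>\<^sub>M (borel :: 'c measure))"
    then have "isCont (h (fst z)) (snd z)"
      using c by (auto simp: space_pair_measure continuous_on_eq_continuous_at)
    from isCont_tendsto_compose[OF this s(2)]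
    show "(\<lambda>i. case z of (t, x) \<Rightarrow> h t (s i x)) \<longlonglongrightarrow> (case z of (t, x) \<Rightarrow> h t x)"
      by (simp add: case_prod_beta')
  qed
qed

section \<open>Regular processes\<close>

text \<open>The common ground of state, control, residual and both adjoints. It contains no
  adaptedness, so that the pathwise adjoint \<open>a\<close> qualifies.\<close>

definition regular_process :: "'w measure \<Rightarrow> real \<Rightarrow> (real \<Rightarrow> 'w \<Rightarrow> 'a::euclidean_space) \<Rightarrow> bool" where
  "regular_process M T X \<longleftrightarrow>
    (\<lambda>(t, w). X t w) \<in> borel_measurable (dt_dP M T) \<and> continuous_paths M T X \<and> S2_bounded M T X"

lemma AE_dt_dP_const:
  assumes M: "prob_space M" and ae: "AE w in M. Q w"
  shows "AE z in dt_dP M T. Q (snd z)"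
proof -
  interpret P: pair_sigma_finite "restrict_space lborel {0..T}" M
    by (rule time_pair_sigma_finite[OF M])
  obtain N where N: "{w \<in> space M. \<not> Q w} \<subseteq> N" "N \<in> null_sets M"
    using ae by (auto elim: AE_E simp: null_sets_def)
  have "space (restrict_space lborel {0..T}) \<times> N \<in> null_sets (dt_dP M T)"
  proof -
    have A: "space (restrict_space lborel {0..T}) \<in> sets (restrict_space lborel {0..T})" by (rule sets.top)
    have N': "N \<in> sets M" "emeasure M N = 0" using N(2) by auto
    show ?thesis
      unfolding dt_dP_def
    proof (rule null_setsI)
      show "emeasure (restrict_space lborel {0..T} \<Otimes>\<^sub>M M) (space (restrict_space lborel {0..T}) \<times> N) = 0"
        unfolding P.M2.emeasure_pair_measure_Times[OF A N'(1)] N'(2) by (rule mult_zero_right)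
    qed (rule pair_measureI[OF A N'(1)])
  qed
  then show ?thesis
    by (rule AE_I') (use N(1) in \<open>auto simp: dt_dP_def space_pair_measure\<close>)
qed

context prob_space
begin

text \<open>Dominated convergence along sequences of times.\<close>

lemma expectation_continuous:
  fixes G :: "real \<Rightarrow> 'a \<Rightarrow> 'b::euclidean_space"
  assumes m: "\<And>t. t \<in> {0..T} \<Longrightarrow> G t \<in> borel_measurable M"
    and c: "AE w in M. continuous_on {0..T} (\<lambda>t. G t w)"
    and \<zeta>: "integrable M \<zeta>" and b: "AE w in M. \<forall>t\<in>{0..T}. norm (G t w) \<le> \<zeta> w"
  shows "continuous_on {0..T} (\<lambda>t. expectation (G t))"
  unfolding continuous_on_sequentially
proof (intro allI ballI impI)
  fix s and t assume t: "t \<in> {0..T}" and s: "(\<forall>n. s n \<in> {0..T}) \<and> s \<longlonglongrightarrow> t"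
  have "(\<lambda>n. expectation (G (s n))) \<longlonglongrightarrow> expectation (G t)"
  proof (rule integral_dominated_convergence)
    show "AE w in M. (\<lambda>n. G (s n) w) \<longlonglongrightarrow> G t w"
      using c by eventually_elim (use t s in \<open>auto simp: continuous_on_sequentially o_def\<close>)
    show "AE w in M. norm (G (s n) w) \<le> \<zeta> w" for n
      using b s by auto
  qed (use m t s \<zeta> in auto)
  then show "((\<lambda>t. expectation (G t)) \<circ> s) \<longlonglongrightarrow> expectation (G t)" by (simp add: o_def)
qed

context
  fixes X :: "real \<Rightarrow> 'a \<Rightarrow> 'b::euclidean_space" and T
  assumes X: "regular_process M T X"
begin

lemma regular_process_bound:
  obtains \<zeta> where "integrable M \<zeta>" "AE w in M. \<forall>t\<in>{0..T}. (norm (X t w))\<^sup>2 \<le> \<zeta> w"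
    "(\<lambda>w. sqrt \<bar>\<zeta> w\<bar>) \<in> L2 M" "AE w in M. \<forall>t\<in>{0..T}. norm (X t w) \<le> sqrt \<bar>\<zeta> w\<bar>"
proof -
  obtain \<zeta> where \<zeta>: "integrable M \<zeta>" "AE w in M. \<forall>t\<in>{0..T}. (norm (X t w))\<^sup>2 \<le> \<zeta> w"
    using X by (auto simp: regular_process_def S2_bounded_def)
  have "(\<lambda>w. sqrt \<bar>\<zeta> w\<bar>) \<in> L2 M"
    using \<zeta>(1) by (auto simp: L2_def)
  moreover have "AE w in M. \<forall>t\<in>{0..T}. norm (X t w) \<le> sqrt \<bar>\<zeta> w\<bar>"
    using \<zeta>(2) by eventually_elim (auto intro!: real_le_rsqrt elim!: ballE order_trans)
  ultimately show ?thesis using \<zeta> that by blast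
qed

lemma regular_process_measurable: "t \<in> {0..T} \<Longrightarrow> X t \<in> borel_measurable M"
  using X by (intro dt_dP_section[of X M T]) (auto simp: regular_process_def)

lemma regular_process_L2: "t \<in> {0..T} \<Longrightarrow> X t \<in> L2 M"
proof -
  assume t: "t \<in> {0..T}"
  obtain \<zeta> where \<zeta>: "(\<lambda>w. sqrt \<bar>\<zeta> w\<bar>) \<in> L2 M" "AE w in M. \<forall>t\<in>{0..T}. norm (X t w) \<le> sqrt \<bar>\<zeta> w\<bar>"
    by (rule regular_process_bound)
  show "X t \<in> L2 M"
    by (rule L2_bound(1)[OF regular_process_measurable[OF t] \<zeta>(1), of 1])
      (use \<zeta>(2) t in \<open>auto elim!: eventually_mono\<close>)
qed

lemma regular_process_L2_time: "(\<lambda>(t, w). X t w) \<in> L2 (dt_dP M T)"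
proof -
  obtain \<zeta> where \<zeta>: "(\<lambda>w. sqrt \<bar>\<zeta> w\<bar>) \<in> L2 M" "AE w in M. \<forall>t\<in>{0..T}. norm (X t w) \<le> sqrt \<bar>\<zeta> w\<bar>"
    by (rule regular_process_bound)
  show ?thesis
  proof (rule L2_bound(1)[OF _ L2_time_constant[OF prob_space_axioms \<zeta>(1)], where c=1])
    show "AE z in dt_dP M T. norm (case z of (t, w) \<Rightarrow> X t w) \<le> 1 * norm (case z of (t, w) \<Rightarrow> sqrt \<bar>\<zeta> w\<bar>)"
      using AE_dt_dP_const[OF prob_space_axioms \<zeta>(2)] AE_space
      by eventually_elim (auto simp: dt_dP_def space_pair_measure space_restrict_space)
  qed (use X in \<open>auto simp: regular_process_def\<close>)
qed

lemma regular_process_norm_bound: "\<exists>K\<ge>0. \<forall>t\<in>{0..T}. L2_norm M (X t) \<le> K"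
proof -
  obtain \<zeta> where \<zeta>: "(\<lambda>w. sqrt \<bar>\<zeta> w\<bar>) \<in> L2 M" "AE w in M. \<forall>t\<in>{0..T}. norm (X t w) \<le> sqrt \<bar>\<zeta> w\<bar>"
    by (rule regular_process_bound)
  have "L2_norm M (X t) \<le> 1 * L2_norm M (\<lambda>w. sqrt \<bar>\<zeta> w\<bar>)" if t: "t \<in> {0..T}" for t
    by (rule L2_bound(2)[OF regular_process_measurable[OF t] \<zeta>(1)])
      (use \<zeta>(2) t in \<open>auto elim!: eventually_mono\<close>)
  then show ?thesis by (intro exI[of _ "L2_norm M (\<lambda>w. sqrt \<bar>\<zeta> w\<bar>)"]) auto
qed

lemma regular_process_L2_continuous:
  assumes t: "t \<in> {0..T}" and s: "\<And>n. s n \<in> {0..T}" "s \<longlonglongrightarrow> t"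
  shows "(\<lambda>n. L2_norm M (\<lambda>w. X (s n) w - X t w)) \<longlonglongrightarrow> 0"
proof -
  obtain \<zeta> where \<zeta>: "integrable M \<zeta>" "AE w in M. \<forall>t\<in>{0..T}. (norm (X t w))\<^sup>2 \<le> \<zeta> w"
    by (rule regular_process_bound)
  note m = regular_process_measurable
  have c: "AE w in M. continuous_on {0..T} (\<lambda>t. X t w)"
    using X by (simp add: regular_process_def continuous_paths_def)
  have "continuous_on {0..T} (\<lambda>r. expectation (\<lambda>w. (norm (X r w - X t w))\<^sup>2))"
  proof (rule expectation_continuous)
    show "(\<lambda>w. (norm (X r w - X t w))\<^sup>2) \<in> borel_measurable M" if "r \<in> {0..T}" for r
      using m[OF that] m[OF t] by measurable
    show "AE w in M. continuous_on {0..T} (\<lambda>r. (norm (X r w - X t w))\<^sup>2)"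
      using c by eventually_elim (intro continuous_intros)
    \<comment> \<open>The squared difference is at most twice the sum of two squares, each of which
      is at most \<open>\<zeta>\<close>.\<close>
    show "integrable M (\<lambda>w. 4 * \<zeta> w)" using \<zeta>(1) by simp
    show "AE w in M. \<forall>r\<in>{0..T}. norm ((norm (X r w - X t w))\<^sup>2) \<le> 4 * \<zeta> w"
      using \<zeta>(2)
    proof eventually_elim
      case (elim w)
      note b = elim
      show ?case
      proof
      fix r assume r: "r \<in> {0..T}"
      have "(norm (X r w - X t w))\<^sup>2 \<le> (norm (X r w) + norm (X t w))\<^sup>2"
        by (intro power_mono norm_triangle_ineq4) simp
      also have "\<dots> \<le> 2 * (norm (X r w))\<^sup>2 + 2 * (norm (X t w))\<^sup>2"
        using sum_squares_bound[of "norm (X r w)" "norm (X t w)"] by (simp add: power2_sum)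
      also have "\<dots> \<le> 4 * \<zeta> w" using bspec[OF b r] bspec[OF b t] by linarith
      finally show "norm ((norm (X r w - X t w))\<^sup>2) \<le> 4 * \<zeta> w" by simp
      qed
    qed
  qed
  then have "(\<lambda>n. expectation (\<lambda>w. (norm (X (s n) w - X t w))\<^sup>2)) \<longlonglongrightarrow> expectation (\<lambda>w. (norm (X t w - X t w))\<^sup>2)"
    by (rule continuous_on_tendsto_compose[OF _ s(2) t]) (intro always_eventually allI s(1))
  then have "(\<lambda>n. sqrt (expectation (\<lambda>w. (norm (X (s n) w - X t w))\<^sup>2))) \<longlonglongrightarrow> sqrt 0"
    by (intro tendsto_real_sqrt) simp
  then show ?thesis by (simp add: L2_norm_def)
qed

lemma regular_process_law: "t \<in> {0..T} \<Longrightarrow> law M X t \<in> P2"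
  unfolding law_def by (rule law_in_P2[OF prob_space_axioms regular_process_L2])

lemma regular_process_law_continuous:
  assumes t: "t \<in> {0..T}" and s: "\<And>n. s n \<in> {0..T}" "s \<longlonglongrightarrow> t"
  shows "(\<lambda>n. W2 (law M X (s n)) (law M X t)) \<longlonglongrightarrow> 0"
  unfolding law_def
  using W2_law_le[OF regular_process_L2[OF s(1)] regular_process_L2[OF t]]
  by (intro tendsto_sandwich[OF _ _ tendsto_const regular_process_L2_continuous[OF t s]] always_eventually) auto

text \<open>Composition with the \<open>W2\<close>-continuous curve of laws of \<open>X\<close>. It
  removes the measure argument and leaves a function that is continuous in the usual topological
  sense.\<close>

lemma continuous_P2_along:
  fixes h :: "real \<Rightarrow> 'c::euclidean_space \<Rightarrow> 'b measure \<Rightarrow> 'd::euclidean_space"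
  assumes h: "continuous_P2 T h"
  shows "continuous_on ({0..T} \<times> UNIV) (\<lambda>(t, x). h t x (law M X t))"
  unfolding continuous_on_sequentially
proof (intro allI ballI impI)
  fix z :: "nat \<Rightarrow> real \<times> 'c" and p :: "real \<times> 'c"
  assume p: "p \<in> {0..T} \<times> UNIV" and z: "(\<forall>n. z n \<in> {0..T} \<times> UNIV) \<and> z \<longlonglongrightarrow> p"
  have t: "fst p \<in> {0..T}" "\<And>n. fst (z n) \<in> {0..T}" using p z by (auto simp: mem_Times_iff)
  have l: "(\<lambda>n. fst (z n)) \<longlonglongrightarrow> fst p" "(\<lambda>n. snd (z n)) \<longlonglongrightarrow> snd p"
    using z by (auto intro: tendsto_fst tendsto_snd)
  have "(\<lambda>n. h (fst (z n)) (snd (z n)) (law M X (fst (z n)))) \<longlonglongrightarrow> h (fst p) (snd p) (law M X (fst p))"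
    using h t l regular_process_law[OF t(1)] regular_process_law[OF t(2)]
      regular_process_law_continuous[OF t(1) t(2) l(1)]
    unfolding continuous_P2_def by simp
  then show "((\<lambda>(t, x). h t x (law M X t)) \<circ> z) \<longlonglongrightarrow> (\<lambda>(t, x). h t x (law M X t)) p"
    by (simp add: o_def case_prod_beta')
qed

lemma lions_measurable_along:
  fixes h :: "real \<Rightarrow> 'b \<Rightarrow> 'b measure \<Rightarrow> 'c::euclidean_space"
  assumes m: "\<And>x \<mu>. \<mu> \<in> P2 \<Longrightarrow> (\<lambda>t. h t x \<mu>) \<in> borel_measurable (restrict_space borel {0..T})"
    and c: "\<And>t \<mu>. t \<in> {0..T} \<Longrightarrow> \<mu> \<in> P2 \<Longrightarrow> continuous_on UNIV (\<lambda>x. h t x \<mu>)"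
    and l: "\<And>t x \<mu>. t \<in> {0..T} \<Longrightarrow> \<mu> \<in> P2 \<Longrightarrow> \<exists>D. has_lions_derivative M (\<lambda>\<nu>. h t x \<nu>) D \<mu>"
    and T: "0 \<le> T"
  shows "(\<lambda>(t, x). h t x (law M X t)) \<in> borel_measurable (restrict_space borel {0..T} \<Otimes>\<^sub>M borel)"
proof (rule borel_measurable_LIMSEQ_metric)
  \<comment> \<open>Dyadic points clamped to \<open>{0..T}\<close>; below, \<open>k n t\<close> is
    the index of the grid point at or just before \<open>t\<close>.\<close>
  define \<theta> where "\<theta> n i = max 0 (min T (of_int i / (2 ^ n)))" for n :: nat and i :: int
  have \<theta>: "\<theta> n i \<in> {0..T}" for n i using T by (auto simp: \<theta>_def)
  define k where "k n t = \<lfloor>t * 2 ^ n\<rfloor>" for n :: nat and t :: real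
  have km: "(\<lambda>z. k n (fst z)) \<in> measurable (restrict_space borel {0..T} \<Otimes>\<^sub>M (borel :: 'b measure)) (count_space UNIV)" for n
    unfolding k_def by (rule measurable_compose[OF measurable_fst], rule measurable_restrict_space1) measurable
  show "(\<lambda>(t, x). h t x (law M X (\<theta> n (k n t)))) \<in> borel_measurable (restrict_space borel {0..T} \<Otimes>\<^sub>M borel)" for n
  proof -
    have "(\<lambda>(t, x). h t x (law M X (\<theta> n i))) \<in> borel_measurable (restrict_space borel {0..T} \<Otimes>\<^sub>M borel)" for i
      using regular_process_law[OF \<theta>] m c
      by (intro caratheodory_measurable) (auto simp: space_restrict_space)
    then have "(\<lambda>z. (\<lambda>(t, x). h t x (law M X (\<theta> n (k n (fst z))))) z) \<in> borel_measurable (restrict_space borel {0..T} \<Otimes>\<^sub>M borel)"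
      by (rule measurable_compose_countable'[OF _ km]) auto
    then show ?thesis by (simp add: case_prod_beta')
  qed
  fix z assume "z \<in> space (restrict_space borel {0..T} \<Otimes>\<^sub>M (borel :: 'b measure))"
  then have t: "fst z \<in> {0..T}" by (auto simp: space_pair_measure space_restrict_space)
  have "(\<lambda>n. \<theta> n (k n (fst z))) \<longlonglongrightarrow> fst z"
  proof (rule tendsto_sandwich)
    show "(\<lambda>n. fst z - (1/2) ^ n) \<longlonglongrightarrow> fst z"
      using tendsto_diff[OF tendsto_const[of "fst z"] LIMSEQ_power_zero[of "1/2 :: real"]] by simp
    show "(\<lambda>n. fst z) \<longlonglongrightarrow> fst z" by simp
    have b: "fst z - (1/2) ^ n \<le> of_int (k n (fst z)) / 2 ^ n \<and> of_int (k n (fst z)) / 2 ^ n \<le> fst z" for n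
    proof -
      have "fst z * 2 ^ n - 1 \<le> of_int (k n (fst z))" "of_int (k n (fst z)) \<le> fst z * 2 ^ n"
        unfolding k_def by linarith+
      then have "(fst z * 2 ^ n - 1) / 2 ^ n \<le> of_int (k n (fst z)) / 2 ^ n"
        "of_int (k n (fst z)) / 2 ^ n \<le> (fst z * 2 ^ n) / 2 ^ n"
        by (intro divide_right_mono; simp)+
      then show ?thesis by (simp add: diff_divide_distrib power_one_over)
    qed
    show "\<forall>\<^sub>F n in sequentially. fst z - (1/2) ^ n \<le> \<theta> n (k n (fst z))"
    proof (intro always_eventually allI)
      fix n
      have "(0::real) \<le> (1/2) ^ n" by simp
      then show "fst z - (1/2) ^ n \<le> \<theta> n (k n (fst z))"
        using b[of n] t unfolding \<theta>_def atLeastAtMost_iff by linarith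
    qed
    show "\<forall>\<^sub>F n in sequentially. \<theta> n (k n (fst z)) \<le> fst z"
    proof (intro always_eventually allI)
      fix n
      show "\<theta> n (k n (fst z)) \<le> fst z"
        using b[of n] t unfolding \<theta>_def atLeastAtMost_iff by linarith
    qed
  qed
  from regular_process_L2_continuous[OF t \<theta> this]
  have lim: "(\<lambda>n. L2_norm M (\<lambda>w. X (\<theta> n (k n (fst z))) w - X (fst z) w)) \<longlonglongrightarrow> 0" .
  obtain D where "has_lions_derivative M (\<lambda>\<nu>. h (fst z) (snd z) \<nu>) D (law M X (fst z))"
    using l[OF t regular_process_law[OF t]] by blast
  from has_lions_derivative_continuous[OF this[unfolded law_def] regular_process_L2[OF t] regular_process_L2[OF \<theta>] lim]
  show "(\<lambda>n. case z of (t, x) \<Rightarrow> h t x (law M X (\<theta> n (k n t)))) \<longlonglongrightarrow> (case z of (t, x) \<Rightarrow> h t x (law M X t))"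
    by (simp add: case_prod_beta' law_def)
qed

end

end

text \<open>A non-integrable \<open>f\<close> has integral 0 by convention, and the right-hand side
  is nonnegative because \<open>g\<close> dominates a norm.\<close>

lemma norm_integral_le:
  fixes f :: "'x \<Rightarrow> 'b::euclidean_space"
  assumes g: "integrable M g" and le: "\<And>x. norm (f x) \<le> g x"
  shows "norm (\<integral>x. f x \<partial>M) \<le> (\<integral>x. g x \<partial>M)"
proof (cases "integrable M f")
  case True
  show ?thesis
    by (rule order_trans[OF integral_norm_bound integral_mono[OF integrable_norm[OF True] g le]])
next
  case False
  have "0 \<le> g x" for x using le[of x] norm_ge_zero order_trans by blast
  then show ?thesis by (simp add: not_integrable_integral_eq[OF False])
qed

section \<open>Adjoint drivers along a flow of laws\<close>

lemma measurable_fst_dt_dP: "fst \<in> measurable (dt_dP M T) (restrict_space borel {0..T})"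
  using measurable_fst[of "restrict_space borel {0..T}" M] unfolding measurable_dt_dP .

lemma measurable_along:
  fixes h :: "real \<Rightarrow> 'c::euclidean_space \<Rightarrow> 'b::euclidean_space"
  assumes h: "(\<lambda>(t, x). h t x) \<in> borel_measurable (restrict_space borel {0..T} \<Otimes>\<^sub>M borel)"
    and t: "\<theta> \<in> measurable N (restrict_space borel {0..T})" and x: "\<xi> \<in> borel_measurable N"
  shows "(\<lambda>z. h (\<theta> z) (\<xi> z)) \<in> borel_measurable N"
  using measurable_compose[OF measurable_Pair[OF t x] h] by simp

lemma measurable_along_fixed:
  fixes h :: "real \<Rightarrow> 'c::euclidean_space \<Rightarrow> 'b::euclidean_space"
  assumes h: "(\<lambda>(t, x). h t x) \<in> borel_measurable (restrict_space borel {0..T} \<Otimes>\<^sub>M borel)"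
    and t: "t \<in> {0..T}"
  shows "h t \<in> borel_measurable borel"
  using measurable_compose[OF measurable_Pair1'[of t "restrict_space borel {0..T}"] h] t
  by (simp add: space_restrict_space)

lemma (in prob_space) mean_field_measurable:
  fixes H :: "real \<Rightarrow> 'c::euclidean_space \<Rightarrow> 'a \<Rightarrow> 'b::euclidean_space"
  assumes "(\<lambda>(z, w). H (fst z) (snd z) w) \<in> borel_measurable ((restrict_space borel {0..T} \<Otimes>\<^sub>M borel) \<Otimes>\<^sub>M M)"
  shows "(\<lambda>(t, x). \<integral>w. H t x w \<partial>M) \<in> borel_measurable (restrict_space borel {0..T} \<Otimes>\<^sub>M borel)"
  using borel_measurable_lebesgue_integral[OF assms] by (simp add: case_prod_beta')

text \<open>The part of the driver that involves the independent copy. Once the copy is averaged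
  out, it is a deterministic function of time and of the current state \<open>x\<close>.\<close>

definition mean_field ::
  "'w measure \<Rightarrow> (real \<Rightarrow> real^'d \<Rightarrow> (real^'d) measure \<Rightarrow> real^'d \<Rightarrow> real^'d^'d)
    \<Rightarrow> (real \<Rightarrow> real^'d \<Rightarrow> (real^'d) measure \<Rightarrow> real^'d \<Rightarrow> real^'d)
    \<Rightarrow> (real \<Rightarrow> 'w \<Rightarrow> real^'d) \<Rightarrow> (real \<Rightarrow> 'w \<Rightarrow> real^'d) \<Rightarrow> real \<Rightarrow> real^'d \<Rightarrow> real^'d" where
  "mean_field M B D X p t x =
    (\<integral>w'. transpose (B t (X t w') (law M X t) x) *v p t w' \<partial>M) + (\<integral>w'. D t (X t w') (law M X t) x \<partial>M)"

lemma adjoint_driver_mean_field: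
  "adjoint_driver M A B C D X p t w =
    transpose (A t (X t w) (law M X t)) *v p t w + C t (X t w) (law M X t) + mean_field M B D X p t (X t w)"
  by (simp add: adjoint_driver_def mean_field_def add.assoc)

text \<open>Conditions on the derivatives along the flow of laws of \<open>X\<close>, shared by the open-loop and the
  closed-loop coefficients.\<close>

definition driver_conditions ::
  "'w measure \<Rightarrow> real \<Rightarrow> (real \<Rightarrow> 'w \<Rightarrow> real^'d) \<Rightarrow> real
    \<Rightarrow> (real \<Rightarrow> real^'d \<Rightarrow> (real^'d) measure \<Rightarrow> real^'d^'d)
    \<Rightarrow> (real \<Rightarrow> real^'d \<Rightarrow> (real^'d) measure \<Rightarrow> real^'d \<Rightarrow> real^'d^'d)
    \<Rightarrow> (real \<Rightarrow> real^'d \<Rightarrow> (real^'d) measure \<Rightarrow> real^'d)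
    \<Rightarrow> (real \<Rightarrow> real^'d \<Rightarrow> (real^'d) measure \<Rightarrow> real^'d \<Rightarrow> real^'d) \<Rightarrow> bool" where
  "driver_conditions M T X K A B C D \<longleftrightarrow>
    0 \<le> K \<and>
    continuous_on ({0..T} \<times> UNIV) (\<lambda>(t, x). A t x (law M X t)) \<and>
    continuous_on ({0..T} \<times> UNIV) (\<lambda>(t, z). B t (fst z) (law M X t) (snd z)) \<and>
    continuous_on ({0..T} \<times> UNIV) (\<lambda>(t, x). C t x (law M X t)) \<and>
    continuous_on ({0..T} \<times> UNIV) (\<lambda>(t, z). D t (fst z) (law M X t) (snd z)) \<and>
    (\<forall>t\<in>{0..T}. \<forall>x y. norm (A t x (law M X t)) \<le> K \<and> norm (B t x (law M X t) y) \<le> K \<and>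
       norm (C t x (law M X t)) \<le> K * (1 + norm x) \<and> norm (D t x (law M X t) y) \<le> K * (1 + norm x + norm y))"

context prob_space
begin

context
  fixes X p :: "real \<Rightarrow> 'a \<Rightarrow> real^'d" and T K :: real
    and A :: "real \<Rightarrow> real^'d \<Rightarrow> (real^'d) measure \<Rightarrow> real^'d^'d"
    and B :: "real \<Rightarrow> real^'d \<Rightarrow> (real^'d) measure \<Rightarrow> real^'d \<Rightarrow> real^'d^'d"
    and C :: "real \<Rightarrow> real^'d \<Rightarrow> (real^'d) measure \<Rightarrow> real^'d"
    and D :: "real \<Rightarrow> real^'d \<Rightarrow> (real^'d) measure \<Rightarrow> real^'d \<Rightarrow> real^'d"
  assumes X: "regular_process M T X" and p: "regular_process M T p"
    and cond: "driver_conditions M T X K A B C D"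
begin

lemma driver_measurable:
  shows driver_A_measurable: "(\<lambda>(t, x). A t x (law M X t)) \<in> borel_measurable (restrict_space borel {0..T} \<Otimes>\<^sub>M borel)"
    and driver_B_measurable: "(\<lambda>(t, z). B t (fst z) (law M X t) (snd z)) \<in> borel_measurable (restrict_space borel {0..T} \<Otimes>\<^sub>M borel)"
    and driver_C_measurable: "(\<lambda>(t, x). C t x (law M X t)) \<in> borel_measurable (restrict_space borel {0..T} \<Otimes>\<^sub>M borel)"
    and driver_D_measurable: "(\<lambda>(t, z). D t (fst z) (law M X t) (snd z)) \<in> borel_measurable (restrict_space borel {0..T} \<Otimes>\<^sub>M borel)"
  using cond unfolding driver_conditions_def by (auto intro: continuous_measurable_time)

lemma mean_field_term_measurable:
  "(\<lambda>(t, x). mean_field M B D X p t x) \<in> borel_measurable (restrict_space borel {0..T} \<Otimes>\<^sub>M borel)"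
proof -
  let ?N = "(restrict_space borel {0..T} \<Otimes>\<^sub>M (borel :: (real^'d) measure)) \<Otimes>\<^sub>M M"
  have tm: "(\<lambda>z. fst (fst z)) \<in> measurable ?N (restrict_space borel {0..T})" by measurable
  have tw: "(\<lambda>z. (fst (fst z), snd z)) \<in> measurable ?N (dt_dP M T)"
  proof -
    have "(\<lambda>z. (fst (fst z), snd z)) \<in> measurable ?N (restrict_space borel {0..T} \<Otimes>\<^sub>M M)" by measurable
    moreover have "sets (dt_dP M T) = sets (restrict_space borel {0..T} \<Otimes>\<^sub>M M)"
      unfolding dt_dP_def by (intro sets_pair_measure_cong sets_restrict_space_cong) auto
    ultimately show ?thesis using measurable_cong_sets[OF refl] by blast
  qed
  have Xm: "(\<lambda>z. X (fst (fst z)) (snd z)) \<in> borel_measurable ?N"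
    using measurable_compose[OF tw, of "\<lambda>(t, w). X t w"] X by (simp add: regular_process_def)
  have pm [measurable]: "(\<lambda>z. p (fst (fst z)) (snd z)) \<in> borel_measurable ?N"
    using measurable_compose[OF tw, of "\<lambda>(t, w). p t w"] p by (simp add: regular_process_def)
  have xm: "(\<lambda>z. (X (fst (fst z)) (snd z), snd (fst z))) \<in> borel_measurable ?N"
    using Xm by measurable
  have [measurable]: "(\<lambda>z. B (fst (fst z)) (X (fst (fst z)) (snd z)) (law M X (fst (fst z))) (snd (fst z))) \<in> borel_measurable ?N"
    using measurable_along[OF driver_B_measurable tm xm] by simp
  have Dm: "(\<lambda>z. D (fst (fst z)) (X (fst (fst z)) (snd z)) (law M X (fst (fst z))) (snd (fst z))) \<in> borel_measurable ?N"
    using measurable_along[OF driver_D_measurable tm xm] by simp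
  have "(\<lambda>z. transpose (B (fst (fst z)) (X (fst (fst z)) (snd z)) (law M X (fst (fst z))) (snd (fst z))) *v p (fst (fst z)) (snd z))
      \<in> borel_measurable ?N" by measurable
  then have 1: "(\<lambda>(t, x). \<integral>w'. transpose (B t (X t w') (law M X t) x) *v p t w' \<partial>M)
      \<in> borel_measurable (restrict_space borel {0..T} \<Otimes>\<^sub>M borel)"
    by (intro mean_field_measurable) (simp add: case_prod_beta')
  have 2: "(\<lambda>(t, x). \<integral>w'. D t (X t w') (law M X t) x \<partial>M) \<in> borel_measurable (restrict_space borel {0..T} \<Otimes>\<^sub>M borel)"
    using Dm by (intro mean_field_measurable) (simp add: case_prod_beta')
  show ?thesis
    using borel_measurable_add[OF 1 2] unfolding mean_field_def by (simp add: case_prod_beta')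
qed

text \<open>\<open>B\<close> is bounded and \<open>D\<close> grows linearly, so both averages are
  controlled by first moments, and these are bounded by the \<open>L2\<close> norms uniformly in
  time.\<close>

lemma mean_field_bound:
  "\<exists>c\<ge>0. \<forall>t\<in>{0..T}. \<forall>x. norm (mean_field M B D X p t x) \<le> c * (1 + norm x)"
proof -
  obtain KX where KX: "KX \<ge> 0" "\<And>t. t \<in> {0..T} \<Longrightarrow> L2_norm M (X t) \<le> KX"
    using regular_process_norm_bound[OF X] by blast
  obtain Kp where Kp: "Kp \<ge> 0" "\<And>t. t \<in> {0..T} \<Longrightarrow> L2_norm M (p t) \<le> Kp"
    using regular_process_norm_bound[OF p] by blast
  have K: "0 \<le> K" using cond by (simp add: driver_conditions_def)
  have E1: "expectation (\<lambda>w. norm (Y w)) \<le> L2_norm M Y" if Y: "Y \<in> L2 M" for Y :: "'a \<Rightarrow> real^'d"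
  proof -
    have n: "(\<lambda>w. norm (Y w)) \<in> L2 M" using Y by (auto simp: L2_def)
    have "expectation (\<lambda>w. norm (Y w)) \<le> L2_norm M (\<lambda>w. norm (Y w)) * L2_norm M (\<lambda>_. 1 :: real)"
      using L2_inner(3)[OF n L2_const[OF finite_measure_axioms, of "1::real"]] by simp
    then show ?thesis by (simp add: L2_norm_def prob_space)
  qed
  have bd: "norm (mean_field M B D X p t x) \<le> (K * Kp + K * (1 + KX)) * (1 + norm x)" if t: "t \<in> {0..T}" for t x
  proof -
    note Xt = regular_process_L2[OF X t] and pt = regular_process_L2[OF p t]
    have iX: "integrable M (\<lambda>w. norm (X t w))" and ip: "integrable M (\<lambda>w. norm (p t w))"
      using L2_imp_integrable[OF finite_measure_axioms Xt] L2_imp_integrable[OF finite_measure_axioms pt] by auto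
    have B: "norm (transpose (B t (X t w) (law M X t) x) *v p t w) \<le> K * norm (p t w)" for w
      using cond t by (intro order_trans[OF norm_matrix_vector_le] mult_right_mono)
        (auto simp: norm_transpose driver_conditions_def)
    have "norm (\<integral>w'. transpose (B t (X t w') (law M X t) x) *v p t w' \<partial>M) \<le> K * Kp"
    proof -
      have "norm (\<integral>w'. transpose (B t (X t w') (law M X t) x) *v p t w' \<partial>M) \<le> (\<integral>w'. K * norm (p t w') \<partial>M)"
        using ip B by (intro norm_integral_le) auto
      also have "\<dots> \<le> K * Kp" using E1[OF pt] Kp(2)[OF t] K by (simp add: mult_left_mono)
      finally show ?thesis .
    qed
    moreover have "norm (\<integral>w'. D t (X t w') (law M X t) x \<partial>M) \<le> K * (1 + KX + norm x)"
    proof -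
      have "norm (\<integral>w'. D t (X t w') (law M X t) x \<partial>M) \<le> (\<integral>w'. K * (1 + norm (X t w') + norm x) \<partial>M)"
        using iX cond t by (intro norm_integral_le) (auto simp: driver_conditions_def)
      also have "\<dots> = K * (1 + expectation (\<lambda>w. norm (X t w)) + norm x)"
        using iX by (simp add: prob_space)
      also have "\<dots> \<le> K * (1 + KX + norm x)" using E1[OF Xt] KX(2)[OF t] K by (intro mult_left_mono) auto
      finally show ?thesis .
    qed
    ultimately have "norm (mean_field M B D X p t x) \<le> K * Kp + K * (1 + KX + norm x)"
      unfolding mean_field_def using norm_triangle_ineq by (rule order_trans[rotated, OF add_mono])
    also have "\<dots> \<le> (K * Kp + K * (1 + KX)) * (1 + norm x)"
      using K KX Kp mult_nonneg_nonneg[OF K Kp(1)] mult_nonneg_nonneg[OF K KX(1)]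
      by (simp add: algebra_simps)
    finally show ?thesis .
  qed
  show ?thesis
    using K KX Kp bd by (intro exI[of _ "K * Kp + K * (1 + KX)"]) auto
qed

text \<open>The driver grows at most linearly in the state and in \<open>p\<close>, so it inherits
  square integrability from both.\<close>

lemma adjoint_driver_regular:
  shows "(\<lambda>(t, w). adjoint_driver M A B C D X p t w) \<in> L2 (dt_dP M T)"
    and "t \<in> {0..T} \<Longrightarrow> adjoint_driver M A B C D X p t \<in> L2 M"
proof -
  obtain c where c: "c \<ge> 0" "\<And>t x. t \<in> {0..T} \<Longrightarrow> norm (mean_field M B D X p t x) \<le> c * (1 + norm x)"
    using mean_field_bound by blast
  have K: "0 \<le> K" using cond by (simp add: driver_conditions_def)
  define d where "d = K + c"
  have d: "0 \<le> d" using K c by (simp add: d_def)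
  have bd: "norm (adjoint_driver M A B C D X p t w) \<le> d * norm (1 + norm (X t w) + norm (p t w))" if t: "t \<in> {0..T}" for t w
  proof -
    have "norm (transpose (A t (X t w) (law M X t)) *v p t w) \<le> K * norm (p t w)"
      using cond t by (intro order_trans[OF norm_matrix_vector_le] mult_right_mono)
        (auto simp: norm_transpose driver_conditions_def)
    moreover have "norm (C t (X t w) (law M X t)) \<le> K * (1 + norm (X t w))"
      using cond t by (simp add: driver_conditions_def)
    ultimately have "norm (adjoint_driver M A B C D X p t w)
        \<le> K * norm (p t w) + K * (1 + norm (X t w)) + c * (1 + norm (X t w))"
      unfolding adjoint_driver_mean_field using c(2)[OF t, of "X t w"]
      by (intro norm_triangle_le add_mono) auto
    also have "\<dots> \<le> d * (1 + norm (X t w) + norm (p t w))"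
      using mult_nonneg_nonneg[OF c(1) norm_ge_zero[of "p t w"]] by (simp add: d_def algebra_simps)
    finally show ?thesis using d by (simp add: abs_of_nonneg)
  qed
  have Xm: "(\<lambda>(t, w). X t w) \<in> borel_measurable (dt_dP M T)"
    and pm: "(\<lambda>(t, w). p t w) \<in> borel_measurable (dt_dP M T)"
    using X p by (auto simp: regular_process_def)
  have m: "(\<lambda>(t, w). adjoint_driver M A B C D X p t w) \<in> borel_measurable (dt_dP M T)"
  proof -
    note along = measurable_along[OF _ measurable_fst_dt_dP Xm[unfolded case_prod_beta']]
    have [measurable]: "(\<lambda>z. A (fst z) (X (fst z) (snd z)) (law M X (fst z))) \<in> borel_measurable (dt_dP M T)"
      by (rule along[OF driver_A_measurable])
    have [measurable]: "(\<lambda>z. C (fst z) (X (fst z) (snd z)) (law M X (fst z))) \<in> borel_measurable (dt_dP M T)"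
      by (rule along[OF driver_C_measurable])
    have [measurable]: "(\<lambda>z. mean_field M B D X p (fst z) (X (fst z) (snd z))) \<in> borel_measurable (dt_dP M T)"
      by (rule along[OF mean_field_term_measurable])
    have [measurable]: "(\<lambda>z. p (fst z) (snd z)) \<in> borel_measurable (dt_dP M T)"
      using pm by (simp add: case_prod_beta')
    show ?thesis unfolding adjoint_driver_mean_field case_prod_beta' by measurable
  qed
  have one: "(\<lambda>z. 1 :: real) \<in> L2 (dt_dP M T)"
    using L2_time_constant[OF prob_space_axioms L2_const[OF finite_measure_axioms, of "1::real"], of T]
    by (simp add: case_prod_beta')
  have nX: "(\<lambda>z. norm (X (fst z) (snd z))) \<in> L2 (dt_dP M T)"
    using regular_process_L2_time[OF X] by (auto simp: L2_def case_prod_beta')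
  have np: "(\<lambda>z. norm (p (fst z) (snd z))) \<in> L2 (dt_dP M T)"
    using regular_process_L2_time[OF p] by (auto simp: L2_def case_prod_beta')
  have G: "(\<lambda>z. 1 + norm (X (fst z) (snd z)) + norm (p (fst z) (snd z))) \<in> L2 (dt_dP M T)"
    by (rule L2_add(1)[OF L2_add(1)[OF one nX] np])
  show "(\<lambda>(t, w). adjoint_driver M A B C D X p t w) \<in> L2 (dt_dP M T)"
  proof (rule L2_bound(1)[OF m G d])
    show "AE z in dt_dP M T. norm (case z of (t, w) \<Rightarrow> adjoint_driver M A B C D X p t w)
        \<le> d * norm (1 + norm (X (fst z) (snd z)) + norm (p (fst z) (snd z)))"
      using AE_space by eventually_elim (use bd in \<open>auto simp: dt_dP_def space_pair_measure space_restrict_space\<close>)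
  qed
  show "adjoint_driver M A B C D X p t \<in> L2 M" if t: "t \<in> {0..T}"
  proof (rule L2_bound(1)[OF dt_dP_section[OF m t] _ d])
    have "(\<lambda>w. norm (X t w)) \<in> L2 M" "(\<lambda>w. norm (p t w)) \<in> L2 M"
      using regular_process_L2[OF X t] regular_process_L2[OF p t] by (auto simp: L2_def)
    then show "(\<lambda>w. 1 + norm (X t w) + norm (p t w)) \<in> L2 M"
      by (intro L2_add(1) L2_const[OF finite_measure_axioms])
  qed (use bd[OF t] in auto)
qed

end

end

section \<open>The Gronwall step for conditional projections\<close>

context finite_measure_subalgebra
begin

text \<open>Let \<open>\<rho>\<close> be the residual of \<open>\<xi>\<close>. Its squared norm is
  the pairing of \<open>\<xi>\<close> with \<open>\<rho>\<close>. In this pairing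
  \<open>\<eta>\<close> contributes 0, being a limit of \<open>F\<close>-measurable vectors, and
  \<open>\<beta> q\<close> contributes at most its distance \<open>k q\<close> to such vectors times
  the norm of \<open>\<rho>\<close>. Dividing by that norm gives the claim.\<close>

lemma cond_proj_time_integral:
  fixes \<beta> :: "real \<Rightarrow> 'a \<Rightarrow> 'b::euclidean_space"
  assumes P: "prob_space M" and \<xi>: "\<xi> \<in> L2 M" and \<eta>: "\<eta> \<in> L2 M"
    and \<eta>F: "\<And>\<epsilon>. 0 < \<epsilon> \<Longrightarrow> \<exists>\<eta>'. \<eta>' \<in> L2 M \<and> \<eta>' \<in> borel_measurable F \<and> L2_norm M (\<lambda>w. \<eta> w - \<eta>' w) \<le> \<epsilon>"
    and \<beta>: "(\<lambda>(t, w). \<beta> t w) \<in> L2 (dt_dP M T)"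
    and rs: "0 \<le> r" "s \<le> T"
    and eq: "AE w in M. \<xi> w = \<eta> w + (LINT q:{r..s}|lborel. \<beta> q w)"
    and approx: "\<And>q. q \<in> {r..s} \<Longrightarrow> \<beta> q \<in> L2 M \<and>
      (\<exists>\<gamma>. \<gamma> \<in> L2 M \<and> \<gamma> \<in> borel_measurable F \<and> L2_norm M (\<lambda>w. \<beta> q w - \<gamma> w) \<le> k q)"
    and k: "continuous_on {r..s} k" and k0: "0 \<le> (LINT q:{r..s}|lborel. k q)"
  shows "L2_norm M (\<lambda>w. \<xi> w - cond_proj M F \<xi> w) \<le> (LINT q:{r..s}|lborel. k q)"
proof -
  define \<rho> where "\<rho> = (\<lambda>w. \<xi> w - cond_proj M F \<xi> w)"
  have \<rho>: "\<rho> \<in> L2 M" unfolding \<rho>_def by (rule L2_diff[OF \<xi> cond_proj_L2[OF \<xi>]])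
  have orth: "(\<integral>w. \<rho> w \<bullet> \<gamma> w \<partial>M) = 0" if "\<gamma> \<in> L2 M" "\<gamma> \<in> borel_measurable F" for \<gamma>
    unfolding \<rho>_def by (rule cond_proj_residual_orthogonal[OF \<xi> that])
  have near: "\<bar>\<integral>w. \<zeta> w \<bullet> \<rho> w \<partial>M\<bar> \<le> e * L2_norm M \<rho>"
    if \<zeta>: "\<zeta> \<in> L2 M" and \<gamma>: "\<gamma> \<in> L2 M" "\<gamma> \<in> borel_measurable F" "L2_norm M (\<lambda>w. \<zeta> w - \<gamma> w) \<le> e" for \<zeta> \<gamma> e
  proof -
    have "(\<integral>w. (\<zeta> w - \<gamma> w) \<bullet> \<rho> w \<partial>M) = (\<integral>w. \<zeta> w \<bullet> \<rho> w \<partial>M) - (\<integral>w. \<rho> w \<bullet> \<gamma> w \<partial>M)"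
      unfolding inner_diff_left inner_commute[of "\<gamma> _"]
      by (rule Bochner_Integration.integral_diff[OF L2_inner(1)[OF \<zeta> \<rho>] L2_inner(1)[OF \<rho> \<gamma>(1)]])
    then have "\<bar>\<integral>w. \<zeta> w \<bullet> \<rho> w \<partial>M\<bar> \<le> L2_norm M (\<lambda>w. \<zeta> w - \<gamma> w) * L2_norm M \<rho>"
      using L2_inner(4)[OF L2_diff[OF \<zeta> \<gamma>(1)] \<rho>] orth[OF \<gamma>(1,2)] by simp
    also have "\<dots> \<le> e * L2_norm M \<rho>" by (rule mult_right_mono[OF \<gamma>(3) L2_norm_nonneg])
    finally show ?thesis .
  qed
  \<comment> \<open>The pairing is bounded by a multiple of \<open>1 / (n + 1)\<close> for every
    \<open>n\<close>.\<close>
  have \<eta>0: "(\<integral>w. \<eta> w \<bullet> \<rho> w \<partial>M) = 0"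
  proof -
    have "\<bar>\<integral>w. \<eta> w \<bullet> \<rho> w \<partial>M\<bar> \<le> inverse (real (Suc n)) * L2_norm M \<rho>" for n
      using \<eta>F[of "inverse (real (Suc n))"] near[OF \<eta>] by auto
    then show ?thesis
      by (rule tendsto_0_norm_bound) (rule tendsto_mult_left_zero[OF LIMSEQ_inverse_real_of_nat])
  qed
  have \<beta>\<rho>: "(\<integral>w. \<beta> q w \<bullet> \<rho> w \<partial>M) \<le> k q * L2_norm M \<rho>" if "q \<in> {r..s}" for q
    using approx[OF that] near[of "\<beta> q"] by (meson abs_le_D1)
  have I: "(\<lambda>w. LINT q:{r..s}|lborel. \<beta> q w) \<in> L2 M" by (rule L2_time_integral(2)[OF P \<beta> rs])
  have "(L2_norm M \<rho>)\<^sup>2 = (\<integral>w. \<rho> w \<bullet> \<rho> w \<partial>M)" by (simp add: L2_norm_sq power2_norm_eq_inner)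
  also have "\<dots> = (\<integral>w. \<xi> w \<bullet> \<rho> w \<partial>M)"
  proof -
    have "(\<integral>w. \<rho> w \<bullet> \<rho> w \<partial>M) = (\<integral>w. \<xi> w \<bullet> \<rho> w - \<rho> w \<bullet> cond_proj M F \<xi> w \<partial>M)"
    proof (intro Bochner_Integration.integral_cong refl)
      fix w
      have "\<rho> w \<bullet> \<rho> w = (\<xi> w - cond_proj M F \<xi> w) \<bullet> \<rho> w" by (simp only: \<rho>_def)
      then show "\<rho> w \<bullet> \<rho> w = \<xi> w \<bullet> \<rho> w - \<rho> w \<bullet> cond_proj M F \<xi> w"
        unfolding inner_diff_left by (simp only: inner_commute[of "\<rho> w" "cond_proj M F \<xi> w"])
    qed
    also have "\<dots> = (\<integral>w. \<xi> w \<bullet> \<rho> w \<partial>M) - (\<integral>w. \<rho> w \<bullet> cond_proj M F \<xi> w \<partial>M)"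
      by (rule Bochner_Integration.integral_diff[OF L2_inner(1)[OF \<xi> \<rho>] L2_inner(1)[OF \<rho> cond_proj_L2[OF \<xi>]]])
    finally show ?thesis using orth[OF cond_proj_L2[OF \<xi>] cond_proj_measurable] by simp
  qed
  also have "\<dots> = (\<integral>w. \<eta> w \<bullet> \<rho> w + (LINT q:{r..s}|lborel. \<beta> q w) \<bullet> \<rho> w \<partial>M)"
  proof (rule integral_cong_AE)
    show "AE w in M. \<xi> w \<bullet> \<rho> w = \<eta> w \<bullet> \<rho> w + (LINT q:{r..s}|lborel. \<beta> q w) \<bullet> \<rho> w"
      using eq by eventually_elim (simp add: inner_add_left)
  qed (use L2_inner(1)[OF \<xi> \<rho>] L2_inner(1)[OF \<eta> \<rho>] L2_inner(1)[OF I \<rho>] in auto)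
  also have "\<dots> = (\<integral>w. \<eta> w \<bullet> \<rho> w \<partial>M) + (\<integral>w. (LINT q:{r..s}|lborel. \<beta> q w) \<bullet> \<rho> w \<partial>M)"
    by (rule Bochner_Integration.integral_add[OF L2_inner(1)[OF \<eta> \<rho>] L2_inner(1)[OF I \<rho>]])
  also have "\<dots> \<le> 0 + (LINT q:{r..s}|lborel. k q * L2_norm M \<rho>)"
    unfolding \<eta>0 by (intro add_left_mono time_integral_inner_le[OF P \<beta> \<rho> rs \<beta>\<rho>] continuous_intros k)
  also have "\<dots> = (LINT q:{r..s}|lborel. k q) * L2_norm M \<rho>" by simp
  finally have "L2_norm M \<rho> * L2_norm M \<rho> \<le> (LINT q:{r..s}|lborel. k q) * L2_norm M \<rho>"
    by (simp add: power2_eq_square)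
  then show ?thesis
    unfolding \<rho>_def[symmetric] using k0
    by (cases "L2_norm M \<rho> = 0") (auto simp: mult_le_cancel_right less_le)
qed

end

section \<open>Coefficients along a state process\<close>

lemma set_borel_measurable_time:
  fixes f :: "real \<Rightarrow> 'b::euclidean_space"
  shows "set_borel_measurable lborel {0..T} f \<Longrightarrow> f \<in> borel_measurable (restrict_space borel {0..T})"
  by (simp add: set_borel_measurable_def borel_measurable_restrict_space_iff)

lemma lipschitz_of_derivative:
  fixes h :: "real^'n \<Rightarrow> real^'k"
  assumes d: "\<And>x. (h has_derivative (\<lambda>v. A x *v v)) (at x)" and b: "\<And>x. norm (A x) \<le> K"
  shows "norm (h x - h y) \<le> K * norm (x - y)"
proof (rule differentiable_bound[where S=UNIV])
  show "(h has_derivative (\<lambda>v. A x *v v)) (at x within UNIV)" for x by (rule d)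
  have "0 \<le> K" using b[of x] norm_ge_zero order_trans by blast
  then show "onorm (\<lambda>v. A x *v v) \<le> K" for x
    using b[of x] by (intro onorm_bound order_trans[OF norm_matrix_vector_le] mult_right_mono) auto
qed auto

locale controlled = brownian_basis M T X0 W
  for M :: "'w measure" and T :: real
    and X0 :: "'w \<Rightarrow> real^'d" and W :: "real \<Rightarrow> 'w \<Rightarrow> real^'m" +
  fixes \<sigma> :: "real \<Rightarrow> real^'m^'d"
    and b :: "real \<Rightarrow> real^'d \<Rightarrow> (real^'d) measure \<Rightarrow> real^'d"
    and bx :: "real \<Rightarrow> real^'d \<Rightarrow> (real^'d) measure \<Rightarrow> real^'d^'d"
    and bm :: "real \<Rightarrow> real^'d \<Rightarrow> (real^'d) measure \<Rightarrow> real^'d \<Rightarrow> real^'d^'d"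
    and f :: "real \<Rightarrow> real^'d \<Rightarrow> (real^'d) measure \<Rightarrow> real"
    and fx :: "real \<Rightarrow> real^'d \<Rightarrow> (real^'d) measure \<Rightarrow> real^'d"
    and fm :: "real \<Rightarrow> real^'d \<Rightarrow> (real^'d) measure \<Rightarrow> real^'d \<Rightarrow> real^'d"
    and g :: "real^'d \<Rightarrow> (real^'d) measure \<Rightarrow> real"
    and gx :: "real^'d \<Rightarrow> (real^'d) measure \<Rightarrow> real^'d"
    and gm :: "real^'d \<Rightarrow> (real^'d) measure \<Rightarrow> real^'d \<Rightarrow> real^'d"
  assumes coeffs: "regular_coefficients M T \<sigma> b bx bm f fx fm g gx gm"
begin

lemma coefficients:
  shows sigma_continuous: "continuous_on {0..T} \<sigma>"
    and sigma_bounded: "bounded (\<sigma> ` {0..T})"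
    and b_time: "\<mu> \<in> P2 \<Longrightarrow> set_borel_measurable lborel {0..T} (\<lambda>t. b t x \<mu>)"
    and b_square: "\<mu> \<in> P2 \<Longrightarrow> set_integrable lborel {0..T} (\<lambda>t. (norm (b t x \<mu>))\<^sup>2)"
    and f_time: "\<mu> \<in> P2 \<Longrightarrow> set_borel_measurable lborel {0..T} (\<lambda>t. f t x \<mu>)"
    and b_lipschitz: "\<exists>L. \<forall>t\<in>{0..T}. \<forall>x x'. \<forall>\<mu>\<in>P2. \<forall>\<mu>'\<in>P2.
       norm (b t x \<mu> - b t x' \<mu>') \<le> L * (norm (x - x') + W2 \<mu> \<mu>')"
    and b_C1: "C1_vector M T b bx bm" and b_bounded: "bounded_derivatives T bx bm"
    and f_C1: "C1_scalar M T f fx fm" and f_linear: "linear_growth_derivatives T fx fm"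
    and g_C1: "C1_scalar M T (\<lambda>_. g) (\<lambda>_. gx) (\<lambda>_. gm)"
    and g_linear: "linear_growth_derivatives T (\<lambda>_. gx) (\<lambda>_. gm)"
    and f_quadratic: "quadratic_growth T f" and g_quadratic: "quadratic_growth T (\<lambda>_. g)"
  using coeffs unfolding regular_coefficients_def by (elim conjE; simp)+

lemma sigma_bound: "\<exists>K\<ge>0. \<forall>t\<in>{0..T}. norm (\<sigma> t) \<le> K"
proof -
  obtain K where K: "\<forall>x\<in>\<sigma> ` {0..T}. norm x \<le> K"
    using sigma_bounded unfolding bounded_iff by blast
  have "norm (\<sigma> t) \<le> \<bar>K\<bar>" if "t \<in> {0..T}" for t
    using order_trans[OF bspec[OF K imageI[OF that]] abs_ge_self] .
  then show ?thesis by (intro exI[of _ "\<bar>K\<bar>"]) auto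
qed

lemma sigma_time_measurable: "\<sigma> \<in> borel_measurable (restrict_space borel {0..T})"
  by (rule borel_measurable_continuous_on_restrict[OF sigma_continuous])

lemma progressive_dt_dP:
  fixes V :: "real \<Rightarrow> 'w \<Rightarrow> 'b::euclidean_space"
  assumes "progressive F T V"
  shows "(\<lambda>(t, w). V t w) \<in> borel_measurable (dt_dP M T)"
proof -
  have "(\<lambda>(t, w). V t w) \<in> borel_measurable (restrict_space borel {0..T} \<Otimes>\<^sub>M F T)"
    using assms T_pos by (auto simp: progressive_def)
  from measurable_pair_subalgebra[OF subalgebra_filt[OF order_refl] this]
  show ?thesis unfolding measurable_dt_dP .
qed

lemma progressive_adapted:
  fixes V :: "real \<Rightarrow> 'w \<Rightarrow> 'b::euclidean_space"
  assumes V: "progressive F T V" and t: "t \<in> {0..T}"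
  shows "V t \<in> borel_measurable (F t)"
proof -
  have m: "(\<lambda>(s, w). V s w) \<in> borel_measurable (restrict_space borel {0..t} \<Otimes>\<^sub>M F t)"
    using V t by (simp add: progressive_def)
  have "t \<in> space (restrict_space borel {0..t})" using t by (simp add: space_restrict_space)
  from measurable_compose[OF measurable_Pair1'[OF this] m] show ?thesis by simp
qed

lemma state_process_regular:
  assumes "state_process M T X0 W \<sigma> b \<alpha> X'"
  shows "regular_process M T X'" and "t \<in> {0..T} \<Longrightarrow> X' t \<in> borel_measurable (F t)"
  using assms progressive_dt_dP[of X'] progressive_adapted[of X' t]
  unfolding state_process_def regular_process_def by blast+

lemma adjoint_processes_regular:
  assumes "adjoint_processes M T X0 W bx bm fx fm gx gm X' Y' Z'"
  shows "regular_process M T Y'" and "t \<in> {0..T} \<Longrightarrow> Y' t \<in> borel_measurable (F t)"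
  using assms progressive_dt_dP[of Y'] progressive_adapted[of Y' t]
  unfolding adjoint_processes_def regular_process_def by blast+

context
  fixes X' :: "real \<Rightarrow> 'w \<Rightarrow> real^'d"
  assumes X': "regular_process M T X'"
begin

text \<open>Both measure arguments coincide, and the distance of a law to itself is 0 by the bound
  through couplings.\<close>

lemma b_lipschitz_along:
  "\<exists>L\<ge>0. \<forall>t\<in>{0..T}. \<forall>x y. norm (b t x (law M X' t) - b t y (law M X' t)) \<le> L * norm (x - y)"
proof -
  obtain L where L: "\<And>t x x' \<mu> \<mu>'. t \<in> {0..T} \<Longrightarrow> \<mu> \<in> P2 \<Longrightarrow> \<mu>' \<in> P2 \<Longrightarrow>
       norm (b t x \<mu> - b t x' \<mu>') \<le> L * (norm (x - x') + W2 \<mu> \<mu>')"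
    using b_lipschitz by blast
  have "norm (b t x (law M X' t) - b t y (law M X' t)) \<le> \<bar>L\<bar> * norm (x - y)" if t: "t \<in> {0..T}" for t x y
  proof -
    note Xt = regular_process_L2[OF X' t]
    have "W2 (law M X' t) (law M X' t) = 0"
      using W2_law_le[OF Xt Xt] by (simp add: law_def L2_norm_def)
    then have "norm (b t x (law M X' t) - b t y (law M X' t)) \<le> L * norm (x - y)"
      using L[OF t regular_process_law[OF X' t] regular_process_law[OF X' t], of x y] by simp
    also have "\<dots> \<le> \<bar>L\<bar> * norm (x - y)" by (intro mult_right_mono) auto
    finally show ?thesis .
  qed
  then show ?thesis by (intro exI[of _ "\<bar>L\<bar>"]) auto
qed

lemma b_measurable_along:
  "(\<lambda>(t, x). b t x (law M X' t)) \<in> borel_measurable (restrict_space borel {0..T} \<Otimes>\<^sub>M borel)"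
proof (rule lions_measurable_along[OF X'])
  show "(\<lambda>t. b t x \<mu>) \<in> borel_measurable (restrict_space borel {0..T})" if "\<mu> \<in> P2" for x \<mu>
    by (rule set_borel_measurable_time[OF b_time[OF that]])
  show "continuous_on UNIV (\<lambda>x. b t x \<mu>)" if t: "t \<in> {0..T}" and \<mu>: "\<mu> \<in> P2" for t \<mu>
  proof (rule continuous_at_imp_continuous_on, rule ballI)
    fix x
    have "((\<lambda>y. b t y \<mu>) has_derivative (\<lambda>v. bx t x \<mu> *v v)) (at x)"
      using b_C1 t \<mu> by (simp add: C1_vector_def)
    then show "isCont (\<lambda>x. b t x \<mu>) x" by (rule has_derivative_continuous)
  qed
  show "\<exists>D. has_lions_derivative M (\<lambda>\<nu>. b t x \<nu>) D \<mu>" if "t \<in> {0..T}" "\<mu> \<in> P2" for t x \<mu>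
    using b_C1 that unfolding C1_vector_def by blast
qed (use T_pos in simp)

lemma f_measurable_along:
  "(\<lambda>(t, x). f t x (law M X' t)) \<in> borel_measurable (restrict_space borel {0..T} \<Otimes>\<^sub>M borel)"
proof (rule lions_measurable_along[OF X'])
  show "(\<lambda>t. f t x \<mu>) \<in> borel_measurable (restrict_space borel {0..T})" if "\<mu> \<in> P2" for x \<mu>
    by (rule set_borel_measurable_time[OF f_time[OF that]])
  show "continuous_on UNIV (\<lambda>x. f t x \<mu>)" if t: "t \<in> {0..T}" and \<mu>: "\<mu> \<in> P2" for t \<mu>
  proof (rule continuous_at_imp_continuous_on, rule ballI)
    fix x
    have "GDERIV (\<lambda>y. f t y \<mu>) x :> fx t x \<mu>"
      using f_C1 t \<mu> by (simp add: C1_scalar_def)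
    then show "isCont (\<lambda>x. f t x \<mu>) x" unfolding gderiv_def by (rule has_derivative_continuous)
  qed
  show "\<exists>D. has_lions_derivative M (\<lambda>\<nu>. f t x \<nu>) D \<mu>" if "t \<in> {0..T}" "\<mu> \<in> P2" for t x \<mu>
    using f_C1 that unfolding C1_scalar_def by blast
qed (use T_pos in simp)

text \<open>The drift is compared with its value at the point 0 and at a fixed law, where square
  integrability in time is assumed. The Lipschitz condition bounds the difference by a multiple of
  \<open>1 + norm (X' t w)\<close>, because the laws of \<open>X'\<close> stay at bounded distance
  from the fixed law.\<close>

lemma drift_L2:
  shows "(\<lambda>(t, w). b t (X' t w) (law M X' t)) \<in> L2 (dt_dP M T)"
    and "t \<in> {0..T} \<Longrightarrow> (\<lambda>w. b t (X' t w) (law M X' t)) \<in> L2 M"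
    and "t \<in> {0..T} \<Longrightarrow> X' t \<in> borel_measurable (F t) \<Longrightarrow> (\<lambda>w. b t (X' t w) (law M X' t)) \<in> borel_measurable (F t)"
proof -
  obtain L where L: "\<And>t x x' \<mu> \<mu>'. t \<in> {0..T} \<Longrightarrow> \<mu> \<in> P2 \<Longrightarrow> \<mu>' \<in> P2 \<Longrightarrow>
       norm (b t x \<mu> - b t x' \<mu>') \<le> L * (norm (x - x') + W2 \<mu> \<mu>')"
    using b_lipschitz by blast
  obtain K where K: "K \<ge> 0" "\<And>t. t \<in> {0..T} \<Longrightarrow> L2_norm M (X' t) \<le> K"
    using regular_process_norm_bound[OF X'] by blast
  \<comment> \<open>The Dirac measure at 0, written as the law of a constant so that the bound for
    \<open>W2\<close> applies.\<close>
  define \<delta> where "\<delta> = distr M borel (\<lambda>_. 0 :: real^'d)"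
  have \<delta>: "\<delta> \<in> P2" unfolding \<delta>_def by (rule law_in_P2[OF prob_space_axioms L2_zero])
  define c where "c = \<bar>L\<bar> * (1 + K)"
  have c: "0 \<le> c" using K by (simp add: c_def)
  have bd: "norm (b t (X' t w) (law M X' t)) \<le> 1 * norm (norm (b t 0 \<delta>) + c * (1 + norm (X' t w)))"
    if t: "t \<in> {0..T}" for t w
  proof -
    note Xt = regular_process_L2[OF X' t]
    have W: "0 \<le> W2 (law M X' t) \<delta>" "W2 (law M X' t) \<delta> \<le> K"
      using W2_law_le[OF Xt L2_zero] K(2)[OF t] by (simp_all add: law_def \<delta>_def)
    have "norm (b t (X' t w) (law M X' t) - b t 0 \<delta>) \<le> L * (norm (X' t w - 0) + W2 (law M X' t) \<delta>)"
      by (rule L[OF t regular_process_law[OF X' t] \<delta>])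
    also have "\<dots> \<le> \<bar>L\<bar> * ((1 + K) * (1 + norm (X' t w)))"
    proof (rule mult_mono)
      have "0 \<le> K * norm (X' t w)" using K by simp
      moreover have "(1 + K) * (1 + norm (X' t w)) = 1 + norm (X' t w) + K + K * norm (X' t w)"
        by (simp add: algebra_simps)
      ultimately show "norm (X' t w - 0) + W2 (law M X' t) \<delta> \<le> (1 + K) * (1 + norm (X' t w))"
        using W unfolding diff_zero by linarith
    qed (use W in auto)
    finally have "norm (b t (X' t w) (law M X' t) - b t 0 \<delta>) \<le> c * (1 + norm (X' t w))"
      by (simp add: c_def mult.assoc)
    then show ?thesis
      using norm_triangle_sub[of "b t (X' t w) (law M X' t)" "b t 0 \<delta>"] c by simp
  qed
  have one: "(\<lambda>z. 1 :: real) \<in> L2 (dt_dP M T)"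
    using L2_time_constant[OF prob_space_axioms L2_const[OF finite_measure_axioms, of "1::real"], of T]
    by (simp add: case_prod_beta')
  have nX: "(\<lambda>z. norm (X' (fst z) (snd z))) \<in> L2 (dt_dP M T)"
    using regular_process_L2_time[OF X'] by (auto simp: L2_def case_prod_beta')
  have b0: "(\<lambda>z. norm (b (fst z) 0 \<delta>)) \<in> L2 (dt_dP M T)"
  proof (rule L2_I)
    interpret PP: pair_sigma_finite "restrict_space lborel {0..T}" M
      by (rule time_pair_sigma_finite[OF prob_space_axioms])
    have m: "(\<lambda>t. b t 0 \<delta>) \<in> borel_measurable (restrict_space borel {0..T})"
      by (rule set_borel_measurable_time[OF b_time[OF \<delta>]])
    have m1: "(\<lambda>z. b (fst z) 0 \<delta>) \<in> borel_measurable (dt_dP M T)"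
      by (rule measurable_compose[OF measurable_fst_dt_dP m])
    then show "(\<lambda>z. norm (b (fst z) 0 \<delta>)) \<in> borel_measurable (dt_dP M T)" by measurable
    have "integrable (restrict_space lborel {0..T}) (\<lambda>t. (norm (b t 0 \<delta>))\<^sup>2)"
      using b_square[OF \<delta>, of 0] by (simp add: integrable_restrict_space set_integrable_def)
    then have "integrable (restrict_space lborel {0..T} \<Otimes>\<^sub>M M) (\<lambda>(t, w). (norm (b t 0 \<delta>))\<^sup>2)"
      using m1 unfolding dt_dP_def by (intro PP.Fubini_integrable) (auto simp: case_prod_beta' prob_space)
    then show "integrable (dt_dP M T) (\<lambda>z. (norm (norm (b (fst z) 0 \<delta>)))\<^sup>2)"
      by (simp add: dt_dP_def case_prod_beta')
  qed
  have cX: "(\<lambda>z. c * (1 + norm (X' (fst z) (snd z)))) \<in> L2 (dt_dP M T)"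
    using L2_scaleR[OF L2_add(1)[OF one nX], of c] by simp
  have G: "(\<lambda>z. norm (b (fst z) 0 \<delta>) + c * (1 + norm (X' (fst z) (snd z)))) \<in> L2 (dt_dP M T)"
    by (rule L2_add(1)[OF b0 cX])
  have Xm: "(\<lambda>(t, w). X' t w) \<in> borel_measurable (dt_dP M T)"
    using X' by (simp add: regular_process_def)
  have m: "(\<lambda>(t, w). b t (X' t w) (law M X' t)) \<in> borel_measurable (dt_dP M T)"
    using measurable_along[OF b_measurable_along measurable_fst_dt_dP Xm] by (simp add: case_prod_beta')
  show "(\<lambda>(t, w). b t (X' t w) (law M X' t)) \<in> L2 (dt_dP M T)"
  proof (rule L2_bound(1)[OF m G zero_le_one])
    show "AE z in dt_dP M T. norm (case z of (t, w) \<Rightarrow> b t (X' t w) (law M X' t))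
        \<le> 1 * norm (norm (b (fst z) 0 \<delta>) + c * (1 + norm (X' (fst z) (snd z))))"
      using AE_space by eventually_elim (use bd in \<open>auto simp: dt_dP_def space_pair_measure space_restrict_space\<close>)
  qed
  show "(\<lambda>w. b t (X' t w) (law M X' t)) \<in> L2 M" if t: "t \<in> {0..T}"
  proof (rule L2_bound(1)[OF dt_dP_section[OF m t] _ zero_le_one])
    have 1: "(\<lambda>w. norm (X' t w)) \<in> L2 M"
      using regular_process_L2[OF X' t] by (auto simp: L2_def)
    have "(\<lambda>w. norm (b t 0 \<delta>) + c *\<^sub>R (1 + norm (X' t w))) \<in> L2 M"
      by (intro L2_add(1) L2_const[OF finite_measure_axioms] L2_scaleR 1)
    then show "(\<lambda>w. norm (b t 0 \<delta>) + c * (1 + norm (X' t w))) \<in> L2 M" by simp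
  qed (use bd[OF t] in auto)
  show "(\<lambda>w. b t (X' t w) (law M X' t)) \<in> borel_measurable (F t)"
    if "t \<in> {0..T}" "X' t \<in> borel_measurable (F t)"
    by (rule measurable_compose[OF that(2) measurable_along_fixed[OF b_measurable_along that(1)]])
qed

lemma quadratic_integrable:
  assumes q: "quadratic_growth T h"
    and m: "(\<lambda>(t, x). h t x (law M X' t)) \<in> borel_measurable (restrict_space borel {0..T} \<Otimes>\<^sub>M borel)"
  shows "integrable (dt_dP M T) (\<lambda>(t, w). h t (X' t w) (law M X' t))"
    and "t \<in> {0..T} \<Longrightarrow> integrable M (\<lambda>w. h t (X' t w) (law M X' t))"
proof -
  obtain C where C: "\<And>t x \<mu>. t \<in> {0..T} \<Longrightarrow> \<mu> \<in> P2 \<Longrightarrow> \<bar>h t x \<mu>\<bar> \<le> C * (1 + (norm x)\<^sup>2 + moment2 \<mu>)"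
    using q unfolding quadratic_growth_def by blast
  obtain K where K: "K \<ge> 0" "\<And>t. t \<in> {0..T} \<Longrightarrow> L2_norm M (X' t) \<le> K"
    using regular_process_norm_bound[OF X'] by blast
  have bd: "norm (h t (X' t w) (law M X' t)) \<le> norm (\<bar>C\<bar> * (1 + (norm (X' t w))\<^sup>2 + K\<^sup>2))" if t: "t \<in> {0..T}" for t w
  proof -
    have m2: "0 \<le> moment2 (law M X' t)" "moment2 (law M X' t) \<le> K\<^sup>2"
    proof -
      show 0: "0 \<le> moment2 (law M X' t)" by (simp add: moment2_def)
      have "sqrt (moment2 (law M X' t)) \<le> K"
        using moment2_law[OF regular_process_measurable[OF X' t]] K(2)[OF t] by (simp add: law_def)
      then show "moment2 (law M X' t) \<le> K\<^sup>2"
        using 0 K(1) by (metis power_mono real_sqrt_ge_zero real_sqrt_pow2)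
    qed
    have "\<bar>h t (X' t w) (law M X' t)\<bar> \<le> C * (1 + (norm (X' t w))\<^sup>2 + moment2 (law M X' t))"
      by (rule C[OF t regular_process_law[OF X' t]])
    also have "\<dots> \<le> \<bar>C\<bar> * (1 + (norm (X' t w))\<^sup>2 + K\<^sup>2)"
      using m2 by (intro mult_mono) auto
    finally show ?thesis by simp
  qed
  have Xm: "(\<lambda>(t, w). X' t w) \<in> borel_measurable (dt_dP M T)"
    using X' by (simp add: regular_process_def)
  have hm: "(\<lambda>(t, w). h t (X' t w) (law M X' t)) \<in> borel_measurable (dt_dP M T)"
    using measurable_along[OF m measurable_fst_dt_dP Xm] by (simp add: case_prod_beta')
  have fin: "finite_measure (dt_dP M T)"
    unfolding dt_dP_def by (intro finite_measure_pair_measure finite_measure_time finite_measure_axioms)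
  have nX: "integrable (dt_dP M T) (\<lambda>z. (norm (X' (fst z) (snd z)))\<^sup>2)"
    using L2_integrable[OF regular_process_L2_time[OF X']] by (simp add: case_prod_beta')
  have dom: "integrable (dt_dP M T) (\<lambda>z. \<bar>C\<bar> * (1 + (norm (X' (fst z) (snd z)))\<^sup>2 + K\<^sup>2))"
    using nX finite_measure.integrable_const[OF fin]
    by (intro integrable_mult_right Bochner_Integration.integrable_add) auto
  show "integrable (dt_dP M T) (\<lambda>(t, w). h t (X' t w) (law M X' t))"
  proof (rule Bochner_Integration.integrable_bound[OF dom hm])
    show "AE z in dt_dP M T. norm (case z of (t, w) \<Rightarrow> h t (X' t w) (law M X' t))
        \<le> norm (\<bar>C\<bar> * (1 + (norm (X' (fst z) (snd z)))\<^sup>2 + K\<^sup>2))"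
      using AE_space
    proof eventually_elim
      case (elim z)
      then have "fst z \<in> {0..T}" by (auto simp: dt_dP_def space_pair_measure space_restrict_space)
      from bd[OF this, of "snd z"] show ?case by (simp only: case_prod_beta')
    qed
  qed
  show "integrable M (\<lambda>w. h t (X' t w) (law M X' t))" if t: "t \<in> {0..T}"
  proof (rule Bochner_Integration.integrable_bound[OF _ dt_dP_section[OF hm t]])
    show "integrable M (\<lambda>w. \<bar>C\<bar> * (1 + (norm (X' t w))\<^sup>2 + K\<^sup>2))"
      using L2_integrable[OF regular_process_L2[OF X' t]] by auto
    show "AE w in M. norm (h t (X' t w) (law M X' t)) \<le> norm (\<bar>C\<bar> * (1 + (norm (X' t w))\<^sup>2 + K\<^sup>2))"
      by (rule AE_I2) (rule bd[OF t])
  qed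
qed

text \<open>Second moments along the flow of laws are bounded in time and can be absorbed into the
  constant.\<close>

lemma linear_growth_along:
  fixes hx :: "real \<Rightarrow> real^'d \<Rightarrow> (real^'d) measure \<Rightarrow> real^'d" and hm :: "real \<Rightarrow> real^'d \<Rightarrow> (real^'d) measure \<Rightarrow> real^'d \<Rightarrow> real^'d"
  assumes "linear_growth_derivatives T hx hm"
  shows "\<exists>c\<ge>0. \<forall>t\<in>{0..T}. \<forall>x y. norm (hx t x (law M X' t)) \<le> c * (1 + norm x) \<and>
    norm (hm t x (law M X' t) y) \<le> c * (1 + norm x + norm y)"
proof -
  obtain C where C: "\<And>t x y \<mu>. t \<in> {0..T} \<Longrightarrow> \<mu> \<in> P2 \<Longrightarrow>
      norm (hx t x \<mu>) \<le> C * (1 + norm x + sqrt (moment2 \<mu>)) \<and>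
      norm (hm t x \<mu> y) \<le> C * (1 + norm x + norm y + sqrt (moment2 \<mu>))"
    using assms unfolding linear_growth_derivatives_def by blast
  obtain K where K: "K \<ge> 0" "\<And>t. t \<in> {0..T} \<Longrightarrow> L2_norm M (X' t) \<le> K"
    using regular_process_norm_bound[OF X'] by blast
  have "norm (hx t x (law M X' t)) \<le> \<bar>C\<bar> * (1 + K) * (1 + norm x) \<and>
      norm (hm t x (law M X' t) y) \<le> \<bar>C\<bar> * (1 + K) * (1 + norm x + norm y)" if t: "t \<in> {0..T}" for t x y
  proof -
    have m: "sqrt (moment2 (law M X' t)) \<le> K" "0 \<le> sqrt (moment2 (law M X' t))"
      using moment2_law[OF regular_process_measurable[OF X' t]] K(2)[OF t] by (simp_all add: law_def)
    have e: "C * (r + sqrt (moment2 (law M X' t))) \<le> \<bar>C\<bar> * (1 + K) * r" if r: "1 \<le> r" for r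
    proof -
      have "K * 1 \<le> K * r" using K r by (intro mult_left_mono) auto
      then have "r + sqrt (moment2 (law M X' t)) \<le> (1 + K) * r" using m by (simp add: distrib_right)
      then have "C * (r + sqrt (moment2 (law M X' t))) \<le> \<bar>C\<bar> * ((1 + K) * r)"
        using r m by (intro mult_mono) auto
      then show ?thesis by (simp only: mult.assoc)
    qed
    show ?thesis
      using C[OF t regular_process_law[OF X' t], of x y] e[of "1 + norm x"] e[of "1 + norm x + norm y"]
      by auto
  qed
  then show ?thesis using K by (intro exI[of _ "\<bar>C\<bar> * (1 + K)"]) auto
qed

lemma continuous_P2_along2:
  fixes h :: "real \<Rightarrow> real^'d \<Rightarrow> (real^'d) measure \<Rightarrow> real^'d \<Rightarrow> 'c::euclidean_space"
  assumes "continuous_P2 T (\<lambda>t (x, y) \<mu>. h t x \<mu> y)"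
  shows "continuous_on ({0..T} \<times> UNIV) (\<lambda>(t, z). h t (fst z) (law M X' t) (snd z))"
  using continuous_P2_along[OF X' assms] by (simp add: case_prod_beta')

lemma open_loop_driver: "\<exists>K. driver_conditions M T X' K bx bm fx fm"
proof -
  obtain C where C: "\<And>t x y \<mu>. t \<in> {0..T} \<Longrightarrow> \<mu> \<in> P2 \<Longrightarrow> norm (bx t x \<mu>) \<le> C \<and> norm (bm t x \<mu> y) \<le> C"
    using b_bounded unfolding bounded_derivatives_def by blast
  obtain c where c: "c \<ge> 0" "\<And>t x y. t \<in> {0..T} \<Longrightarrow> norm (fx t x (law M X' t)) \<le> c * (1 + norm x) \<and>
    norm (fm t x (law M X' t) y) \<le> c * (1 + norm x + norm y)"
    using linear_growth_along[OF f_linear] by blast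
  have cont: "continuous_P2 T bx" "continuous_P2 T (\<lambda>t (x, y) \<mu>. bm t x \<mu> y)"
    "continuous_P2 T fx" "continuous_P2 T (\<lambda>t (x, y) \<mu>. fm t x \<mu> y)"
    using b_C1 f_C1 by (auto simp: C1_vector_def C1_scalar_def)
  have "driver_conditions M T X' (\<bar>C\<bar> + c) bx bm fx fm"
    unfolding driver_conditions_def
  proof (intro conjI ballI allI)
    fix t x y assume t: "t \<in> {0..T}"
    have "norm (bx t x (law M X' t)) \<le> \<bar>C\<bar>" "norm (bm t x (law M X' t) y) \<le> \<bar>C\<bar>"
      using C[OF t regular_process_law[OF X' t], of x y] by auto
    then show "norm (bx t x (law M X' t)) \<le> \<bar>C\<bar> + c" "norm (bm t x (law M X' t) y) \<le> \<bar>C\<bar> + c"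
      using c(1) by linarith+
    show "norm (fx t x (law M X' t)) \<le> (\<bar>C\<bar> + c) * (1 + norm x)"
      using conjunct1[OF c(2)[OF t, of x y]] by (simp add: distrib_right add_increasing)
    show "norm (fm t x (law M X' t) y) \<le> (\<bar>C\<bar> + c) * (1 + norm x + norm y)"
      using conjunct2[OF c(2)[OF t, of x y]] by (simp add: distrib_right[of "\<bar>C\<bar>"] add_increasing)
  qed (use c continuous_P2_along[OF X'] continuous_P2_along2 cont in auto)
  then show ?thesis by blast
qed

end

end

section \<open>The closed loop\<close>

lemma norm_transpose_vector_le: "norm (transpose A *v w) \<le> norm A * norm w" for A :: "real^'n^'k"
  using norm_matrix_vector_le[of "transpose A" w] by (simp only: norm_transpose)

lemma norm_matrix_mult_le: "norm (A ** B) \<le> norm A * norm B"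
  for A :: "real^'n^'k" and B :: "real^'l^'n"
proof -
  have row: "(A ** B) $ i = transpose B *v (A $ i)" for i
    by (simp add: vec_eq_iff matrix_matrix_mult_def matrix_vector_mult_def transpose_def mult.commute)
  have "(norm (A ** B))\<^sup>2 = (\<Sum>i\<in>UNIV. (norm ((A ** B) $ i))\<^sup>2)"
    by (simp add: norm_vec_def[of "A ** B"] L2_set_def sum_nonneg)
  also have "\<dots> \<le> (\<Sum>i\<in>UNIV. (norm B * norm (A $ i))\<^sup>2)"
    unfolding row using norm_matrix_vector_le[of "transpose B"]
    by (intro sum_mono power_mono) (simp_all add: norm_transpose)
  also have "\<dots> = (norm A * norm B)\<^sup>2"
    by (simp add: norm_vec_def[of A] L2_set_def sum_nonneg power_mult_distrib sum_distrib_left mult.commute)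
  finally show ?thesis by (rule power2_le_imp_le) simp
qed

lemma continuous_on_matrix_mult:
  fixes A :: "'z::topological_space \<Rightarrow> real^'n^'k" and B :: "'z \<Rightarrow> real^'l^'n"
  assumes "continuous_on S A" "continuous_on S B"
  shows "continuous_on S (\<lambda>z. A z ** B z)"
  unfolding matrix_matrix_mult_def
  by (intro continuous_on_vec_lambda continuous_on_sum continuous_on_mult continuous_on_component assms)

lemma set_integral_split:
  fixes h :: "real \<Rightarrow> 'b::euclidean_space"
  assumes h: "set_integrable lborel {r..s} h" and t: "r \<le> t" "t \<le> s"
  shows "(LINT q:{r..s}|lborel. h q) = (LINT q:{r..t}|lborel. h q) + (LINT q:{t..s}|lborel. h q)"
proof -
  have 1: "set_integrable lborel {r..t} h" "set_integrable lborel {t..s} h"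
    using t by (auto intro!: set_integrable_subset[OF h])
  show ?thesis
    using set_borel_integral_eq_integral[OF h] set_borel_integral_eq_integral[OF 1(1)]
      set_borel_integral_eq_integral[OF 1(2)] Henstock_Kurzweil_Integration.integral_combine[OF t, of h]
    by simp
qed

locale closed_loop = controlled M T X0 W \<sigma> b bx bm f fx fm g gx gm
  for M :: "'w measure" and T :: real
    and X0 :: "'w \<Rightarrow> real^'d" and W :: "real \<Rightarrow> 'w \<Rightarrow> real^'m"
    and \<sigma> b bx bm f fx fm g gx gm +
  fixes u :: "real \<Rightarrow> real^'d \<Rightarrow> (real^'d) measure \<Rightarrow> real^'m"
    and ux :: "real \<Rightarrow> real^'d \<Rightarrow> (real^'d) measure \<Rightarrow> real^'d^'m"
    and um :: "real \<Rightarrow> real^'d \<Rightarrow> (real^'d) measure \<Rightarrow> real^'d \<Rightarrow> real^'d^'m"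
    and X a Y :: "real \<Rightarrow> 'w \<Rightarrow> real^'d" and Z :: "real \<Rightarrow> 'w \<Rightarrow> real^'m^'d"
  assumes feedback: "regular_feedback M T u ux um"
    and state: "state_process M T X0 W \<sigma> b (feedback_control M u X) X"
    and basic_adj: "basic_adjoint M T \<sigma> bx bm fx fm gx gm u ux um X a"
    and critical: "stop_gradient_critical M T \<sigma> u X a"
    and adjoint: "adjoint_processes M T X0 W bx bm fx fm gx gm X Y Z"
begin

abbreviation ctrl :: "real \<Rightarrow> 'w \<Rightarrow> real^'m" where "ctrl \<equiv> feedback_control M u X"

abbreviation cl_driver :: "real \<Rightarrow> 'w \<Rightarrow> real^'d" where
  "cl_driver \<equiv> adjoint_driver M (cl_drift_dx \<sigma> bx ux) (cl_drift_dm \<sigma> bm um) (cl_cost_dx fx u ux) (cl_cost_dm fm u um) X a"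

lemma X_regular: "regular_process M T X" and X_adapted: "t \<in> {0..T} \<Longrightarrow> X t \<in> borel_measurable (F t)"
  by (rule state_process_regular[OF state])+

lemma Y_regular: "regular_process M T Y" and Y_adapted: "t \<in> {0..T} \<Longrightarrow> Y t \<in> borel_measurable (F t)"
  by (rule adjoint_processes_regular[OF adjoint])+

lemma a_regular: "regular_process M T a"
proof -
  have "AE w in M. \<forall>t\<in>{0..T}. ((\<lambda>s. a s w) has_vector_derivative - cl_driver t w) (at t within {0..T})"
    using basic_adj by (simp add: basic_adjoint_def)
  then have "AE w in M. continuous_on {0..T} (\<lambda>t. a t w)"
  proof eventually_elim
    case (elim w)
    show ?case
      unfolding continuous_on_eq_continuous_within using elim has_vector_derivative_continuous by blast
  qed
  then show ?thesis
    using basic_adj by (simp add: basic_adjoint_def regular_process_def continuous_paths_def)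
qed

lemma u_continuous: "continuous_on ({0..T} \<times> UNIV) (\<lambda>(t, x). u t x (law M X t))"
  using feedback by (intro continuous_P2_along[OF X_regular]) (simp add: regular_feedback_def)

lemma u_measurable: "(\<lambda>(t, x). u t x (law M X t)) \<in> borel_measurable (restrict_space borel {0..T} \<Otimes>\<^sub>M borel)"
  by (rule continuous_measurable_time[OF u_continuous])

lemma u_derivative_bound: "\<exists>K\<ge>0. \<forall>t\<in>{0..T}. \<forall>x y. norm (ux t x (law M X t)) \<le> K \<and> norm (um t x (law M X t) y) \<le> K"
proof -
  obtain C where C: "\<And>t x y \<mu>. t \<in> {0..T} \<Longrightarrow> \<mu> \<in> P2 \<Longrightarrow> norm (ux t x \<mu>) \<le> C \<and> norm (um t x \<mu> y) \<le> C"
    using feedback unfolding regular_feedback_def bounded_derivatives_def by blast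
  have "norm (ux t x (law M X t)) \<le> \<bar>C\<bar> \<and> norm (um t x (law M X t) y) \<le> \<bar>C\<bar>" if "t \<in> {0..T}" for t x y
    using C[OF that regular_process_law[OF X_regular that], of x y] by auto
  then show ?thesis by (intro exI[of _ "\<bar>C\<bar>"]) auto
qed

lemma u_lipschitz: "\<exists>L\<ge>0. \<forall>t\<in>{0..T}. \<forall>x y. norm (u t x (law M X t) - u t y (law M X t)) \<le> L * norm (x - y)"
proof -
  obtain K where K: "K \<ge> 0" "\<And>t x y. t \<in> {0..T} \<Longrightarrow> norm (ux t x (law M X t)) \<le> K \<and> norm (um t x (law M X t) y) \<le> K"
    using u_derivative_bound by blast
  have "norm (u t x (law M X t) - u t y (law M X t)) \<le> K * norm (x - y)" if t: "t \<in> {0..T}" for t x y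
  proof (rule lipschitz_of_derivative)
    show "((\<lambda>x. u t x (law M X t)) has_derivative (\<lambda>v. ux t x (law M X t) *v v)) (at x)" for x
      using feedback t regular_process_law[OF X_regular t] by (simp add: regular_feedback_def C1_vector_def)
    show "norm (ux t x (law M X t)) \<le> K" for x using K(2)[OF t] by blast
  qed
  then show ?thesis using K by blast
qed

text \<open>Lipschitz continuity in space, together with compactness of the time interval for the
  values at 0.\<close>

lemma u_growth: "\<exists>c\<ge>0. \<forall>t\<in>{0..T}. \<forall>x. norm (u t x (law M X t)) \<le> c * (1 + norm x)"
proof -
  obtain L where L: "L \<ge> 0" "\<And>t x y. t \<in> {0..T} \<Longrightarrow> norm (u t x (law M X t) - u t y (law M X t)) \<le> L * norm (x - y)"
    using u_lipschitz by blast
  have "continuous_on {0..T} (\<lambda>t. (\<lambda>(t, x). u t x (law M X t)) (t, 0))"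
    by (rule continuous_on_compose2[OF u_continuous]) (auto intro!: continuous_intros)
  then have "bounded ((\<lambda>t. u t 0 (law M X t)) ` {0..T})"
    by (intro compact_imp_bounded compact_continuous_image) auto
  then obtain c where c: "\<forall>x\<in>(\<lambda>t. u t 0 (law M X t)) ` {0..T}. norm x \<le> c"
    unfolding bounded_iff by blast
  have "norm (u t x (law M X t)) \<le> (L + \<bar>c\<bar>) * (1 + norm x)" if t: "t \<in> {0..T}" for t x
  proof -
    have 0: "norm (u t 0 (law M X t)) \<le> \<bar>c\<bar>" using order_trans[OF bspec[OF c imageI[OF t]] abs_ge_self] .
    have "norm (u t x (law M X t)) \<le> L * norm x + \<bar>c\<bar>"
      using norm_triangle_sub[of "u t x (law M X t)" "u t 0 (law M X t)"] L(2)[OF t, of x 0] 0 by simp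
    also have "\<dots> \<le> (L + \<bar>c\<bar>) * (1 + norm x)"
      using L by (simp add: algebra_simps)
    finally show ?thesis .
  qed
  then show ?thesis using L by (intro exI[of _ "L + \<bar>c\<bar>"]) auto
qed

lemma ctrl_regular: "regular_process M T ctrl"
proof -
  have Xm: "(\<lambda>(t, w). X t w) \<in> borel_measurable (dt_dP M T)"
    and Xc: "AE w in M. continuous_on {0..T} (\<lambda>t. X t w)"
    using X_regular by (auto simp: regular_process_def continuous_paths_def)
  obtain \<zeta> where \<zeta>: "integrable M \<zeta>" "AE w in M. \<forall>t\<in>{0..T}. (norm (X t w))\<^sup>2 \<le> \<zeta> w"
    by (rule regular_process_bound[OF X_regular])
  obtain c where c: "c \<ge> 0" "\<And>t x. t \<in> {0..T} \<Longrightarrow> norm (u t x (law M X t)) \<le> c * (1 + norm x)"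
    using u_growth by blast
  have "(\<lambda>(t, w). ctrl t w) \<in> borel_measurable (dt_dP M T)"
    using measurable_along[OF u_measurable measurable_fst_dt_dP Xm]
    by (simp add: feedback_control_def case_prod_beta')
  moreover have "continuous_paths M T ctrl"
    unfolding continuous_paths_def feedback_control_def using Xc
  proof eventually_elim
    case (elim w)
    have "continuous_on {0..T} (\<lambda>t. (\<lambda>(t, x). u t x (law M X t)) (t, X t w))"
      by (rule continuous_on_compose2[OF u_continuous]) (auto intro!: continuous_intros elim)
    then show ?case by simp
  qed
  moreover have "S2_bounded M T ctrl"
    unfolding S2_bounded_def
  proof (intro exI conjI)
    show "integrable M (\<lambda>w. c\<^sup>2 * (2 + 2 * \<zeta> w))" using \<zeta>(1) by auto
    show "AE w in M. \<forall>t\<in>{0..T}. (norm (ctrl t w))\<^sup>2 \<le> c\<^sup>2 * (2 + 2 * \<zeta> w)"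
      using \<zeta>(2)
    proof eventually_elim
      case (elim w)
      show ?case
      proof
        fix t assume t: "t \<in> {0..T}"
        have "(norm (ctrl t w))\<^sup>2 \<le> (c * (1 + norm (X t w)))\<^sup>2"
          unfolding feedback_control_def by (rule power_mono[OF c(2)[OF t] norm_ge_zero])
        also have "\<dots> = c\<^sup>2 * (1 + norm (X t w))\<^sup>2" by (rule power_mult_distrib)
        also have "\<dots> \<le> c\<^sup>2 * (2 + 2 * \<zeta> w)"
        proof (rule mult_left_mono)
          have "(1 + norm (X t w))\<^sup>2 \<le> 2 + 2 * (norm (X t w))\<^sup>2"
            using sum_squares_bound[of 1 "norm (X t w)"] by (simp add: power2_sum)
          then show "(1 + norm (X t w))\<^sup>2 \<le> 2 + 2 * \<zeta> w" using bspec[OF elim t] by linarith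
        qed simp
        finally show "(norm (ctrl t w))\<^sup>2 \<le> c\<^sup>2 * (2 + 2 * \<zeta> w)" .
      qed
    qed
  qed
  ultimately show ?thesis by (simp add: regular_process_def)
qed

lemma ctrl_adapted: "t \<in> {0..T} \<Longrightarrow> ctrl t \<in> borel_measurable (F t)"
  unfolding feedback_control_def[abs_def]
  by (rule measurable_compose[OF X_adapted measurable_along_fixed[OF u_measurable]])

lemma ctrl_progressive: "progressive F T ctrl"
  unfolding progressive_def
proof
  fix t assume t: "t \<in> {0..T}"
  let ?N = "restrict_space borel {0..t} \<Otimes>\<^sub>M F t"
  have X: "(\<lambda>(s, w). X s w) \<in> borel_measurable ?N"
    using state t by (simp add: state_process_def progressive_def)
  have "(\<lambda>s::real. s) \<in> measurable (restrict_space borel {0..t}) (restrict_space borel {0..T})"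
    using t by (intro measurable_restrict_space2 measurable_restrict_space1) (auto simp: space_restrict_space)
  from measurable_along[OF u_measurable measurable_compose[OF measurable_fst this] X]
  show "(\<lambda>(s, w). ctrl s w) \<in> borel_measurable ?N"
    by (simp add: feedback_control_def case_prod_beta')
qed

lemma ctrl_admissible: "admissible M F T ctrl"
  using ctrl_progressive L2_integrable[OF regular_process_L2_time[OF ctrl_regular]]
  by (simp add: admissible_def case_prod_beta')

text \<open>The derivatives of \<open>u\<close> are bounded while \<open>u\<close> grows linearly,
  which keeps the products in the derivative of the closed-loop cost within linear growth.\<close>

lemma closed_loop_driver:
  "\<exists>K. driver_conditions M T X K (cl_drift_dx \<sigma> bx ux) (cl_drift_dm \<sigma> bm um) (cl_cost_dx fx u ux) (cl_cost_dm fm u um)"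
proof -
  obtain K0 where D: "driver_conditions M T X K0 bx bm fx fm" using open_loop_driver[OF X_regular] by blast
  obtain Ks where Ks: "Ks \<ge> 0" "\<And>t. t \<in> {0..T} \<Longrightarrow> norm (\<sigma> t) \<le> Ks" using sigma_bound by blast
  obtain Ku where Ku: "Ku \<ge> 0" "\<And>t x y. t \<in> {0..T} \<Longrightarrow> norm (ux t x (law M X t)) \<le> Ku \<and> norm (um t x (law M X t) y) \<le> Ku"
    using u_derivative_bound by blast
  obtain c where c: "c \<ge> 0" "\<And>t x. t \<in> {0..T} \<Longrightarrow> norm (u t x (law M X t)) \<le> c * (1 + norm x)"
    using u_growth by blast
  have K0: "0 \<le> K0" using D by (simp add: driver_conditions_def)
  have uxc: "continuous_on ({0..T} \<times> UNIV) (\<lambda>(t, x). ux t x (law M X t))"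
    and umc: "continuous_on ({0..T} \<times> UNIV) (\<lambda>(t, z). um t (fst z) (law M X t) (snd z))"
  proof -
    have c: "continuous_P2 T ux" "continuous_P2 T (\<lambda>t (x, y) \<mu>. um t x \<mu> y)"
      using feedback by (auto simp: regular_feedback_def C1_vector_def)
    show "continuous_on ({0..T} \<times> UNIV) (\<lambda>(t, x). ux t x (law M X t))"
      "continuous_on ({0..T} \<times> UNIV) (\<lambda>(t, z). um t (fst z) (law M X t) (snd z))"
      by (rule continuous_P2_along[OF X_regular c(1)], rule continuous_P2_along2[OF X_regular c(2)])
  qed
  have sc: "continuous_on ({0..T} \<times> UNIV) (\<lambda>z. \<sigma> (fst z))"
    by (rule continuous_on_compose2[OF sigma_continuous continuous_on_fst[OF continuous_on_id]]) auto
  have uc2: "continuous_on ({0..T} \<times> UNIV) (\<lambda>z. u (fst z) (fst (snd z)) (law M X (fst z)))"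
  proof -
    have "continuous_on ({0..T} \<times> UNIV) (\<lambda>z. (\<lambda>(t, x). u t x (law M X t)) (fst z, fst (snd z)))"
      by (rule continuous_on_compose2[OF u_continuous]) (auto intro!: continuous_intros)
    then show ?thesis by simp
  qed
  \<comment> \<open>\<open>K0\<close> stems from the open-loop derivatives, \<open>Ks * Ku\<close>
    from \<sigma> times a derivative of \<open>u\<close>, and \<open>Ku * c\<close> from the
    derivative of half the squared norm of \<open>u\<close>.\<close>
  define K where "K = K0 + Ks * Ku + Ku * c"
  have nn: "0 \<le> Ks * Ku" "0 \<le> Ku * c" using Ks Ku c by auto
  have "driver_conditions M T X K (cl_drift_dx \<sigma> bx ux) (cl_drift_dm \<sigma> bm um) (cl_cost_dx fx u ux) (cl_cost_dm fm u um)"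
    unfolding driver_conditions_def
  proof (intro conjI ballI allI)
    show "0 \<le> K" using K0 nn by (simp add: K_def)
    show "continuous_on ({0..T} \<times> UNIV) (\<lambda>(t, x). cl_drift_dx \<sigma> bx ux t x (law M X t))"
      using D uxc unfolding driver_conditions_def cl_drift_dx_def case_prod_beta'
      by (intro continuous_on_add continuous_on_matrix_mult sc) auto
    show "continuous_on ({0..T} \<times> UNIV) (\<lambda>(t, z). cl_drift_dm \<sigma> bm um t (fst z) (law M X t) (snd z))"
      using D umc unfolding driver_conditions_def cl_drift_dm_def case_prod_beta'
      by (intro continuous_on_add continuous_on_matrix_mult sc) auto
    show "continuous_on ({0..T} \<times> UNIV) (\<lambda>(t, x). cl_cost_dx fx u ux t x (law M X t))"
      using D uxc u_continuous unfolding driver_conditions_def cl_cost_dx_def case_prod_beta'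
      by (intro continuous_on_add continuous_matrix_vector) auto
    show "continuous_on ({0..T} \<times> UNIV) (\<lambda>(t, z). cl_cost_dm fm u um t (fst z) (law M X t) (snd z))"
      using D umc uc2 unfolding driver_conditions_def cl_cost_dm_def case_prod_beta'
      by (intro continuous_on_add continuous_matrix_vector) auto
    fix t x y assume t: "t \<in> {0..T}"
    have 0: "norm (bx t x (law M X t)) \<le> K0" "norm (bm t x (law M X t) y) \<le> K0"
      "norm (fx t x (law M X t)) \<le> K0 * (1 + norm x)" "norm (fm t x (law M X t) y) \<le> K0 * (1 + norm x + norm y)"
      using D t by (auto simp: driver_conditions_def)
    have 1: "norm (\<sigma> t ** ux t x (law M X t)) \<le> Ks * Ku" "norm (\<sigma> t ** um t x (law M X t) y) \<le> Ks * Ku"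
      using Ks Ku(1) Ku(2)[OF t, of x y] t by (auto intro!: order_trans[OF norm_matrix_mult_le] mult_mono)
    have 2: "norm (transpose (ux t x (law M X t)) *v u t x (law M X t)) \<le> Ku * (c * (1 + norm x))"
      "norm (transpose (um t x (law M X t) y) *v u t x (law M X t)) \<le> Ku * (c * (1 + norm x))"
      using c(2)[OF t, of x] Ku(1) Ku(2)[OF t, of x y]
      by (intro order_trans[OF norm_transpose_vector_le] mult_mono; blast intro: norm_ge_zero)+
    show "norm (cl_drift_dx \<sigma> bx ux t x (law M X t)) \<le> K" "norm (cl_drift_dm \<sigma> bm um t x (law M X t) y) \<le> K"
      unfolding cl_drift_dx_def cl_drift_dm_def K_def using 0(1,2) 1 nn
      by (intro norm_triangle_le; linarith)+
    have "norm (cl_cost_dx fx u ux t x (law M X t)) \<le> K0 * (1 + norm x) + Ku * (c * (1 + norm x))"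
      unfolding cl_cost_dx_def using 0(3) 2(1) by (intro norm_triangle_le add_mono)
    also have "\<dots> \<le> K * (1 + norm x)"
    proof -
      have "K * (1 + norm x) = (K0 * (1 + norm x) + Ku * (c * (1 + norm x))) + Ks * Ku * (1 + norm x)"
        by (simp add: K_def algebra_simps)
      moreover have "0 \<le> Ks * Ku * (1 + norm x)" using nn by simp
      ultimately show ?thesis by linarith
    qed
    finally show "norm (cl_cost_dx fx u ux t x (law M X t)) \<le> K * (1 + norm x)" .
    have "norm (cl_cost_dm fm u um t x (law M X t) y) \<le> K0 * (1 + norm x + norm y) + Ku * (c * (1 + norm x))"
      unfolding cl_cost_dm_def using 0(4) 2(2) by (intro norm_triangle_le add_mono)
    also have "\<dots> \<le> K * (1 + norm x + norm y)"
    proof -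
      have "K * (1 + norm x + norm y) = (K0 * (1 + norm x + norm y) + Ku * (c * (1 + norm x)))
          + (Ks * Ku * (1 + norm x + norm y) + Ku * c * norm y)"
        by (simp add: K_def algebra_simps)
      moreover have "0 \<le> Ks * Ku * (1 + norm x + norm y)" "0 \<le> Ku * c * norm y" using nn by auto
      ultimately show ?thesis by linarith
    qed
    finally show "norm (cl_cost_dm fm u um t x (law M X t) y) \<le> K * (1 + norm x + norm y)" .
  qed
  then show ?thesis by blast
qed

lemma cl_driver_L2: "(\<lambda>(t, w). cl_driver t w) \<in> L2 (dt_dP M T)" "t \<in> {0..T} \<Longrightarrow> cl_driver t \<in> L2 M"
  using closed_loop_driver adjoint_driver_regular[OF X_regular a_regular] by blast+

text \<open>The fundamental theorem of calculus produces a gauge integral along each path; almost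
  surely the driver is Lebesgue integrable, and then both integrals agree.\<close>

lemma basic_adjoint_equation:
  assumes r: "r \<in> {0..T}"
  shows "AE w in M. a r w = a T w + (LINT q:{r..T}|lborel. cl_driver q w)"
proof -
  have d: "AE w in M. \<forall>t\<in>{0..T}. ((\<lambda>s. a s w) has_vector_derivative - cl_driver t w) (at t within {0..T})"
    using basic_adj by (simp add: basic_adjoint_def)
  have "AE w in M. set_integrable lborel {r..T} (\<lambda>q. cl_driver q w)"
    using L2_time_integral(3)[OF prob_space_axioms cl_driver_L2(1), of r T] r by auto
  then show ?thesis using d
  proof eventually_elim
    case (elim w)
    have "((\<lambda>q. - cl_driver q w) has_integral (a T w - a r w)) {r..T}"
      using elim(2) r
    proof (intro fundamental_theorem_of_calculus)
      fix x assume "x \<in> {r..T}"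
      then have "x \<in> {0..T}" "{r..T} \<subseteq> {0..T}" using r by auto
      then show "((\<lambda>s. a s w) has_vector_derivative - cl_driver x w) (at x within {r..T})"
        using elim(2) has_vector_derivative_within_subset by blast
    qed simp
    from has_integral_neg[OF this] have "integral {r..T} (\<lambda>q. cl_driver q w) = - (a T w - a r w)"
      by (intro integral_unique) simp
    then show ?case
      using set_borel_integral_eq_integral(2)[OF elim(1)] by simp
  qed
qed

lemma drift_sigma_L2:
  fixes \<beta> :: "real \<Rightarrow> 'w \<Rightarrow> real^'m"
  assumes X': "regular_process M T X'" and \<beta>: "(\<lambda>(t, w). \<beta> t w) \<in> L2 (dt_dP M T)"
  shows "(\<lambda>(t, w). b t (X' t w) (law M X' t) + \<sigma> t *v \<beta> t w) \<in> L2 (dt_dP M T)"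
proof -
  obtain Ks where Ks: "Ks \<ge> 0" "\<And>t. t \<in> {0..T} \<Longrightarrow> norm (\<sigma> t) \<le> Ks" using sigma_bound by blast
  have m: "(\<lambda>z. \<sigma> (fst z)) \<in> borel_measurable (dt_dP M T)"
    by (rule measurable_compose[OF measurable_fst_dt_dP sigma_time_measurable])
  have "(\<lambda>z. \<sigma> (fst z) *v (case z of (t, w) \<Rightarrow> \<beta> t w)) \<in> L2 (dt_dP M T)"
    by (rule L2_matrix(1)[OF m \<beta> Ks(1)])
      (use Ks(2) in \<open>auto simp: dt_dP_def space_pair_measure space_restrict_space\<close>)
  from L2_add(1)[OF drift_L2(1)[OF X'] this] show ?thesis
    by (simp add: case_prod_beta')
qed

text \<open>One version \<open>S\<close> of the noise integral serves all subintervals. The form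
  between \<open>t\<close> and \<open>r\<close> is used for the Markov property, the form from 0 for
  the comparison of two states.\<close>

lemma state_increment:
  assumes X': "state_process M T X0 W \<sigma> b \<beta> X'" and \<beta>: "(\<lambda>(t, w). \<beta> t w) \<in> L2 (dt_dP M T)"
  obtains S where "ito_integral M F T W (\<lambda>t w. \<sigma> t) S"
    "\<And>t r. 0 \<le> t \<Longrightarrow> t \<le> r \<Longrightarrow> r \<le> T \<Longrightarrow> AE w in M. X' r w = X' t w
       + (LINT q:{t..r}|lborel. b q (X' q w) (law M X' q) + \<sigma> q *v \<beta> q w) + (S r w - S t w)"
    "\<And>r. r \<in> {0..T} \<Longrightarrow> AE w in M. X' r w = X0 w
       + (LINT q:{0..r}|lborel. b q (X' q w) (law M X' q) + \<sigma> q *v \<beta> q w) + S r w"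
proof -
  obtain S where S: "ito_integral M F T W (\<lambda>t w. \<sigma> t) S"
    and eq: "AE w in M. \<forall>t\<in>{0..T}. X' t w = X0 w
       + (LINT s:{0..t}|lborel. b s (X' s w) (law M X' s) + \<sigma> s *v \<beta> s w) + S t w"
    using X' unfolding state_process_def by blast
  note L = drift_sigma_L2[OF state_process_regular(1)[OF X'] \<beta>]
  have 1: "AE w in M. X' r w = X' t w
       + (LINT q:{t..r}|lborel. b q (X' q w) (law M X' q) + \<sigma> q *v \<beta> q w) + (S r w - S t w)"
    if tr: "0 \<le> t" "t \<le> r" "r \<le> T" for t r
  proof -
    have "AE w in M. set_integrable lborel {0..r} (\<lambda>q. b q (X' q w) (law M X' q) + \<sigma> q *v \<beta> q w)"
      using L2_time_integral(3)[OF prob_space_axioms L, of 0 r] tr by auto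
    then show ?thesis using eq
    proof eventually_elim
      case (elim w)
      have "X' r w = X0 w + (LINT s:{0..r}|lborel. b s (X' s w) (law M X' s) + \<sigma> s *v \<beta> s w) + S r w"
        "X' t w = X0 w + (LINT s:{0..t}|lborel. b s (X' s w) (law M X' s) + \<sigma> s *v \<beta> s w) + S t w"
        using elim(2) tr by auto
      then show ?case using set_integral_split[OF elim(1) tr(1,2)] by simp
    qed
  qed
  have 2: "AE w in M. X' r w = X0 w
       + (LINT q:{0..r}|lborel. b q (X' q w) (law M X' q) + \<sigma> q *v \<beta> q w) + S r w" if "r \<in> {0..T}" for r
    using eq by eventually_elim (use that in auto)
  show thesis by (rule that[OF S 1 2])
qed

end

section \<open>The Markov property of the closed loop\<close>

context closed_loop
begin

definition present :: "real \<Rightarrow> 'w measure" where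
  "present t = sigma (space M) (generated M {()} (\<lambda>_. X t))"

text \<open>A pi-system that generates the information in the state at time \<open>t\<close> and the
  increments of \<open>W\<close> after \<open>t\<close>. Its product form lets independence act on
  one factor only.\<close>

definition future_sets :: "real \<Rightarrow> 'w set set" where
  "future_sets t = {B \<inter> D | B D. B \<in> sets (present t) \<and> D \<in> sets (increments {t<..T} t)}"

definition future :: "real \<Rightarrow> 'w measure" where
  "future t = sigma (space M) (future_sets t)"

lemma space_present [simp]: "space (present t) = space M"
  unfolding present_def by (rule space_measure_of[OF generated_subset_Pow])

lemma sets_present: "sets (present t) = generated M {()} (\<lambda>_. X t)"
  unfolding present_def by (rule sets_generated)

lemma X_present: "X t \<in> borel_measurable (present t)"
  unfolding present_def by (rule measurable_generated[of "()" "{()}" "\<lambda>_. X t"]) simp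

lemma present_subset: "t \<in> {0..T} \<Longrightarrow> sets (present t) \<subseteq> sets (F t)"
  unfolding sets_present by (rule generated_least[OF space_filt X_adapted])

lemma increments_future_subset: "t \<in> {0..T} \<Longrightarrow> sets (increments {t<..T} t) \<subseteq> sets M"
  by (rule increments_subset) auto

lemma future_sets_subset:
  assumes t: "t \<in> {0..T}" shows "future_sets t \<subseteq> sets M"
proof -
  have "sets (present t) \<subseteq> sets M" using present_subset[OF t] sets_filt_subset[of t] t by auto
  then show ?thesis
    using increments_future_subset[OF t] unfolding future_sets_def by auto
qed

context
  fixes t :: real
  assumes t: "t \<in> {0..T}"
begin

lemma future_sets_Pow: "future_sets t \<subseteq> Pow (space M)"
  using future_sets_subset[OF t] sets.space_closed by blast

lemma space_future [simp]: "space (future t) = space M"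
  unfolding future_def by (rule space_measure_of[OF future_sets_Pow])

lemma sets_future: "sets (future t) = sigma_sets (space M) (future_sets t)"
  unfolding future_def by (rule sets_measure_of[OF future_sets_Pow])

lemma subalgebra_future: "subalgebra M (future t)"
  unfolding subalgebra_def sets_future using sets.sigma_sets_subset[OF future_sets_subset[OF t]] by simp

lemma subalgebra_present_filt: "subalgebra (F t) (present t)"
  unfolding subalgebra_def using present_subset[OF t] by simp

lemma subalgebra_present: "subalgebra M (present t)"
  unfolding subalgebra_def using present_subset[OF t] sets_filt_subset[of t] t by auto

lemma subalgebra_future_present: "subalgebra (future t) (present t)"
proof -
  have "B \<in> sets (future t)" if B: "B \<in> sets (present t)" for B
  proof -
    have "B = B \<inter> space (increments {t<..T} t)" using sets.sets_into_space[OF B] by auto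
    then have "B \<in> future_sets t" unfolding future_sets_def using B by blast
    then show ?thesis unfolding sets_future by (rule sigma_sets.Basic)
  qed
  then show ?thesis unfolding subalgebra_def by auto
qed

lemma subalgebra_future_increments: "subalgebra (future t) (increments {t<..T} t)"
proof -
  have "D \<in> sets (future t)" if D: "D \<in> sets (increments {t<..T} t)" for D
  proof -
    have "D = space (present t) \<inter> D" using sets.sets_into_space[OF D] by auto
    then have "D \<in> future_sets t" unfolding future_sets_def using D by blast
    then show ?thesis unfolding sets_future by (rule sigma_sets.Basic)
  qed
  then show ?thesis unfolding subalgebra_def by auto
qed

interpretation G: finite_measure_subalgebra M "future t"
  by unfold_locales (rule subalgebra_future)

interpretation P: finite_measure_subalgebra M "present t"
  by unfold_locales (rule subalgebra_present)

lemma X_future_measurable: "X t \<in> borel_measurable (future t)"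
  by (rule measurable_from_subalg[OF subalgebra_future_present X_present])

lemma drift_lipschitz_along:
  "\<exists>L\<ge>0. \<forall>q\<in>{0..T}. \<forall>x y. norm ((b q x (law M X q) + \<sigma> q *v u q x (law M X q))
      - (b q y (law M X q) + \<sigma> q *v u q y (law M X q))) \<le> L * norm (x - y)"
proof -
  obtain Lb where Lb: "Lb \<ge> 0" "\<And>q x y. q \<in> {0..T} \<Longrightarrow> norm (b q x (law M X q) - b q y (law M X q)) \<le> Lb * norm (x - y)"
    using b_lipschitz_along[OF X_regular] by blast
  obtain Lu where Lu: "Lu \<ge> 0" "\<And>q x y. q \<in> {0..T} \<Longrightarrow> norm (u q x (law M X q) - u q y (law M X q)) \<le> Lu * norm (x - y)"
    using u_lipschitz by blast
  obtain Ks where Ks: "Ks \<ge> 0" "\<And>t. t \<in> {0..T} \<Longrightarrow> norm (\<sigma> t) \<le> Ks" using sigma_bound by blast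
  have "norm ((b q x (law M X q) + \<sigma> q *v u q x (law M X q)) - (b q y (law M X q) + \<sigma> q *v u q y (law M X q)))
      \<le> (Lb + Ks * Lu) * norm (x - y)" if q: "q \<in> {0..T}" for q x y
  proof -
    have "norm (\<sigma> q *v (u q x (law M X q) - u q y (law M X q))) \<le> Ks * (Lu * norm (x - y))"
      using Ks(1) Ks(2)[OF q] Lu(2)[OF q, of x y] by (intro order_trans[OF norm_matrix_vector_le] mult_mono) auto
    then have "norm ((b q x (law M X q) - b q y (law M X q)) + \<sigma> q *v (u q x (law M X q) - u q y (law M X q)))
        \<le> Lb * norm (x - y) + Ks * (Lu * norm (x - y))"
      by (intro norm_triangle_le add_mono Lb(2)[OF q])
    then show ?thesis by (simp add: matrix_vector_mult_diff_distrib algebra_simps)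
  qed
  then show ?thesis using Lb Lu Ks by (intro exI[of _ "Lb + Ks * Lu"]) auto
qed

text \<open>Forward iteration for the distance of \<open>X\<close> to the
  \<open>future t\<close>-measurable vectors. The initial value \<open>X t\<close> is measurable and
  the noise increment is a limit of measurable vectors; the drift at a time \<open>q\<close> can be
  approximated by its value at the projection of \<open>X q\<close>, at the cost of its Lipschitz
  constant.\<close>

lemma X_future:
  assumes r: "t \<le> r" "r \<le> T"
  shows "AE w in M. X r w = cond_proj M (future t) (X r) w"
proof -
  have t0: "0 \<le> t" "t \<le> T" using t by auto
  obtain L where L: "L \<ge> 0" "\<And>q x y. q \<in> {0..T} \<Longrightarrow> norm ((b q x (law M X q) + \<sigma> q *v u q x (law M X q))
      - (b q y (law M X q) + \<sigma> q *v u q y (law M X q))) \<le> L * norm (x - y)"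
    using drift_lipschitz_along by blast
  obtain K where K: "K \<ge> 0" "\<And>t. t \<in> {0..T} \<Longrightarrow> L2_norm M (X t) \<le> K"
    using regular_process_norm_bound[OF X_regular] by blast
  note ctrl_L2 = regular_process_L2_time[OF ctrl_regular]
  obtain S where S: "ito_integral M F T W (\<lambda>t w. \<sigma> t) S"
    and inc: "\<And>t r. 0 \<le> t \<Longrightarrow> t \<le> r \<Longrightarrow> r \<le> T \<Longrightarrow> AE w in M. X r w = X t w
       + (LINT q:{t..r}|lborel. b q (X q w) (law M X q) + \<sigma> q *v ctrl q w) + (S r w - S t w)"
    by (rule state_increment[OF state ctrl_L2]) (rule that)
  define dr where "dr q w = b q (X q w) (law M X q) + \<sigma> q *v ctrl q w" for q w
  have dr: "(\<lambda>(q, w). dr q w) \<in> L2 (dt_dP M T)"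
    unfolding dr_def by (rule drift_sigma_L2[OF X_regular ctrl_L2])
  have drq: "dr q \<in> L2 M" if q: "q \<in> {0..T}" for q
    unfolding dr_def[abs_def]
    by (intro L2_add(1) drift_L2(2)[OF X_regular q] L2_matrix(1)[where c="norm (\<sigma> q)"] regular_process_L2[OF ctrl_regular q]) auto
  \<comment> \<open>The argument is the time elapsed since \<open>t\<close>, so that the iteration
    starts at 0.\<close>
  define N where "N s = L2_norm M (\<lambda>w. X (t + s) w - cond_proj M (future t) (X (t + s)) w)" for s
  have XL: "X q \<in> L2 M" if "q \<in> {0..T}" for q by (rule regular_process_L2[OF X_regular that])
  have small: "\<exists>\<kappa>. 0 \<le> \<kappa> \<and> \<kappa> < \<epsilon> \<and> N s \<le> \<kappa>" if s: "s \<in> {0..T - t}" and \<epsilon>: "0 < \<epsilon>" for s \<epsilon>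
  proof (rule gronwall_iterate[of L K "T - t", OF L(1) K(1) _ _ s \<epsilon>])
    fix s assume "s \<in> {0..T - t}"
    then have q: "t + s \<in> {0..T}" using t by auto
    \<comment> \<open>The starting bound: 0 is a competitor for the projection.\<close>
    show "N s \<le> K"
      using G.cond_proj_residual_norm_le[OF XL[OF q] L2_zero] K(2)[OF q] by (simp add: N_def)
  next
    fix c s :: real and n :: nat
    assume c: "0 \<le> c" and s: "s \<in> {0..T - t}" and IH: "\<And>s'. s' \<in> {0..s} \<Longrightarrow> N s' \<le> c * s' ^ n"
    have q: "t + s \<in> {0..T}" and ts: "t \<le> t + s" "t + s \<le> T" using t s by auto
    let ?k = "\<lambda>q. L * c * (q - t) ^ n"
    note val = set_integral_powers(1)[OF ts(1), of "L * c" n]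
    have \<eta>: "(\<lambda>w. X t w + (S (t + s) w - S t w)) \<in> L2 M"
      by (intro L2_add(1) L2_diff XL[OF t] ito_integral_D(2)[OF S q] ito_integral_D(2)[OF S t])
    have "N s \<le> (LINT q:{t..t + s}|lborel. ?k q)"
      unfolding N_def
    proof (rule G.cond_proj_time_integral[OF prob_space_axioms XL[OF q] \<eta> _ dr t0(1) ts(2)])
      fix \<epsilon> :: real assume \<epsilon>: "0 < \<epsilon>"
      obtain \<eta>' where \<eta>': "\<eta>' \<in> L2 M" "\<eta>' \<in> borel_measurable (increments {t<..T} t)"
        "L2_norm M (\<lambda>w. (S (t + s) w - S t w) - \<eta>' w) \<le> \<epsilon>"
        using wiener_increment_approx[OF S t0(1) ts \<epsilon>] by blast
      have m: "(\<lambda>w. X t w + \<eta>' w) \<in> borel_measurable (future t)"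
        by (intro borel_measurable_add X_future_measurable
            measurable_from_subalg[OF subalgebra_future_increments \<eta>'(2)])
      have e: "(\<lambda>w. (X t w + (S (t + s) w - S t w)) - (X t w + \<eta>' w)) = (\<lambda>w. (S (t + s) w - S t w) - \<eta>' w)"
        by simp
      show "\<exists>\<eta>'. \<eta>' \<in> L2 M \<and> \<eta>' \<in> borel_measurable (future t) \<and>
          L2_norm M (\<lambda>w. X t w + (S (t + s) w - S t w) - \<eta>' w) \<le> \<epsilon>"
        by (intro exI[of _ "\<lambda>w. X t w + \<eta>' w"] conjI L2_add(1) XL[OF t] \<eta>'(1) m) (unfold e, rule \<eta>'(3))
    next
      show "AE w in M. X (t + s) w = X t w + (S (t + s) w - S t w) + (LINT q:{t..t + s}|lborel. dr q w)"
        using inc[OF t0(1) ts] by eventually_elim (simp add: dr_def)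
    next
      fix q assume q': "q \<in> {t..t + s}"
      then have q: "q \<in> {0..T}" and qs: "q - t \<in> {0..s}" using t ts by auto
      define \<xi> where "\<xi> = cond_proj M (future t) (X q)"
      have \<xi>: "\<xi> \<in> L2 M" "\<xi> \<in> borel_measurable (future t)"
        unfolding \<xi>_def by (rule G.cond_proj_L2[OF XL[OF q]], rule G.cond_proj_measurable)
      \<comment> \<open>A measurable competitor for the drift; it need not be the projection of
        \<open>dr q\<close>, since the projection is at least as close.\<close>
      define \<gamma> where "\<gamma> w = b q (\<xi> w) (law M X q) + \<sigma> q *v u q (\<xi> w) (law M X q)" for w
      have hm: "(\<lambda>x. b q x (law M X q) + \<sigma> q *v u q x (law M X q)) \<in> borel_measurable borel"
        by (intro borel_measurable_add borel_measurable_matrix_vector borel_measurable_const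
            measurable_along_fixed[OF b_measurable_along[OF X_regular] q] measurable_along_fixed[OF u_measurable q])
      have \<gamma>m: "\<gamma> \<in> borel_measurable (future t)"
        unfolding \<gamma>_def[abs_def] by (rule measurable_compose[OF \<xi>(2) hm])
      have dm: "(\<lambda>w. dr q w - \<gamma> w) \<in> borel_measurable M"
        by (intro borel_measurable_diff L2_measurable[OF drq[OF q]] G.measurable_sub[OF \<gamma>m])
      have "AE w in M. norm (dr q w - \<gamma> w) \<le> L * norm (X q w - \<xi> w)"
        unfolding dr_def \<gamma>_def feedback_control_def by (intro AE_I2 L(2)[OF q])
      note D = L2_bound[OF dm L2_diff[OF XL[OF q] \<xi>(1)] L(1) this]
      have \<gamma>L: "\<gamma> \<in> L2 M"
        using L2_diff[OF drq[OF q] D(1)] by simp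
      have "L2_norm M (\<lambda>w. X q w - \<xi> w) \<le> c * (q - t) ^ n"
        using IH[OF qs] by (simp add: N_def \<xi>_def)
      then have "L2_norm M (\<lambda>w. dr q w - \<gamma> w) \<le> L * (c * (q - t) ^ n)"
        by (intro order_trans[OF D(2)] mult_left_mono L(1))
      then have "L2_norm M (\<lambda>w. dr q w - \<gamma> w) \<le> ?k q" by (simp only: mult.assoc)
      then show "dr q \<in> L2 M \<and> (\<exists>\<gamma>. \<gamma> \<in> L2 M \<and> \<gamma> \<in> borel_measurable (future t) \<and> L2_norm M (\<lambda>w. dr q w - \<gamma> w) \<le> ?k q)"
        using drq[OF q] \<gamma>L \<gamma>m by blast
    next
      show "continuous_on {t..t + s} ?k" by (intro continuous_intros)
      show "0 \<le> (LINT q:{t..t + s}|lborel. ?k q)"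
        unfolding val using L(1) c s by (intro divide_nonneg_nonneg mult_nonneg_nonneg zero_le_power) auto
    qed
    then show "N s \<le> L * c * s ^ Suc n / real (Suc n)"
      unfolding val by simp
  qed
  show ?thesis
  proof (rule G.AE_eq_cond_proj)
    have q: "r \<in> {0..T}" "r - t \<in> {0..T - t}" using r t by auto
    show "X r \<in> L2 M" by (rule XL[OF q(1)])
    fix \<epsilon> :: real assume "0 < \<epsilon>"
    from small[OF q(2) this] have "L2_norm M (\<lambda>w. X r w - cond_proj M (future t) (X r) w) \<le> \<epsilon>"
      by (auto simp: N_def)
    then show "\<exists>\<eta>. \<eta> \<in> L2 M \<and> \<eta> \<in> borel_measurable (future t) \<and> L2_norm M (\<lambda>w. X r w - \<eta> w) \<le> \<epsilon>"
      using G.cond_proj_L2[OF XL[OF q(1)]] G.cond_proj_measurable by blast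
  qed
qed

text \<open>This carries \<open>X_future\<close> at time \<open>T\<close> over to the terminal value
  of \<open>a\<close>.\<close>

lemma adjoint_terminal_measurable:
  "\<exists>h. h \<in> borel_measurable borel \<and> (\<forall>w. adjoint_terminal M T gx gm X w = h (X T w))"
proof -
  have T: "T \<in> {0..T}" using T_pos by simp
  have c: "continuous_P2 T (\<lambda>_. gx)" "continuous_P2 T (\<lambda>_ (x, y) \<mu>. gm x \<mu> y)"
    using g_C1 by (auto simp: C1_scalar_def)
  have 1: "(\<lambda>x. gx x (law M X T)) \<in> borel_measurable borel"
    using measurable_along_fixed[OF continuous_measurable_time[OF continuous_P2_along[OF X_regular c(1)]] T] .
  have m2: "(\<lambda>z. gm (fst z) (law M X T) (snd z)) \<in> borel_measurable borel"
    using measurable_along_fixed[OF continuous_measurable_time[OF continuous_P2_along2[OF X_regular c(2)]] T] .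
  have XT: "X T \<in> borel_measurable M" by (rule regular_process_measurable[OF X_regular T])
  have "(\<lambda>z. (X T (snd z), fst z)) \<in> measurable (borel \<Otimes>\<^sub>M M) (borel :: ((real^'d) \<times> (real^'d)) measure)"
    unfolding borel_prod[symmetric] using XT by measurable
  from measurable_compose[OF this m2]
  have "(\<lambda>(x, w'). gm (X T w') (law M X T) x) \<in> borel_measurable (borel \<Otimes>\<^sub>M M)"
    by (simp add: case_prod_beta')
  from borel_measurable_lebesgue_integral[OF this]
  have 2: "(\<lambda>x. \<integral>w'. gm (X T w') (law M X T) x \<partial>M) \<in> borel_measurable borel" .
  show ?thesis
    by (intro exI[of _ "\<lambda>x. gx x (law M X T) + (\<integral>w'. gm (X T w') (law M X T) x \<partial>M)"] conjI
        borel_measurable_add 1 2) (simp add: adjoint_terminal_def)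
qed

text \<open>Backward iteration from \<open>T\<close>. At each time the driver is affine in
  \<open>a\<close>, with coefficients that are functions of the state alone, and by
  \<open>X_future\<close> the state is already measurable up to null sets. Only the projection error
  of \<open>a\<close> itself is left to estimate.\<close>

lemma a_future:
  "AE w in M. a t w = cond_proj M (future t) (a t) w"
proof -
  have T: "T \<in> {0..T}" and t0: "0 \<le> t" "t \<le> T" using T_pos t by auto
  note aL = regular_process_L2[OF a_regular]
  obtain K0 where D: "driver_conditions M T X K0 (cl_drift_dx \<sigma> bx ux) (cl_drift_dm \<sigma> bm um) (cl_cost_dx fx u ux) (cl_cost_dm fm u um)"
    using closed_loop_driver by blast
  have K0: "0 \<le> K0" using D by (simp add: driver_conditions_def)
  obtain K where K: "K \<ge> 0" "\<And>t. t \<in> {0..T} \<Longrightarrow> L2_norm M (a t) \<le> K"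
    using regular_process_norm_bound[OF a_regular] by blast
  \<comment> \<open>\<open>A\<close> is the linear coefficient. \<open>C\<close> below collects all
    terms that do not contain \<open>a\<close> at the same sample point; the average over the copy
    of \<open>a\<close> counts among them.\<close>
  define A where "A q x = cl_drift_dx \<sigma> bx ux q x (law M X q)" for q x
  define C where "C q x = cl_cost_dx fx u ux q x (law M X q)
      + mean_field M (cl_drift_dm \<sigma> bm um) (cl_cost_dm fm u um) X a q x" for q x
  have Am: "A q \<in> borel_measurable borel" if "q \<in> {0..T}" for q
    unfolding A_def[abs_def] by (rule measurable_along_fixed[OF driver_A_measurable[OF X_regular a_regular D] that])
  have Cm: "C q \<in> borel_measurable borel" if "q \<in> {0..T}" for q
    unfolding C_def[abs_def]
    by (intro borel_measurable_add measurable_along_fixed[OF driver_C_measurable[OF X_regular a_regular D] that]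
        measurable_along_fixed[OF mean_field_term_measurable[OF X_regular a_regular D] that])
  have drv: "cl_driver q w = transpose (A q (X q w)) *v a q w + C q (X q w)" for q w
    by (simp only: adjoint_driver_mean_field A_def C_def add.assoc)
  have AK: "norm (A q x) \<le> K0" if "q \<in> {0..T}" for q x
    using D that by (simp add: A_def driver_conditions_def)
  \<comment> \<open>The argument is the time left until \<open>T\<close>, so that the iteration
    starts at the terminal time.\<close>
  define N where "N s = L2_norm M (\<lambda>w. a (T - s) w - cond_proj M (future t) (a (T - s)) w)" for s
  \<comment> \<open>The terminal value coincides almost surely with the same function of the
    projected state, which is measurable without exceptional sets.\<close>
  have aT: "\<exists>\<eta>'. \<eta>' \<in> L2 M \<and> \<eta>' \<in> borel_measurable (future t) \<and> L2_norm M (\<lambda>w. a T w - \<eta>' w) = 0"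
  proof -
    obtain h where h: "h \<in> borel_measurable borel" "\<And>w. adjoint_terminal M T gx gm X w = h (X T w)"
      using adjoint_terminal_measurable by blast
    define \<eta> where "\<eta> w = h (cond_proj M (future t) (X T) w)" for w
    have m: "\<eta> \<in> borel_measurable (future t)"
      unfolding \<eta>_def[abs_def] by (rule measurable_compose[OF G.cond_proj_measurable h(1)])
    have "AE w in M. a T w = adjoint_terminal M T gx gm X w"
      using basic_adj by (simp add: basic_adjoint_def)
    then have eq: "AE w in M. \<eta> w = a T w"
      using X_future[OF t0(2) order_refl] by eventually_elim (simp add: \<eta>_def h(2))
    have mM: "\<eta> \<in> borel_measurable M" by (rule G.measurable_sub[OF m])
    have L: "\<eta> \<in> L2 M" by (rule L2_cong_AE[OF mM aL[OF T] eq])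
    have "AE w in M. norm (a T w - \<eta> w) \<le> 0 * norm (a T w)" using eq by eventually_elim simp
    then have "L2_norm M (\<lambda>w. a T w - \<eta> w) \<le> 0 * L2_norm M (a T)"
      by (intro L2_bound(2) borel_measurable_diff L2_measurable[OF aL[OF T]] mM aL[OF T] order_refl)
    then have "L2_norm M (\<lambda>w. a T w - \<eta> w) = 0"
      using L2_norm_nonneg[of M "\<lambda>w. a T w - \<eta> w"] by simp
    then show ?thesis using L m by blast
  qed
  have small: "\<exists>\<kappa>. 0 \<le> \<kappa> \<and> \<kappa> < \<epsilon> \<and> N s \<le> \<kappa>" if s: "s \<in> {0..T - t}" and \<epsilon>: "0 < \<epsilon>" for s \<epsilon>
  proof (rule gronwall_iterate[of K0 K "T - t", OF K0 K(1) _ _ s \<epsilon>])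
    fix s assume "s \<in> {0..T - t}"
    then have q: "T - s \<in> {0..T}" using t by auto
    show "N s \<le> K"
      using G.cond_proj_residual_norm_le[OF aL[OF q] L2_zero] K(2)[OF q] by (simp add: N_def)
  next
    fix c s :: real and n :: nat
    assume c: "0 \<le> c" and s: "s \<in> {0..T - t}" and IH: "\<And>s'. s' \<in> {0..s} \<Longrightarrow> N s' \<le> c * s' ^ n"
    have q: "T - s \<in> {0..T}" and ts: "0 \<le> T - s" "T - s \<le> T" using t s by auto
    let ?k = "\<lambda>q. K0 * c * (T - q) ^ n"
    note val = set_integral_powers(2)[OF ts(2), of "K0 * c" n]
    have "N s \<le> (LINT q:{T - s..T}|lborel. ?k q)"
      unfolding N_def
    proof (rule G.cond_proj_time_integral[OF prob_space_axioms aL[OF q] aL[OF T] _ cl_driver_L2(1) ts(1) order_refl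
          basic_adjoint_equation[OF q]])
      fix \<epsilon> :: real assume "0 < \<epsilon>"
      then show "\<exists>\<eta>'. \<eta>' \<in> L2 M \<and> \<eta>' \<in> borel_measurable (future t) \<and> L2_norm M (\<lambda>w. a T w - \<eta>' w) \<le> \<epsilon>"
        using aT by (metis less_imp_le)
    next
      fix q assume q': "q \<in> {T - s..T}"
      then have q: "q \<in> {0..T}" and qs: "T - q \<in> {0..s}" and tq: "t \<le> q" "q \<le> T" using t s by auto
      define \<xi> where "\<xi> = cond_proj M (future t) (X q)"
      define \<alpha> where "\<alpha> = cond_proj M (future t) (a q)"
      have \<xi>m: "\<xi> \<in> borel_measurable (future t)" unfolding \<xi>_def by (rule G.cond_proj_measurable)
      have \<alpha>: "\<alpha> \<in> L2 M" "\<alpha> \<in> borel_measurable (future t)"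
        unfolding \<alpha>_def by (rule G.cond_proj_L2[OF aL[OF q]], rule G.cond_proj_measurable)
      define \<gamma> where "\<gamma> w = transpose (A q (\<xi> w)) *v \<alpha> w + C q (\<xi> w)" for w
      have \<gamma>m: "\<gamma> \<in> borel_measurable (future t)"
        unfolding \<gamma>_def[abs_def]
        by (intro borel_measurable_add borel_measurable_matrix_vector borel_measurable_transpose \<alpha>(2)
            measurable_compose[OF \<xi>m Am[OF q]] measurable_compose[OF \<xi>m Cm[OF q]])
      have dm: "(\<lambda>w. cl_driver q w - \<gamma> w) \<in> borel_measurable M"
        by (intro borel_measurable_diff L2_measurable[OF cl_driver_L2(2)[OF q]] G.measurable_sub[OF \<gamma>m])
      have "AE w in M. norm (cl_driver q w - \<gamma> w) \<le> K0 * norm (a q w - \<alpha> w)"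
        using X_future[OF tq]
      proof eventually_elim
        case (elim w)
        have "cl_driver q w - \<gamma> w = transpose (A q (X q w)) *v (a q w - \<alpha> w)"
          unfolding drv \<gamma>_def \<xi>_def elim[symmetric] matrix_vector_mult_diff_distrib by (rule add_diff_cancel_right)
        then show ?case
          using AK[OF q, of "X q w"]
          by (simp only:) (intro order_trans[OF norm_transpose_vector_le] mult_right_mono norm_ge_zero)
      qed
      note B = L2_bound[OF dm L2_diff[OF aL[OF q] \<alpha>(1)] K0 this]
      have \<gamma>L: "\<gamma> \<in> L2 M"
        using L2_diff[OF cl_driver_L2(2)[OF q] B(1)] by simp
      have "L2_norm M (\<lambda>w. a q w - \<alpha> w) \<le> c * (T - q) ^ n"
        using IH[OF qs] by (simp add: N_def \<alpha>_def)
      then have "L2_norm M (\<lambda>w. cl_driver q w - \<gamma> w) \<le> K0 * (c * (T - q) ^ n)"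
        by (intro order_trans[OF B(2)] mult_left_mono K0)
      then have "L2_norm M (\<lambda>w. cl_driver q w - \<gamma> w) \<le> ?k q" by (simp only: mult.assoc)
      then show "cl_driver q \<in> L2 M \<and> (\<exists>\<gamma>. \<gamma> \<in> L2 M \<and> \<gamma> \<in> borel_measurable (future t) \<and>
          L2_norm M (\<lambda>w. cl_driver q w - \<gamma> w) \<le> ?k q)"
        using cl_driver_L2(2)[OF q] \<gamma>L \<gamma>m by blast
    next
      show "continuous_on {T - s..T} ?k" by (intro continuous_intros)
      show "0 \<le> (LINT q:{T - s..T}|lborel. ?k q)"
        unfolding val using K0 c s by (intro divide_nonneg_nonneg mult_nonneg_nonneg zero_le_power) auto
    qed
    then show "N s \<le> K0 * c * s ^ Suc n / real (Suc n)"
      unfolding val by simp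
  qed
  show ?thesis
  proof (rule G.AE_eq_cond_proj[OF aL[OF t]])
    fix \<epsilon> :: real assume \<epsilon>: "0 < \<epsilon>"
    have "T - t \<in> {0..T - t}" using t by auto
    from small[OF this \<epsilon>] have "L2_norm M (\<lambda>w. a t w - cond_proj M (future t) (a t) w) \<le> \<epsilon>"
      by (auto simp: N_def)
    then show "\<exists>\<eta>. \<eta> \<in> L2 M \<and> \<eta> \<in> borel_measurable (future t) \<and> L2_norm M (\<lambda>w. a t w - \<eta> w) \<le> \<epsilon>"
      using G.cond_proj_L2[OF aL[OF t]] G.cond_proj_measurable by blast
  qed
qed

end

end

section \<open>The critical point condition\<close>

lemma continuous_nonneg_integral_zero:
  fixes h :: "real \<Rightarrow> real"
  assumes h: "continuous_on {0..T} h" and nn: "\<And>t. t \<in> {0..T} \<Longrightarrow> 0 \<le> h t"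
    and zero: "(LINT t:{0..T}|lborel. h t) = 0" and T: "0 < T" and t: "t \<in> {0..T}"
  shows "h t = 0"
proof -
  have "set_integrable lborel {0..T} h"
    by (rule borel_integrable_atLeastAtMost'[OF h])
  from set_borel_integral_eq_integral(2)[OF this] zero have "integral {0..T} h = 0" by simp
  with integral_eq_0_iff[OF h T] nn t show ?thesis by auto
qed

lemma quadratic_derivative_zero:
  fixes A B C :: real
  shows "((\<lambda>x. (A + 2 * x * B + x\<^sup>2 * C) / 2) has_real_derivative B) (at 0)"
proof -
  have "((\<lambda>x. A / 2 + (B * x + C / 2 * (x * x))) has_real_derivative 0 + (B * 1 + C / 2 * (1 * 0 + 1 * 0))) (at 0)"
    by (intro DERIV_add DERIV_cmult DERIV_mult DERIV_ident DERIV_const)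
  moreover have "(\<lambda>x. A / 2 + (B * x + C / 2 * (x * x))) = (\<lambda>x. (A + 2 * x * B + x\<^sup>2 * C) / 2)"
    by (rule ext) (simp add: power2_eq_square field_simps)
  ultimately show ?thesis by (simp only:) simp
qed
text \<open>The functions \<open>max 0 (1 - real n * infdist x C)\<close> are continuous with values
  between 0 and 1 and tend to the indicator. Nonemptiness of \<open>C\<close> matters because
  \<open>infdist\<close> to the empty set is 0 by convention.\<close>

lemma integral_indicator_closed_limit:
  fixes Q :: "'w \<Rightarrow> real" and V :: "'w \<Rightarrow> 'a::euclidean_space"
  assumes Q: "integrable M Q" and V [measurable]: "V \<in> borel_measurable M"
    and \<psi>: "\<And>\<psi>. continuous_on UNIV \<psi> \<Longrightarrow> (\<And>x. norm (\<psi> x :: real) \<le> 1) \<Longrightarrow> (\<integral>w. Q w * \<psi> (V w) \<partial>M) = 0"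
    and C: "closed C" "C \<noteq> {}"
  shows "(\<integral>w. Q w * indicator C (V w) \<partial>M) = 0"
proof -
  have [measurable]: "Q \<in> borel_measurable M" using Q by simp
  define g where "g n x = max 0 (1 - real n * infdist x C)" for n x
  have gc: "continuous_on UNIV (g n)" for n unfolding g_def by (intro continuous_intros)
  have [measurable]: "g n \<in> borel_measurable borel" for n
    by (rule borel_measurable_continuous_onI[OF gc])
  have g1: "norm (g n x) \<le> 1" for n x
    using infdist_nonneg[of x C] by (auto simp: g_def)
  have [measurable]: "C \<in> sets borel" using C by simp
  have lim: "(\<lambda>n. g n x) \<longlonglongrightarrow> indicator C x" for x
  proof (cases "x \<in> C")
    case True
    then show ?thesis by (simp add: g_def)
  next
    case False
    then have pos: "0 < infdist x C"
      using in_closed_iff_infdist_zero[OF C] infdist_nonneg[of x C] by (metis less_eq_real_def)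
    obtain N where N: "1 / infdist x C < real N" using reals_Archimedean2 by blast
    have "g n x = 0" if "n \<ge> N" for n
    proof -
      have "1 < real N * infdist x C" using N pos by (simp add: field_simps)
      also have "\<dots> \<le> real n * infdist x C" using that pos by (intro mult_right_mono) auto
      finally show ?thesis by (simp add: g_def)
    qed
    then have "eventually (\<lambda>n. g n x = 0) sequentially" by (auto simp: eventually_sequentially)
    then show ?thesis using False by (simp add: tendsto_eventually)
  qed
  have "(\<lambda>n. \<integral>w. Q w * g n (V w) \<partial>M) \<longlonglongrightarrow> (\<integral>w. Q w * indicator C (V w) \<partial>M)"
  proof (rule integral_dominated_convergence[where w="\<lambda>w. norm (Q w)"])
    show "AE w in M. (\<lambda>n. Q w * g n (V w)) \<longlonglongrightarrow> Q w * indicator C (V w)"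
      by (intro AE_I2 tendsto_mult tendsto_const lim)
    show "AE w in M. norm (Q w * g n (V w)) \<le> norm (Q w)" for n
      using mult_left_mono[OF g1 norm_ge_zero, of "Q _"] by (intro AE_I2) (simp only: norm_mult mult_1_right)
  qed (use Q in auto)
  moreover have "(\<integral>w. Q w * g n (V w) \<partial>M) = 0" for n by (rule \<psi>[OF gc g1])
  ultimately show ?thesis by (simp add: LIMSEQ_const_iff)
qed

text \<open>Dynkin's argument for the signed measure with density \<open>Q\<close>; the vanishing
  total mass handles complements.\<close>

lemma integral_zero_sigma_sets:
  fixes Q :: "'w \<Rightarrow> real"
  assumes Q: "integrable M Q" and GG: "Int_stable GG" "GG \<subseteq> sets M"
    and zero: "\<And>A. A \<in> GG \<Longrightarrow> (\<integral>w. Q w * indicator A w \<partial>M) = 0" and total: "(\<integral>w. Q w \<partial>M) = 0"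
    and A: "A \<in> sigma_sets (space M) GG"
  shows "(\<integral>w. Q w * indicator A w \<partial>M) = 0"
proof -
  have Pow: "GG \<subseteq> Pow (space M)" using GG(2) sets.space_closed by blast
  have S: "sigma_sets (space M) GG \<subseteq> sets M" by (rule sets.sigma_sets_subset[OF GG(2)])
  have int: "integrable M (\<lambda>w. Q w * indicator A w)" if "A \<in> sets M" for A
    by (rule integrable_real_mult_indicator[OF that Q])
  from A show ?thesis
  proof (induction rule: sigma_sets_induct_disjoint[OF GG(1) Pow, consumes 1, case_names basic empty compl union])
    case (basic A)
    then show ?case by (rule zero)
  next
    case empty
    then show ?case by simp
  next
    case (compl A)
    have [measurable]: "A \<in> sets M" using compl(1) S by auto
    have "(\<integral>w. Q w * indicator (space M - A) w \<partial>M) = (\<integral>w. Q w - Q w * indicator A w \<partial>M)"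
      by (rule Bochner_Integration.integral_cong) (auto simp: indicator_def)
    then show ?case using compl(2) total Q int[of A] by simp
  next
    case (union A)
    have Am: "A i \<in> sets M" for i using union(2) S by auto
    have "set_integrable M (\<Union>i. A i) Q"
      unfolding set_integrable_def using Am by (intro integrable_mult_indicator Q sets.countable_UN) auto
    from lebesgue_integral_countable_add[OF Am _ this]
    have "set_lebesgue_integral M (\<Union>i. A i) Q = (\<Sum>i. set_lebesgue_integral M (A i) Q)"
      using union(1) by (auto simp: disjoint_family_on_def)
    then show ?case
      using union(3) unfolding set_lebesgue_integral_def by (simp add: mult.commute)
  qed
qed

context closed_loop
begin

text \<open>The derivative of the pointwise loss with respect to the control value.\<close>

definition residual :: "real \<Rightarrow> 'w \<Rightarrow> real^'m" where
  "residual t w = ctrl t w + transpose (\<sigma> t) *v a t w"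

lemma residual_regular: "regular_process M T residual"
proof -
  obtain Ks where Ks: "Ks \<ge> 0" "\<And>t. t \<in> {0..T} \<Longrightarrow> norm (\<sigma> t) \<le> Ks" using sigma_bound by blast
  have cm: "(\<lambda>(t, w). ctrl t w) \<in> borel_measurable (dt_dP M T)" and cc: "AE w in M. continuous_on {0..T} (\<lambda>t. ctrl t w)"
    using ctrl_regular by (auto simp: regular_process_def continuous_paths_def)
  have am: "(\<lambda>(t, w). a t w) \<in> borel_measurable (dt_dP M T)" and ac: "AE w in M. continuous_on {0..T} (\<lambda>t. a t w)"
    using a_regular by (auto simp: regular_process_def continuous_paths_def)
  have sm: "(\<lambda>z. \<sigma> (fst z)) \<in> borel_measurable (dt_dP M T)"
    by (rule measurable_compose[OF measurable_fst_dt_dP sigma_time_measurable])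
  have "(\<lambda>(t, w). residual t w) \<in> borel_measurable (dt_dP M T)"
    using borel_measurable_add[OF cm borel_measurable_matrix_vector[OF borel_measurable_transpose[OF sm] am]]
    unfolding residual_def case_prod_beta' .
  moreover have "continuous_paths M T residual"
    unfolding continuous_paths_def residual_def using cc ac
    by eventually_elim
      (intro continuous_on_add continuous_matrix_vector bounded_linear.continuous_on[OF bounded_linear_transpose]
        sigma_continuous)
  moreover have "S2_bounded M T residual"
  proof -
    obtain \<zeta>1 where \<zeta>1: "integrable M \<zeta>1" "AE w in M. \<forall>t\<in>{0..T}. (norm (ctrl t w))\<^sup>2 \<le> \<zeta>1 w"
      by (rule regular_process_bound[OF ctrl_regular])
    obtain \<zeta>2 where \<zeta>2: "integrable M \<zeta>2" "AE w in M. \<forall>t\<in>{0..T}. (norm (a t w))\<^sup>2 \<le> \<zeta>2 w"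
      by (rule regular_process_bound[OF a_regular])
    show ?thesis
      unfolding S2_bounded_def
    proof (intro exI conjI)
      show "integrable M (\<lambda>w. 2 * \<zeta>1 w + 2 * (Ks\<^sup>2 * \<zeta>2 w))" using \<zeta>1(1) \<zeta>2(1) by auto
      show "AE w in M. \<forall>t\<in>{0..T}. (norm (residual t w))\<^sup>2 \<le> 2 * \<zeta>1 w + 2 * (Ks\<^sup>2 * \<zeta>2 w)"
        using \<zeta>1(2) \<zeta>2(2)
      proof eventually_elim
        case (elim w)
        show ?case
        proof
          fix t assume t: "t \<in> {0..T}"
          have "norm (transpose (\<sigma> t) *v a t w) \<le> Ks * norm (a t w)"
            by (rule order_trans[OF norm_transpose_vector_le mult_right_mono[OF Ks(2)[OF t] norm_ge_zero]])
          then have "norm (residual t w) \<le> norm (ctrl t w) + Ks * norm (a t w)"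
            unfolding residual_def by (intro norm_triangle_le) linarith
          then have "(norm (residual t w))\<^sup>2 \<le> (norm (ctrl t w) + Ks * norm (a t w))\<^sup>2"
            by (rule power_mono) simp
          also have "\<dots> \<le> 2 * (norm (ctrl t w))\<^sup>2 + 2 * (Ks * norm (a t w))\<^sup>2"
            using sum_squares_bound[of "norm (ctrl t w)" "Ks * norm (a t w)"] by (simp add: power2_sum)
          also have "\<dots> \<le> 2 * \<zeta>1 w + 2 * (Ks\<^sup>2 * \<zeta>2 w)"
            unfolding power_mult_distrib
            using bspec[OF elim(1) t] mult_left_mono[OF bspec[OF elim(2) t] zero_le_power2[of Ks]] by linarith
          finally show "(norm (residual t w))\<^sup>2 \<le> 2 * \<zeta>1 w + 2 * (Ks\<^sup>2 * \<zeta>2 w)" .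
        qed
      qed
    qed
  qed
  ultimately show ?thesis by (simp add: regular_process_def)
qed

lemma residual_L2: "t \<in> {0..T} \<Longrightarrow> residual t \<in> L2 M"
  by (rule regular_process_L2[OF residual_regular])

text \<open>The averaged loss is a quadratic polynomial in \<open>\<epsilon>\<close> whose linear coefficient is the left-hand side.\<close>

lemma first_variation:
  assumes \<phi>: "(\<lambda>(t, x). \<phi> t x (law M X t)) \<in> borel_measurable (restrict_space borel {0..T} \<Otimes>\<^sub>M borel)"
    and sq: "(\<lambda>(t, w). \<phi> t (X t w) (law M X t)) \<in> L2 (dt_dP M T)"
  shows "(\<integral>(t, w). residual t w \<bullet> \<phi> t (X t w) (law M X t) \<partial>dt_dP M T) = 0"
proof -
  have T0: "(0::real) \<le> 0" by simp
  define \<theta> where "\<theta> t w = \<phi> t (X t w) (law M X t)" for t w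
  note rL = regular_process_L2_time[OF residual_regular]
  have \<theta>L: "(\<lambda>(t, w). \<theta> t w) \<in> L2 (dt_dP M T)" using sq by (simp add: \<theta>_def)
  define A where "A = (\<integral>(t, w). (norm (residual t w))\<^sup>2 \<partial>dt_dP M T)"
  define B where "B = (\<integral>(t, w). residual t w \<bullet> \<theta> t w \<partial>dt_dP M T)"
  define C where "C = (\<integral>(t, w). (norm (\<theta> t w))\<^sup>2 \<partial>dt_dP M T)"
  have iA: "integrable (dt_dP M T) (\<lambda>(t, w). (norm (residual t w))\<^sup>2)"
    using L2_integrable[OF rL] by (simp add: case_prod_beta')
  have iC: "integrable (dt_dP M T) (\<lambda>(t, w). (norm (\<theta> t w))\<^sup>2)"
    using L2_integrable[OF \<theta>L] by (simp add: case_prod_beta')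
  note iB = L2_time_inner[OF rL \<theta>L]
  have loss: "(\<integral>w. basic_loss M T \<sigma> X a (\<lambda>t x \<mu>. u t x \<mu> + \<epsilon> *\<^sub>R \<phi> t x \<mu>) w \<partial>M) = (A + 2 * \<epsilon> * B + \<epsilon>\<^sup>2 * C) / 2" for \<epsilon>
  proof -
    define h where "h t w = (norm (residual t w))\<^sup>2 + 2 * \<epsilon> * (residual t w \<bullet> \<theta> t w) + \<epsilon>\<^sup>2 * (norm (\<theta> t w))\<^sup>2" for t w
    have i: "integrable (dt_dP M T) (\<lambda>(t, w). h t w)"
      using iA iB iC unfolding h_def case_prod_beta' by (intro Bochner_Integration.integrable_add integrable_mult_right)
    have eq: "basic_loss M T \<sigma> X a (\<lambda>t x \<mu>. u t x \<mu> + \<epsilon> *\<^sub>R \<phi> t x \<mu>) w = (LINT t:{0..T}|lborel. h t w) / 2" for w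
    proof -
      have "(norm ((u t (X t w) (law M X t) + \<epsilon> *\<^sub>R \<phi> t (X t w) (law M X t)) + transpose (\<sigma> t) *v a t w))\<^sup>2 = h t w" for t
      proof -
        have "(u t (X t w) (law M X t) + \<epsilon> *\<^sub>R \<phi> t (X t w) (law M X t)) + transpose (\<sigma> t) *v a t w = residual t w + \<epsilon> *\<^sub>R \<theta> t w"
          unfolding residual_def \<theta>_def feedback_control_def by (simp only: ac_simps)
        moreover have "(norm (residual t w + \<epsilon> *\<^sub>R \<theta> t w))\<^sup>2 = h t w"
          unfolding h_def power2_norm_eq_inner inner_add_left inner_add_right inner_scaleR_left inner_scaleR_right
          by (simp add: inner_commute[of "\<theta> t w" "residual t w"] power2_eq_square distrib_left)
        ultimately show ?thesis by (simp only:)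
      qed
      then show ?thesis unfolding basic_loss_def by simp
    qed
    have "(\<integral>w. (LINT t:{0..T}|lborel. h t w) \<partial>M) = (\<integral>(t, w). h t w \<partial>dt_dP M T)"
      using dt_dP_fubini(2,5)[OF prob_space_axioms i T0 order_refl] by simp
    also have "\<dots> = A + 2 * \<epsilon> * B + \<epsilon>\<^sup>2 * C"
      unfolding A_def B_def C_def h_def using iA iB iC unfolding case_prod_beta' by simp
    finally show ?thesis unfolding eq by simp
  qed
  have "((\<lambda>\<epsilon>. (A + 2 * \<epsilon> * B + \<epsilon>\<^sup>2 * C) / 2) has_real_derivative 0) (at 0)"
  proof -
    have "integrable (dt_dP M T) (\<lambda>(t, w). (norm (\<phi> t (X t w) (law M X t)))\<^sup>2)"
      using L2_integrable[OF sq] by (simp only: case_prod_beta')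
    from critical[unfolded stop_gradient_critical_def, THEN spec, of \<phi>, THEN mp, OF \<phi>, THEN mp, OF this]
    show ?thesis by (simp only: loss)
  qed
  moreover have "((\<lambda>\<epsilon>. (A + 2 * \<epsilon> * B + \<epsilon>\<^sup>2 * C) / 2) has_real_derivative B) (at 0)"
    by (rule quadratic_derivative_zero)
  ultimately have "B = 0" using DERIV_unique[of _ B 0 0] by simp
  then show ?thesis by (simp add: B_def \<theta>_def)
qed

text \<open>With the chosen direction, the first variation is the time integral of the square of
  \<open>K\<close>. Paths are continuous and dominated by an integrable variable, so
  \<open>K\<close> is continuous; this turns vanishing at almost every time into vanishing at every
  time.\<close>

lemma residual_test:
  fixes \<psi> :: "real^'d \<Rightarrow> real"
  assumes \<psi>: "continuous_on UNIV \<psi>" "\<And>x. norm (\<psi> x) \<le> 1" and t: "t \<in> {0..T}"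
  shows "(\<integral>w. (residual t w \<bullet> c) * \<psi> (X t w) \<partial>M) = 0"
proof -
  have T0: "(0::real) \<le> 0" by simp
  have \<psi>m [measurable]: "\<psi> \<in> borel_measurable borel" by (rule borel_measurable_continuous_onI[OF \<psi>(1)])
  define K where "K t = (\<integral>w. (residual t w \<bullet> c) * \<psi> (X t w) \<partial>M)" for t
  obtain \<zeta> where \<zeta>: "(\<lambda>w. sqrt \<bar>\<zeta> w\<bar>) \<in> L2 M" "AE w in M. \<forall>t\<in>{0..T}. norm (residual t w) \<le> sqrt \<bar>\<zeta> w\<bar>"
    by (rule regular_process_bound[OF residual_regular])
  have rc: "AE w in M. continuous_on {0..T} (\<lambda>t. residual t w)" and Xc: "AE w in M. continuous_on {0..T} (\<lambda>t. X t w)"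
    using residual_regular X_regular by (auto simp: regular_process_def continuous_paths_def)
  have Kc: "continuous_on {0..T} K"
    unfolding K_def[abs_def]
  proof (rule expectation_continuous[where \<zeta>="\<lambda>w. norm c * sqrt \<bar>\<zeta> w\<bar>"])
    show "(\<lambda>w. (residual t w \<bullet> c) * \<psi> (X t w)) \<in> borel_measurable M" if t: "t \<in> {0..T}" for t
      by (intro borel_measurable_times borel_measurable_inner borel_measurable_const
          regular_process_measurable[OF residual_regular t] measurable_compose[OF regular_process_measurable[OF X_regular t] \<psi>m])
    show "AE w in M. continuous_on {0..T} (\<lambda>t. (residual t w \<bullet> c) * \<psi> (X t w))"
      using rc Xc
    proof eventually_elim
      case (elim w)
      show ?case
        by (intro continuous_on_mult continuous_on_inner continuous_on_const elim(1) continuous_on_compose2[OF \<psi>(1) elim(2)]) auto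
    qed
    show "integrable M (\<lambda>w. norm c * sqrt \<bar>\<zeta> w\<bar>)"
      by (intro integrable_mult_right L2_imp_integrable[OF finite_measure_axioms \<zeta>(1)])
    show "AE w in M. \<forall>t\<in>{0..T}. norm ((residual t w \<bullet> c) * \<psi> (X t w)) \<le> norm c * sqrt \<bar>\<zeta> w\<bar>"
      using \<zeta>(2)
    proof eventually_elim
      case (elim w)
      show ?case
      proof
        fix t assume "t \<in> {0..T}"
        then have r: "norm (residual t w) \<le> sqrt \<bar>\<zeta> w\<bar>" using elim by blast
        have "\<bar>residual t w \<bullet> c\<bar> \<le> norm c * sqrt \<bar>\<zeta> w\<bar>"
          using order_trans[OF Cauchy_Schwarz_ineq2 mult_right_mono[OF r norm_ge_zero[of c]]] by (simp only: mult.commute)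
        then have "\<bar>residual t w \<bullet> c\<bar> * norm (\<psi> (X t w)) \<le> (norm c * sqrt \<bar>\<zeta> w\<bar>) * 1"
          by (intro mult_mono \<psi>(2)) auto
        then show "norm ((residual t w \<bullet> c) * \<psi> (X t w)) \<le> norm c * sqrt \<bar>\<zeta> w\<bar>"
          by (simp add: abs_mult)
      qed
    qed
  qed
  \<comment> \<open>The extra factor \<open>K t\<close> makes the integrand a square, hence
    nonnegative.\<close>
  define \<phi> :: "real \<Rightarrow> real^'d \<Rightarrow> (real^'d) measure \<Rightarrow> real^'m" where "\<phi> t x \<mu> = (K t * \<psi> x) *\<^sub>R c" for t x \<mu>
  have Km: "K \<in> borel_measurable (restrict_space borel {0..T})"
    by (rule borel_measurable_continuous_on_restrict[OF Kc])
  have \<phi>m: "(\<lambda>(t, x). \<phi> t x (law M X t)) \<in> borel_measurable (restrict_space borel {0..T} \<Otimes>\<^sub>M borel)"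
    unfolding \<phi>_def case_prod_beta'
    by (intro borel_measurable_scaleR borel_measurable_times borel_measurable_const
        measurable_compose[OF measurable_fst Km] measurable_compose[OF measurable_snd \<psi>m])
  obtain KB where KB: "\<And>t. t \<in> {0..T} \<Longrightarrow> norm (K t) \<le> KB"
    using compact_imp_bounded[OF compact_continuous_image[OF Kc compact_Icc]] unfolding bounded_iff by blast
  have KB0: "0 \<le> KB" using KB[OF t] norm_ge_zero[of "K t"] by linarith
  have L: "(\<lambda>(t, w). \<phi> t (X t w) (law M X t)) \<in> L2 (dt_dP M T)"
  proof (rule L2_bound(1)[where Y="\<lambda>(t, w). c" and c=KB])
    have "(\<lambda>z. X (fst z) (snd z)) \<in> borel_measurable (dt_dP M T)"
      using X_regular by (simp add: regular_process_def case_prod_beta')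
    from measurable_along[OF \<phi>m measurable_fst_dt_dP this]
    show "(\<lambda>(t, w). \<phi> t (X t w) (law M X t)) \<in> borel_measurable (dt_dP M T)"
      by (simp only: case_prod_beta')
    show "(\<lambda>(t, w). c) \<in> L2 (dt_dP M T)"
      by (rule L2_time_constant[OF prob_space_axioms L2_const[OF finite_measure_axioms]])
    show "AE z in dt_dP M T. norm (case z of (t, w) \<Rightarrow> \<phi> t (X t w) (law M X t)) \<le> KB * norm (case z of (t, w) \<Rightarrow> c)"
      using AE_space
    proof eventually_elim
      case (elim z)
      then have "fst z \<in> {0..T}" by (auto simp: dt_dP_def space_pair_measure space_restrict_space)
      then have "norm (K (fst z)) * norm (\<psi> (X (fst z) (snd z))) \<le> KB * 1"
        by (intro mult_mono KB \<psi>(2) KB0 norm_ge_zero)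
      then show ?case
        by (simp add: \<phi>_def case_prod_beta' abs_mult mult_right_mono)
    qed
  qed (rule KB0)
  have i: "integrable (dt_dP M T) (\<lambda>(t, w). residual t w \<bullet> \<phi> t (X t w) (law M X t))"
    by (rule L2_time_inner[OF regular_process_L2_time[OF residual_regular] L])
  have "(LINT t:{0..T}|lborel. (K t)\<^sup>2) = (LINT t:{0..T}|lborel. \<integral>w. residual t w \<bullet> \<phi> t (X t w) (law M X t) \<partial>M)"
  proof -
    have "(\<integral>w. residual t w \<bullet> \<phi> t (X t w) (law M X t) \<partial>M) = (K t)\<^sup>2" for t
    proof -
      have "(\<integral>w. residual t w \<bullet> \<phi> t (X t w) (law M X t) \<partial>M) = (\<integral>w. K t * ((residual t w \<bullet> c) * \<psi> (X t w)) \<partial>M)"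
        unfolding \<phi>_def by (simp add: mult.assoc mult.left_commute mult.commute)
      then show ?thesis by (simp add: K_def power2_eq_square)
    qed
    then show ?thesis by simp
  qed
  also have "\<dots> = 0"
    using first_variation[where \<phi>=\<phi>, OF \<phi>m L] dt_dP_fubini(5)[OF prob_space_axioms i T0 order_refl] by simp
  finally have "(K t)\<^sup>2 = 0"
    by (intro continuous_nonneg_integral_zero[of T "\<lambda>t. (K t)\<^sup>2", OF _ _ _ T_pos t] continuous_on_power Kc) auto
  then show ?thesis by (simp add: K_def)
qed

section \<open>From the present state to the whole past\<close>

context
  fixes t :: real
  assumes t: "t \<in> {0..T}"
begin

interpretation G: finite_measure_subalgebra M "future t"
  by unfold_locales (rule subalgebra_future[OF t])

interpretation P: finite_measure_subalgebra M "present t"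
  by unfold_locales (rule subalgebra_present[OF t])

lemma residual_component_integrable: "integrable M (\<lambda>w. residual t w \<bullet> c)"
  by (rule L2_inner(1)[OF residual_L2[OF t] L2_const[OF finite_measure_axioms]])

text \<open>The preimages of closed sets under \<open>X t\<close> form a pi-system that generates
  \<open>present t\<close>, and closed sets are within reach of the continuous test
  functions.\<close>

lemma residual_present:
  assumes B: "B \<in> sets (present t)"
  shows "(\<integral>w. (residual t w \<bullet> c) * indicator B w \<partial>M) = 0"
proof -
  let ?GG = "{X t -` C \<inter> space M | C. closed C}"
  have Xm [measurable]: "X t \<in> borel_measurable M" by (rule regular_process_measurable[OF X_regular t])
  have tot: "(\<integral>w. residual t w \<bullet> c \<partial>M) = 0"
    using residual_test[of "\<lambda>_. 1" t c] t by simp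
  have sig: "sets (present t) = sigma_sets (space M) ?GG"
  proof -
    have "sets (present t) = {X t -` A \<inter> space M | A. A \<in> sets borel}"
    proof -
      have "sets (present t) = sets (vimage_algebra (space M) (X t) borel)"
        unfolding sets_present generated_def sets_vimage_algebra by (rule arg_cong[where f="sigma_sets (space M)"]) auto
      then show ?thesis by (simp add: sets_vimage_algebra2)
    qed
    also have "\<dots> = {X t -` A \<inter> space M | A. A \<in> sigma_sets UNIV (Collect closed)}"
      unfolding borel_eq_closed by simp
    also have "\<dots> = sigma_sets (space M) {X t -` A \<inter> space M | A. A \<in> Collect closed}"
      by (rule sigma_sets_vimage_commute) simp
    finally show ?thesis by simp
  qed
  show ?thesis
  proof (rule integral_zero_sigma_sets[of M _ ?GG, OF residual_component_integrable _ _ _ tot])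
    show "Int_stable ?GG"
    proof (rule Int_stableI)
      fix A B assume "A \<in> ?GG" "B \<in> ?GG"
      then obtain C D where C: "A = X t -` C \<inter> space M" "closed C" and D: "B = X t -` D \<inter> space M" "closed D" by blast
      have "A \<inter> B = X t -` (C \<inter> D) \<inter> space M" using C(1) D(1) by auto
      with closed_Int[OF C(2) D(2)] show "A \<inter> B \<in> ?GG" by blast
    qed
    show "?GG \<subseteq> sets M"
    proof
      fix A assume "A \<in> ?GG"
      then obtain C where C: "A = X t -` C \<inter> space M" "closed C" by blast
      show "A \<in> sets M" unfolding C(1) using Xm borel_closed[OF C(2)] by (rule measurable_sets)
    qed
    show "B \<in> sigma_sets (space M) ?GG" using B sig by simp
    fix A assume "A \<in> ?GG"
    then obtain C where C: "A = X t -` C \<inter> space M" "closed C" by blast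
    show "(\<integral>w. (residual t w \<bullet> c) * indicator A w \<partial>M) = 0"
    proof (cases "C = {}")
      case True
      then show ?thesis by (simp add: C(1))
    next
      case False
      have "(\<integral>w. (residual t w \<bullet> c) * indicator A w \<partial>M) = (\<integral>w. (residual t w \<bullet> c) * indicator C (X t w) \<partial>M)"
        by (rule Bochner_Integration.integral_cong) (auto simp: C(1) indicator_def)
      also have "\<dots> = 0"
        by (rule integral_indicator_closed_limit[OF residual_component_integrable Xm residual_test[OF _ _ t] C(2) False])
      finally show ?thesis .
    qed
  qed
qed

lemma Int_stable_future_sets: "Int_stable (future_sets t)"
  unfolding future_sets_def by (rule Int_stable_Int_sets)

text \<open>By independence of the increments after \<open>t\<close>, conditioning an event of the past on the future
  \<sigma>-algebra only sees the present state.\<close>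

lemma cond_exp_future_present:
  assumes A: "A \<in> sets (F t)"
  shows "AE w in M. real_cond_exp M (future t) (indicator A) w = real_cond_exp M (present t) (indicator A) w"
proof -
  have t0: "0 \<le> t" "t \<le> T" using t by auto
  let ?h = "real_cond_exp M (present t) (indicator A)"
  have AM: "A \<in> sets M" using A sets_filt_subset[OF t0(2)] by auto
  have iA: "integrable M (indicator A :: 'w \<Rightarrow> real)" using AM by (simp add: emeasure_finite less_top[symmetric])
  note ih = P.real_cond_exp_int(1)[OF iA]
  have hP: "?h \<in> borel_measurable (present t)" by simp
  have iQ: "integrable M (\<lambda>w. indicator A w - ?h w)" by (rule Bochner_Integration.integrable_diff[OF iA ih])
  have hF: "(\<lambda>w. indicator A w - ?h w) \<in> borel_measurable (F t)"
    using A measurable_from_subalg[OF subalgebra_present_filt[OF t] hP] by measurable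
  have zero: "(\<integral>w. (indicator A w - ?h w) * indicator E w \<partial>M) = 0" if E: "E \<in> sets (future t)" for E
  proof (rule integral_zero_sigma_sets[OF iQ Int_stable_future_sets future_sets_subset[OF t]])
    show "E \<in> sigma_sets (space M) (future_sets t)" using E sets_future[OF t] by simp
    show "(\<integral>w. indicator A w - ?h w \<partial>M) = 0"
      using iA ih P.real_cond_exp_int(2)[OF iA] by simp
    fix C assume "C \<in> future_sets t"
    then obtain B D where C: "C = B \<inter> D" and B: "B \<in> sets (present t)" and D: "D \<in> sets (increments {t<..T} t)"
      unfolding future_sets_def by blast
    have BF: "B \<in> sets (F t)" using B present_subset[OF t] by auto
    have BM: "B \<in> sets M" using BF sets_filt_subset[OF t0(2)] by auto
    have DM: "D \<in> sets M" using D increments_future_subset[OF t] by auto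
    have sN: "subalgebra M (increments {t<..T} t)"
      unfolding subalgebra_def using increments_future_subset[OF t] by simp
    have iB: "integrable M (\<lambda>w. (indicator A w - ?h w) * indicator B w)"
      by (rule integrable_real_mult_indicator[OF BM iQ])
    have "(\<integral>w. (indicator A w - ?h w) * indicator C w \<partial>M)
        = (\<integral>w. ((indicator A w - ?h w) * indicator B w) * indicator D w \<partial>M)"
      unfolding C by (simp add: indicator_inter_arith mult.assoc)
    \<comment> \<open>The factor with \<open>A\<close> and \<open>B\<close> belongs to the past and
      \<open>D\<close> to the increments after \<open>t\<close>. The first expectation then vanishes
      by the defining property of the conditional expectation given the present.\<close>
    also have "\<dots> = (\<integral>w. (indicator A w - ?h w) * indicator B w \<partial>M) * (\<integral>w. indicator D w \<partial>M)"
    proof (rule indep_sets_integral_mult(2)[OF subalgebra_filt[OF t0(2)] sN _ _ iB])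
      show "prob (A' \<inter> E') = prob A' * prob E'" if "A' \<in> sets (F t)" "E' \<in> sets (increments {t<..T} t)" for A' E'
        by (rule filt_indep_future[OF t0 that])
      show "(\<lambda>w. (indicator A w - ?h w) * indicator B w) \<in> borel_measurable (F t)"
        using hF BF by measurable
      show "indicator D \<in> borel_measurable (increments {t<..T} t)" using D by measurable
      show "integrable M (indicator D :: 'w \<Rightarrow> real)" using DM by (simp add: emeasure_finite less_top[symmetric])
    qed
    also have "(\<integral>w. (indicator A w - ?h w) * indicator B w \<partial>M) = 0"
    proof -
      have "(\<integral>w. indicator B w * ?h w \<partial>M) = (\<integral>w. indicator B w * indicator A w \<partial>M)"
        using integrable_real_mult_indicator[OF BM iA] B AM by (intro P.real_cond_exp_intg(2)) (auto simp: mult.commute)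
      moreover have "(\<integral>w. (indicator A w - ?h w) * indicator B w \<partial>M)
          = (\<integral>w. indicator A w * indicator B w \<partial>M) - (\<integral>w. ?h w * indicator B w \<partial>M)"
        unfolding left_diff_distrib
        by (rule Bochner_Integration.integral_diff[OF integrable_real_mult_indicator[OF BM iA] integrable_real_mult_indicator[OF BM ih]])
      ultimately show ?thesis by (simp only: mult.commute[of _ "indicator B _"] diff_self)
    qed
    finally show "(\<integral>w. (indicator A w - ?h w) * indicator C w \<partial>M) = 0" by simp
  qed
  show ?thesis
  proof (rule G.real_cond_exp_charact[OF _ iA ih measurable_from_subalg[OF subalgebra_future_present[OF t] hP]])
    fix E assume E: "E \<in> sets (future t)"
    then have EM: "E \<in> sets M" using subalgebra_future[OF t] by (auto simp: subalgebra_def)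
    show "(LINT x:E|M. indicator A x) = (LINT x:E|M. ?h x)"
    proof -
      have "(\<integral>w. (indicator A w - ?h w) * indicator E w \<partial>M)
          = (\<integral>w. indicator A w * indicator E w \<partial>M) - (\<integral>w. ?h w * indicator E w \<partial>M)"
        unfolding left_diff_distrib
        by (rule Bochner_Integration.integral_diff[OF integrable_real_mult_indicator[OF EM iA] integrable_real_mult_indicator[OF EM ih]])
      then show ?thesis
        using zero[OF E] unfolding set_lebesgue_integral_def real_scaleR_def by (simp only: mult.commute[of "indicator E _"])
    qed
  qed
qed

text \<open>The conditioning is shifted from the residual to the event. The residual is
  \<open>future t\<close>-measurable up to null sets, so the indicator may be replaced by its
  conditional expectation given \<open>future t\<close>. That is a function of the present, and
  given the present the residual has mean 0.\<close>

lemma residual_past: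
  assumes A: "A \<in> sets (F t)"
  shows "(\<integral>w. (residual t w \<bullet> c) * indicator A w \<partial>M) = 0"
proof -
  have t0: "0 \<le> t" "t \<le> T" using t by auto
  have AM [measurable]: "A \<in> sets M" using A sets_filt_subset[OF t0(2)] by auto
  define Q where "Q w = residual t w \<bullet> c" for w
  \<comment> \<open>A version of \<open>Q\<close> that is measurable without exceptional
    sets.\<close>
  define Q' where "Q' w = (u t (X t w) (law M X t) + transpose (\<sigma> t) *v cond_proj M (future t) (a t) w) \<bullet> c" for w
  have iQ: "integrable M Q" unfolding Q_def[abs_def] by (rule residual_component_integrable)
  have Qm [measurable]: "Q \<in> borel_measurable M" using iQ by simp
  have Q'm: "Q' \<in> borel_measurable (future t)"
    unfolding Q'_def[abs_def]
    by (intro borel_measurable_inner borel_measurable_add borel_measurable_matrix_vector borel_measurable_const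
        measurable_compose[OF X_future_measurable[OF t] measurable_along_fixed[OF u_measurable t]] G.cond_proj_measurable)
  have Q'M [measurable]: "Q' \<in> borel_measurable M" by (rule G.measurable_sub[OF Q'm])
  have QQ: "AE w in M. Q w = Q' w"
    using a_future[OF t]
  proof eventually_elim
    case (elim w)
    show ?case unfolding Q_def Q'_def residual_def feedback_control_def elim[symmetric] by (rule refl)
  qed
  let ?h = "real_cond_exp M (present t) (indicator A)" and ?k = "real_cond_exp M (future t) (indicator A)"
  have hP: "?h \<in> borel_measurable (present t)" by simp
  have hM [measurable]: "?h \<in> borel_measurable M" by (rule P.measurable_sub[OF hP])
  have kM [measurable]: "?k \<in> borel_measurable M" by simp
  have iA: "integrable M (indicator A :: 'w \<Rightarrow> real)" using AM by (simp add: emeasure_finite less_top[symmetric])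
  have iQ'A: "integrable M (\<lambda>w. Q' w * indicator A w)"
    by (rule integrable_real_mult_indicator[OF AM integrable_cong_AE_imp[OF iQ Q'M]]) (use QQ in auto)
  have zeroP: "AE w in M. real_cond_exp M (present t) Q w = 0"
  proof (rule P.real_cond_exp_charact[OF _ iQ])
    fix B assume "B \<in> sets (present t)"
    from residual_present[OF this, of c] show "(LINT x:B|M. Q x) = (LINT x:B|M. 0)"
      unfolding set_lebesgue_integral_def by (simp add: Q_def mult.commute)
  qed auto
  \<comment> \<open>A conditional probability lies between 0 and 1; this makes its product with
    \<open>Q\<close> integrable.\<close>
  have hb: "AE w in M. norm (?h w) \<le> 1"
  proof -
    have "AE w in M. ?h w \<ge> 0" by (rule P.real_cond_exp_pos) (auto intro!: AE_I2)
    moreover have "AE w in M. ?h w \<le> 1" by (rule P.real_cond_exp_le_c[OF iA]) (auto intro!: AE_I2 simp: indicator_def)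
    ultimately show ?thesis by eventually_elim simp
  qed
  have iQh: "integrable M (\<lambda>w. ?h w * Q w)"
  proof (rule Bochner_Integration.integrable_bound[OF iQ])
    show "AE w in M. norm (?h w * Q w) \<le> norm (Q w)"
      using hb
    proof eventually_elim
      case (elim w)
      show ?case using mult_right_mono[OF elim norm_ge_zero[of "Q w"]] by (simp add: abs_mult)
    qed
  qed measurable
  have "(\<integral>w. Q w * indicator A w \<partial>M) = (\<integral>w. Q' w * indicator A w \<partial>M)"
    using QQ by (intro integral_cong_AE) auto
  also have "\<dots> = (\<integral>w. Q' w * ?k w \<partial>M)"
    using G.real_cond_exp_intg(2)[OF iQ'A Q'm] by simp
  also have "\<dots> = (\<integral>w. ?h w * Q w \<partial>M)"
    using QQ cond_exp_future_present[OF A] by (intro integral_cong_AE) (auto simp: mult.commute)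
  also have "\<dots> = (\<integral>w. ?h w * real_cond_exp M (present t) Q w \<partial>M)"
    using P.real_cond_exp_intg(2)[OF iQh hP Qm] by simp
  also have "\<dots> = (\<integral>w. 0 \<partial>M)"
    using zeroP by (intro integral_cong_AE) auto
  finally show ?thesis by (simp add: Q_def)
qed

text \<open>Vanishing on all events of \<open>F t\<close> means that every coordinate has
  conditional expectation 0, and the projection turns this into orthogonality to vectors.\<close>

lemma residual_orthogonal:
  assumes \<eta>: "\<eta> \<in> L2 M" "\<eta> \<in> borel_measurable (F t)"
  shows "(\<integral>w. residual t w \<bullet> \<eta> w \<partial>M) = 0"
proof -
  have tT: "t \<le> T" using t by simp
  interpret N: finite_measure_subalgebra M "F t" by unfold_locales (rule subalgebra_filt[OF tT])
  have z: "AE w in M. real_cond_exp M (F t) (\<lambda>w. residual t w \<bullet> i) w = 0" for i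
  proof (rule N.real_cond_exp_charact[OF _ residual_component_integrable])
    fix A assume "A \<in> sets (F t)"
    from residual_past[OF this, of i] show "(LINT x:A|M. residual t x \<bullet> i) = (LINT x:A|M. 0)"
      unfolding set_lebesgue_integral_def by (simp add: mult.commute)
  qed auto
  have "AE w in M. \<forall>i\<in>Basis. real_cond_exp M (F t) (\<lambda>w. residual t w \<bullet> i) w = 0"
    by (rule AE_finite_allI[OF finite_Basis z])
  then have "AE w in M. cond_proj M (F t) (residual t) w = 0"
    by eventually_elim (simp add: cond_proj_def)
  then have "(\<integral>w. cond_proj M (F t) (residual t) w \<bullet> \<eta> w \<partial>M) = (\<integral>w. 0 \<partial>M)"
  proof (intro integral_cong_AE borel_measurable_inner N.measurable_sub[OF N.cond_proj_measurable] L2_measurable[OF \<eta>(1)])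
  qed auto
  then show ?thesis using N.cond_proj_inner[OF residual_L2[OF t] \<eta>] by simp
qed

end

end

section \<open>Comparison of the two adjoint processes\<close>

text \<open>Domination by a product of integrable functions gives integrability on the product
  space. In the second variable it is asked for only almost everywhere, since time sections of a
  square-integrable process are square-integrable only at almost every time.\<close>

lemma (in sigma_finite_measure) product_bound_fubini:
  fixes k :: "'a \<Rightarrow> 'a \<Rightarrow> real"
  assumes m: "(\<lambda>(x, y). k x y) \<in> borel_measurable (M \<Otimes>\<^sub>M M)"
    and P: "integrable M P" and Q: "integrable M Q"
    and le: "\<And>x. x \<in> space M \<Longrightarrow> AE y in M. \<bar>k x y\<bar> \<le> P x * Q y"
  shows "(\<integral>y. (\<integral>x. k x y \<partial>M) \<partial>M) = (\<integral>x. (\<integral>y. k x y \<partial>M) \<partial>M)"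
    and "integrable M (\<lambda>y. \<integral>x. k x y \<partial>M)" and "integrable M (\<lambda>x. \<integral>y. k x y \<partial>M)"
proof -
  interpret MM: pair_sigma_finite M M ..
  have [measurable]: "(\<lambda>z. k (fst z) (snd z)) \<in> borel_measurable (M \<Otimes>\<^sub>M M)" using m by (simp add: case_prod_beta')
  have ky: "integrable M (k x)" if x: "x \<in> space M" for x
  proof (rule Bochner_Integration.integrable_bound[OF integrable_mult_right[OF Q, of "P x"]])
    show "k x \<in> borel_measurable M" using measurable_Pair2[OF m x] by simp
    show "AE y in M. norm (k x y) \<le> norm (P x * Q y)"
      using le[OF x] by eventually_elim simp
  qed
  have int: "integrable (M \<Otimes>\<^sub>M M) (\<lambda>(x, y). k x y)"
  proof (rule MM.Fubini_integrable[OF m])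
    show "AE x in M. integrable M (\<lambda>y. case (x, y) of (x, y) \<Rightarrow> k x y)"
      using ky by (intro AE_I2) simp
    show "integrable M (\<lambda>x. \<integral>y. norm (case (x, y) of (x, y) \<Rightarrow> k x y) \<partial>M)"
    proof (rule Bochner_Integration.integrable_bound[OF integrable_mult_left[OF P, of "\<integral>y. Q y \<partial>M"]])
      show "(\<lambda>x. \<integral>y. norm (case (x, y) of (x, y) \<Rightarrow> k x y) \<partial>M) \<in> borel_measurable M" by measurable
      show "AE x in M. norm (\<integral>y. norm (case (x, y) of (x, y) \<Rightarrow> k x y) \<partial>M) \<le> norm (P x * (\<integral>y. Q y \<partial>M))"
        using AE_space
      proof eventually_elim
        case (elim x)
        have "(\<integral>y. \<bar>k x y\<bar> \<partial>M) \<le> (\<integral>y. P x * Q y \<partial>M)"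
          by (rule integral_mono_AE[OF integrable_abs[OF ky[OF elim]] integrable_mult_right[OF Q] le[OF elim]])
        moreover have "0 \<le> (\<integral>y. \<bar>k x y\<bar> \<partial>M)" by simp
        ultimately show ?case by simp
      qed
    qed
  qed
  show "(\<integral>y. (\<integral>x. k x y \<partial>M) \<partial>M) = (\<integral>x. (\<integral>y. k x y \<partial>M) \<partial>M)" by (rule MM.Fubini_integral[OF int])
  show "integrable M (\<lambda>y. \<integral>x. k x y \<partial>M)" by (rule MM.integrable_snd[OF int])
  show "integrable M (\<lambda>x. \<integral>y. k x y \<partial>M)" by (rule MM.integrable_fst[OF int])
qed

context prob_space
begin

lemma expectation_norm_le:
  assumes \<eta>: "\<eta> \<in> L2 M"
  shows "expectation (\<lambda>w. norm (\<eta> w)) \<le> L2_norm M \<eta>"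
proof -
  have "(\<lambda>w. norm (\<eta> w)) \<in> L2 M" using \<eta> by (auto simp: L2_def)
  from L2_inner(3)[OF L2_const[OF finite_measure_axioms, of "1::real"] this] show ?thesis
    by (simp add: L2_norm_def prob_space)
qed

text \<open>The adjoint of averaging over the copy: Fubini moves the kernel from the copy of
  \<open>p\<close> to the test vector. The new test vector is a bounded Borel function of
  \<open>V\<close>, so it is adapted whenever \<open>V\<close> is, and its norm is controlled by
  that of \<open>\<eta>\<close>.\<close>

lemma transposed_mean:
  fixes G :: "(real^'n) \<times> (real^'n) \<Rightarrow> real^'n^'k" and V \<eta> :: "'a \<Rightarrow> real^'n" and p :: "'a \<Rightarrow> real^'k"
  assumes G: "G \<in> borel_measurable borel" "\<And>z. norm (G z) \<le> K"
    and V: "V \<in> borel_measurable M" and p: "p \<in> L2 M" and \<eta>: "\<eta> \<in> L2 M"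
  defines "\<theta> \<equiv> (\<lambda>x. \<integral>w. G (x, V w) *v \<eta> w \<partial>M)"
  shows "(\<integral>w. (\<integral>w'. transpose (G (V w', V w)) *v p w' \<partial>M) \<bullet> \<eta> w \<partial>M) = (\<integral>w'. p w' \<bullet> \<theta> (V w') \<partial>M)"
    and "integrable M (\<lambda>w. (\<integral>w'. transpose (G (V w', V w)) *v p w' \<partial>M) \<bullet> \<eta> w)"
    and "\<theta> \<in> borel_measurable borel" and "(\<lambda>w. \<theta> (V w)) \<in> L2 M" and "L2_norm M (\<lambda>w. \<theta> (V w)) \<le> K * L2_norm M \<eta>"
proof -
  note [measurable] = V L2_measurable[OF p] L2_measurable[OF \<eta>]
  have K: "0 \<le> K" using G(2)[of undefined] norm_ge_zero[of "G undefined"] by linarith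
  have GM: "(\<lambda>z. G (V (fst z), V (snd z))) \<in> borel_measurable (M \<Otimes>\<^sub>M M)"
    by (rule measurable_compose[OF _ G(1)]) (simp add: borel_prod[symmetric])
  note [measurable] = GM
  have Gy: "(\<lambda>w. G (x, V w)) \<in> borel_measurable M" "(\<lambda>w. G (V w, x)) \<in> borel_measurable M" for x
    by (rule measurable_compose[OF _ G(1)], simp add: borel_prod[symmetric])+
  define k where "k w' w = (transpose (G (V w', V w)) *v p w') \<bullet> \<eta> w" for w' w
  have km: "(\<lambda>(w', w). k w' w) \<in> borel_measurable (M \<Otimes>\<^sub>M M)"
    unfolding k_def case_prod_beta' by measurable
  have P: "integrable M (\<lambda>w. K * norm (p w))" and Q: "integrable M (\<lambda>w. norm (\<eta> w))"
    using L2_imp_integrable[OF finite_measure_axioms p] L2_imp_integrable[OF finite_measure_axioms \<eta>] by auto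
  have le: "\<bar>k w' w\<bar> \<le> (K * norm (p w')) * norm (\<eta> w)" for w' w
  proof -
    have "norm (transpose (G (V w', V w)) *v p w') \<le> K * norm (p w')"
      by (rule order_trans[OF norm_transpose_vector_le mult_right_mono[OF G(2) norm_ge_zero]])
    then show ?thesis unfolding k_def
      by (rule order_trans[OF Cauchy_Schwarz_ineq2 mult_right_mono[OF _ norm_ge_zero]])
  qed
  note F = product_bound_fubini[OF km P Q AE_I2[OF le]]
  have i1: "integrable M (\<lambda>w'. transpose (G (V w', x)) *v p w')" for x
    by (rule L2_imp_integrable[OF finite_measure_axioms L2_matrix(1)[where c=K, OF borel_measurable_transpose[OF Gy(2)] p K]])
      (simp add: norm_transpose G(2))
  have i2: "(\<lambda>w. G (x, V w) *v \<eta> w) \<in> L2 M" for x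
    by (rule L2_matrix(1)[where c=K, OF Gy(1) \<eta> K G(2)])
  have e1: "(\<integral>w'. k w' w \<partial>M) = (\<integral>w'. transpose (G (V w', V w)) *v p w' \<partial>M) \<bullet> \<eta> w" for w
    unfolding k_def by (rule integral_inner_left[OF i1])
  have e2: "(\<integral>w. k w' w \<partial>M) = p w' \<bullet> \<theta> (V w')" for w'
    unfolding k_def \<theta>_def transpose_inner
    by (rule integral_inner_right[OF L2_imp_integrable[OF finite_measure_axioms i2]])
  show "(\<integral>w. (\<integral>w'. transpose (G (V w', V w)) *v p w' \<partial>M) \<bullet> \<eta> w \<partial>M) = (\<integral>w'. p w' \<bullet> \<theta> (V w') \<partial>M)"
    using F(1) unfolding e1 e2 .
  show "integrable M (\<lambda>w. (\<integral>w'. transpose (G (V w', V w)) *v p w' \<partial>M) \<bullet> \<eta> w)"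
    using F(2) unfolding e1 .
  have "(\<lambda>z. G (fst z, V (snd z))) \<in> borel_measurable (borel \<Otimes>\<^sub>M M)"
    by (rule measurable_compose[OF _ G(1)]) (simp add: borel_prod[symmetric])
  then have "(\<lambda>(x, w). G (x, V w) *v \<eta> w) \<in> borel_measurable (borel \<Otimes>\<^sub>M M)"
    unfolding case_prod_beta' by (rule borel_measurable_matrix_vector) measurable
  from borel_measurable_lebesgue_integral[OF this]
  show \<theta>m: "\<theta> \<in> borel_measurable borel" unfolding \<theta>_def .
  have b: "norm (\<theta> x) \<le> K * L2_norm M \<eta>" for x
  proof -
    have "norm (\<theta> x) \<le> (\<integral>w. norm (G (x, V w) *v \<eta> w) \<partial>M)" unfolding \<theta>_def by (rule integral_norm_bound)
    also have "\<dots> \<le> (\<integral>w. K * norm (\<eta> w) \<partial>M)"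
      by (intro integral_mono integrable_norm L2_imp_integrable[OF finite_measure_axioms i2] integrable_mult_right Q
          order_trans[OF norm_matrix_vector_le mult_right_mono[OF G(2) norm_ge_zero]])
    also have "\<dots> \<le> K * L2_norm M \<eta>"
      using expectation_norm_le[OF \<eta>] K by (simp add: mult_left_mono)
    finally show ?thesis .
  qed
  have c: "0 \<le> K * L2_norm M \<eta>" using K by simp
  have one: "(\<lambda>_. 1::real) \<in> L2 M" by (rule L2_const[OF finite_measure_axioms])
  note B = L2_bound[OF measurable_compose[OF V \<theta>m] one c]
  show "(\<lambda>w. \<theta> (V w)) \<in> L2 M" by (rule B(1)) (simp add: b)
  have "L2_norm M (\<lambda>w. \<theta> (V w)) \<le> K * L2_norm M \<eta> * L2_norm M (\<lambda>_. 1::real)" by (rule B(2)) (simp add: b)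
  then show "L2_norm M (\<lambda>w. \<theta> (V w)) \<le> K * L2_norm M \<eta>" by (simp add: L2_norm_def prob_space)
qed

end

lemma transpose_mult_add_vector:
  fixes A :: "real^'n^'k" and S :: "real^'m^'k" and B :: "real^'n^'m" and v :: "real^'k"
  shows "transpose (A + S ** B) *v v = transpose A *v v + transpose B *v (transpose S *v v)"
proof -
  have "transpose (A + S ** B) = transpose A + transpose B ** transpose S"
    unfolding matrix_transpose_mul[symmetric] by (simp add: transpose_def vec_eq_iff)
  then show ?thesis by (simp only: matrix_vector_mult_add_rdistrib matrix_vector_mul_assoc)
qed

section \<open>The difference of the two drivers\<close>

context closed_loop
begin

abbreviation ol_driver :: "real \<Rightarrow> 'w \<Rightarrow> real^'d" where
  "ol_driver \<equiv> adjoint_driver M bx bm fx fm X Y"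

lemma ol_driver_L2: "(\<lambda>(t, w). ol_driver t w) \<in> L2 (dt_dP M T)" "t \<in> {0..T} \<Longrightarrow> ol_driver t \<in> L2 M"
  using open_loop_driver[OF X_regular] adjoint_driver_regular[OF X_regular Y_regular] by blast+

lemma adjoint_increment:
  obtains I where "ito_integral M F T W Z I"
    "\<And>t r. 0 \<le> t \<Longrightarrow> t \<le> r \<Longrightarrow> r \<le> T \<Longrightarrow>
      AE w in M. Y t w = Y r w + (LINT q:{t..r}|lborel. ol_driver q w) - (I r w - I t w)"
proof -
  obtain I where I: "ito_integral M F T W Z I"
    and eq: "AE w in M. \<forall>t\<in>{0..T}. Y t w = Y 0 w - (LINT s:{0..t}|lborel. ol_driver s w) + I t w"
    using adjoint unfolding adjoint_processes_def by blast
  show thesis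
  proof (rule that[OF I])
    fix t r :: real assume tr: "0 \<le> t" "t \<le> r" "r \<le> T"
    have "AE w in M. set_integrable lborel {0..r} (\<lambda>q. ol_driver q w)"
      using L2_time_integral(3)[OF prob_space_axioms ol_driver_L2(1) order_refl tr(3)] by auto
    then show "AE w in M. Y t w = Y r w + (LINT q:{t..r}|lborel. ol_driver q w) - (I r w - I t w)"
      using eq
    proof eventually_elim
      case (elim w)
      have tI: "t \<in> {0..T}" "r \<in> {0..T}" using tr by auto
      show ?case
        unfolding bspec[OF elim(2) tI(1)] bspec[OF elim(2) tI(2)] set_integral_split[OF elim(1) tr(1,2)]
        by (simp add: algebra_simps)
    qed
  qed
qed

context
  fixes q :: real
  assumes q: "q \<in> {0..T}"
begin

lemma coefficient_sections: "(\<lambda>z. bm q (fst z) (law M X q) (snd z)) \<in> borel_measurable borel"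
    "\<exists>K\<ge>0. \<forall>t\<in>{0..T}. \<forall>x y. norm (bx t x (law M X t)) \<le> K \<and> norm (bm t x (law M X t) y) \<le> K"
    "(\<lambda>x. bx q x (law M X q)) \<in> borel_measurable borel"
    "(\<lambda>z. fm q (fst z) (law M X q) (snd z)) \<in> borel_measurable borel"
    "(\<lambda>x. fx q x (law M X q)) \<in> borel_measurable borel"
proof -
  obtain K0 where D: "driver_conditions M T X K0 bx bm fx fm" using open_loop_driver[OF X_regular] by blast
  note m = driver_A_measurable[OF X_regular Y_regular D] driver_B_measurable[OF X_regular Y_regular D]
    driver_C_measurable[OF X_regular Y_regular D] driver_D_measurable[OF X_regular Y_regular D]
  show "(\<lambda>z. bm q (fst z) (law M X q) (snd z)) \<in> borel_measurable borel"
    "(\<lambda>x. bx q x (law M X q)) \<in> borel_measurable borel"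
    "(\<lambda>z. fm q (fst z) (law M X q) (snd z)) \<in> borel_measurable borel"
    "(\<lambda>x. fx q x (law M X q)) \<in> borel_measurable borel"
    using m by (auto intro: measurable_along_fixed[OF _ q])
  show "\<exists>K\<ge>0. \<forall>t\<in>{0..T}. \<forall>x y. norm (bx t x (law M X t)) \<le> K \<and> norm (bm t x (law M X t) y) \<le> K"
    using D unfolding driver_conditions_def by blast
qed

lemma feedback_sections: "(\<lambda>z. um q (fst z) (law M X q) (snd z)) \<in> borel_measurable borel"
    "(\<lambda>x. ux q x (law M X q)) \<in> borel_measurable borel"
proof -
  have c: "continuous_P2 T ux" "continuous_P2 T (\<lambda>t (x, y) \<mu>. um t x \<mu> y)"
    using feedback by (auto simp: regular_feedback_def C1_vector_def)
  show "(\<lambda>z. um q (fst z) (law M X q) (snd z)) \<in> borel_measurable borel"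
    "(\<lambda>x. ux q x (law M X q)) \<in> borel_measurable borel"
    using measurable_along_fixed[OF continuous_measurable_time[OF continuous_P2_along2[OF X_regular c(2)]] q]
      measurable_along_fixed[OF continuous_measurable_time[OF continuous_P2_along[OF X_regular c(1)]] q] by auto
qed

lemma section_measurable:
  fixes G :: "(real^'d) \<times> (real^'d) \<Rightarrow> 'c::euclidean_space"
  assumes "G \<in> borel_measurable borel"
  shows "(\<lambda>w'. G (X q w', x)) \<in> borel_measurable M"
  by (rule measurable_compose[OF _ assms])
    (use regular_process_measurable[OF X_regular q] in \<open>simp add: borel_prod[symmetric]\<close>)

lemma matrix_copy_integrable:
  fixes G :: "(real^'d) \<times> (real^'d) \<Rightarrow> real^'d^'k"
  assumes G: "G \<in> borel_measurable borel" and b: "\<And>z. norm (G z) \<le> K" and p: "p \<in> L2 M"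
  shows "integrable M (\<lambda>w'. transpose (G (X q w', x)) *v p w')"
proof -
  have "0 \<le> K" using b[of undefined] norm_ge_zero[of "G undefined"] by linarith
  then show ?thesis
    by (intro L2_imp_integrable[OF finite_measure_axioms]
        L2_matrix(1)[where c=K, OF borel_measurable_transpose[OF section_measurable[OF G]] p]) (simp_all add: norm_transpose b)
qed

lemma fm_copy_integrable: "integrable M (\<lambda>w'. fm q (X q w') (law M X q) x)"
proof -
  obtain c where c: "c \<ge> 0" "\<And>y z. norm (fm q y (law M X q) z) \<le> c * (1 + norm y + norm z)"
    using linear_growth_along[OF X_regular f_linear] q by blast
  have XL: "X q \<in> L2 M" by (rule regular_process_L2[OF X_regular q])
  show ?thesis
  proof (rule Bochner_Integration.integrable_bound)
    show "integrable M (\<lambda>w. c * (1 + norm (X q w) + norm x))"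
      using L2_imp_integrable[OF finite_measure_axioms XL] by simp
    show "(\<lambda>w'. fm q (X q w') (law M X q) x) \<in> borel_measurable M"
      using section_measurable[OF coefficient_sections(4), of x] by simp
    show "AE w in M. norm (fm q (X q w) (law M X q) x) \<le> norm (c * (1 + norm (X q w) + norm x))"
      by (intro AE_I2 order_trans[OF c(2)]) simp
  qed
qed

text \<open>The terms of the closed-loop equation that contain the derivatives of \<open>u\<close> combine to terms in the
  residual.\<close>

lemma driver_difference:
  "cl_driver q w - ol_driver q w =
    transpose (bx q (X q w) (law M X q)) *v (a q w - Y q w)
    + (\<integral>w'. transpose (bm q (X q w') (law M X q) (X q w)) *v (a q w' - Y q w') \<partial>M)
    + transpose (ux q (X q w) (law M X q)) *v residual q w
    + (\<integral>w'. transpose (um q (X q w') (law M X q) (X q w)) *v residual q w' \<partial>M)"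
proof -
  obtain K0 where K0: "\<And>z. norm (bm q (fst z) (law M X q) (snd z)) \<le> K0" using coefficient_sections(2) q by blast
  obtain Ku where Ku: "\<And>z. norm (um q (fst z) (law M X q) (snd z)) \<le> Ku" using u_derivative_bound q by blast
  note L = regular_process_L2[OF a_regular q] regular_process_L2[OF Y_regular q] regular_process_L2[OF ctrl_regular q]
  note ibm = matrix_copy_integrable[OF coefficient_sections(1) K0, unfolded fst_conv snd_conv]
  note ium = matrix_copy_integrable[OF feedback_sections(1) Ku, unfolded fst_conv snd_conv]
  have \<sigma>a: "(\<lambda>w. transpose (\<sigma> q) *v a q w) \<in> L2 M"
    by (rule L2_matrix(1)[OF borel_measurable_const L(1) norm_ge_zero order_refl])
  have uX: "u q (X q w) (law M X q) = ctrl q w" for w by (simp only: feedback_control_def)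
  let ?bm = "\<lambda>w'. bm q (X q w') (law M X q) (X q w)" and ?um = "\<lambda>w'. um q (X q w') (law M X q) (X q w)"
    and ?fm = "\<lambda>w'. fm q (X q w') (law M X q) (X q w)"
  have cl: "cl_driver q w =
      (transpose (bx q (X q w) (law M X q)) *v a q w + transpose (ux q (X q w) (law M X q)) *v (transpose (\<sigma> q) *v a q w))
      + (fx q (X q w) (law M X q) + transpose (ux q (X q w) (law M X q)) *v ctrl q w)
      + ((\<integral>w'. transpose (?bm w') *v a q w' \<partial>M) + (\<integral>w'. transpose (?um w') *v (transpose (\<sigma> q) *v a q w') \<partial>M))
      + ((\<integral>w'. ?fm w' \<partial>M) + (\<integral>w'. transpose (?um w') *v ctrl q w' \<partial>M))"
    unfolding adjoint_driver_def cl_drift_dx_def cl_drift_dm_def cl_cost_dx_def cl_cost_dm_def transpose_mult_add_vector uX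
    unfolding Bochner_Integration.integral_add[OF ibm[OF L(1)] ium[OF \<sigma>a]]
      Bochner_Integration.integral_add[OF fm_copy_integrable ium[OF L(3)]]
    by (rule refl)
  have r1: "transpose (ux q (X q w) (law M X q)) *v residual q w = transpose (ux q (X q w) (law M X q)) *v ctrl q w
      + transpose (ux q (X q w) (law M X q)) *v (transpose (\<sigma> q) *v a q w)"
    unfolding residual_def by (rule matrix_vector_right_distrib)
  have r2: "(\<integral>w'. transpose (?um w') *v residual q w' \<partial>M) = (\<integral>w'. transpose (?um w') *v ctrl q w' \<partial>M)
      + (\<integral>w'. transpose (?um w') *v (transpose (\<sigma> q) *v a q w') \<partial>M)"
    unfolding residual_def matrix_vector_right_distrib by (rule Bochner_Integration.integral_add[OF ium[OF L(3)] ium[OF \<sigma>a]])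
  have r3: "(\<integral>w'. transpose (?bm w') *v (a q w' - Y q w') \<partial>M) = (\<integral>w'. transpose (?bm w') *v a q w' \<partial>M) - (\<integral>w'. transpose (?bm w') *v Y q w' \<partial>M)"
    unfolding matrix_vector_mult_diff_distrib by (rule Bochner_Integration.integral_diff[OF ibm[OF L(1)] ibm[OF L(2)]])
  have ol: "ol_driver q w = transpose (bx q (X q w) (law M X q)) *v Y q w + fx q (X q w) (law M X q)
      + (\<integral>w'. transpose (?bm w') *v Y q w' \<partial>M) + (\<integral>w'. ?fm w' \<partial>M)"
    by (rule adjoint_driver_def)
  have rearrange: "((A + B) + (C + D)) + (E + G) + (H + J) - (A' + C + E' + H) = (A - A') + (E - E') + (D + B) + (J + G)"
    for A B C D E G H J A' E' :: "real^'d" by simp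
  show ?thesis
    unfolding cl ol r1 r2 r3 matrix_vector_mult_diff_distrib[of _ "a q w"] by (rule rearrange)
qed

text \<open>Transposition turns all four terms into pairings with adapted test vectors. The two
  terms with the residual vanish by orthogonality; the two terms with \<open>a - Y\<close> each cost
  a factor \<open>K\<close>, whence \<open>2 * K\<close>.\<close>

lemma driver_difference_inner:
  assumes \<eta>: "\<eta> \<in> L2 M" "\<eta> \<in> borel_measurable (F q)"
    and K: "0 \<le> K" "\<And>t x y. t \<in> {0..T} \<Longrightarrow> norm (bx t x (law M X t)) \<le> K \<and> norm (bm t x (law M X t) y) \<le> K"
    and c: "0 \<le> c" "\<And>\<xi>. \<xi> \<in> L2 M \<Longrightarrow> \<xi> \<in> borel_measurable (F q) \<Longrightarrow> (\<integral>w. (a q w - Y q w) \<bullet> \<xi> w \<partial>M) \<le> c * L2_norm M \<xi>"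
  shows "(\<integral>w. (cl_driver q w - ol_driver q w) \<bullet> \<eta> w \<partial>M) \<le> 2 * K * c * L2_norm M \<eta>"
proof -
  have qT: "q \<le> T" using q by simp
  have Xm: "X q \<in> borel_measurable M" by (rule regular_process_measurable[OF X_regular q])
  note XF = X_adapted[OF q]
  have bF: "(\<lambda>w. bx q (X q w) (law M X q)) \<in> borel_measurable (F q)" and uF: "(\<lambda>w. ux q (X q w) (law M X q)) \<in> borel_measurable (F q)"
    by (rule measurable_compose[OF XF coefficient_sections(3)], rule measurable_compose[OF XF feedback_sections(2)])
  obtain Ku where Ku: "Ku \<ge> 0" "\<And>x y. norm (ux q x (law M X q)) \<le> Ku \<and> norm (um q x (law M X q) y) \<le> Ku"
    using u_derivative_bound q by blast
  have aY: "(\<lambda>w. a q w - Y q w) \<in> L2 M" by (rule L2_diff[OF regular_process_L2[OF a_regular q] regular_process_L2[OF Y_regular q]])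
  have Kb: "norm (bm q (fst z) (law M X q) (snd z)) \<le> K" for z using K(2)[OF q] by blast
  have Kum: "norm (um q (fst z) (law M X q) (snd z)) \<le> Ku" for z using Ku(2) by blast
  note tb = transposed_mean[OF coefficient_sections(1) Kb Xm aY \<eta>(1), unfolded fst_conv snd_conv]
  note tu = transposed_mean[OF feedback_sections(1) Kum Xm residual_L2[OF q] \<eta>(1), unfolded fst_conv snd_conv]
  note lb = L2_matrix[OF filt_to_M[OF qT bF] \<eta>(1) K(1) conjunct1[OF K(2)[OF q]]]
  note lu = L2_matrix(1)[OF filt_to_M[OF qT uF] \<eta>(1) Ku(1) conjunct1[OF Ku(2)]]
  let ?A = "\<lambda>w. (a q w - Y q w) \<bullet> (bx q (X q w) (law M X q) *v \<eta> w)"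
  let ?B = "\<lambda>w. (\<integral>w'. transpose (bm q (X q w') (law M X q) (X q w)) *v (a q w' - Y q w') \<partial>M) \<bullet> \<eta> w"
  let ?C = "\<lambda>w. residual q w \<bullet> (ux q (X q w) (law M X q) *v \<eta> w)"
  let ?D = "\<lambda>w. (\<integral>w'. transpose (um q (X q w') (law M X q) (X q w)) *v residual q w' \<partial>M) \<bullet> \<eta> w"
  have iA: "integrable M ?A" by (rule L2_inner(1)[OF aY lb(1)])
  have iC: "integrable M ?C" by (rule L2_inner(1)[OF residual_L2[OF q] lu])
  have A: "(\<integral>w. ?A w \<partial>M) \<le> c * (K * L2_norm M \<eta>)"
    by (rule order_trans[OF c(2)[OF lb(1) borel_measurable_matrix_vector[OF bF \<eta>(2)]] mult_left_mono[OF lb(2) c(1)]])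
  have B: "(\<integral>w. ?B w \<partial>M) \<le> c * (K * L2_norm M \<eta>)"
    unfolding tb(1)
    by (rule order_trans[OF c(2)[OF tb(4) measurable_compose[OF XF tb(3)]] mult_left_mono[OF tb(5) c(1)]])
  have C: "(\<integral>w. ?C w \<partial>M) = 0"
    by (rule residual_orthogonal[OF q lu borel_measurable_matrix_vector[OF uF \<eta>(2)]])
  have D: "(\<integral>w. ?D w \<partial>M) = 0"
    unfolding tu(1) by (rule residual_orthogonal[OF q tu(4) measurable_compose[OF XF tu(3)]])
  have "(\<integral>w. (cl_driver q w - ol_driver q w) \<bullet> \<eta> w \<partial>M) = (\<integral>w. ?A w + ?B w + ?C w + ?D w \<partial>M)"
    unfolding driver_difference inner_add_left transpose_inner by (rule refl)
  also have "\<dots> = (\<integral>w. ?A w \<partial>M) + (\<integral>w. ?B w \<partial>M) + (\<integral>w. ?C w \<partial>M) + (\<integral>w. ?D w \<partial>M)"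
    unfolding Bochner_Integration.integral_add[OF Bochner_Integration.integrable_add[OF Bochner_Integration.integrable_add[OF iA tb(2)] iC] tu(2)]
      Bochner_Integration.integral_add[OF Bochner_Integration.integrable_add[OF iA tb(2)] iC] Bochner_Integration.integral_add[OF iA tb(2)]
    by (rule refl)
  also have "\<dots> \<le> c * (K * L2_norm M \<eta>) + c * (K * L2_norm M \<eta>)"
    unfolding C D using A B by linarith
  finally show ?thesis by (simp add: mult.assoc mult.left_commute)
qed

end

text \<open>The bound is one-sided, but it covers all adapted test vectors, including their
  negatives, so the pairing is in fact 0. The stochastic integral in the equation for
  \<open>Y\<close> drops out since the test vector is known at the left end of the interval.\<close>

lemma adjoint_comparison:
  assumes t: "t \<in> {0..T}" and \<eta>: "\<eta> \<in> L2 M" "\<eta> \<in> borel_measurable (F t)"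
  shows "(\<integral>w. (a t w - Y t w) \<bullet> \<eta> w \<partial>M) \<le> 0"
proof -
  have T: "T \<in> {0..T}" using T_pos by simp
  note aL = regular_process_L2[OF a_regular] and YL = regular_process_L2[OF Y_regular]
  obtain K where K: "0 \<le> K" "\<And>t x y. t \<in> {0..T} \<Longrightarrow> norm (bx t x (law M X t)) \<le> K \<and> norm (bm t x (law M X t) y) \<le> K"
    using coefficient_sections(2)[OF T] by blast
  obtain Ka where Ka: "Ka \<ge> 0" "\<And>t. t \<in> {0..T} \<Longrightarrow> L2_norm M (a t) \<le> Ka" using regular_process_norm_bound[OF a_regular] by blast
  obtain KY where KY: "KY \<ge> 0" "\<And>t. t \<in> {0..T} \<Longrightarrow> L2_norm M (Y t) \<le> KY" using regular_process_norm_bound[OF Y_regular] by blast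
  obtain I where I: "ito_integral M F T W Z I"
    and inc: "\<And>t r. 0 \<le> t \<Longrightarrow> t \<le> r \<Longrightarrow> r \<le> T \<Longrightarrow>
      AE w in M. Y t w = Y r w + (LINT q:{t..r}|lborel. ol_driver q w) - (I r w - I t w)"
    by (rule adjoint_increment) (rule that)
  define \<beta> where "\<beta> q w = cl_driver q w - ol_driver q w" for q w
  have \<beta>: "(\<lambda>(q, w). \<beta> q w) \<in> L2 (dt_dP M T)"
    using L2_diff[OF cl_driver_L2(1) ol_driver_L2(1)] by (simp add: \<beta>_def case_prod_beta')
  \<comment> \<open>The bound ranges over all test vectors because the driver estimate replaces the
    given test vector by transposed ones. The argument is again the time left until
    \<open>T\<close>.\<close>
  define N where "N s \<kappa> \<longleftrightarrow> (\<forall>\<eta>. \<eta> \<in> L2 M \<longrightarrow> \<eta> \<in> borel_measurable (F (T - s)) \<longrightarrow>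
      (\<integral>w. (a (T - s) w - Y (T - s) w) \<bullet> \<eta> w \<partial>M) \<le> \<kappa> * L2_norm M \<eta>)" for s \<kappa>
  have small: "\<exists>\<kappa>. 0 \<le> \<kappa> \<and> \<kappa> < \<epsilon> \<and> N (T - t) \<kappa>" if \<epsilon>: "0 < \<epsilon>" for \<epsilon>
  proof (rule gronwall_iterate[of "2 * K" "Ka + KY" T])
    show "0 \<le> 2 * K" "0 \<le> Ka + KY" using K(1) Ka(1) KY(1) by auto
    show "T - t \<in> {0..T}" "0 < \<epsilon>" using t \<epsilon> by auto
    fix s assume "s \<in> {0..T}"
    then have r: "T - s \<in> {0..T}" by auto
    show "N s (Ka + KY)"
      unfolding N_def
    proof (intro allI impI)
      fix \<eta> :: "'w \<Rightarrow> real^'d" assume \<eta>: "\<eta> \<in> L2 M"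
      have "L2_norm M (\<lambda>w. a (T - s) w - Y (T - s) w) \<le> Ka + KY"
        using L2_norm_triangle3[OF aL[OF r] L2_zero YL[OF r]] Ka(2)[OF r] KY(2)[OF r] L2_norm_minus[of M "Y (T - s)"]
        by simp
      then show "(\<integral>w. (a (T - s) w - Y (T - s) w) \<bullet> \<eta> w \<partial>M) \<le> (Ka + KY) * L2_norm M \<eta>"
        using L2_inner(4)[OF L2_diff[OF aL[OF r] YL[OF r]] \<eta>] mult_right_mono[OF _ L2_norm_nonneg[of M \<eta>]]
        by (meson abs_le_D1 order_trans)
    qed
  next
    fix c s :: real and n :: nat
    assume c: "0 \<le> c" and s: "s \<in> {0..T}" and IH: "\<And>s'. s' \<in> {0..s} \<Longrightarrow> N s' (c * s' ^ n)"
    have r: "T - s \<in> {0..T}" and ts: "0 \<le> T - s" "T - s \<le> T" using s by auto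
    show "N s (2 * K * c * s ^ Suc n / real (Suc n))"
      unfolding N_def
    proof (intro allI impI)
      fix \<eta> :: "'w \<Rightarrow> real^'d" assume \<eta>: "\<eta> \<in> L2 M" "\<eta> \<in> borel_measurable (F (T - s))"
      let ?k = "\<lambda>q. (2 * K * c * L2_norm M \<eta>) * (T - q) ^ n"
      have ae: "AE w in M. a (T - s) w - Y (T - s) w = (LINT q:{T - s..T}|lborel. \<beta> q w) + (I T w - I (T - s) w)"
      proof -
        have 1: "AE w in M. a T w = adjoint_terminal M T gx gm X w" using basic_adj by (simp add: basic_adjoint_def)
        have 2: "AE w in M. Y T w = adjoint_terminal M T gx gm X w" using adjoint by (simp add: adjoint_processes_def)
        have 3: "AE w in M. set_integrable lborel {T - s..T} (\<lambda>q. cl_driver q w)"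
          using L2_time_integral(3)[OF prob_space_axioms cl_driver_L2(1) ts(1) order_refl] by auto
        have 4: "AE w in M. set_integrable lborel {T - s..T} (\<lambda>q. ol_driver q w)"
          using L2_time_integral(3)[OF prob_space_axioms ol_driver_L2(1) ts(1) order_refl] by auto
        show ?thesis
          using 1 2 3 4 basic_adjoint_equation[OF r] inc[OF ts order_refl]
        proof eventually_elim
          case (elim w)
          show ?case
            unfolding elim(5,6) elim(1,2) \<beta>_def set_integral_diff(2)[OF elim(3,4)] by simp
        qed
      qed
      have Iint: "integrable M (\<lambda>w. (I T w - I (T - s) w) \<bullet> \<eta> w)"
        by (rule L2_inner(1)[OF L2_diff[OF ito_integral_D(2)[OF I T] ito_integral_D(2)[OF I r]] \<eta>(1)])
      have Bint: "integrable M (\<lambda>w. (LINT q:{T - s..T}|lborel. \<beta> q w) \<bullet> \<eta> w)"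
        by (rule L2_inner(1)[OF L2_time_integral(2)[OF prob_space_axioms \<beta> ts(1) order_refl] \<eta>(1)])
      have m: "(\<lambda>w. (a (T - s) w - Y (T - s) w) \<bullet> \<eta> w) \<in> borel_measurable M"
        by (intro borel_measurable_inner borel_measurable_diff L2_measurable[OF aL[OF r]] L2_measurable[OF YL[OF r]] L2_measurable[OF \<eta>(1)])
      have "(\<integral>w. (a (T - s) w - Y (T - s) w) \<bullet> \<eta> w \<partial>M)
          = (\<integral>w. (LINT q:{T - s..T}|lborel. \<beta> q w) \<bullet> \<eta> w + (I T w - I (T - s) w) \<bullet> \<eta> w \<partial>M)"
      proof (rule integral_cong_AE[OF m])
        show "(\<lambda>w. (LINT q:{T - s..T}|lborel. \<beta> q w) \<bullet> \<eta> w + (I T w - I (T - s) w) \<bullet> \<eta> w) \<in> borel_measurable M"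
          using Bint Iint by (intro borel_measurable_add borel_measurable_integrable)
        show "AE w in M. (a (T - s) w - Y (T - s) w) \<bullet> \<eta> w
            = (LINT q:{T - s..T}|lborel. \<beta> q w) \<bullet> \<eta> w + (I T w - I (T - s) w) \<bullet> \<eta> w"
          using ae by eventually_elim (simp only: inner_add_left)
      qed
      also have "\<dots> = (\<integral>w. (LINT q:{T - s..T}|lborel. \<beta> q w) \<bullet> \<eta> w \<partial>M) + (\<integral>w. (I T w - I (T - s) w) \<bullet> \<eta> w \<partial>M)"
        by (rule Bochner_Integration.integral_add[OF Bint Iint])
      also have "(\<integral>w. (I T w - I (T - s) w) \<bullet> \<eta> w \<partial>M) = 0"
        by (rule ito_integral_martingale[OF I ts order_refl \<eta>])
      also have "(\<integral>w. (LINT q:{T - s..T}|lborel. \<beta> q w) \<bullet> \<eta> w \<partial>M) \<le> (LINT q:{T - s..T}|lborel. ?k q)"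
      proof (rule time_integral_inner_le[OF prob_space_axioms \<beta> \<eta>(1) ts(1) order_refl])
        fix q assume q': "q \<in> {T - s..T}"
        then have q: "q \<in> {0..T}" and qs: "T - q \<in> {0..s}" and tq: "T - s \<le> q" using s by auto
        have \<eta>q: "\<eta> \<in> borel_measurable (F q)" by (rule filt_mono[OF tq \<eta>(2)])
        have "(\<integral>w. \<beta> q w \<bullet> \<eta> w \<partial>M) \<le> 2 * K * (c * (T - q) ^ n) * L2_norm M \<eta>"
          unfolding \<beta>_def
        proof (rule driver_difference_inner[OF q \<eta>(1) \<eta>q K])
          show "0 \<le> c * (T - q) ^ n" using c qs by auto
          fix \<xi> :: "'w \<Rightarrow> real^'d" assume \<xi>: "\<xi> \<in> L2 M" "\<xi> \<in> borel_measurable (F q)"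
          show "(\<integral>w. (a q w - Y q w) \<bullet> \<xi> w \<partial>M) \<le> c * (T - q) ^ n * L2_norm M \<xi>"
            using IH[OF qs] \<xi> by (simp add: N_def)
        qed
        then show "(\<integral>w. \<beta> q w \<bullet> \<eta> w \<partial>M) \<le> ?k q" by (simp only: ac_simps)
      next
        show "continuous_on {T - s..T} ?k" by (intro continuous_intros)
      qed
      also have "(LINT q:{T - s..T}|lborel. ?k q) = 2 * K * c * s ^ Suc n / real (Suc n) * L2_norm M \<eta>"
        unfolding set_integral_powers(2)[OF ts(2)] by simp
      finally show "(\<integral>w. (a (T - s) w - Y (T - s) w) \<bullet> \<eta> w \<partial>M) \<le> 2 * K * c * s ^ Suc n / real (Suc n) * L2_norm M \<eta>"
        by simp
    qed
  qed
  show ?thesis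
  proof (rule field_le_epsilon)
    fix \<epsilon> :: real assume "0 < \<epsilon>"
    \<comment> \<open>The 1 covers the case that \<open>\<eta>\<close> has norm 0.\<close>
    then have "0 < \<epsilon> / (1 + L2_norm M \<eta>)" using L2_norm_nonneg[of M \<eta>] by (intro divide_pos_pos) linarith+
    from small[OF this] obtain \<kappa> where \<kappa>: "0 \<le> \<kappa>" "\<kappa> < \<epsilon> / (1 + L2_norm M \<eta>)" "N (T - t) \<kappa>" by blast
    have "(\<integral>w. (a t w - Y t w) \<bullet> \<eta> w \<partial>M) \<le> \<kappa> * L2_norm M \<eta>"
      using \<kappa>(3) \<eta> by (simp add: N_def)
    also have "\<dots> \<le> \<kappa> * (1 + L2_norm M \<eta>)" using \<kappa>(1) by (intro mult_left_mono) auto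
    also have "\<dots> \<le> \<epsilon>" using \<kappa>(2) L2_norm_nonneg[of M \<eta>] by (simp add: pos_less_divide_eq)
    finally show "(\<integral>w. (a t w - Y t w) \<bullet> \<eta> w \<partial>M) \<le> 0 + \<epsilon>" by simp
  qed
qed

text \<open>The vector in question is adapted and equals the residual minus
  \<open>transpose (\<sigma> t)\<close> applied to \<open>a - Y\<close>. Tested against itself, the
  first part contributes 0 and the second at most 0.\<close>

lemma control_adjoint:
  assumes t: "t \<in> {0..T}"
  shows "AE w in M. ctrl t w + transpose (\<sigma> t) *v Y t w = 0"
proof -
  define \<eta> where "\<eta> w = ctrl t w + transpose (\<sigma> t) *v Y t w" for w
  note aL = regular_process_L2[OF a_regular t] and YL = regular_process_L2[OF Y_regular t]
  have \<eta>: "\<eta> \<in> L2 M"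
    unfolding \<eta>_def[abs_def]
    by (intro L2_add(1) regular_process_L2[OF ctrl_regular t] L2_matrix(1)[OF borel_measurable_const YL norm_ge_zero order_refl])
  have \<eta>F: "\<eta> \<in> borel_measurable (F t)"
    unfolding \<eta>_def[abs_def]
    by (intro borel_measurable_add ctrl_adapted[OF t] borel_measurable_matrix_vector borel_measurable_const Y_adapted[OF t])
  \<comment> \<open>The minus sign is absorbed into the test vector so that the one-sided comparison
    points in the right direction.\<close>
  have \<xi>: "(\<lambda>w. (- \<sigma> t) *v \<eta> w) \<in> L2 M" by (rule L2_matrix(1)[OF borel_measurable_const \<eta> norm_ge_zero order_refl])
  have \<xi>F: "(\<lambda>w. (- \<sigma> t) *v \<eta> w) \<in> borel_measurable (F t)"
    by (intro borel_measurable_matrix_vector borel_measurable_const \<eta>F)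
  have cancel: "c + y = (c + z) - (z - y)" for c y z :: "real^'m" by simp
  have "(L2_norm M \<eta>)\<^sup>2 = (\<integral>w. residual t w \<bullet> \<eta> w + (a t w - Y t w) \<bullet> ((- \<sigma> t) *v \<eta> w) \<partial>M)"
    unfolding L2_norm_sq
  proof (rule Bochner_Integration.integral_cong[OF refl])
    fix w
    have "\<eta> w = residual t w - transpose (\<sigma> t) *v (a t w - Y t w)"
      unfolding \<eta>_def residual_def matrix_vector_mult_diff_distrib by (rule cancel)
    then have "\<eta> w \<bullet> \<eta> w = residual t w \<bullet> \<eta> w - (transpose (\<sigma> t) *v (a t w - Y t w)) \<bullet> \<eta> w"
      using inner_diff_left[of "residual t w" "transpose (\<sigma> t) *v (a t w - Y t w)" "\<eta> w"] by (simp only:)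
    moreover have "(- \<sigma> t) *v \<eta> w = - (\<sigma> t *v \<eta> w)" by (simp add: matrix_vector_mult_def vec_eq_iff sum_negf)
    ultimately show "(norm (\<eta> w))\<^sup>2 = residual t w \<bullet> \<eta> w + (a t w - Y t w) \<bullet> ((- \<sigma> t) *v \<eta> w)"
      unfolding power2_norm_eq_inner transpose_inner by (simp only: inner_minus_right diff_conv_add_uminus)
  qed
  also have "\<dots> = (\<integral>w. residual t w \<bullet> \<eta> w \<partial>M) + (\<integral>w. (a t w - Y t w) \<bullet> ((- \<sigma> t) *v \<eta> w) \<partial>M)"
    by (rule Bochner_Integration.integral_add[OF L2_inner(1)[OF residual_L2[OF t] \<eta>] L2_inner(1)[OF L2_diff[OF aL YL] \<xi>]])
  also have "\<dots> \<le> 0"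
    using residual_orthogonal[OF t \<eta> \<eta>F] adjoint_comparison[OF t \<xi> \<xi>F] by simp
  finally have "L2_norm M \<eta> = 0" by simp
  from L2_norm_eq_0[OF \<eta> this] show ?thesis by (simp add: \<eta>_def)
qed

end

section \<open>Duality between the adjoint process and the variation of the state\<close>

lemma set_integral_whole_time:
  fixes h :: "real \<Rightarrow> 'b::euclidean_space"
  shows "(LINT q:{0..T}|lborel. h q) = (\<integral>q. h q \<partial>restrict_space lborel {0..T})"
    and "set_integrable lborel {0..T} h \<longleftrightarrow> integrable (restrict_space lborel {0..T}) h"
  by (simp_all add: integral_restrict_space integrable_restrict_space set_lebesgue_integral_def set_integrable_def)

lemma L2_time_sections:
  fixes \<beta> :: "real \<Rightarrow> 'w \<Rightarrow> 'b::euclidean_space"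
  assumes M: "prob_space M" and \<beta>: "(\<lambda>(t, w). \<beta> t w) \<in> L2 (dt_dP M T)"
  shows "AE t in restrict_space lborel {0..T}. \<beta> t \<in> L2 M"
    and "(\<lambda>t. L2_norm M (\<beta> t)) \<in> L2 (restrict_space lborel {0..T})"
proof -
  let ?N = "restrict_space lborel {0..T}"
  interpret P: pair_sigma_finite ?N M by (rule time_pair_sigma_finite[OF M])
  interpret M: prob_space M by fact
  have i: "integrable (?N \<Otimes>\<^sub>M M) (\<lambda>(t, w). (norm (\<beta> t w))\<^sup>2)"
    using L2_integrable[OF \<beta>] by (simp add: case_prod_beta' dt_dP_def)
  show "AE t in ?N. \<beta> t \<in> L2 M"
    using P.AE_integrable_fst[OF i] AE_space
  proof eventually_elim
    case (elim t)
    then show ?case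
      using dt_dP_section[OF L2_measurable[OF \<beta>], of t] by (auto intro!: L2_I simp: space_restrict_space)
  qed
  have sq: "integrable ?N (\<lambda>t. \<integral>w. (norm (\<beta> t w))\<^sup>2 \<partial>M)"
    using P.integrable_fst[OF i] by simp
  have "(\<lambda>t. sqrt (\<integral>w. (norm (\<beta> t w))\<^sup>2 \<partial>M)) \<in> borel_measurable ?N"
    using borel_measurable_integrable[OF sq] by measurable
  then show "(\<lambda>t. L2_norm M (\<beta> t)) \<in> L2 ?N"
    using sq by (intro L2_I) (simp_all add: L2_norm_def)
qed

text \<open>Fubini on the triangle \<open>q \<le> r\<close>; the kernel is dominated by the product
  of the \<open>L2\<close> norms of the sections at \<open>r\<close> and at
  \<open>q\<close>.\<close>

lemma (in prob_space) triangle_swap: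
  fixes \<beta> \<gamma> :: "real \<Rightarrow> 'a \<Rightarrow> 'b::euclidean_space"
  assumes \<beta>: "(\<lambda>(t, w). \<beta> t w) \<in> L2 (dt_dP M T)" and \<gamma>: "(\<lambda>(t, w). \<gamma> t w) \<in> L2 (dt_dP M T)"
    and \<gamma>s: "\<And>t. t \<in> {0..T} \<Longrightarrow> \<gamma> t \<in> L2 M"
  shows "(LINT q:{0..T}|lborel. LINT r:{q..T}|lborel. \<integral>w. \<gamma> r w \<bullet> \<beta> q w \<partial>M)
      = (LINT r:{0..T}|lborel. LINT q:{0..r}|lborel. \<integral>w. \<gamma> r w \<bullet> \<beta> q w \<partial>M)"
    and "set_integrable lborel {0..T} (\<lambda>q. LINT r:{q..T}|lborel. \<integral>w. \<gamma> r w \<bullet> \<beta> q w \<partial>M)"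
proof -
  let ?N = "restrict_space lborel {0..T}"
  interpret N: finite_measure ?N by (rule finite_measure_time)
  define G where "G r q = (\<integral>w. \<gamma> r w \<bullet> \<beta> q w \<partial>M)" for r q
  \<comment> \<open>The kernel extended by 0 from the triangle to the square.\<close>
  define k where "k r q = indicator {p. snd p \<le> fst p} (r, q) * G r q" for r q
  have sp: "space ?N = {0..T}" by (simp add: space_restrict_space)
  have \<beta>m: "(\<lambda>z. \<beta> (fst z) (snd z)) \<in> borel_measurable (?N \<Otimes>\<^sub>M M)" and \<gamma>m: "(\<lambda>z. \<gamma> (fst z) (snd z)) \<in> borel_measurable (?N \<Otimes>\<^sub>M M)"
    using L2_measurable[OF \<beta>] L2_measurable[OF \<gamma>] by (simp_all add: dt_dP_def case_prod_beta')
  have "(\<lambda>z. \<gamma> (fst (fst z)) (snd z)) \<in> borel_measurable ((?N \<Otimes>\<^sub>M ?N) \<Otimes>\<^sub>M M)"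
  proof -
    have "(\<lambda>z. (fst (fst z), snd z)) \<in> measurable ((?N \<Otimes>\<^sub>M ?N) \<Otimes>\<^sub>M M) (?N \<Otimes>\<^sub>M M)" by measurable
    from measurable_compose[OF this \<gamma>m] show ?thesis by simp
  qed
  moreover have "(\<lambda>z. \<beta> (snd (fst z)) (snd z)) \<in> borel_measurable ((?N \<Otimes>\<^sub>M ?N) \<Otimes>\<^sub>M M)"
  proof -
    have "(\<lambda>z. (snd (fst z), snd z)) \<in> measurable ((?N \<Otimes>\<^sub>M ?N) \<Otimes>\<^sub>M M) (?N \<Otimes>\<^sub>M M)" by measurable
    from measurable_compose[OF this \<beta>m] show ?thesis by simp
  qed
  ultimately have "(\<lambda>(p, w). \<gamma> (fst p) w \<bullet> \<beta> (snd p) w) \<in> borel_measurable ((?N \<Otimes>\<^sub>M ?N) \<Otimes>\<^sub>M M)"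
    unfolding case_prod_beta' by (rule borel_measurable_inner)
  from borel_measurable_lebesgue_integral[OF this]
  have Gm: "(\<lambda>p. G (fst p) (snd p)) \<in> borel_measurable (?N \<Otimes>\<^sub>M ?N)" unfolding G_def .
  have im: "(\<lambda>p. indicator {p. snd p \<le> fst p} p :: real) \<in> borel_measurable (?N \<Otimes>\<^sub>M ?N)"
  proof (rule borel_measurable_indicator')
    have [measurable]: "fst \<in> borel_measurable (?N \<Otimes>\<^sub>M ?N)" "snd \<in> borel_measurable (?N \<Otimes>\<^sub>M ?N)"
      by (auto intro!: measurable_compose[OF measurable_fst] measurable_compose[OF measurable_snd] measurable_restrict_space1)
    show "{x \<in> space (?N \<Otimes>\<^sub>M ?N). x \<in> {p. snd p \<le> fst p}} \<in> sets (?N \<Otimes>\<^sub>M ?N)" by measurable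
  qed
  have km: "(\<lambda>(r, q). k r q) \<in> borel_measurable (?N \<Otimes>\<^sub>M ?N)"
    using borel_measurable_times[OF im Gm] by (simp add: k_def case_prod_beta')
  have P: "integrable ?N (\<lambda>t. L2_norm M (\<gamma> t))" and Q: "integrable ?N (\<lambda>t. L2_norm M (\<beta> t))"
    using L2_imp_integrable[OF finite_measure_time] L2_time_sections(2)[OF prob_space_axioms \<gamma>] L2_time_sections(2)[OF prob_space_axioms \<beta>]
    by blast+
  have le: "AE q in ?N. \<bar>k r q\<bar> \<le> L2_norm M (\<gamma> r) * L2_norm M (\<beta> q)" if r: "r \<in> space ?N" for r
    using L2_time_sections(1)[OF prob_space_axioms \<beta>]
  proof eventually_elim
    case (elim q)
    have "\<gamma> r \<in> L2 M" by (rule \<gamma>s) (use r sp in simp)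
    from L2_inner(4)[OF this elim] have "\<bar>G r q\<bar> \<le> L2_norm M (\<gamma> r) * L2_norm M (\<beta> q)" by (simp add: G_def)
    moreover have "\<bar>k r q\<bar> \<le> \<bar>G r q\<bar>" by (simp add: k_def indicator_def)
    ultimately show ?case by simp
  qed
  note fub = N.product_bound_fubini[OF km P Q le]
  have e1: "(LINT r:{q..T}|lborel. G r q) = (\<integral>r. k r q \<partial>?N)" if q: "q \<in> {0..T}" for q
  proof -
    have "(LINT r:{q..T}|lborel. G r q) = (\<integral>r. indicator {q..T} r *\<^sub>R G r q \<partial>?N)"
      using q by (intro set_integral_time(1)) auto
    also have "\<dots> = (\<integral>r. k r q \<partial>?N)"
      by (rule Bochner_Integration.integral_cong) (auto simp: k_def indicator_def space_restrict_space)
    finally show ?thesis .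
  qed
  have e2: "(LINT q:{0..r}|lborel. G r q) = (\<integral>q. k r q \<partial>?N)" if r: "r \<in> {0..T}" for r
  proof -
    have "(LINT q:{0..r}|lborel. G r q) = (\<integral>q. indicator {0..r} q *\<^sub>R G r q \<partial>?N)"
      using r by (intro set_integral_time(1)) auto
    also have "\<dots> = (\<integral>q. k r q \<partial>?N)"
      by (rule Bochner_Integration.integral_cong) (auto simp: k_def indicator_def space_restrict_space)
    finally show ?thesis .
  qed
  have "(LINT q:{0..T}|lborel. LINT r:{q..T}|lborel. G r q) = (\<integral>q. (\<integral>r. k r q \<partial>?N) \<partial>?N)"
    unfolding set_integral_whole_time by (rule Bochner_Integration.integral_cong[OF refl e1]) (simp add: sp)
  also have "\<dots> = (\<integral>r. (\<integral>q. k r q \<partial>?N) \<partial>?N)" by (rule fub(1))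
  also have "\<dots> = (LINT r:{0..T}|lborel. LINT q:{0..r}|lborel. G r q)"
    unfolding set_integral_whole_time(1)[of T] by (rule Bochner_Integration.integral_cong[OF refl e2[symmetric]]) (simp add: sp)
  finally show "(LINT q:{0..T}|lborel. LINT r:{q..T}|lborel. \<integral>w. \<gamma> r w \<bullet> \<beta> q w \<partial>M)
      = (LINT r:{0..T}|lborel. LINT q:{0..r}|lborel. \<integral>w. \<gamma> r w \<bullet> \<beta> q w \<partial>M)" unfolding G_def .
  have "integrable ?N (\<lambda>q. LINT r:{q..T}|lborel. G r q)"
  proof (rule Bochner_Integration.integrable_cong[THEN iffD2, OF refl _ fub(2)])
    fix q assume "q \<in> space ?N"
    then show "(LINT r:{q..T}|lborel. G r q) = (\<integral>r. k r q \<partial>?N)" by (intro e1) (simp add: sp)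
  qed
  then show "set_integrable lborel {0..T} (\<lambda>q. LINT r:{q..T}|lborel. \<integral>w. \<gamma> r w \<bullet> \<beta> q w \<partial>M)"
    unfolding set_integral_whole_time G_def .
qed

context closed_loop
begin

definition state_change :: "(real \<Rightarrow> 'w \<Rightarrow> real^'d) \<Rightarrow> real \<Rightarrow> 'w \<Rightarrow> real^'d" where
  "state_change X' t w = X' t w - X t w"

definition drift_change ::
  "(real \<Rightarrow> 'w \<Rightarrow> real^'m) \<Rightarrow> (real \<Rightarrow> 'w \<Rightarrow> real^'d) \<Rightarrow> real \<Rightarrow> 'w \<Rightarrow> real^'d" where
  "drift_change \<beta> X' t w = (b t (X' t w) (law M X' t) + \<sigma> t *v \<beta> t w) - (b t (X t w) (law M X t) + \<sigma> t *v ctrl t w)"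

context
  fixes \<beta> :: "real \<Rightarrow> 'w \<Rightarrow> real^'m" and X' :: "real \<Rightarrow> 'w \<Rightarrow> real^'d"
  assumes \<beta>: "admissible M F T \<beta>" and X': "state_process M T X0 W \<sigma> b \<beta> X'"
begin

lemma X'_regular: "regular_process M T X'" by (rule state_process_regular(1)[OF X'])

lemma beta_L2: "(\<lambda>(t, w). \<beta> t w) \<in> L2 (dt_dP M T)"
  using \<beta> progressive_dt_dP by (auto simp: admissible_def intro!: L2_I simp: case_prod_beta')

lemma state_change_L2: "t \<in> {0..T} \<Longrightarrow> state_change X' t \<in> L2 M"
  unfolding state_change_def[abs_def]
  by (rule L2_diff[OF regular_process_L2[OF X'_regular] regular_process_L2[OF X_regular]])

lemma state_change_L2_time: "(\<lambda>(t, w). state_change X' t w) \<in> L2 (dt_dP M T)"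
  using L2_diff[OF regular_process_L2_time[OF X'_regular] regular_process_L2_time[OF X_regular]]
  by (simp add: state_change_def case_prod_beta')

lemma drift_change_L2_time: "(\<lambda>(t, w). drift_change \<beta> X' t w) \<in> L2 (dt_dP M T)"
  using L2_diff[OF drift_sigma_L2[OF X'_regular beta_L2] drift_sigma_L2[OF X_regular regular_process_L2_time[OF ctrl_regular]]]
  by (simp add: drift_change_def case_prod_beta')

lemma drift_change_adapted: "t \<in> {0..T} \<Longrightarrow> drift_change \<beta> X' t \<in> borel_measurable (F t)"
  unfolding drift_change_def[abs_def]
  using \<beta> unfolding admissible_def
  by (intro borel_measurable_diff borel_measurable_add borel_measurable_matrix_vector borel_measurable_const ctrl_adapted
      drift_L2(3)[OF X'_regular] drift_L2(3)[OF X_regular] state_process_regular(2)[OF X'] X_adapted) (auto intro: progressive_adapted)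

text \<open>At each time the two versions of the noise integral agree almost surely and cancel,
  together with the common initial value.\<close>

lemma state_change_eq:
  assumes t: "t \<in> {0..T}"
  shows "AE w in M. state_change X' t w = (LINT q:{0..t}|lborel. drift_change \<beta> X' q w)"
proof -
  have t0: "0 \<le> (0::real)" "t \<le> T" using t by auto
  note uL = regular_process_L2_time[OF ctrl_regular]
  obtain S where S: "ito_integral M F T W (\<lambda>t w. \<sigma> t) S"
    and eq: "\<And>r. r \<in> {0..T} \<Longrightarrow> AE w in M. X r w = X0 w
       + (LINT q:{0..r}|lborel. b q (X q w) (law M X q) + \<sigma> q *v ctrl q w) + S r w"
    by (rule state_increment[OF state uL]) (rule that)
  obtain S' where S': "ito_integral M F T W (\<lambda>t w. \<sigma> t) S'"
    and eq': "\<And>r. r \<in> {0..T} \<Longrightarrow> AE w in M. X' r w = X0 w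
       + (LINT q:{0..r}|lborel. b q (X' q w) (law M X' q) + \<sigma> q *v \<beta> q w) + S' r w"
    by (rule state_increment[OF X' beta_L2]) (rule that)
  have 1: "AE w in M. set_integrable lborel {0..t} (\<lambda>q. b q (X q w) (law M X q) + \<sigma> q *v ctrl q w)"
    using L2_time_integral(3)[OF prob_space_axioms drift_sigma_L2[OF X_regular uL] t0] by eventually_elim blast
  have 2: "AE w in M. set_integrable lborel {0..t} (\<lambda>q. b q (X' q w) (law M X' q) + \<sigma> q *v \<beta> q w)"
    using L2_time_integral(3)[OF prob_space_axioms drift_sigma_L2[OF X'_regular beta_L2] t0] by eventually_elim blast
  show ?thesis
    using 1 2 eq[OF t] eq'[OF t] wiener_integral_unique[OF S S' t]
  proof eventually_elim
    case (elim w)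
    show ?case
      unfolding state_change_def drift_change_def elim(3,4,5) set_integral_diff(2)[OF elim(2,1)] by simp
  qed
qed

text \<open>The drift change at time \<open>q\<close> is known at \<open>q\<close>, hence orthogonal
  to the stochastic integral after \<open>q\<close>; the remaining terms are the backward equation
  on \<open>{q..T}\<close>.\<close>

lemma drift_change_terminal_adjoint:
  assumes q: "q \<in> {0..T}" and \<delta>: "drift_change \<beta> X' q \<in> L2 M"
  shows "(\<integral>w. drift_change \<beta> X' q w \<bullet> Y T w \<partial>M) =
    (\<integral>w. Y q w \<bullet> drift_change \<beta> X' q w \<partial>M) - (LINT r:{q..T}|lborel. \<integral>w. ol_driver r w \<bullet> drift_change \<beta> X' q w \<partial>M)"
proof -
  have T: "T \<in> {0..T}" and q0: "0 \<le> q" "q \<le> T" using T_pos q by auto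
  note YL = regular_process_L2[OF Y_regular]
  obtain I where I: "ito_integral M F T W Z I"
    and inc: "\<And>t r. 0 \<le> t \<Longrightarrow> t \<le> r \<Longrightarrow> r \<le> T \<Longrightarrow>
      AE w in M. Y t w = Y r w + (LINT q:{t..r}|lborel. ol_driver q w) - (I r w - I t w)"
    by (rule adjoint_increment) (rule that)
  note IL = ito_integral_D(2)[OF I]
  let ?V = "\<lambda>w. LINT r:{q..T}|lborel. ol_driver r w"
  have VL: "?V \<in> L2 M" by (rule L2_time_integral(2)[OF prob_space_axioms ol_driver_L2(1) q0(1) order_refl])
  note i = L2_inner(1)[OF YL[OF T] \<delta>] L2_inner(1)[OF VL \<delta>] L2_inner(1)[OF L2_diff[OF IL[OF T] IL[OF q]] \<delta>]
  have "(\<integral>w. Y q w \<bullet> drift_change \<beta> X' q w \<partial>M)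
      = (\<integral>w. Y T w \<bullet> drift_change \<beta> X' q w + ?V w \<bullet> drift_change \<beta> X' q w - (I T w - I q w) \<bullet> drift_change \<beta> X' q w \<partial>M)"
  proof (rule integral_cong_AE)
    show "(\<lambda>w. Y q w \<bullet> drift_change \<beta> X' q w) \<in> borel_measurable M"
      using L2_inner(1)[OF YL[OF q] \<delta>] by (rule borel_measurable_integrable)
    show "(\<lambda>w. Y T w \<bullet> drift_change \<beta> X' q w + ?V w \<bullet> drift_change \<beta> X' q w - (I T w - I q w) \<bullet> drift_change \<beta> X' q w) \<in> borel_measurable M"
      using i by (intro borel_measurable_add borel_measurable_diff borel_measurable_integrable)
    show "AE w in M. Y q w \<bullet> drift_change \<beta> X' q w
        = Y T w \<bullet> drift_change \<beta> X' q w + ?V w \<bullet> drift_change \<beta> X' q w - (I T w - I q w) \<bullet> drift_change \<beta> X' q w"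
      using inc[OF q0 order_refl]
    proof eventually_elim
      case (elim w)
      show ?case unfolding elim inner_diff_left[of "_ + _"] inner_add_left[of "Y T w"] by (rule refl)
    qed
  qed
  also have "\<dots> = (\<integral>w. Y T w \<bullet> drift_change \<beta> X' q w \<partial>M) + (\<integral>w. ?V w \<bullet> drift_change \<beta> X' q w \<partial>M) - (\<integral>w. (I T w - I q w) \<bullet> drift_change \<beta> X' q w \<partial>M)"
    unfolding Bochner_Integration.integral_diff[OF Bochner_Integration.integrable_add[OF i(1,2)] i(3)]
      Bochner_Integration.integral_add[OF i(1,2)] by (rule refl)
  also have "(\<integral>w. (I T w - I q w) \<bullet> drift_change \<beta> X' q w \<partial>M) = 0"
    by (rule ito_integral_martingale[OF I q0 order_refl \<delta> drift_change_adapted[OF q]])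
  also have "(\<integral>w. ?V w \<bullet> drift_change \<beta> X' q w \<partial>M) = (LINT r:{q..T}|lborel. \<integral>w. ol_driver r w \<bullet> drift_change \<beta> X' q w \<partial>M)"
    by (rule time_integral_inner(1)[OF prob_space_axioms ol_driver_L2(1) \<delta> q0(1) order_refl])
  finally show ?thesis unfolding inner_commute[of "drift_change \<beta> X' q _" "Y T _"] by linarith
qed

text \<open>Integration by parts in expectation; the additive deterministic noise cancels in \<open>X' - X\<close>, so that
  Fubini's theorem replaces Ito's product rule.\<close>

lemma duality:
  "(\<integral>w. Y T w \<bullet> state_change X' T w \<partial>M) =
    (LINT q:{0..T}|lborel. \<integral>w. Y q w \<bullet> drift_change \<beta> X' q w \<partial>M)
    - (LINT q:{0..T}|lborel. \<integral>w. ol_driver q w \<bullet> state_change X' q w \<partial>M)"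
proof -
  have T: "T \<in> {0..T}" and z: "(0::real) \<le> 0" using T_pos by auto
  let ?N = "restrict_space lborel {0..T}"
  note YT = regular_process_L2[OF Y_regular T]
  \<comment> \<open>The state change is the time integral of the drift change, so pairings may be
    taken with either of them.\<close>
  have swap: "(\<integral>w. (LINT q:{0..r}|lborel. drift_change \<beta> X' q w) \<bullet> \<rho> w \<partial>M) = (\<integral>w. \<rho> w \<bullet> state_change X' r w \<partial>M)"
    if r: "r \<in> {0..T}" and \<rho>: "\<rho> \<in> L2 M" for r \<rho>
  proof (rule integral_cong_AE)
    have r0: "0 \<le> (0::real)" "r \<le> T" using r by auto
    show "(\<lambda>w. (LINT q:{0..r}|lborel. drift_change \<beta> X' q w) \<bullet> \<rho> w) \<in> borel_measurable M"
      using L2_inner(1)[OF L2_time_integral(2)[OF prob_space_axioms drift_change_L2_time r0] \<rho>] by (rule borel_measurable_integrable)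
    show "(\<lambda>w. \<rho> w \<bullet> state_change X' r w) \<in> borel_measurable M"
      using L2_inner(1)[OF \<rho> state_change_L2[OF r]] by (rule borel_measurable_integrable)
    show "AE w in M. (LINT q:{0..r}|lborel. drift_change \<beta> X' q w) \<bullet> \<rho> w = \<rho> w \<bullet> state_change X' r w"
      using state_change_eq[OF r] by eventually_elim (simp only: inner_commute)
  qed
  have i1: "integrable ?N (\<lambda>q. \<integral>w. Y q w \<bullet> drift_change \<beta> X' q w \<partial>M)"
    using dt_dP_fubini(4)[OF prob_space_axioms L2_time_inner[OF regular_process_L2_time[OF Y_regular] drift_change_L2_time] z order_refl]
    unfolding set_integral_whole_time .
  note sw = triangle_swap[OF drift_change_L2_time ol_driver_L2]
  note i2 = sw(2)[unfolded set_integral_whole_time]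
  have i0: "integrable ?N (\<lambda>q. \<integral>w. drift_change \<beta> X' q w \<bullet> Y T w \<partial>M)"
    using time_integral_inner(2)[OF prob_space_axioms drift_change_L2_time YT z order_refl] unfolding set_integral_whole_time .
  have "(\<integral>w. Y T w \<bullet> state_change X' T w \<partial>M) = (\<integral>q. (\<integral>w. drift_change \<beta> X' q w \<bullet> Y T w \<partial>M) \<partial>?N)"
    unfolding swap[OF T YT, symmetric] time_integral_inner(1)[OF prob_space_axioms drift_change_L2_time YT z order_refl]
    by (rule set_integral_whole_time)
  also have "\<dots> = (\<integral>q. (\<integral>w. Y q w \<bullet> drift_change \<beta> X' q w \<partial>M) - (LINT r:{q..T}|lborel. \<integral>w. ol_driver r w \<bullet> drift_change \<beta> X' q w \<partial>M) \<partial>?N)"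
  proof (rule integral_cong_AE)
    show "AE q in ?N. (\<integral>w. drift_change \<beta> X' q w \<bullet> Y T w \<partial>M) =
        (\<integral>w. Y q w \<bullet> drift_change \<beta> X' q w \<partial>M) - (LINT r:{q..T}|lborel. \<integral>w. ol_driver r w \<bullet> drift_change \<beta> X' q w \<partial>M)"
      using L2_time_sections(1)[OF prob_space_axioms drift_change_L2_time] AE_space
    proof eventually_elim
      case (elim q)
      then show ?case by (intro drift_change_terminal_adjoint) (simp_all add: space_restrict_space)
    qed
  qed (use i0 i1 i2 in \<open>auto intro!: borel_measurable_diff borel_measurable_integrable\<close>)
  also have "\<dots> = (LINT q:{0..T}|lborel. \<integral>w. Y q w \<bullet> drift_change \<beta> X' q w \<partial>M)
      - (LINT q:{0..T}|lborel. LINT r:{q..T}|lborel. \<integral>w. ol_driver r w \<bullet> drift_change \<beta> X' q w \<partial>M)"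
    unfolding set_integral_whole_time(1)[of T] by (rule Bochner_Integration.integral_diff[OF i1 i2])
  \<comment> \<open>After the exchange the inner integral collects the drift change up to time
    \<open>r\<close>, which is the state change at \<open>r\<close>.\<close>
  also have "(LINT q:{0..T}|lborel. LINT r:{q..T}|lborel. \<integral>w. ol_driver r w \<bullet> drift_change \<beta> X' q w \<partial>M)
      = (LINT r:{0..T}|lborel. LINT q:{0..r}|lborel. \<integral>w. ol_driver r w \<bullet> drift_change \<beta> X' q w \<partial>M)"
    by (rule sw(1))
  also have "\<dots> = (LINT r:{0..T}|lborel. \<integral>w. ol_driver r w \<bullet> state_change X' r w \<partial>M)"
  proof (rule set_lebesgue_integral_cong)
    show "\<forall>r. r \<in> {0..T} \<longrightarrow> (LINT q:{0..r}|lborel. \<integral>w. ol_driver r w \<bullet> drift_change \<beta> X' q w \<partial>M) = (\<integral>w. ol_driver r w \<bullet> state_change X' r w \<partial>M)"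
    proof (intro allI impI)
      fix r assume r: "r \<in> {0..T}"
      then have rT: "r \<le> T" by simp
      have "(LINT q:{0..r}|lborel. \<integral>w. ol_driver r w \<bullet> drift_change \<beta> X' q w \<partial>M)
          = (LINT q:{0..r}|lborel. \<integral>w. drift_change \<beta> X' q w \<bullet> ol_driver r w \<partial>M)"
        by (simp only: inner_commute[of "ol_driver r _"])
      also have "\<dots> = (\<integral>w. (LINT q:{0..r}|lborel. drift_change \<beta> X' q w) \<bullet> ol_driver r w \<partial>M)"
        by (rule time_integral_inner(1)[OF prob_space_axioms drift_change_L2_time ol_driver_L2(2)[OF r] z rT, symmetric])
      also have "\<dots> = (\<integral>w. ol_driver r w \<bullet> state_change X' r w \<partial>M)" by (rule swap[OF r ol_driver_L2(2)[OF r]])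
      finally show "(LINT q:{0..r}|lborel. \<integral>w. ol_driver r w \<bullet> drift_change \<beta> X' q w \<partial>M) = (\<integral>w. ol_driver r w \<bullet> state_change X' r w \<partial>M)" .
    qed
  qed simp
  finally show ?thesis .
qed

end

end

section \<open>The maximum principle\<close>

text \<open>Freezing the control leaves convexity in the state and the law. The control enters the
  Hamiltonian through an explicit quadratic separate from the state, and its exact expansion is
  treated in \<open>running_cost_inequality\<close>.\<close>

lemma L_convex_imp_state:
  fixes h :: "'b::euclidean_space \<Rightarrow> 'b measure \<Rightarrow> 'e::euclidean_space \<Rightarrow> real"
  shows "L_convex \<Omega> h \<Longrightarrow> L_convex_state \<Omega> (\<lambda>x \<mu>. h x \<mu> c)"
  unfolding L_convex_state_def
proof (intro allI ballI)
  fix x and \<mu> :: "'b measure"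
  assume h: "L_convex \<Omega> h" and \<mu>: "\<mu> \<in> P2"
  then obtain p q D where d: "GDERIV (\<lambda>y. h y \<mu> c) x :> p" "has_lions_derivative \<Omega> (\<lambda>\<nu>. h x \<nu> c) (\<lambda>y v. D y \<bullet> v) \<mu>"
    and le: "\<forall>x' a'. \<forall>\<mu>'\<in>P2. \<forall>(P :: ('b \<times> 'b) measure) X X'.
        prob_space P \<longrightarrow> X \<in> L2 P \<longrightarrow> X' \<in> L2 P \<longrightarrow>
        distr P borel X = \<mu> \<longrightarrow> distr P borel X' = \<mu>' \<longrightarrow>
        h x' \<mu>' a' \<ge> h x \<mu> c + p \<bullet> (x' - x) + q \<bullet> (a' - c) + (\<integral>w. D (X w) \<bullet> (X' w - X w) \<partial>P)"
    unfolding L_convex_def by blast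
  show "\<exists>p D. GDERIV (\<lambda>y. h y \<mu> c) x :> p \<and> has_lions_derivative \<Omega> (\<lambda>\<nu>. h x \<nu> c) (\<lambda>y v. D y \<bullet> v) \<mu> \<and>
      (\<forall>x'. \<forall>\<mu>'\<in>P2. \<forall>(P :: ('b \<times> 'b) measure) X X'.
        prob_space P \<longrightarrow> X \<in> L2 P \<longrightarrow> X' \<in> L2 P \<longrightarrow>
        distr P borel X = \<mu> \<longrightarrow> distr P borel X' = \<mu>' \<longrightarrow>
        h x' \<mu>' c \<ge> h x \<mu> c + p \<bullet> (x' - x) + (\<integral>w. D (X w) \<bullet> (X' w - X w) \<partial>P))"
  proof (intro exI conjI allI ballI impI)
    fix x' and \<mu>' :: "'b measure" and P :: "('b \<times> 'b) measure" and X X'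
    assume a: "\<mu>' \<in> P2" "prob_space P" "X \<in> L2 P" "X' \<in> L2 P" "distr P borel X = \<mu>" "distr P borel X' = \<mu>'"
    have "h x' \<mu>' c \<ge> h x \<mu> c + p \<bullet> (x' - x) + q \<bullet> (c - c) + (\<integral>w. D (X w) \<bullet> (X' w - X w) \<partial>P)"
      using le a by blast
    then show "h x' \<mu>' c \<ge> h x \<mu> c + p \<bullet> (x' - x) + (\<integral>w. D (X w) \<bullet> (X' w - X w) \<partial>P)" by simp
  qed (rule d)+
qed

lemma GDERIV_unique: "GDERIV f x :> p \<Longrightarrow> GDERIV f x :> q \<Longrightarrow> p = q" for p q :: "'a::euclidean_space"
  unfolding gderiv_def
proof -
  assume "(f has_derivative (\<lambda>h. h \<bullet> p)) (at x)" "(f has_derivative (\<lambda>h. h \<bullet> q)) (at x)"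
  from has_derivative_unique[OF this] have "h \<bullet> p = h \<bullet> q" for h by (rule fun_cong)
  then show "p = q" using vector_eq_ldot[of p q] by blast
qed

text \<open>Convexity speaks of some gradients and of variables on the space
  \<open>'b \<times> 'b\<close>. The joint law of \<open>V\<close> and \<open>V'\<close> transports
  them there, and uniqueness of gradients and of pairings with Lions derivatives replaces the
  unnamed gradients by the given ones.\<close>

lemma (in prob_space) L_convex_state_inequality:
  fixes h :: "'b::euclidean_space \<Rightarrow> 'b measure \<Rightarrow> real" and V V' :: "'a \<Rightarrow> 'b"
  assumes h: "L_convex_state M h" and V: "V \<in> L2 M" and V': "V' \<in> L2 M"
    and p: "GDERIV (\<lambda>y. h y (distr M borel V)) x :> p"
    and E: "has_lions_derivative M (\<lambda>\<nu>. h x \<nu>) (\<lambda>y v. E y \<bullet> v) (distr M borel V)"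
  shows "h x (distr M borel V) + p \<bullet> (x' - x) + (\<integral>w. E (V w) \<bullet> (V' w - V w) \<partial>M) \<le> h x' (distr M borel V')"
proof -
  note [measurable] = L2_measurable[OF V] L2_measurable[OF V']
  obtain p' D where p': "GDERIV (\<lambda>y. h y (distr M borel V)) x :> p'"
    and D: "has_lions_derivative M (\<lambda>\<nu>. h x \<nu>) (\<lambda>y v. D y \<bullet> v) (distr M borel V)"
    and le: "\<forall>x'. \<forall>\<mu>'\<in>P2. \<forall>(P :: ('b \<times> 'b) measure) X X'.
        prob_space P \<longrightarrow> X \<in> L2 P \<longrightarrow> X' \<in> L2 P \<longrightarrow>
        distr P borel X = distr M borel V \<longrightarrow> distr P borel X' = \<mu>' \<longrightarrow>
        h x' \<mu>' \<ge> h x (distr M borel V) + p' \<bullet> (x' - x) + (\<integral>w. D (X w) \<bullet> (X' w - X w) \<partial>P)"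
    using h law_in_P2[OF prob_space_axioms V] unfolding L_convex_state_def by blast
  define P where "P = distr M (borel :: ('b \<times> 'b) measure) (\<lambda>w. (V w, V' w))"
  have m: "(\<lambda>w. (V w, V' w)) \<in> measurable M (borel :: ('b \<times> 'b) measure)" by measurable
  have fs: "fst \<in> borel_measurable (borel :: ('b \<times> 'b) measure)" "snd \<in> borel_measurable (borel :: ('b \<times> 'b) measure)"
    by (intro borel_measurable_continuous_onI continuous_on_fst continuous_on_snd continuous_on_id)+
  have fst: "fst \<in> L2 P" and snd: "snd \<in> L2 P"
    using fs L2_integrable[OF V] L2_integrable[OF V'] by (auto intro!: L2_I simp: P_def integrable_distr_eq[OF m])
  have d: "distr P borel fst = distr M borel V" "distr P borel snd = distr M borel V'"
    unfolding P_def using distr_distr[OF fs(1) m] distr_distr[OF fs(2) m] by (simp_all add: comp_def)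
  have Dm: "D \<in> borel_measurable borel"
    using D unfolding has_lions_derivative_def borel_measurable_euclidean_space[of D] by blast
  have "h x' (distr M borel V') \<ge> h x (distr M borel V) + p' \<bullet> (x' - x) + (\<integral>z. D (fst z) \<bullet> (snd z - fst z) \<partial>P)"
    using le law_in_P2[OF prob_space_axioms V'] prob_space_distr[OF m, folded P_def] fst snd d by blast
  moreover have "(\<integral>z. D (fst z) \<bullet> (snd z - fst z) \<partial>P) = (\<integral>w. D (V w) \<bullet> (V' w - V w) \<partial>M)"
    unfolding P_def
    by (subst integral_distr[OF m])
      (auto intro!: borel_measurable_inner borel_measurable_diff fs measurable_compose[OF fs(1) Dm])
  moreover have "(\<integral>w. D (V w) \<bullet> (V' w - V w) \<partial>M) = (\<integral>w. E (V w) \<bullet> (V' w - V w) \<partial>M)"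
    by (rule has_lions_derivative_unique[OF D E V L2_diff[OF V' V]])
  ultimately show ?thesis using GDERIV_unique[OF p p'] by simp
qed

text \<open>For fixed \<open>y\<close>, \<open>z\<close> and \<open>c\<close> the Hamiltonian is
  \<open>f\<close> plus an affine function \<open>G\<close> of the value of the drift, so sum and
  chain rule apply.\<close>

lemma hamiltonian_derivatives:
  assumes b: "C1_vector \<Omega> T b bx bm" and f: "C1_scalar \<Omega> T f fx fm" and t: "t \<in> {0..T}" and \<mu>: "\<mu> \<in> P2"
  shows "GDERIV (\<lambda>x. hamiltonian \<sigma> b f t x \<mu> y z c) x :> fx t x \<mu> + transpose (bx t x \<mu>) *v y"
    and "has_lions_derivative \<Omega> (\<lambda>\<nu>. hamiltonian \<sigma> b f t x \<nu> y z c)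
      (\<lambda>w v. (fm t x \<mu> w + transpose (bm t x \<mu> w) *v y) \<bullet> v) \<mu>"
proof -
  have b': "((\<lambda>x. b t x \<mu>) has_derivative (\<lambda>v. bx t x \<mu> *v v)) (at x)"
      "has_lions_derivative \<Omega> (\<lambda>\<nu>. b t x \<nu>) (\<lambda>w v. bm t x \<mu> w *v v) \<mu>"
    and f': "((\<lambda>x. f t x \<mu>) has_derivative (\<lambda>v. v \<bullet> fx t x \<mu>)) (at x)"
      "has_lions_derivative \<Omega> (\<lambda>\<nu>. f t x \<nu>) (\<lambda>w v. fm t x \<mu> w \<bullet> v) \<mu>"
    using assms by (auto simp: C1_vector_def C1_scalar_def gderiv_def)
  define G where "G w = (w + \<sigma> t *v c) \<bullet> y + ((norm c)\<^sup>2 / 2 + trace (transpose (\<sigma> t) ** z))" for w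
  have H: "hamiltonian \<sigma> b f t x \<mu> y z c = f t x \<mu> + G (b t x \<mu>)" for x \<mu>
    by (simp add: hamiltonian_def G_def)
  have G: "(G has_derivative (\<lambda>v. v \<bullet> y)) (at w)" for w
    unfolding G_def[abs_def] by (auto intro!: derivative_eq_intros)
  have tr: "(bx t x \<mu> *v v) \<bullet> y = v \<bullet> (transpose (bx t x \<mu>) *v y)" for v
    unfolding inner_commute[of v] transpose_inner by (rule inner_commute)
  show "GDERIV (\<lambda>x. hamiltonian \<sigma> b f t x \<mu> y z c) x :> fx t x \<mu> + transpose (bx t x \<mu>) *v y"
    unfolding H gderiv_def inner_add_right tr[symmetric]
    by (rule has_derivative_add[OF f'(1) has_derivative_compose[OF b'(1) G]])
  have tr': "(transpose (bm t x \<mu> w) *v y) \<bullet> v = (bm t x \<mu> w *v v) \<bullet> y" for w v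
    unfolding transpose_inner by (rule inner_commute)
  show "has_lions_derivative \<Omega> (\<lambda>\<nu>. hamiltonian \<sigma> b f t x \<nu> y z c)
      (\<lambda>w v. (fm t x \<mu> w + transpose (bm t x \<mu> w) *v y) \<bullet> v) \<mu>"
    unfolding H inner_add_left tr'
    by (rule has_lions_derivative_add[OF \<mu> f'(2) has_lions_derivative_compose[OF \<mu> b'(2) G]])
qed

text \<open>Fubini for a kernel of linear growth; the growth bound is first turned into a product of
  a function of each variable.\<close>

lemma (in prob_space) copy_swap:
  fixes G :: "(real^'n) \<times> (real^'n) \<Rightarrow> real^'n" and V \<eta> :: "'a \<Rightarrow> real^'n"
  assumes G: "G \<in> borel_measurable borel" "\<And>x y. norm (G (x, y)) \<le> c * (1 + norm x + norm y)" and c: "0 \<le> c"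
    and V: "V \<in> L2 M" and \<eta>: "\<eta> \<in> L2 M"
  shows "(\<integral>w. (\<integral>w'. G (V w', V w) \<partial>M) \<bullet> \<eta> w \<partial>M) = (\<integral>w'. (\<integral>w. G (V w', V w) \<bullet> \<eta> w \<partial>M) \<partial>M)"
    and "integrable M (\<lambda>w. (\<integral>w'. G (V w', V w) \<partial>M) \<bullet> \<eta> w)"
    and "integrable M (\<lambda>w'. \<integral>w. G (V w', V w) \<bullet> \<eta> w \<partial>M)"
    and "integrable M (\<lambda>w. G (x, V w) \<bullet> \<eta> w)"
proof -
  note Vm [measurable] = L2_measurable[OF V]
  note \<eta>m [measurable] = L2_measurable[OF \<eta>]
  note nV = integrable_norm[OF L2_imp_integrable[OF finite_measure_axioms V]]
  have P: "integrable M (\<lambda>w. c * (1 + norm (V w)))" using nV by simp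
  have Q: "integrable M (\<lambda>w. norm (\<eta> w) + norm (V w) * norm (\<eta> w))"
    using integrable_norm[OF L2_imp_integrable[OF finite_measure_axioms \<eta>]] L2_inner(2)[OF V \<eta>] by simp
  have bd: "\<bar>G (x, y) \<bullet> w\<bar> \<le> c * (1 + norm x) * (norm w + norm y * norm w)" for x y w
  proof -
    have "\<bar>G (x, y) \<bullet> w\<bar> \<le> norm (G (x, y)) * norm w" by (rule Cauchy_Schwarz_ineq2)
    also have "\<dots> \<le> (c * ((1 + norm x) * (1 + norm y))) * norm w"
    proof (rule mult_right_mono[OF order_trans[OF G(2) mult_left_mono[OF _ c]] norm_ge_zero])
      \<comment> \<open>This is where the sum becomes a product, as
        \<open>product_bound_fubini\<close> requires.\<close>
      show "1 + norm x + norm y \<le> (1 + norm x) * (1 + norm y)" by (simp add: algebra_simps)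
    qed
    also have "\<dots> = c * (1 + norm x) * (norm w + norm y * norm w)" by (simp add: algebra_simps)
    finally show ?thesis .
  qed
  have pm: "(\<lambda>z. (V (fst z), V (snd z))) \<in> measurable (M \<Otimes>\<^sub>M M) (borel :: ((real^'n) \<times> (real^'n)) measure)"
    by (simp add: borel_prod[symmetric])
  have km: "(\<lambda>(w', w). G (V w', V w) \<bullet> \<eta> w) \<in> borel_measurable (M \<Otimes>\<^sub>M M)"
    unfolding case_prod_beta' using measurable_compose[OF pm G(1)] by (intro borel_measurable_inner) simp_all
  note F = product_bound_fubini[OF km P Q AE_I2[OF bd]]
  have m1: "(\<lambda>w. (V w, x)) \<in> measurable M (borel :: ((real^'n) \<times> (real^'n)) measure)"
    and m2: "(\<lambda>w. (x, V w)) \<in> measurable M (borel :: ((real^'n) \<times> (real^'n)) measure)" for x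
    by (simp_all add: borel_prod[symmetric])
  have i: "integrable M (\<lambda>w'. G (V w', x))" for x
  proof (rule Bochner_Integration.integrable_bound)
    show "integrable M (\<lambda>w. c * (1 + norm (V w) + norm x))" using nV by simp
    show "AE w in M. norm (G (V w, x)) \<le> norm (c * (1 + norm (V w) + norm x))"
      by (intro AE_I2 order_trans[OF G(2)]) simp
  qed (rule measurable_compose[OF m1 G(1)])
  have e: "(\<integral>w'. G (V w', V w) \<bullet> \<eta> w \<partial>M) = (\<integral>w'. G (V w', V w) \<partial>M) \<bullet> \<eta> w" for w
    by (rule integral_inner_left[OF i])
  show "(\<integral>w. (\<integral>w'. G (V w', V w) \<partial>M) \<bullet> \<eta> w \<partial>M) = (\<integral>w'. (\<integral>w. G (V w', V w) \<bullet> \<eta> w \<partial>M) \<partial>M)"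
    using F(1) unfolding e .
  show "integrable M (\<lambda>w. (\<integral>w'. G (V w', V w) \<partial>M) \<bullet> \<eta> w)" using F(2) unfolding e .
  show "integrable M (\<lambda>w'. \<integral>w. G (V w', V w) \<bullet> \<eta> w \<partial>M)" by (rule F(3))
  show "integrable M (\<lambda>w. G (x, V w) \<bullet> \<eta> w)"
  proof (rule Bochner_Integration.integrable_bound[OF integrable_mult_right[OF Q, of "c * (1 + norm x)"]])
    show "(\<lambda>w. G (x, V w) \<bullet> \<eta> w) \<in> borel_measurable M"
      by (rule borel_measurable_inner[OF measurable_compose[OF m2 G(1)] \<eta>m])
    show "AE w in M. norm (G (x, V w) \<bullet> \<eta> w) \<le> norm (c * (1 + norm x) * (norm (\<eta> w) + norm (V w) * norm (\<eta> w)))"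
      unfolding real_norm_def by (intro AE_I2 order_trans[OF bd abs_ge_self])
  qed
qed

section \<open>Costs as time integrals\<close>

context controlled
begin

text \<open>Expectation and time integral are exchanged because the convexity inequalities are
  proved at fixed times.\<close>

lemma cost_time_integral:
  fixes \<alpha> :: "real \<Rightarrow> 'w \<Rightarrow> real^'m"
  assumes V: "regular_process M T V" and \<alpha>: "(\<lambda>(t, w). \<alpha> t w) \<in> L2 (dt_dP M T)"
  shows "cost M T f g \<alpha> V = (LINT t:{0..T}|lborel. \<integral>w. f t (V t w) (law M V t) + (norm (\<alpha> t w))\<^sup>2 / 2 \<partial>M)
      + (\<integral>w. g (V T w) (law M V T) \<partial>M)"
    and "set_integrable lborel {0..T} (\<lambda>t. \<integral>w. f t (V t w) (law M V t) + (norm (\<alpha> t w))\<^sup>2 / 2 \<partial>M)"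
    and "integrable M (\<lambda>w. g (V T w) (law M V T))"
proof -
  have T: "T \<in> {0..T}" and z: "(0::real) \<le> 0" using T_pos by auto
  have gm: "(\<lambda>(t, x). g x (law M V t)) \<in> borel_measurable (restrict_space borel {0..T} \<Otimes>\<^sub>M borel)"
  proof (rule lions_measurable_along[OF V])
    fix x t and \<mu> :: "(real^'d) measure" assume \<mu>: "\<mu> \<in> P2"
    show "(\<lambda>t. g x \<mu>) \<in> borel_measurable (restrict_space borel {0..T})" by simp
    assume t: "t \<in> {0..T}"
    have "GDERIV (\<lambda>y. g y \<mu>) y :> gx y \<mu>" for y using g_C1 t \<mu> by (auto simp: C1_scalar_def)
    then have "isCont (\<lambda>y. g y \<mu>) y" for y unfolding gderiv_def by (rule has_derivative_continuous)
    then show "continuous_on UNIV (\<lambda>y. g y \<mu>)" by (simp add: continuous_at_imp_continuous_on)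
    show "\<exists>D. has_lions_derivative M (\<lambda>\<nu>. g x \<nu>) D \<mu>" using g_C1 t \<mu> by (auto simp: C1_scalar_def)
  qed (use T_pos in simp)
  show gi: "integrable M (\<lambda>w. g (V T w) (law M V T))"
    using quadratic_integrable(2)[OF V g_quadratic gm T] .
  have fi: "integrable (dt_dP M T) (\<lambda>(t, w). f t (V t w) (law M V t))"
    by (rule quadratic_integrable(1)[OF V f_quadratic f_measurable_along[OF V]])
  have ai: "integrable (dt_dP M T) (\<lambda>(t, w). (norm (\<alpha> t w))\<^sup>2 / 2)"
    using L2_integrable[OF \<alpha>] by (simp add: case_prod_beta')
  have i: "integrable (dt_dP M T) (\<lambda>(t, w). f t (V t w) (law M V t) + (norm (\<alpha> t w))\<^sup>2 / 2)"
    using Bochner_Integration.integrable_add[OF fi ai] by (simp add: case_prod_beta')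
  note fub = dt_dP_fubini[OF prob_space_axioms i z order_refl]
  show "set_integrable lborel {0..T} (\<lambda>t. \<integral>w. f t (V t w) (law M V t) + (norm (\<alpha> t w))\<^sup>2 / 2 \<partial>M)" by (rule fub(4))
  show "cost M T f g \<alpha> V = (LINT t:{0..T}|lborel. \<integral>w. f t (V t w) (law M V t) + (norm (\<alpha> t w))\<^sup>2 / 2 \<partial>M)
      + (\<integral>w. g (V T w) (law M V T) \<partial>M)"
    unfolding cost_def fub(2)[symmetric] by (rule Bochner_Integration.integral_add[OF fub(1) gi])
qed

end

section \<open>Inequalities for an arbitrary admissible control\<close>

context closed_loop
begin

context
  fixes \<beta> :: "real \<Rightarrow> 'w \<Rightarrow> real^'m" and X' :: "real \<Rightarrow> 'w \<Rightarrow> real^'d"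
  assumes \<beta>: "admissible M F T \<beta>" and X': "state_process M T X0 W \<sigma> b \<beta> X'"
begin

lemma state_change_X: "X' t w - X t w = state_change X' t w"
  by (simp only: state_change_def)

lemma change_L2: "t \<in> {0..T} \<Longrightarrow> state_change X' t \<in> L2 M"
  by (rule state_change_L2[OF \<beta> X'])

text \<open>Convexity of \<open>g\<close> is applied at each sample point, with the state change
  averaged over the copy; the terminal value of \<open>Y\<close> averages the derivative over the
  copy instead. The two agree after integration, when sample point and copy exchange roles.\<close>

lemma terminal_inequality:
  assumes g: "L_convex_state M g"
  shows "(\<integral>w. g (X T w) (law M X T) \<partial>M) + (\<integral>w. Y T w \<bullet> state_change X' T w \<partial>M) \<le> (\<integral>w. g (X' T w) (law M X' T) \<partial>M)"
proof -
  have T: "T \<in> {0..T}" using T_pos by simp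
  note XL = regular_process_L2[OF X_regular T] and XL' = regular_process_L2[OF X'_regular[OF \<beta> X'] T]
  note \<Delta> = change_L2[OF T]
  note c1 = g_C1[unfolded C1_scalar_def]
  obtain c where c: "c \<ge> 0" "\<And>x y. norm (gx x (law M X T)) \<le> c * (1 + norm x) \<and> norm (gm x (law M X T) y) \<le> c * (1 + norm x + norm y)"
    using linear_growth_along[OF X_regular g_linear] T by blast
  have Gm: "(\<lambda>z. gm (fst z) (law M X T) (snd z)) \<in> borel_measurable borel"
    using measurable_along_fixed[OF continuous_measurable_time[OF continuous_P2_along2[OF X_regular conjunct2[OF conjunct2[OF c1]]]] T] .
  have Gb: "norm ((\<lambda>z. gm (fst z) (law M X T) (snd z)) (x, y)) \<le> c * (1 + norm x + norm y)" for x y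
    using c(2) by simp
  note sw = copy_swap[OF Gm Gb c(1) XL \<Delta>, unfolded fst_conv snd_conv]
  have YeqAE: "AE w in M. Y T w = gx (X T w) (law M X T) + (\<integral>w'. gm (X T w') (law M X T) (X T w) \<partial>M)"
    using adjoint by (simp add: adjoint_processes_def adjoint_terminal_def)
  have gxi: "integrable M (\<lambda>w. gx (X T w) (law M X T) \<bullet> state_change X' T w)"
  proof (rule L2_inner(1)[OF _ \<Delta>])
    have gxm: "(\<lambda>x. gx x (law M X T)) \<in> borel_measurable borel"
      using measurable_along_fixed[OF continuous_measurable_time[OF continuous_P2_along[OF X_regular conjunct1[OF conjunct2[OF c1]]]] T] .
    have nX: "(\<lambda>w. 1 + norm (X T w)) \<in> L2 M"
      using XL by (intro L2_add(1) L2_const[OF finite_measure_axioms]) (auto simp: L2_def)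
    show "(\<lambda>w. gx (X T w) (law M X T)) \<in> L2 M"
      by (rule L2_bound(1)[OF measurable_compose[OF L2_measurable[OF XL] gxm] nX c(1)]) (use c(2) in auto)
  qed
  \<comment> \<open>The first-order terms of the convexity inequality. Here the copy stands in the
    last argument of \<open>gm\<close>, in \<open>Y T\<close> it stands in the first.\<close>
  let ?R = "\<lambda>w. gx (X T w) (law M X T) \<bullet> state_change X' T w + (\<integral>w'. gm (X T w) (law M X T) (X T w') \<bullet> state_change X' T w' \<partial>M)"
  have gi: "integrable M (\<lambda>w. g (X T w) (law M X T))" and gi': "integrable M (\<lambda>w. g (X' T w) (law M X' T))"
    by (rule cost_time_integral(3)[OF X_regular regular_process_L2_time[OF ctrl_regular]],
        rule cost_time_integral(3)[OF X'_regular[OF \<beta> X'] beta_L2[OF \<beta> X']])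
  have pointwise: "g (X T w) (law M X T) + ?R w \<le> g (X' T w) (law M X' T)" for w
  proof -
    have d: "GDERIV (\<lambda>y. g y (distr M borel (X T))) (X T w) :> gx (X T w) (law M X T)"
        "has_lions_derivative M (\<lambda>\<nu>. g (X T w) \<nu>) (\<lambda>y v. gm (X T w) (law M X T) y \<bullet> v) (distr M borel (X T))"
      using c1 T regular_process_law[OF X_regular T] by (auto simp: law_def)
    from L_convex_state_inequality[OF g XL XL' d, of "X' T w"] show ?thesis
      unfolding law_def[symmetric] state_change_X by (simp only: add.assoc)
  qed
  have "(\<integral>w. Y T w \<bullet> state_change X' T w \<partial>M)
      = (\<integral>w. gx (X T w) (law M X T) \<bullet> state_change X' T w + (\<integral>w'. gm (X T w') (law M X T) (X T w) \<partial>M) \<bullet> state_change X' T w \<partial>M)"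
  proof (rule integral_cong_AE)
    show "AE w in M. Y T w \<bullet> state_change X' T w = gx (X T w) (law M X T) \<bullet> state_change X' T w
        + (\<integral>w'. gm (X T w') (law M X T) (X T w) \<partial>M) \<bullet> state_change X' T w"
      using YeqAE by eventually_elim (simp only: inner_add_left)
  qed (use gxi sw(2) L2_inner(1)[OF regular_process_L2[OF Y_regular T] \<Delta>] in \<open>auto intro!: borel_measurable_add borel_measurable_integrable\<close>)
  also have "\<dots> = (\<integral>w. ?R w \<partial>M)"
    unfolding Bochner_Integration.integral_add[OF gxi sw(2)] Bochner_Integration.integral_add[OF gxi sw(3)] sw(1) by (rule refl)
  finally have "(\<integral>w. g (X T w) (law M X T) \<partial>M) + (\<integral>w. Y T w \<bullet> state_change X' T w \<partial>M) = (\<integral>w. g (X T w) (law M X T) + ?R w \<partial>M)"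
    using Bochner_Integration.integral_add[OF gi Bochner_Integration.integrable_add[OF gxi sw(3)]] by simp
  also have "\<dots> \<le> (\<integral>w. g (X' T w) (law M X' T) \<partial>M)"
    by (rule integral_mono[OF Bochner_Integration.integrable_add[OF gi Bochner_Integration.integrable_add[OF gxi sw(3)]] gi' pointwise])
  finally show ?thesis .
qed

text \<open>Convexity of the Hamiltonian is used with the adjoint values frozen at one sample point.
  After integration and exchange of sample point and copy, its first-order terms are the open-loop
  driver paired with the state change.\<close>

lemma running_inequality:
  assumes t: "t \<in> {0..T}" and conv: "AE w in M. L_convex M (\<lambda>x \<mu> c. hamiltonian \<sigma> b f t x \<mu> (Y t w) (Z t w) c)"
  shows "(\<integral>w. f t (X t w) (law M X t) \<partial>M) + (\<integral>w. ol_driver t w \<bullet> state_change X' t w \<partial>M)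
    \<le> (\<integral>w. f t (X' t w) (law M X' t) \<partial>M) + (\<integral>w. (b t (X' t w) (law M X' t) - b t (X t w) (law M X t)) \<bullet> Y t w \<partial>M)"
proof -
  note XL = regular_process_L2[OF X_regular t] and XL' = regular_process_L2[OF X'_regular[OF \<beta> X'] t]
  note YL = regular_process_L2[OF Y_regular t] and Xm = regular_process_measurable[OF X_regular t]
  note \<Delta> = change_L2[OF t]
  note P2t = regular_process_law[OF X_regular t]
  note bm_sec = coefficient_sections[OF t]
  obtain c where c: "c \<ge> 0" "\<And>x y. norm (fx t x (law M X t)) \<le> c * (1 + norm x) \<and> norm (fm t x (law M X t) y) \<le> c * (1 + norm x + norm y)"
    using linear_growth_along[OF X_regular f_linear] t by blast
  obtain K where K: "K \<ge> 0" "\<And>x y. norm (bx t x (law M X t)) \<le> K \<and> norm (bm t x (law M X t) y) \<le> K"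
    using bm_sec(2) t by blast
  have Gb: "norm ((\<lambda>z. fm t (fst z) (law M X t) (snd z)) (x, y)) \<le> c * (1 + norm x + norm y)" for x y
    using c(2) by simp
  have Kb: "norm (bm t (fst z) (law M X t) (snd z)) \<le> K" for z using K(2) by blast
  note sw = copy_swap[OF bm_sec(4) Gb c(1) XL \<Delta>, unfolded fst_conv snd_conv]
  note tm = transposed_mean[OF bm_sec(1) Kb Xm YL \<Delta>, unfolded fst_conv snd_conv]
  define \<theta> where "\<theta> x = (\<integral>w'. bm t x (law M X t) (X t w') *v state_change X' t w' \<partial>M)" for x
  note tm = tm[folded \<theta>_def]
  define \<kappa> where "\<kappa> x = (\<integral>w'. fm t x (law M X t) (X t w') \<bullet> state_change X' t w' \<partial>M)" for x
  note sw = sw[folded \<kappa>_def]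
  have bxL: "(\<lambda>w. transpose (bx t (X t w) (law M X t)) *v Y t w) \<in> L2 M"
    by (rule L2_matrix(1)[OF borel_measurable_transpose[OF measurable_compose[OF Xm bm_sec(3)]] YL K(1)])
      (simp add: norm_transpose K(2))
  have fxL: "(\<lambda>w. fx t (X t w) (law M X t)) \<in> L2 M"
  proof -
    have nX: "(\<lambda>w. 1 + norm (X t w)) \<in> L2 M"
      using XL by (intro L2_add(1) L2_const[OF finite_measure_axioms]) (auto simp: L2_def)
    show ?thesis by (rule L2_bound(1)[OF measurable_compose[OF Xm bm_sec(5)] nX c(1)]) (use c(2) in auto)
  qed
  note fi = quadratic_integrable(2)[OF X_regular f_quadratic f_measurable_along[OF X_regular] t]
  note fi' = quadratic_integrable(2)[OF X'_regular[OF \<beta> X'] f_quadratic f_measurable_along[OF X'_regular[OF \<beta> X']] t]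
  note bi = L2_inner(1)[OF L2_diff[OF drift_L2(2)[OF X'_regular[OF \<beta> X'] t] drift_L2(2)[OF X_regular t]] YL]
  let ?A = "\<lambda>w. (transpose (bx t (X t w) (law M X t)) *v Y t w) \<bullet> state_change X' t w"
  let ?B = "\<lambda>w. fx t (X t w) (law M X t) \<bullet> state_change X' t w"
  let ?C = "\<lambda>w. Y t w \<bullet> \<theta> (X t w)"
  let ?D = "\<lambda>w. \<kappa> (X t w)"
  note iA = L2_inner(1)[OF bxL \<Delta>] and iB = L2_inner(1)[OF fxL \<Delta>] and iC = L2_inner(1)[OF YL tm(4)] and iD = sw(3)
  have "(\<integral>w. ol_driver t w \<bullet> state_change X' t w \<partial>M) = (\<integral>w. ?A w + ?B w
      + (\<integral>w'. transpose (bm t (X t w') (law M X t) (X t w)) *v Y t w' \<partial>M) \<bullet> state_change X' t w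
      + (\<integral>w'. fm t (X t w') (law M X t) (X t w) \<partial>M) \<bullet> state_change X' t w \<partial>M)"
    unfolding adjoint_driver_def inner_add_left by (rule refl)
  also have "\<dots> = (\<integral>w. ?A w + ?B w + ?C w + ?D w \<partial>M)"
    unfolding Bochner_Integration.integral_add[OF Bochner_Integration.integrable_add[OF Bochner_Integration.integrable_add[OF iA iB] tm(2)] sw(2)]
      Bochner_Integration.integral_add[OF Bochner_Integration.integrable_add[OF iA iB] tm(2)]
      Bochner_Integration.integral_add[OF Bochner_Integration.integrable_add[OF Bochner_Integration.integrable_add[OF iA iB] iC] iD]
      Bochner_Integration.integral_add[OF Bochner_Integration.integrable_add[OF iA iB] iC] tm(1) sw(1)
    by (rule refl)
  finally have ol: "(\<integral>w. ol_driver t w \<bullet> state_change X' t w \<partial>M) = (\<integral>w. ?A w + ?B w + ?C w + ?D w \<partial>M)" .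
  note iABCD = Bochner_Integration.integrable_add[OF Bochner_Integration.integrable_add[OF Bochner_Integration.integrable_add[OF iA iB] iC] iD]
  have ae: "AE w in M. f t (X t w) (law M X t) + (?A w + ?B w + ?C w + ?D w)
      \<le> f t (X' t w) (law M X' t) + (b t (X' t w) (law M X' t) - b t (X t w) (law M X t)) \<bullet> Y t w"
    using conv
  proof eventually_elim
    case (elim w)
    let ?y = "Y t w" and ?z = "Z t w" and ?x = "X t w" and ?\<mu> = "law M X t"
    \<comment> \<open>With control 0 the terms in the control vanish, and the term in
      \<open>z\<close> is common to both sides; \<open>f\<close> and the pairing of the drift with
      \<open>Y\<close> remain.\<close>
    let ?H = "\<lambda>x \<mu>. hamiltonian \<sigma> b f t x \<mu> ?y ?z 0"
    note d = hamiltonian_derivatives[where \<sigma>=\<sigma> and y="?y" and z="?z" and c=0 and x="?x", OF b_C1 f_C1 t P2t]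
    have E: "(\<integral>w'. (fm t ?x ?\<mu> (X t w') + transpose (bm t ?x ?\<mu> (X t w')) *v ?y) \<bullet> state_change X' t w' \<partial>M) = ?D w + ?C w"
    proof -
      have m: "(\<lambda>w'. bm t ?x ?\<mu> (X t w')) \<in> borel_measurable M"
      proof -
        have "(\<lambda>w'. (?x, X t w')) \<in> measurable M (borel :: ((real^'d) \<times> (real^'d)) measure)"
          using Xm by (simp add: borel_prod[symmetric])
        from measurable_compose[OF this bm_sec(1)] show ?thesis by simp
      qed
      note L = L2_matrix(1)[OF m \<Delta> K(1) conjunct2[OF K(2)]]
      have e: "(\<integral>w'. ?y \<bullet> (bm t ?x ?\<mu> (X t w') *v state_change X' t w') \<partial>M) = ?C w"
        unfolding \<theta>_def by (rule integral_inner_right[OF L2_imp_integrable[OF finite_measure_axioms L]])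
      have i: "integrable M (\<lambda>w'. ?y \<bullet> (bm t ?x ?\<mu> (X t w') *v state_change X' t w'))"
        by (rule integrable_inner_right[OF L2_imp_integrable[OF finite_measure_axioms L]])
      show ?thesis
        unfolding inner_add_left transpose_inner Bochner_Integration.integral_add[OF sw(4) i] e \<kappa>_def by (rule refl)
    qed
    from L_convex_state_inequality[OF L_convex_imp_state[OF elim, of 0] XL XL' d[unfolded law_def], of "X' t w"]
    have "?H ?x ?\<mu> + (fx t ?x ?\<mu> + transpose (bx t ?x ?\<mu>) *v ?y) \<bullet> state_change X' t w + (?D w + ?C w) \<le> ?H (X' t w) (law M X' t)"
      unfolding law_def[symmetric] state_change_X E .
    then show ?case
      unfolding hamiltonian_def inner_add_left inner_diff_left by linarith
  qed
  have "(\<integral>w. f t (X t w) (law M X t) \<partial>M) + (\<integral>w. ol_driver t w \<bullet> state_change X' t w \<partial>M)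
      = (\<integral>w. f t (X t w) (law M X t) + (?A w + ?B w + ?C w + ?D w) \<partial>M)"
    unfolding ol by (rule Bochner_Integration.integral_add[OF fi iABCD, symmetric])
  also have "\<dots> \<le> (\<integral>w. f t (X' t w) (law M X' t) + (b t (X' t w) (law M X' t) - b t (X t w) (law M X t)) \<bullet> Y t w \<partial>M)"
    by (rule integral_mono_AE[OF Bochner_Integration.integrable_add[OF fi iABCD] Bochner_Integration.integrable_add[OF fi' bi] ae])
  also have "\<dots> = (\<integral>w. f t (X' t w) (law M X' t) \<partial>M) + (\<integral>w. (b t (X' t w) (law M X' t) - b t (X t w) (law M X t)) \<bullet> Y t w \<partial>M)"
    by (rule Bochner_Integration.integral_add[OF fi' bi])
  finally show ?thesis .
qed

text \<open>The drift change contains \<sigma> applied to the change of control. By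
  \<open>control_adjoint\<close> its pairing with \<open>Y\<close> is the negative of the linear
  term in the expansion of half the squared norm of \<beta> around the feedback control, so only the
  quadratic remainder is left.\<close>

lemma running_cost_inequality:
  assumes t: "t \<in> {0..T}" and conv: "AE w in M. L_convex M (\<lambda>x \<mu> c. hamiltonian \<sigma> b f t x \<mu> (Y t w) (Z t w) c)"
    and \<beta>t: "\<beta> t \<in> L2 M"
  shows "(\<integral>w. f t (X t w) (law M X t) + (norm (ctrl t w))\<^sup>2 / 2 \<partial>M)
      + (\<integral>w. ol_driver t w \<bullet> state_change X' t w \<partial>M) - (\<integral>w. Y t w \<bullet> drift_change \<beta> X' t w \<partial>M)
      + (\<integral>w. (norm (\<beta> t w - ctrl t w))\<^sup>2 / 2 \<partial>M)
    \<le> (\<integral>w. f t (X' t w) (law M X' t) + (norm (\<beta> t w))\<^sup>2 / 2 \<partial>M)"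
proof -
  note YL = regular_process_L2[OF Y_regular t] and uL = regular_process_L2[OF ctrl_regular t]
  note fi = quadratic_integrable(2)[OF X_regular f_quadratic f_measurable_along[OF X_regular] t]
  note fi' = quadratic_integrable(2)[OF X'_regular[OF \<beta> X'] f_quadratic f_measurable_along[OF X'_regular[OF \<beta> X']] t]
  note bi = L2_inner(1)[OF L2_diff[OF drift_L2(2)[OF X'_regular[OF \<beta> X'] t] drift_L2(2)[OF X_regular t]] YL]
  note bu = L2_diff[OF \<beta>t uL]
  note si = L2_inner(1)[OF YL L2_matrix(1)[OF borel_measurable_const bu norm_ge_zero order_refl, of "\<sigma> t"]]
  have i1: "integrable M (\<lambda>w. (norm (ctrl t w))\<^sup>2 / 2)" and i2: "integrable M (\<lambda>w. (norm (\<beta> t w))\<^sup>2 / 2)"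
    and i3: "integrable M (\<lambda>w. (norm (\<beta> t w - ctrl t w))\<^sup>2 / 2)"
    using L2_integrable[OF uL] L2_integrable[OF \<beta>t] L2_integrable[OF bu] by auto
  have yd: "(\<integral>w. Y t w \<bullet> drift_change \<beta> X' t w \<partial>M)
      = (\<integral>w. (b t (X' t w) (law M X' t) - b t (X t w) (law M X t)) \<bullet> Y t w \<partial>M) + (\<integral>w. Y t w \<bullet> (\<sigma> t *v (\<beta> t w - ctrl t w)) \<partial>M)"
  proof -
    have "Y t w \<bullet> drift_change \<beta> X' t w = (b t (X' t w) (law M X' t) - b t (X t w) (law M X t)) \<bullet> Y t w + Y t w \<bullet> (\<sigma> t *v (\<beta> t w - ctrl t w))" for w
      unfolding drift_change_def matrix_vector_mult_diff_distrib inner_commute[of "_ - _" "Y t w"]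
        inner_diff_right inner_add_right by linarith
    then show ?thesis by (simp only: Bochner_Integration.integral_add[OF bi si])
  qed
  have "(\<integral>w. (norm (ctrl t w))\<^sup>2 / 2 \<partial>M) + (\<integral>w. (norm (\<beta> t w - ctrl t w))\<^sup>2 / 2 \<partial>M)
      = (\<integral>w. (norm (ctrl t w))\<^sup>2 / 2 + (norm (\<beta> t w - ctrl t w))\<^sup>2 / 2 \<partial>M)"
    by (rule Bochner_Integration.integral_add[OF i1 i3, symmetric])
  also have "\<dots> = (\<integral>w. (norm (\<beta> t w))\<^sup>2 / 2 + Y t w \<bullet> (\<sigma> t *v (\<beta> t w - ctrl t w)) \<partial>M)"
  proof (rule integral_cong_AE)
    show "AE w in M. (norm (ctrl t w))\<^sup>2 / 2 + (norm (\<beta> t w - ctrl t w))\<^sup>2 / 2 = (norm (\<beta> t w))\<^sup>2 / 2 + Y t w \<bullet> (\<sigma> t *v (\<beta> t w - ctrl t w))"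
      using control_adjoint[OF t]
    proof eventually_elim
      case (elim w)
      have "transpose (\<sigma> t) *v Y t w = - ctrl t w" using elim by (rule eq_neg_iff_add_eq_0[THEN iffD2, OF trans[OF add.commute]])
      then have "Y t w \<bullet> (\<sigma> t *v (\<beta> t w - ctrl t w)) = (- ctrl t w) \<bullet> (\<beta> t w - ctrl t w)"
        unfolding transpose_inner[symmetric] by (rule arg_cong)
      \<comment> \<open>The exact second-order expansion of half the squared norm around
        \<open>v\<close>.\<close>
      moreover have "(norm v)\<^sup>2 / 2 + (norm (w - v))\<^sup>2 / 2 = (norm w)\<^sup>2 / 2 + (- v) \<bullet> (w - v)" for v w :: "real^'m"
        by (simp add: power2_norm_eq_inner inner_diff_left inner_diff_right inner_commute[of w v] field_simps)
      ultimately show ?case by (simp only:)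
    qed
  qed (use i1 i2 i3 si in \<open>auto intro!: borel_measurable_add borel_measurable_integrable\<close>)
  also have "\<dots> = (\<integral>w. (norm (\<beta> t w))\<^sup>2 / 2 \<partial>M) + (\<integral>w. Y t w \<bullet> (\<sigma> t *v (\<beta> t w - ctrl t w)) \<partial>M)"
    by (rule Bochner_Integration.integral_add[OF i2 si])
  finally show ?thesis
    using running_inequality[OF t conv]
    unfolding yd Bochner_Integration.integral_add[OF fi i1] Bochner_Integration.integral_add[OF fi' i2] by linarith
qed

text \<open>The running inequality is integrated over time and added to the terminal one; by
  \<open>duality\<close> the pairings with the state change and the drift change cancel.\<close>

lemma cost_gap:
  assumes convex_g: "L_convex_state M g"
    and convex_H: "AE (t, w) in dt_dP M T. L_convex M (\<lambda>x \<mu> c. hamiltonian \<sigma> b f t x \<mu> (Y t w) (Z t w) c)"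
  shows "integrable (dt_dP M T) (\<lambda>(t, w). (norm (\<beta> t w - ctrl t w))\<^sup>2 / 2)"
    and "cost M T f g ctrl X + (\<integral>(t, w). (norm (\<beta> t w - ctrl t w))\<^sup>2 / 2 \<partial>dt_dP M T) \<le> cost M T f g \<beta> X'"
proof -
  let ?N = "restrict_space lborel {0..T}"
  have z: "(0::real) \<le> 0" by simp
  note uL = regular_process_L2_time[OF ctrl_regular] and bL = beta_L2[OF \<beta> X']
  note c = cost_time_integral[OF X_regular uL, unfolded set_integral_whole_time]
    and c' = cost_time_integral[OF X'_regular[OF \<beta> X'] bL, unfolded set_integral_whole_time]
  show i: "integrable (dt_dP M T) (\<lambda>(t, w). (norm (\<beta> t w - ctrl t w))\<^sup>2 / 2)"
    using L2_integrable[OF L2_diff[OF bL uL]] by (simp add: case_prod_beta')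
  note fub = dt_dP_fubini[OF prob_space_axioms i z order_refl, unfolded set_integral_whole_time]
  have i1: "integrable ?N (\<lambda>t. \<integral>w. ol_driver t w \<bullet> state_change X' t w \<partial>M)"
    using dt_dP_fubini(4)[OF prob_space_axioms L2_time_inner[OF ol_driver_L2(1) state_change_L2_time[OF \<beta> X']] z order_refl]
    unfolding set_integral_whole_time .
  have i2: "integrable ?N (\<lambda>t. \<integral>w. Y t w \<bullet> drift_change \<beta> X' t w \<partial>M)"
    using dt_dP_fubini(4)[OF prob_space_axioms L2_time_inner[OF regular_process_L2_time[OF Y_regular] drift_change_L2_time[OF \<beta> X']] z order_refl]
    unfolding set_integral_whole_time .
  let ?A = "\<lambda>t. \<integral>w. f t (X t w) (law M X t) + (norm (ctrl t w))\<^sup>2 / 2 \<partial>M"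
    and ?B = "\<lambda>t. \<integral>w. ol_driver t w \<bullet> state_change X' t w \<partial>M" and ?C = "\<lambda>t. \<integral>w. Y t w \<bullet> drift_change \<beta> X' t w \<partial>M"
    and ?D = "\<lambda>t. \<integral>w. (norm (\<beta> t w - ctrl t w))\<^sup>2 / 2 \<partial>M" and ?E = "\<lambda>t. \<integral>w. f t (X' t w) (law M X' t) + (norm (\<beta> t w))\<^sup>2 / 2 \<partial>M"
  note iAB = Bochner_Integration.integrable_add[OF c(2) i1]
  note iABC = Bochner_Integration.integrable_diff[OF iAB i2]
  have "(\<integral>t. ?A t + ?B t - ?C t + ?D t \<partial>?N) \<le> (\<integral>t. ?E t \<partial>?N)"
  proof (rule integral_mono_AE[OF Bochner_Integration.integrable_add[OF iABC fub(4)] c'(2)])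
    show "AE t in ?N. ?A t + ?B t - ?C t + ?D t \<le> ?E t"
      using AE_dt_dP_D[OF prob_space_axioms convex_H] L2_time_sections(1)[OF prob_space_axioms bL] AE_space
    proof eventually_elim
      case (elim t)
      then show ?case by (intro running_cost_inequality) (simp_all add: space_restrict_space)
    qed
  qed
  moreover have "(\<integral>t. ?A t + ?B t - ?C t + ?D t \<partial>?N) = (\<integral>t. ?A t \<partial>?N) + (\<integral>t. ?B t \<partial>?N) - (\<integral>t. ?C t \<partial>?N) + (\<integral>t. ?D t \<partial>?N)"
    unfolding Bochner_Integration.integral_add[OF iABC fub(4)] Bochner_Integration.integral_diff[OF iAB i2] Bochner_Integration.integral_add[OF c(2) i1]
    by (rule refl)
  moreover have "(\<integral>w. Y T w \<bullet> state_change X' T w \<partial>M) = (\<integral>t. ?C t \<partial>?N) - (\<integral>t. ?B t \<partial>?N)"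
    using duality[OF \<beta> X'] unfolding set_integral_whole_time .
  ultimately show "cost M T f g ctrl X + (\<integral>(t, w). (norm (\<beta> t w - ctrl t w))\<^sup>2 / 2 \<partial>dt_dP M T) \<le> cost M T f g \<beta> X'"
    using terminal_inequality[OF convex_g] unfolding c(1) c'(1) fub(5)[symmetric] by linarith
qed

end

end

theorem theorem2p4:
  fixes M :: "'w measure" and T :: real
    and X0 :: "'w \<Rightarrow> real^'d" and W :: "real \<Rightarrow> 'w \<Rightarrow> real^'m"
    and \<sigma> :: "real \<Rightarrow> real^'m^'d"
    and b :: "real \<Rightarrow> real^'d \<Rightarrow> (real^'d) measure \<Rightarrow> real^'d"
    and bx :: "real \<Rightarrow> real^'d \<Rightarrow> (real^'d) measure \<Rightarrow> real^'d^'d"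
    and bm :: "real \<Rightarrow> real^'d \<Rightarrow> (real^'d) measure \<Rightarrow> real^'d \<Rightarrow> real^'d^'d"
    and f :: "real \<Rightarrow> real^'d \<Rightarrow> (real^'d) measure \<Rightarrow> real"
    and fx :: "real \<Rightarrow> real^'d \<Rightarrow> (real^'d) measure \<Rightarrow> real^'d"
    and fm :: "real \<Rightarrow> real^'d \<Rightarrow> (real^'d) measure \<Rightarrow> real^'d \<Rightarrow> real^'d"
    and g :: "real^'d \<Rightarrow> (real^'d) measure \<Rightarrow> real"
    and gx :: "real^'d \<Rightarrow> (real^'d) measure \<Rightarrow> real^'d"
    and gm :: "real^'d \<Rightarrow> (real^'d) measure \<Rightarrow> real^'d \<Rightarrow> real^'d"
    and u :: "real \<Rightarrow> real^'d \<Rightarrow> (real^'d) measure \<Rightarrow> real^'m"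
    and ux :: "real \<Rightarrow> real^'d \<Rightarrow> (real^'d) measure \<Rightarrow> real^'d^'m"
    and um :: "real \<Rightarrow> real^'d \<Rightarrow> (real^'d) measure \<Rightarrow> real^'d \<Rightarrow> real^'d^'m"
    and X a Y :: "real \<Rightarrow> 'w \<Rightarrow> real^'d" and Z :: "real \<Rightarrow> 'w \<Rightarrow> real^'m^'d"
  assumes basis: "stochastic_basis M T X0 W"
    and coeffs: "regular_coefficients M T \<sigma> b bx bm f fx fm g gx gm"
    and feedback: "regular_feedback M T u ux um"
    and state: "state_process M T X0 W \<sigma> b (feedback_control M u X) X"
    and basic_adj: "basic_adjoint M T \<sigma> bx bm fx fm gx gm u ux um X a"
    and critical: "stop_gradient_critical M T \<sigma> u X a"
    and adjoint: "adjoint_processes M T X0 W bx bm fx fm gx gm X Y Z"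
    and convex_g: "L_convex_state M g"
    and convex_H: "AE (t, \<omega>) in dt_dP M T.
        L_convex M (\<lambda>x \<mu> c. hamiltonian \<sigma> b f t x \<mu> (Y t \<omega>) (Z t \<omega>) c)"
  shows "optimal_control M T X0 W \<sigma> b f g (feedback_control M u X) \<and>
    (\<forall>\<alpha>. optimal_control M T X0 W \<sigma> b f g \<alpha> \<longrightarrow>
      (AE (t, \<omega>) in dt_dP M T. \<alpha> t \<omega> = feedback_control M u X t \<omega>))"
proof -
  interpret closed_loop M T X0 W \<sigma> b bx bm f fx fm g gx gm u ux um X a Y Z
    using basis coeffs feedback state basic_adj critical adjoint by unfold_locales
  have gap: "integrable (dt_dP M T) (\<lambda>(t, \<omega>). (norm (\<beta> t \<omega> - feedback_control M u X t \<omega>))\<^sup>2 / 2)"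
      "cost M T f g (feedback_control M u X) X
        + (\<integral>(t, \<omega>). (norm (\<beta> t \<omega> - feedback_control M u X t \<omega>))\<^sup>2 / 2 \<partial>dt_dP M T) \<le> cost M T f g \<beta> X'"
    if "admissible M (filt M X0 W) T \<beta>" "state_process M T X0 W \<sigma> b \<beta> X'" for \<beta> X'
    by (rule cost_gap(1)[OF that convex_g convex_H], rule cost_gap(2)[OF that convex_g convex_H])
  have nn: "0 \<le> (\<integral>(t, \<omega>). (norm (\<beta> t \<omega> - feedback_control M u X t \<omega>))\<^sup>2 / 2 \<partial>dt_dP M T)" for \<beta>
    by (rule Bochner_Integration.integral_nonneg) auto
  have opt: "cost M T f g (feedback_control M u X) X \<le> cost M T f g \<beta> X'"
    if "admissible M (filt M X0 W) T \<beta>" "state_process M T X0 W \<sigma> b \<beta> X'" for \<beta> X'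
    using gap(2)[OF that] nn[of \<beta>] by linarith
  show ?thesis
  proof (intro conjI allI impI)
    show "optimal_control M T X0 W \<sigma> b f g (feedback_control M u X)"
      unfolding optimal_control_def using ctrl_admissible state opt by blast
  next
    fix \<alpha> assume "optimal_control M T X0 W \<sigma> b f g \<alpha>"
    then obtain X' where \<alpha>: "admissible M (filt M X0 W) T \<alpha>" and X': "state_process M T X0 W \<sigma> b \<alpha> X'"
      and best: "cost M T f g \<alpha> X' \<le> cost M T f g (feedback_control M u X) X"
      unfolding optimal_control_def using ctrl_admissible state by blast
    \<comment> \<open>Both controls have the least cost, so the gap inequality squeezes the
      quadratic term to 0.\<close>
    have "(\<integral>(t, \<omega>). (norm (\<alpha> t \<omega> - feedback_control M u X t \<omega>))\<^sup>2 / 2 \<partial>dt_dP M T) = 0"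
      using gap(2)[OF \<alpha> X'] best nn[of \<alpha>] by linarith
    then have "AE z in dt_dP M T. (case z of (t, \<omega>) \<Rightarrow> (norm (\<alpha> t \<omega> - feedback_control M u X t \<omega>))\<^sup>2 / 2) = 0"
      by (subst (asm) integral_nonneg_eq_0_iff_AE[OF gap(1)[OF \<alpha> X']]) (auto simp: case_prod_beta')
    then show "AE (t, \<omega>) in dt_dP M T. \<alpha> t \<omega> = feedback_control M u X t \<omega>"
      by eventually_elim (auto simp: case_prod_beta')
  qed
qed

end
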